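(* Let $W:\mathbb{R}\to\mathbb{R}$ be continuously differentiable and even, and suppose there is $c>0$ such that $x\mapsto W(x)+\frac{c}{2}x^2$ is convex and that $\sup_{x\in\mathbb{R}}\frac{|W'(x)|}{1+|x|}<\infty$. Let $\rho_0\in\mathcal{P}(\mathbb{R})$ satisfy $\int_{\mathbb{R}}x^2\,d\rho_0(x)<\infty$ and let $v_0:\mathbb{R}\to\mathbb{R}$ be absolutely continuous. Then there is $\eta\in\mathcal{P}(\Gamma)$ which has the following properties. (i) For $\eta$ almost every $\gamma\in\Gamma$, $\Psi(\gamma)<\infty$. (ii) $\rho_0=e_{0\#}\eta$. (iii) For each $0<s\le t$ and $\gamma,\xi\in\operatorname{supp}(\eta)$, $$\frac{|\gamma(t)-\xi(t)|}{\sinh(\sqrt{c}\,t)}\le\frac{|\gamma(s)-\xi(s)|}{\sinh(\sqrt{c}\,s)} .$$ (iv) For each $t\ge0$ and $\gamma,\xi\in\operatorname{supp}(\eta)$ with $\gamma(0)\ge\xi(0)$, $$0\le\gamma(t)-\xi(t)\le\cosh(\sqrt{c}\,t)(\gamma(0)-\xi(0))+\frac{1}{\sqrt{c}}\sinh(\sqrt{c}\,t)\int_{\xi(0)}^{\gamma(0)}|v_0'(x)|\,dx .$$ (v) There is a Borel $v:\mathbb{R}\times(0,\infty)\to\mathbb{R}$ such that $$\dot\gamma(t)=v(\gamma(t),t)\quad\text{for a.e. }t>0$$ for $\eta$ almost every $\gamma\in\Gamma$. (vi) For almost every $t\ge0$ and each Borel $h:\mathbb{R}\to\mathbb{R}$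 with $\int_\Gamma h(\gamma(t))^2d\eta(\gamma)<\infty$, $$\int_\Gamma\dot\gamma(t)h(\gamma(t))\,d\eta(\gamma)=\int_\Gamma\left(v_0(\gamma(0))-\int_0^tW'*(e_{s\#}\eta)(\gamma(s))\,ds\right)h(\gamma(t))\,d\eta(\gamma).$$ (vii) For almost every $0\le s\le t$, $$\int_\Gamma\frac12\dot\gamma(t)^2d\eta(\gamma)+\frac12\int_\Gamma\int_\Gamma W(\gamma(t)-\xi(t))\,d\eta(\gamma)d\eta(\xi)\le\int_\Gamma\frac12\dot\gamma(s)^2d\eta(\gamma)+\frac12\int_\Gamma\int_\Gamma W(\gamma(s)-\xi(s))\,d\eta(\gamma)d\eta(\xi).$$
   Context: $\Gamma=C([0,\infty))$ is the space of continuous paths $\gamma:[0,\infty)\to\mathbb{R}$ with the complete separable metric $$d(\gamma,\xi)=\sum_{n\in\mathbb{N}}\frac{1}{2^n}\,\frac{\max_{0\le t\le n}|\gamma(t)-\xi(t)|}{1+\max_{0\le t\le n}|\gamma(t)-\xi(t)|},$$ i.e. the topology of locally uniform convergence; $\mathbb{N}=\{1,2,\dots\}$. $\mathcal{P}(\mathbb{R})$ and $\mathcal{P}(\Gamma)$ are the Borel probability measures on $\mathbb{R}$ and $\Gamma$. $e_t:\Gamma\to\mathbb{R}$, $e_t(\gamma)=\gamma(t)$, and $e_{t\#}\eta$ is the push-forward of $\eta$. For $\mu\in\mathcal{P}(\mathbb{R})$, $(W'*\mu)(x)=\int_{\mathbb{R}}W'(x-y)\,d\mu(y)$. Let $\varphi(t)=e^{(c+1)t^2}\int_0^te^{-(c+1)s^2}ds$,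 let $X$ be the set of absolutely continuous $\gamma:[0,\infty)\to\mathbb{R}$ (i.e. absolutely continuous on bounded intervals) with $\int_0^n\dot\gamma(t)^2dt<\infty$ for all $n\in\mathbb{N}$, and let $$\Psi(\gamma)=\begin{cases}\displaystyle\sum_{n=1}^\infty\frac{1}{2^n\varphi(n)}\left(\int_0^n\dot\gamma(t)^2dt+\gamma(0)^2\right),&\gamma\in X,\\ +\infty,&\gamma\notin X.\end{cases}$$ Absolutely continuous on $\mathbb{R}$ (for $v_0$) means: for every $\epsilon>0$ there is $\delta>0$ such that $\sum_k|v_0(b_k)-v_0(a_k)|<\epsilon$ for every finite family of disjoint intervals $(a_k,b_k)\subset\mathbb{R}$ with $\sum_k(b_k-a_k)<\delta$. "For almost every $0\le s\le t$" means for all $s\le t$ in $[0,\infty)$ outside a Lebesgue null set of times. *)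

theory Defs
  imports "HOL-Probability.Probability"
begin

section \<open>The path space \<open>C([0,\<infinity>))\<close>\<close>

text \<open>A path is a function on \<open>[0,\<infinity>)\<close>; being \<^const>\<open>extensional\<close> only pins down the junk values
  at negative times, so that two paths are equal iff they agree on \<open>[0,\<infinity>)\<close>.\<close>

typedef cpath = "{f :: real \<Rightarrow> real. continuous_on {0..} f \<and> f \<in> extensional {0..}}"
  morphisms apply_cpath Abs_cpath
  by (rule exI[of _ "restrict (\<lambda>_. 0) {0..}"]) (simp cong: continuous_on_cong_simp)

declare [[coercion "apply_cpath :: cpath \<Rightarrow> real \<Rightarrow> real"]]

lemma continuous_on_apply_cpath: "continuous_on {0..} (apply_cpath \<gamma>)"
  using apply_cpath[of \<gamma>] by simp

lemma cpath_eqI: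
  assumes "\<And>t. 0 \<le> t \<Longrightarrow> apply_cpath \<gamma> t = apply_cpath \<xi> t"
  shows "\<gamma> = \<xi>"
proof -
  have "apply_cpath \<gamma> = apply_cpath \<xi>"
    using apply_cpath[of \<gamma>] apply_cpath[of \<xi>] assms by (intro extensionalityI[of _ "{0..}"]) auto
  then show ?thesis by (simp add: apply_cpath_inject)
qed

text \<open>The supremum is a maximum, because paths are continuous and \<open>{0..n}\<close> is compact.\<close>

definition maxdist :: "nat \<Rightarrow> cpath \<Rightarrow> cpath \<Rightarrow> real" where
  "maxdist n \<gamma> \<xi> = (SUP t\<in>{0..real n}. \<bar>\<gamma> t - \<xi> t\<bar>)"

lemma maxdist_bdd: "bdd_above ((\<lambda>t. \<bar>apply_cpath \<gamma> t - apply_cpath \<xi> t\<bar>) ` {0..real n})"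
proof -
  have "continuous_on {0..real n} (\<lambda>t. \<bar>apply_cpath \<gamma> t - apply_cpath \<xi> t\<bar>)"
    by (intro continuous_intros continuous_on_subset[OF continuous_on_apply_cpath]) auto
  then have "compact ((\<lambda>t. \<bar>apply_cpath \<gamma> t - apply_cpath \<xi> t\<bar>) ` {0..real n})"
    by (rule compact_continuous_image) simp
  then show ?thesis
    by (intro bounded_imp_bdd_above compact_imp_bounded)
qed

lemma maxdist_upper: "0 \<le> t \<Longrightarrow> t \<le> real n \<Longrightarrow> \<bar>apply_cpath \<gamma> t - apply_cpath \<xi> t\<bar> \<le> maxdist n \<gamma> \<xi>"
  unfolding maxdist_def by (rule cSUP_upper[OF _ maxdist_bdd]) simp

lemma maxdist_least:
  assumes "\<And>t. 0 \<le> t \<Longrightarrow> t \<le> real n \<Longrightarrow> \<bar>apply_cpath \<gamma> t - apply_cpath \<xi> t\<bar> \<le> B"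
  shows "maxdist n \<gamma> \<xi> \<le> B"
  unfolding maxdist_def using assms by (intro cSUP_least) auto

lemma maxdist_nonneg: "0 \<le> maxdist n \<gamma> \<xi>"
  using maxdist_upper[of 0 n \<gamma> \<xi>] by simp

lemma maxdist_triangle2: "maxdist n \<gamma> \<xi> \<le> maxdist n \<gamma> \<zeta> + maxdist n \<xi> \<zeta>"
proof (rule maxdist_least)
  fix t :: real assume "0 \<le> t" "t \<le> real n"
  then show "\<bar>apply_cpath \<gamma> t - apply_cpath \<xi> t\<bar> \<le> maxdist n \<gamma> \<zeta> + maxdist n \<xi> \<zeta>"
    using maxdist_upper[of t n \<gamma> \<zeta>] maxdist_upper[of t n \<xi> \<zeta>] by linarith
qed

text \<open>The series starts at \<open>n = 1\<close>, hence the \<^const>\<open>Suc\<close>.\<close>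

instantiation cpath :: metric_space
begin

definition dist_cpath :: "cpath \<Rightarrow> cpath \<Rightarrow> real" where
  "dist_cpath \<gamma> \<xi> = (\<Sum>n. 1 / 2 ^ Suc n * (maxdist (Suc n) \<gamma> \<xi> / (1 + maxdist (Suc n) \<gamma> \<xi>)))"

definition uniformity_cpath :: "(cpath \<times> cpath) filter" where
  "uniformity_cpath = (INF e\<in>{0 <..}. principal {(x, y). dist x y < e})"

definition open_cpath :: "cpath set \<Rightarrow> bool" where
  "open_cpath U = (\<forall>x\<in>U. \<forall>\<^sub>F (x', y) in uniformity. x' = x \<longrightarrow> y \<in> U)"

instance
proof
  let ?g = "\<lambda>r::real. r / (1 + r)"
  let ?s = "\<lambda>\<gamma> \<xi> n. 1 / 2 ^ Suc n * ?g (maxdist (Suc n) \<gamma> \<xi>)"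
  have geo: "summable (\<lambda>n. 1 / 2 ^ Suc n :: real)"
    using summable_mult[OF summable_geometric[of "1/2::real"], of "1/2"]
    by (simp add: power_divide)
  have nonneg: "0 \<le> ?s \<gamma> \<xi> n" for \<gamma> \<xi> n
    using maxdist_nonneg[of "Suc n" \<gamma> \<xi>] by simp
  have summ: "summable (?s \<gamma> \<xi>)" for \<gamma> \<xi>
  proof (rule summable_comparison_test'[OF geo])
    fix n :: nat
    have "?g (maxdist (Suc n) \<gamma> \<xi>) \<le> 1"
      using maxdist_nonneg[of "Suc n" \<gamma> \<xi>] by simp
    then have "?s \<gamma> \<xi> n \<le> 1 / 2 ^ Suc n"
      by (intro mult_left_le) auto
    then show "norm (?s \<gamma> \<xi> n) \<le> 1 / 2 ^ Suc n"
      using nonneg[of n \<gamma> \<xi>] by (simp only: real_norm_def abs_of_nonneg)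
  qed
  fix x y z :: cpath
  show "dist x y = 0 \<longleftrightarrow> x = y"
  proof
    assume "x = y"
    then have "maxdist n x y = 0" for n
      using maxdist_least[of n x y 0] maxdist_nonneg[of n x y] by simp
    then show "dist x y = 0" by (simp add: dist_cpath_def)
  next
    assume "dist x y = 0"
    then have "?s x y n = 0" for n
      using suminf_eq_zero_iff[OF summ nonneg, of x y] by (simp only: dist_cpath_def)
    then have "maxdist (Suc n) x y = 0 \<or> 1 + maxdist (Suc n) x y = 0" for n
      by simp
    then have "maxdist (Suc n) x y = 0" for n
      using maxdist_nonneg[of "Suc n" x y] by (smt (verit))
    moreover have "\<exists>n. t \<le> real (Suc n)" for t :: real
      by (meson le_trans real_arch_simple lessI less_imp_le_nat of_nat_mono order_trans)
    ultimately show "x = y"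
      by (intro cpath_eqI) (metis abs_le_zero_iff eq_iff_diff_eq_0 maxdist_upper)
  qed
  have g: "?g a \<le> ?g b + ?g c" if "a \<le> b + c" "0 \<le> a" "0 \<le> b" "0 \<le> c" for a b c :: real
  proof -
    have "?g a \<le> ?g (b + c)"
      using that by (simp add: divide_simps algebra_simps)
    also have "\<dots> = b / (1 + (b + c)) + c / (1 + (b + c))"
      by (simp add: add_divide_distrib)
    also have "\<dots> \<le> ?g b + ?g c"
      using that by (intro add_mono divide_left_mono mult_pos_pos) auto
    finally show ?thesis .
  qed
  have le: "?s x y n \<le> ?s x z n + ?s y z n" for n
    unfolding distrib_left[symmetric]
    by (intro mult_left_mono g maxdist_triangle2 maxdist_nonneg) auto
  have "dist x y \<le> (\<Sum>n. ?s x z n + ?s y z n)"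
    unfolding dist_cpath_def by (rule suminf_le[OF le summ summable_add[OF summ summ]])
  also have "\<dots> = dist x z + dist y z"
    unfolding dist_cpath_def by (rule suminf_add[OF summ summ, symmetric])
  finally show "dist x y \<le> dist x z + dist y z" .
qed (simp_all add: uniformity_cpath_def open_cpath_def)

end


section \<open>Absolute continuity, support, convolution\<close>

definition abs_continuous_on :: "real set \<Rightarrow> (real \<Rightarrow> real) \<Rightarrow> bool" where
  "abs_continuous_on S f \<longleftrightarrow>
     (\<forall>\<epsilon>>0. \<exists>\<delta>>0. \<forall>(I::nat set) a b.
        finite I \<and> (\<forall>k\<in>I. a k \<le> b k \<and> {a k..b k} \<subseteq> S) \<and>
        disjoint_family_on (\<lambda>k. {a k<..<b k}) I \<and> (\<Sum>k\<in>I. b k - a k) < \<delta>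
        \<longrightarrow> (\<Sum>k\<in>I. \<bar>f (b k) - f (a k)\<bar>) < \<epsilon>)"

definition supp :: "'a::topological_space measure \<Rightarrow> 'a set" where
  "supp M = {x. \<forall>U. open U \<and> x \<in> U \<longrightarrow> emeasure M U > 0}"

definition convol :: "(real \<Rightarrow> real) \<Rightarrow> real measure \<Rightarrow> real \<Rightarrow> real" where
  "convol f \<mu> x = (LINT y|\<mu>. f (x - y))"

abbreviation eval_distr :: "real \<Rightarrow> cpath measure \<Rightarrow> real measure" where
  "eval_distr t \<eta> \<equiv> distr \<eta> borel (\<lambda>\<gamma>. \<gamma> t)"


section \<open>The functional \<open>\<Psi>\<close>\<close>

text \<open>Throughout, \<open>deriv \<gamma> t\<close> renders \<open>\<gamma>\<close>-dot; at times where \<open>\<gamma>\<close> is not differentiable it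
  has an unspecified value that depends neither on \<open>\<gamma>\<close> nor on \<open>t\<close>, so \<open>deriv\<close> of a path is
  still Borel measurable and integrals are unaffected by a null set of such times or paths.\<close>

definition phi :: "real \<Rightarrow> real \<Rightarrow> real" where
  "phi c t = exp ((c + 1) * t\<^sup>2) * (LBINT s:{0..t}. exp (- (c + 1) * s\<^sup>2))"

definition path_energy :: "nat \<Rightarrow> cpath \<Rightarrow> ennreal" where
  "path_energy n \<gamma> = (\<integral>\<^sup>+t\<in>{0..real n}. ennreal ((deriv \<gamma> t)\<^sup>2) \<partial>lborel)"

definition ac_paths :: "cpath set" where
  "ac_paths = {\<gamma>. (\<forall>T>0. abs_continuous_on {0..T} (apply_cpath \<gamma>)) \<and> (\<forall>n\<ge>1. path_energy n \<gamma> < \<infinity>)}"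

definition Psi :: "real \<Rightarrow> cpath \<Rightarrow> ennreal" where
  "Psi c \<gamma> =
     (if \<gamma> \<in> ac_paths
      then (\<Sum>n. ennreal (1 / (2 ^ Suc n * phi c (real (Suc n))))
                  * (path_energy (Suc n) \<gamma> + ennreal ((\<gamma> 0)\<^sup>2)))
      else \<infinity>)"

end

theory Submission
 imports Defs "HOL-Complex_Analysis.Great_Picard"
begin

text \<open>
The theorem constructs weak solutions of the pressureless Euler equations with interaction potential \<open>W\<close> as
laws of sticky particle trajectories.  A particle is labelled by its starting point \<open>x\<close> in the support of the
initial distribution \<open>\<rho>\<close>, and \<open>\<eta>\<close> is the law of its trajectory \<open>X x\<close>.

Trajectories come from a scheme that is discrete in mass and in time.  In each time step particles move
under their forces, and the outcome is projected onto nondecreasing functions of the label.  This projection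
merges particles and never separates merged ones (\<open>sticky\<close>).  Two estimates survive refinement.  Neighbouring
gaps satisfy the recursion of \<open>sinh\<close> and \<open>cosh\<close>, since semiconvexity of \<open>W\<close> bounds the relative force by \<open>c\<close>
times the gap; this gives the two inequalities on the support (\<open>gap_ratio\<close>, \<open>gap_bound\<close>).  And kinetic energy
stays bounded in mean (\<open>energy_bound\<close>).  Arzela-Ascoli yields the limit \<open>X\<close>, continuous in label and time.
Mean energy bounds for difference quotients give absolute continuity and finiteness of \<open>Psi\<close>.

Merging preserves momentum in each cluster.  Integrated twice in time this says that \<open>X u\<close> and the
collisionless trajectory \<open>Y u\<close> have the same conditional mean given the position at any later time (\<open>balance\<close>).
The formulation uses positions only and therefore passes to the limit; difference quotients of it give the
momentum equation (\<open>V_balance\<close>).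

The contraction estimate makes the position at time \<open>t\<close> a Lipschitz function \<open>flow s t\<close> of the position at an
earlier time \<open>s > 0\<close>.  This gives the velocity field as a right derivative of the flow.  It also shows that the
true velocity is a projection of the collisionless one, \<open>Z\<close>, onto a decreasing family of spaces, so that
kinetic energy gains no more than \<open>Z\<close> does (\<open>kinetic_energy_step\<close>); the gain of \<open>Z\<close> is paid for by the potential
energy (\<open>free_energy_nonincreasing\<close>).
\<close>

section \<open>Lebesgue differentiation of indefinite integrals\<close>

text \<open>A point of \<open>?E\<close> lies in arbitrarily short intervals on which the mean of \<open>g\<close> exceeds \<open>q\<close>, although
\<open>g\<close> itself is at most \<open>p < q\<close> there.  A disjoint Vitali subfamily of such intervals covers almost all of
\<open>?E\<close> inside an open set of nearly the same measure, and integrating \<open>g\<close> over the subfamily contradicts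
\<open>p < q\<close> unless \<open>?E\<close> is null.\<close>

lemma exceeding_slope_negligible:
 fixes g F :: "real => real"
 assumes g: "integrable lborel g"
  and F: "!!x y. x <= y ==> F y - F x = (LBINT t:{x..y}. g t)"
  and pq: "p < q"
 shows "negligible {x. g x <= p & (\<forall>n::nat. \<exists>u v. u < x & x < v & v - u < 1 / real (Suc n) & q * (v - u) < F v - F u)}"
  (is "negligible ?E")
proof -
 define Op where "Op n = (\<Union>(u, v)\<in>{(u, v). v - u < 1 / real (Suc n) & q * (v - u) < F v - F u}. {u<..<v})" for n :: nat
 have gm: "g \<in> borel_measurable borel" using borel_measurable_integrable[OF g] by simp
 have E_eq: "?E = {x. g x <= p} \<inter> (\<Inter>n. Op n)"
  unfolding Op_def by (auto simp: set_eq_iff) blast+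
 have Op_open: "open (Op n)" for n unfolding Op_def by auto
 have "{x. g x <= p} \<in> sets borel" using gm by measurable
 then have E_meas: "?E \<in> sets borel" unfolding E_eq using Op_open by auto
 have "negligible (?E \<inter> {-r<..<r})" for r :: real
 proof -
  define E' where "E' = ?E \<inter> {-r<..<r}"
  have E'm[measurable]: "E' \<in> sets borel" unfolding E'_def using E_meas by auto
  have E'p: "g x <= p" if "x \<in> E'" for x using that by (auto simp: E'_def)
  have E'r: "E' \<subseteq> {-r<..<r}" by (auto simp: E'_def)
  have fin: "emeasure lborel E' < \<infinity>"
   by (rule le_less_trans[OF emeasure_mono[OF E'r]]) (auto simp flip: box_real simp: emeasure_lborel_box_eq)
  define \<nu> where "\<nu> = density lborel (%x. ennreal (\<bar>g x - q\<bar> * indicator {-r<..<r} x))"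
  have int_q: "set_integrable lborel {-r<..<r} (%x. g x - q)"
  proof (rule set_integral_diff(1))
   show "set_integrable lborel {-r<..<r} g"
   unfolding set_integrable_def using g by (intro integrable_mult_indicator) auto
   show "set_integrable lborel {-r<..<r} (%x. q)"
   unfolding set_integrable_def by (simp flip: box_real add: emeasure_lborel_box_eq integrable_real_indicator)
  qed
  have int_abs: "integrable lborel (%x. \<bar>g x - q\<bar> * indicator {-r<..<r} x)"
   using integrable_abs[OF int_q[unfolded set_integrable_def]]
   by (rule Bochner_Integration.integrable_cong[THEN iffD1, rotated 2]) (auto simp: abs_mult)
  have em\<nu>: "emeasure \<nu> B = ennreal (LBINT x. \<bar>g x - q\<bar> * indicator {-r<..<r} x * indicator B x)" if "B \<in> sets borel" for B
  proof -
   have "emeasure \<nu> B = (\<integral>\<^sup>+x. ennreal (\<bar>g x - q\<bar> * indicator {-r<..<r} x * indicator B x) \<partial>lborel)"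
   unfolding \<nu>_def using that gm
   by (subst emeasure_density) (auto intro!: nn_integral_cong simp: ennreal_mult'' split: split_indicator)
   also have "... = ennreal (LBINT x. \<bar>g x - q\<bar> * indicator {-r<..<r} x * indicator B x)"
   proof (rule nn_integral_eq_integral)
   show "integrable lborel (%x. \<bar>g x - q\<bar> * indicator {-r<..<r} x * indicator B x)"
   by (rule integrable_real_mult_indicator) (use that int_abs in auto)
   qed auto
   finally show ?thesis .
  qed
  have fin\<nu>: "emeasure \<nu> (space \<nu>) ~= \<infinity>"
   using em\<nu>[of UNIV] by (simp add: \<nu>_def)
  have small: "(q - p) * measure lborel E' <= \<epsilon>" if "\<epsilon> > 0" for \<epsilon>
  proof -
   have "emeasure \<nu> E' = (INF U \<in> {U. E' \<subseteq> U & open U}. emeasure \<nu> U)"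
   by (rule outer_regular) (use E'm fin\<nu> in \<open>auto simp: \<nu>_def\<close>)
   moreover have lt: "emeasure \<nu> E' < emeasure \<nu> E' + ennreal \<epsilon>"
   proof -
   have "0 <= (LBINT x. \<bar>g x - q\<bar> * indicator {-r<..<r} x * indicator E' x)"
   by (rule Bochner_Integration.integral_nonneg) auto
   then show ?thesis unfolding em\<nu>[OF E'm] using \<open>\<epsilon> > 0\<close> by (simp flip: ennreal_plus add: ennreal_less_iff)
   qed
   ultimately obtain U0 where U0: "E' \<subseteq> U0" "open U0" "emeasure \<nu> U0 < emeasure \<nu> E' + ennreal \<epsilon>"
   by (auto simp: INF_less_iff)
   define U where "U = U0 \<inter> {-r<..<r}"
   have U: "E' \<subseteq> U" "open U" "U \<subseteq> {-r<..<r}" using U0 E'r by (auto simp: U_def)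
   have "emeasure \<nu> U <= emeasure \<nu> U0" using U0 by (intro emeasure_mono) (auto simp: U_def \<nu>_def)
   then have U\<nu>: "emeasure \<nu> U < emeasure \<nu> E' + ennreal \<epsilon>" using U0(3) by (rule le_less_trans)
   define K where "K = {(a, s::real). s > 0 & {a - s..a + s} \<subseteq> U & q * (2 * s) < F (a + s) - F (a - s)}"
   obtain C where C: "countable C" "C \<subseteq> K"
   "pairwise (%i j. disjnt (cball (fst i) (snd i)) (cball (fst j) (snd j))) C"
   "negligible(E' - (\<Union>i \<in> C. cball (fst i) (snd i)))"
   proof (rule Vitali_covering_theorem_cballs[of K snd E' fst])
   fix x d :: real assume x: "x \<in> E'" and d: "0 < d"
   then have "x \<in> U" using U by auto
   with U(2) obtain e where e: "e > 0" "ball x e \<subseteq> U" by (meson open_contains_ball)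
   obtain n :: nat where n: "1 / real (Suc n) < min e d"
   using e d by (metis min_less_iff_conj nat_approx_posE)
   obtain u v where uv: "u < x" "x < v" "v - u < 1 / real (Suc n)" "q * (v - u) < F v - F u"
   using x unfolding E'_def by blast
   have "{u..v} \<subseteq> ball x e" using uv n by (auto simp: dist_real_def)
   then have "{u..v} \<subseteq> U" using e by blast
   then have "((u + v) / 2, (v - u) / 2) \<in> K"
   using uv by (auto simp: K_def field_simps)
   moreover have "x \<in> cball ((u + v) / 2) ((v - u) / 2)"
   using uv by (auto simp: dist_real_def abs_le_iff field_simps)
   moreover have "(v - u) / 2 < d" using uv n by auto
   ultimately show "\<exists>i. i \<in> K & x \<in> cball (fst i) (snd i) & snd i < d" by force
   next
   show "0 < snd i" if "i \<in> K" for i using that by (auto simp: K_def)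
   qed (rule that)
   define I where "I i = {fst i - snd i..fst i + snd i}" for i :: "real \<times> real"
   have cI: "cball (fst i) (snd i) = I i" for i by (simp add: I_def cball_eq_atLeastAtMost)
   define G where "G = (\<Union>i\<in>C. I i)"
   have Gm[measurable]: "G \<in> sets borel" unfolding G_def using C(1) by (auto simp: I_def)
   have IU: "I i \<subseteq> U" if "i \<in> C" for i
   proof -
   have "i \<in> K" using that C(2) by blast
   then show ?thesis by (simp add: K_def I_def split_beta)
   qed
   have GU: "G \<subseteq> U" unfolding G_def using IU by blast
   have intS: "set_integrable lborel S (%x. g x - q)" if "S \<subseteq> {-r<..<r}" "S \<in> sets borel" for S
   by (rule set_integrable_subset[OF int_q]) (use that in auto)
   have disj: "disjoint_family_on I C"
   using C(3) unfolding disjoint_family_on_def pairwise_def disjnt_def cI by blast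
   have pos: "0 <= (LBINT x:G. g x - q)"
   proof -
   have IC: "(LBINT x:I i. g x - q) >= 0" if "i \<in> C" for i
   proof -
   have iK: "i \<in> K" using that C by auto
   then have s: "snd i > 0" and "q * (2 * snd i) < F (fst i + snd i) - F (fst i - snd i)"
   by (auto simp: K_def split_beta)
   moreover have "F (fst i + snd i) - F (fst i - snd i) = (LBINT x:I i. g x)"
   using F s by (simp add: I_def)
   moreover have "(LBINT x:I i. g x - q) = (LBINT x:I i. g x) - (LBINT x:I i. q)"
   proof (rule set_integral_diff(2))
   show "set_integrable lborel (I i) g"
   unfolding set_integrable_def using g by (intro integrable_mult_indicator) (auto simp: I_def)
   show "set_integrable lborel (I i) (%x. q)"
   unfolding set_integrable_def using s by (simp add: I_def integrable_real_indicator)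
   qed
   moreover have "(LBINT x:I i. q) = q * (2 * snd i)"
   using s by (simp add: set_lebesgue_integral_def I_def)
   ultimately show ?thesis by simp
   qed
   define A where "A k = (\<Union>j\<in>{j. j < k & j \<in> to_nat_on C ` C}. I (from_nat_into C j))" for k :: nat
   have fromC: "from_nat_into C j \<in> C" if "j \<in> to_nat_on C ` C" for j using that C(1) by auto
   have AG: "(\<Union>k. A k) = G"
   proof (intro equalityI subsetI)
   fix x assume "x \<in> G"
   then obtain i where "i \<in> C" "x \<in> I i" by (auto simp: G_def)
   then have "x \<in> A (Suc (to_nat_on C i))"
   unfolding A_def using C(1) by (intro UN_I[of "to_nat_on C i"]) auto
   then show "x \<in> (\<Union>k. A k)" by blast
   next
   fix x assume "x \<in> (\<Union>k. A k)"
   then show "x \<in> G" unfolding A_def G_def using fromC by blast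
   qed
   have "(LBINT x:A k. g x - q) >= 0" for k
   proof -
   let ?J = "{j. j < k & j \<in> to_nat_on C ` C}"
   have "(LBINT x:A k. g x - q) = (\<Sum>j\<in>?J. LBINT x:I (from_nat_into C j). g x - q)"
   unfolding A_def
   proof (rule set_integral_finite_Union)
   show "disjoint_family_on (%j. I (from_nat_into C j)) ?J"
   unfolding disjoint_family_on_def
   proof (intro ballI impI)
   fix j l assume jl: "j \<in> ?J" "l \<in> ?J" "j ~= l"
   have "from_nat_into C j ~= from_nat_into C l"
   using jl C(1) by (metis (no_types, lifting) mem_Collect_eq to_nat_on_from_nat_into)
   with fromC jl disj show "I (from_nat_into C j) \<inter> I (from_nat_into C l) = {}"
   unfolding disjoint_family_on_def by blast
   qed
   show "set_integrable lborel (I (from_nat_into C j)) (%x. g x - q)" if "j \<in> ?J" for j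
   using IU[of "from_nat_into C j"] fromC[of j] that U(3) by (intro intS) (auto simp: I_def)
   qed (simp_all add: I_def)
   also have "... >= 0" by (intro sum_nonneg IC fromC) auto
   finally show ?thesis .
   qed
   moreover have "(%k. LBINT x:A k. g x - q) \<longlonglongrightarrow> (LBINT x:(\<Union>k. A k). g x - q)"
   proof (rule set_integral_cont_up)
   show "set_integrable lborel (\<Union>k. A k) (%x. g x - q)"
   unfolding AG using GU U(3) by (intro intS) auto
   show "incseq A" unfolding incseq_def A_def by (intro allI impI UN_mono) auto
   show "A k \<in> sets lborel" for k unfolding A_def I_def by auto
   qed
   ultimately show ?thesis unfolding AG by (intro LIMSEQ_le_const) auto
   qed
   have Gr: "G \<subseteq> {-r<..<r}" using GU U(3) by auto
   have "(LBINT x:G. g x - q) = (LBINT x:(G \<inter> E') \<union> (G - E'). g x - q)"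
   by (rule arg_cong[where f="%S. set_lebesgue_integral lborel S _"]) auto
   also have "... = (LBINT x:G \<inter> E'. g x - q) + (LBINT x:G - E'. g x - q)"
   by (intro set_integral_Un intS) (use Gr in auto)
   finally have split: "(LBINT x:G. g x - q) = (LBINT x:G \<inter> E'. g x - q) + (LBINT x:G - E'. g x - q)" .
   have fin2: "emeasure lborel (G \<inter> E') < \<infinity>"
   by (rule le_less_trans[OF emeasure_mono[of _ E'] fin]) auto
   have "(LBINT x:G \<inter> E'. g x - q) <= (LBINT x:G \<inter> E'. p - q)"
   by (intro set_integral_mono intS) (use Gr E'r fin2 E'm E'p in \<open>auto simp: set_integrable_def integrable_real_indicator\<close>)
   also have "... = (p - q) * measure lborel (G \<inter> E')"
   by (simp add: set_lebesgue_integral_def)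
   also have "measure lborel (G \<inter> E') = measure lborel E'"
   proof -
   have "E' - G \<in> null_sets lborel"
   using C(4) unfolding cI G_def[symmetric] by (simp add: negligible_iff_null_sets null_sets_completion_iff)
   then have "measure lborel (E' - (E' - G)) = measure lborel E'"
   by (intro measure_Diff_null_set) auto
   moreover have "E' - (E' - G) = G \<inter> E'" by auto
   ultimately show ?thesis by simp
   qed
   finally have b1: "(LBINT x:G \<inter> E'. g x - q) <= (p - q) * measure lborel E'" .
   have b2: "(LBINT x:G - E'. g x - q) <= \<epsilon>"
   proof -
   have dm: "G - E' \<in> sets borel" by auto
   have "(LBINT x:G - E'. g x - q) <= (LBINT x. \<bar>g x - q\<bar> * indicator {-r<..<r} x * indicator (G - E') x)"
   unfolding set_lebesgue_integral_def
   proof (rule integral_mono)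
   show "integrable lborel (%x. indicat_real (G - E') x *\<^sub>R (g x - q))"
   using intS[of "G - E'"] Gr by (auto simp: set_integrable_def)
   show "integrable lborel (%x. \<bar>g x - q\<bar> * indicator {-r<..<r} x * indicator (G - E') x)"
   by (rule integrable_real_mult_indicator) (use int_abs in auto)
   qed (use Gr in \<open>auto split: split_indicator\<close>)
   moreover have "emeasure \<nu> (G - E') <= ennreal \<epsilon>"
   proof -
   have "emeasure \<nu> E' + emeasure \<nu> (G - E') = emeasure \<nu> (E' \<union> (G - E'))"
   by (rule plus_emeasure) (auto simp: \<nu>_def)
   also have "... <= emeasure \<nu> U"
   by (rule emeasure_mono) (use U GU in \<open>auto simp: \<nu>_def\<close>)
   also have "... <= emeasure \<nu> E' + ennreal \<epsilon>" using U\<nu> by simp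
   finally show ?thesis
   using em\<nu>[OF E'm] by (simp add: ennreal_add_left_cancel_le)
   qed
   ultimately show ?thesis
   unfolding em\<nu>[OF dm] using \<open>\<epsilon> > 0\<close> by (simp add: ennreal_le_iff)
   qed
   show ?thesis using pos split b1 b2 by (simp add: algebra_simps)
  qed
  have "(q - p) * measure lborel E' <= 0"
   by (rule field_le_epsilon) (use small in simp)
  then have "measure lborel E' = 0" using pq by (simp add: mult_le_0_iff measure_le_0_iff)
  then have "emeasure lborel E' = 0" using fin by (metis emeasure_eq_ennreal_measure ennreal_0 infinity_ennreal_def less_irrefl)
  then have "E' \<in> null_sets lborel" by auto
  then show ?thesis unfolding E'_def[symmetric] by (simp add: negligible_iff_null_sets null_sets_completion_iff)
 qed
 then have "negligible (\<Union>r::nat. ?E \<inter> {-real r<..<real r})" by (intro negligible_countable_Union) auto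
 moreover have "(\<Union>r::nat. {-real r<..<real r}) = UNIV"
 proof (intro set_eqI iffI UNIV_I)
  fix x :: real
  obtain r :: nat where "\<bar>x\<bar> < real r" using reals_Archimedean2 by blast
  then have "x \<in> {-real r<..<real r}" by auto
  then show "x \<in> (\<Union>r::nat. {-real r<..<real r})" by blast
 qed
 ultimately show ?thesis by (simp flip: Int_UN_distrib)
qed

lemma set_integrable_Icc:
 fixes g :: "real => real"
 assumes "integrable lborel g"
 shows "set_integrable lborel {x..y} g"
 unfolding set_integrable_def using assms by (intro integrable_mult_indicator) auto

lemma continuous_on_indefinite_integral:
 fixes g F :: "real => real"
 assumes g: "integrable lborel g"
  and F: "!!x y. x <= y ==> F y - F x = (LBINT t:{x..y}. g t)"
 shows "isCont F x"
proof -
 have "continuous_on {x - 1..x + 1} (%y. F (x - 1) + integral {x - 1..y} g)"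
  using set_borel_integral_eq_integral(1)[OF set_integrable_Icc[OF g]]
  by (intro continuous_intros indefinite_integral_continuous_1) auto
 moreover have "F (x - 1) + integral {x - 1..y} g = F y" if "y \<in> {x - 1..x + 1}" for y
  using F[of "x - 1" y] that set_borel_integral_eq_integral(2)[OF set_integrable_Icc[OF g]] by auto
 ultimately have "continuous_on {x - 1..x + 1} F" by (simp cong: continuous_on_cong_simp)
 then show ?thesis by (rule continuous_on_interior) auto
qed

lemma lborel_AE_I_negligible:
 fixes P :: "real => bool"
 assumes "negligible N" "!!x. x \<notin> N ==> P x"
 shows "AE x in lborel. P x"
proof -
 have "AE x in lebesgue. P x"
  using assms by (intro AE_I'[of N]) (auto simp: negligible_iff_null_sets)
 then show ?thesis by (simp add: AE_completion_iff)
qed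

text \<open>At a point where no rational pair \<open>p < q\<close> separates \<open>g x\<close> from infinitely many nearby difference quotients
of \<open>F\<close>, those quotients converge to \<open>g x\<close>; the previous lemma, applied to \<open>g\<close> and to \<open>- g\<close>, discards the
other points.\<close>

theorem AE_has_derivative_indefinite_integral:
 fixes g F :: "real => real"
 assumes g: "integrable lborel g"
  and F: "!!x y. x <= y ==> F y - F x = (LBINT t:{x..y}. g t)"
 shows "AE x in lborel. (F has_real_derivative g x) (at x)"
proof -
 define E where "E G h p q = {x::real. h x <= p & (\<forall>n::nat. \<exists>u v. u < x & x < v & v - u < 1 / real (Suc n) & q * (v - u) < G v - G u)}"
  for G h :: "real => real" and p q :: real
 define N where "N = (\<Union>p\<in>\<rat>. \<Union>q\<in>{q\<in>\<rat>. p < q}. E F g p q \<union> E (%x. - F x) (%x. - g x) p q)"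
 have 1: "negligible (E F g p q)" if "p < q" for p q
  unfolding E_def by (rule exceeding_slope_negligible[OF g F that])
 have 2: "negligible (E (%x. - F x) (%x. - g x) p q)" if "p < q" for p q
  unfolding E_def
 proof (rule exceeding_slope_negligible)
  show "integrable lborel (%x. - g x)" using g by simp
  show "- F y - - F x = (LBINT t:{x..y}. - g t)" if "x <= y" for x y
   using F[OF that] by (simp add: set_lebesgue_integral_def)
 qed (rule that)
 have "countable {q\<in>\<rat>. (p::real) < q}" for p
  by (rule countable_subset[OF _ countable_rat]) auto
 then have N: "negligible N"
  unfolding N_def using 1 2 countable_rat
  by (intro negligible_countable_Union) (auto intro!: negligible_countable_Union countable_image)
 have upper: "\<exists>d>0. \<forall>u v. u <= x & x <= v & v - u < d --> G v - G u <= (h x + e) * (v - u)"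
  if e: "e > 0" and nE: "!!p q. p \<in> \<rat> ==> q \<in> \<rat> ==> p < q ==> x \<notin> E G h p q" and c: "isCont G x"
  for G h :: "real => real" and e x
 proof -
  obtain p where p: "p \<in> \<rat>" "h x < p" "p < h x + e/2" using e Rats_dense_in_real[of "h x" "h x + e/2"] by auto
  obtain q where q: "q \<in> \<rat>" "p < q" "q < h x + e" using e p Rats_dense_in_real[of p "h x + e"] by auto
  have "x \<notin> E G h p q" using nE p q by blast
  with p obtain n :: nat where "~ (\<exists>u v. u < x & x < v & v - u < 1 / real (Suc n) & q * (v - u) < G v - G u)"
   unfolding E_def mem_Collect_eq using less_imp_le by blast
  then have n: "G v - G u <= q * (v - u)" if "u < x" "x < v" "v - u < 1 / real (Suc n)" for u v
   using that not_less by blast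
  have "G v - G u <= (h x + e) * (v - u)" if uv: "u <= x" "x <= v" "v - u < 1 / real (Suc n)" for u v
  proof (cases "u = v")
   case False
   have tG: "((%s. G (x - s)) \<longlongrightarrow> G x) (at_right 0)" "((%s. G (x + s)) \<longlongrightarrow> G x) (at_right 0)"
   by (rule isCont_tendsto_compose[OF c], auto intro!: tendsto_eq_intros)+
   have ev: "eventually (%s. s \<in> {0<..<1 / real (Suc n) - (v - u)}) (at_right 0)"
   by (rule eventually_at_right_real) (use uv in simp)
   have "G v - G u <= q * (v - u)"
   proof -
   consider "u < x" "x < v" | "u = x" "x < v" | "u < x" "x = v" using uv False by linarith
   then show ?thesis
   proof cases
   case 1 then show ?thesis using n uv by auto
   next
   case 2
   have "((%s. G v - G (x - s)) \<longlongrightarrow> G v - G x) (at_right 0)" by (intro tendsto_intros tG)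
   moreover have "((%s. q * (v - (x - s))) \<longlongrightarrow> q * (v - (x - 0))) (at_right 0)" by (intro tendsto_intros)
   moreover have "eventually (%s. G v - G (x - s) <= q * (v - (x - s))) (at_right 0)"
   using ev by (rule eventually_mono) (use 2 in \<open>auto intro!: n\<close>)
   ultimately show ?thesis using 2 by (auto intro: tendsto_le[OF trivial_limit_at_right_real])
   next
   case 3
   have "((%s. G (x + s) - G u) \<longlongrightarrow> G x - G u) (at_right 0)" by (intro tendsto_intros tG)
   moreover have "((%s. q * (x + s - u)) \<longlongrightarrow> q * (x + 0 - u)) (at_right 0)" by (intro tendsto_intros)
   moreover have "eventually (%s. G (x + s) - G u <= q * (x + s - u)) (at_right 0)"
   using ev by (rule eventually_mono) (use 3 in \<open>auto intro!: n\<close>)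
   ultimately show ?thesis using 3 by (auto intro: tendsto_le[OF trivial_limit_at_right_real])
   qed
   qed
   also have "... <= (h x + e) * (v - u)" using q uv by (intro mult_right_mono) auto
   finally show ?thesis .
  qed simp
  then show ?thesis by (intro exI[of _ "1 / real (Suc n)"]) auto
 qed
 show ?thesis
 proof (rule lborel_AE_I_negligible[OF N])
  fix x assume x: "x \<notin> N"
  have c: "isCont F x" by (rule continuous_on_indefinite_integral[OF g F])
  show "(F has_real_derivative g x) (at x)"
   unfolding has_field_derivative_iff LIM_eq
  proof (intro allI impI)
   fix r :: real assume r: "0 < r"
   obtain d1 where d1: "d1 > 0" "!!u v. u <= x ==> x <= v ==> v - u < d1 ==> F v - F u <= (g x + r/2) * (v - u)"
   using upper[of "r/2" x F g] r x c unfolding N_def by auto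
   obtain d2 where d2: "d2 > 0" "!!u v. u <= x ==> x <= v ==> v - u < d2 ==> - F v + F u <= (- g x + r/2) * (v - u)"
   using upper[of "r/2" x "%x. - F x" "%x. - g x"] r x c unfolding N_def by auto
   have "\<bar>(F y - F x) / (y - x) - g x\<bar> < r" if y: "y ~= x" "\<bar>y - x\<bar> < min d1 d2" for y
   proof (cases "x < y")
   case True
   then have "F y - F x <= (g x + r/2) * (y - x)" "- (F y - F x) <= (- g x + r/2) * (y - x)"
   using d1(2)[of x y] d2(2)[of x y] y by auto
   then have "(F y - F x) / (y - x) <= g x + r/2" "g x - r/2 <= (F y - F x) / (y - x)"
   using True by (auto simp: field_simps)
   then show ?thesis using r by (auto simp: abs_less_iff)
   next
   case False
   then have yx: "y < x" using y by auto
   then have "F x - F y <= (g x + r/2) * (x - y)" "- (F x - F y) <= (- g x + r/2) * (x - y)"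
   using d1(2)[of y x] d2(2)[of y x] y by auto
   then have "(F x - F y) / (x - y) <= g x + r/2" "g x - r/2 <= (F x - F y) / (x - y)"
   using yx by (auto simp: field_simps)
   moreover have "(F x - F y) / (x - y) = (F y - F x) / (y - x)"
   by (metis minus_diff_eq minus_divide_divide)
   ultimately show ?thesis using r by (auto simp: abs_less_iff)
   qed
   then show "\<exists>s>0. \<forall>y. y ~= x & norm (y - x) < s --> norm ((F y - F x) / (y - x) - g x) < r"
   using d1 d2 by (intro exI[of _ "min d1 d2"]) auto
  qed
 qed
qed

section \<open>Absolutely continuous functions and their total variation\<close>

definition nonoverlapping :: "real set => 'i set => ('i => real) => ('i => real) => bool" where
 "nonoverlapping S J a b \<longleftrightarrow> finite J & (\<forall>k\<in>J. a k <= b k & {a k..b k} \<subseteq> S) &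
   disjoint_family_on (%k. {a k<..<b k}) J"

lemma nonoverlapping_reindex:
 assumes "nonoverlapping S (J :: 'i set) a b"
 obtains I :: "nat set" and h :: "nat => 'i" where "nonoverlapping S I (a \<circ> h) (b \<circ> h)"
  "\<forall>G :: 'i => real. (\<Sum>k\<in>I. G (h k)) = (\<Sum>k\<in>J. G k)"
proof -
 have "finite J" using assms by (simp add: nonoverlapping_def)
 then obtain h :: "nat => 'i" where h: "bij_betw h {0..<card J} J" using ex_bij_betw_nat_finite by blast
 show thesis
 proof (rule that[of "{0..<card J}" h])
  have "disjoint_family_on (%k. {a (h k)<..<b (h k)}) {0..<card J}"
   unfolding disjoint_family_on_def
  proof (intro ballI impI)
   fix k l assume kl: "k \<in> {0..<card J}" "l \<in> {0..<card J}" "k ~= l"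
   have "h k \<in> J" "h l \<in> J" using bij_betwE[OF h] kl by blast+
   moreover have "h k ~= h l" using inj_onD[OF bij_betw_imp_inj_on[OF h]] kl by blast
   ultimately show "{a (h k)<..<b (h k)} \<inter> {a (h l)<..<b (h l)} = {}"
   using assms unfolding nonoverlapping_def disjoint_family_on_def by blast
  qed
  then show "nonoverlapping S {0..<card J} (a \<circ> h) (b \<circ> h)"
   using assms h unfolding nonoverlapping_def bij_betw_def by auto
  show "\<forall>G :: 'i => real. (\<Sum>k\<in>{0..<card J}. G (h k)) = (\<Sum>k\<in>J. G k)"
   using sum.reindex_bij_betw[OF h] by blast
 qed
qed

text \<open>A null set is covered by countably many dyadic intervals of small total length; the \<open>\<epsilon>\<close>-\<open>\<delta>\<close> condition then
bounds the Stieltjes measure of the cover.\<close>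

lemma interval_measure_absolutely_continuous:
 fixes H :: "real => real"
 assumes AB: "A <= B" and mono: "!!x y. x <= y ==> H x <= H y"
  and cont: "continuous_on UNIV H"
  and out: "!!x. x <= A ==> H x = H A" "!!x. B <= x ==> H x = H B"
  and ac: "!!\<epsilon>. \<epsilon> > 0 ==> \<exists>\<delta>>0. \<forall>(I::nat set) a b. nonoverlapping {A..B} I a b & (\<Sum>k\<in>I. b k - a k) < \<delta>
   --> (\<Sum>k\<in>I. H (b k) - H (a k)) <= \<epsilon>"
 shows "absolutely_continuous lborel (interval_measure H)"
  and "emeasure (interval_measure H) (space (interval_measure H)) = ennreal (H B - H A)"
proof -
 let ?\<mu> = "interval_measure H"
 have Icc: "emeasure ?\<mu> {x..y} = ennreal (H y - H x)" if "x <= y" for x y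
  using emeasure_interval_measure_Icc[OF that mono cont] .
 have outer_null: "emeasure ?\<mu> (- {A..B}) = 0"
 proof -
  have "- {A..B} \<subseteq> (\<Union>n::nat. ({A - real n..A} - {A}) \<union> ({B..B + real n} - {B}))"
  proof
   fix x assume "x \<in> - {A..B}"
   moreover obtain n :: nat where "\<bar>x\<bar> + \<bar>A\<bar> + \<bar>B\<bar> < real n" using reals_Archimedean2 by blast
   ultimately show "x \<in> (\<Union>n::nat. ({A - real n..A} - {A}) \<union> ({B..B + real n} - {B}))"
   by (intro UN_I[of n]) auto
  qed
  moreover have "(\<Union>n::nat. ({A - real n..A} - {A}) \<union> ({B..B + real n} - {B})) \<in> null_sets ?\<mu>"
  proof (intro null_sets_UN null_sets.Un)
   fix n :: nat
   have "{A - real n..A} \<in> null_sets ?\<mu>" "{B..B + real n} \<in> null_sets ?\<mu>"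
   using out(1)[of "A - real n"] out(2)[of "B + real n"] by (auto simp: null_sets_def Icc)
   then show "{A - real n..A} - {A} \<in> null_sets ?\<mu>" "{B..B + real n} - {B} \<in> null_sets ?\<mu>"
   by (auto intro: null_sets_subset)
  qed
  ultimately have "- {A..B} \<in> null_sets ?\<mu>" by (rule null_sets_subset[rotated 2]) auto
  then show ?thesis by auto
 qed
 have "emeasure ?\<mu> UNIV = emeasure ?\<mu> ({A..B} \<union> - {A..B})" by simp
 also have "... = emeasure ?\<mu> {A..B} + emeasure ?\<mu> (- {A..B})" by (rule plus_emeasure[symmetric]) auto
 finally show "emeasure ?\<mu> (space ?\<mu>) = ennreal (H B - H A)" using outer_null AB by (simp add: Icc)
 show "absolutely_continuous lborel ?\<mu>"
  unfolding absolutely_continuous_def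
 proof
  fix N :: "real set" assume N: "N \<in> null_sets lborel"
  then have Nm: "N \<in> sets borel" by auto
  have small: "emeasure ?\<mu> (N \<inter> {A..B}) <= 0 + ennreal \<epsilon>" if eps: "\<epsilon> > 0" for \<epsilon>
  proof -
   obtain \<delta> where *: "\<delta> > 0 & (\<forall>(I::nat set) a b. nonoverlapping {A..B} I a b & (\<Sum>k\<in>I. b k - a k) < \<delta>
   --> (\<Sum>k\<in>I. H (b k) - H (a k)) <= \<epsilon>)" using ac[OF eps] by (rule exE)
   note \<delta> = conjunct1[OF *] conjunct2[OF *]
   have N0: "N \<inter> {A..B} \<in> null_sets lborel" using N by (auto intro: null_set_Int2)
   then have "N \<inter> {A..B} \<in> null_sets lebesgue" by (rule null_sets_completionI)
   then have Nl: "N \<inter> {A..B} \<in> lmeasurable" "measure lebesgue (N \<inter> {A..B}) = 0"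
   using negligible_iff_null_sets negligible_imp_measurable negligible_imp_measure0 by blast+
   have sub: "N \<inter> {A..B} \<subseteq> cbox A B" "0 < \<delta>/2" using \<delta>(1) by auto
   obtain \<D> where D: "countable \<D>"
   "!!K. K \<in> \<D> ==> K \<subseteq> cbox A B & K ~= {} & (\<exists>c d. K = cbox c d)"
   "pairwise (%A B. interior A \<inter> interior B = {}) \<D>"
   "!!u v. cbox u v \<in> \<D> ==> \<exists>n. \<forall>i \<in> Basis. v \<bullet> i - u \<bullet> i = (B \<bullet> i - A \<bullet> i)/2^n"
   "!!K. [|K \<in> \<D>; box A B ~= {}|] ==> interior K ~= {}"
   "N \<inter> {A..B} \<subseteq> \<Union>\<D>" "\<Union>\<D> \<in> lmeasurable" "measure lebesgue (\<Union>\<D>) <= measure lebesgue (N \<inter> {A..B}) + \<delta>/2"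
   by (rule measurable_outer_intervals_bounded[OF Nl(1) sub]) (rule that)
   have K: "\<exists>c d. K = {c..d} & c <= d & Inf K = c & Sup K = d & A <= c & d <= B" if KD: "K \<in> \<D>" for K
   proof -
   obtain c d where "K = cbox c d" "K ~= {}" "K \<subseteq> cbox A B" using D(2)[OF KD] by blast
   then show ?thesis by (intro exI[of _ c] exI[of _ d]) auto
   qed
   have Dm: "\<Union>\<D> \<in> sets borel"
   proof (rule sets.countable_Union[OF D(1)])
   show "\<D> \<subseteq> sets borel" using K by (metis atLeastAtMost_borel subsetI)
   qed
   have fin: "emeasure ?\<mu> (\<Union>F) <= ennreal \<epsilon>" if F: "finite F" "F \<subseteq> \<D>" for F
   proof -
   have no: "nonoverlapping {A..B} F Inf Sup"
   unfolding nonoverlapping_def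
   proof (intro conjI ballI F)
   fix k assume "k \<in> F"
   with K F show "Inf k <= Sup k" "{Inf k..Sup k} \<subseteq> {A..B}" by fastforce+
   next
   have "{Inf k<..<Sup k} = interior k" if kF: "k \<in> F" for k
   proof -
   obtain c d where "k = {c..d}" "Inf k = c" "Sup k = d" using K[of k] kF F by blast
   then show ?thesis by (metis interior_atLeastAtMost_real)
   qed
   then show "disjoint_family_on (%k. {Inf k<..<Sup k}) F"
   using D(3) F unfolding disjoint_family_on_def pairwise_def by (metis subsetD)
   qed
   have "ennreal (\<Sum>k\<in>F. Sup k - Inf k) = (\<Sum>k\<in>F. ennreal (Sup k - Inf k))"
   by (rule sum_ennreal[symmetric]) (use no in \<open>auto simp: nonoverlapping_def\<close>)
   also have "... = (\<Sum>k\<in>F. emeasure lborel {Inf k<..<Sup k})"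
   by (rule sum.cong) (use no in \<open>auto simp: nonoverlapping_def\<close>)
   also have "... = emeasure lborel (\<Union>k\<in>F. {Inf k<..<Sup k})"
   using no by (intro sum_emeasure) (auto simp: nonoverlapping_def)
   also have "... <= emeasure lborel (\<Union>\<D>)"
   proof (rule emeasure_mono)
   have "{Inf k<..<Sup k} \<subseteq> k" if kF: "k \<in> F" for k
   proof -
   obtain c d where "k = {c..d}" "Inf k = c" "Sup k = d" using K[of k] kF F by blast
   then show ?thesis by (metis greaterThanLessThan_subseteq_atLeastAtMost_iff order_refl)
   qed
   then show "(\<Union>k\<in>F. {Inf k<..<Sup k}) \<subseteq> \<Union>\<D>" using F(2) by fast
   qed (use Dm in simp)
   also have "... = ennreal (measure lebesgue (\<Union>\<D>))"
   proof -
   have "emeasure lborel (\<Union>\<D>) <= emeasure lborel (cbox A B)" using D(2) by (intro emeasure_mono) auto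
   then have "emeasure lborel (\<Union>\<D>) ~= \<top>" using emeasure_lborel_cbox_finite[of A B] by (metis infinity_ennreal_def less_irrefl top_unique)
   then show ?thesis using Dm by (simp add: emeasure_eq_ennreal_measure measure_completion)
   qed
   finally have "(\<Sum>k\<in>F. Sup k - Inf k) <= measure lebesgue (\<Union>\<D>)" by simp
   then have lt: "(\<Sum>k\<in>F. Sup k - Inf k) < \<delta>" using D(8) Nl \<delta>(1) by linarith
   obtain I :: "nat set" and h where Ih: "nonoverlapping {A..B} I (Inf \<circ> h) (Sup \<circ> h)"
   "\<forall>G :: real set => real. (\<Sum>k\<in>I. G (h k)) = (\<Sum>k\<in>F. G k)"
   using nonoverlapping_reindex[OF no] by blast
   have le: "(\<Sum>k\<in>F. H (Sup k) - H (Inf k)) <= \<epsilon>"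
   using \<delta>(2)[rule_format, OF conjI, OF Ih(1)] Ih(2)[rule_format, of "%k. Sup k - Inf k"] Ih(2)[rule_format, of "%k. H (Sup k) - H (Inf k)"] lt by simp
   have "emeasure ?\<mu> (\<Union>F) = emeasure ?\<mu> (\<Union>k\<in>F. {Inf k..Sup k})"
   proof (rule arg_cong[where f="emeasure ?\<mu>"])
   have "{Inf k..Sup k} = k" if "k \<in> F" for k using K[of k] that F by auto
   then show "\<Union>F = (\<Union>k\<in>F. {Inf k..Sup k})" by simp
   qed
   also have "... <= (\<Sum>k\<in>F. emeasure ?\<mu> {Inf k..Sup k})"
   using F by (intro emeasure_subadditive_finite) auto
   also have "... = (\<Sum>k\<in>F. ennreal (H (Sup k) - H (Inf k)))"
   by (rule sum.cong) (use no in \<open>auto simp: nonoverlapping_def Icc\<close>)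
   also have "... = ennreal (\<Sum>k\<in>F. H (Sup k) - H (Inf k))"
   by (rule sum_ennreal) (use no mono in \<open>auto simp: nonoverlapping_def\<close>)
   also have "... <= ennreal \<epsilon>" using le by (rule ennreal_leI)
   finally show ?thesis .
   qed
   show ?thesis
   proof (cases "\<D> = {}")
   case True then show ?thesis using D(6) by simp
   next
   case False
   define U where "U n = \<Union>(from_nat_into \<D> ` {..<n::nat})" for n
   have D_eq: "\<Union>\<D> = (\<Union>n. U n)"
   proof -
   have "\<Union>\<D> = \<Union>(range (from_nat_into \<D>))" using False D(1) by simp
   also have "... = (\<Union>n. U n)" unfolding U_def by auto
   finally show ?thesis .
   qed
   have Um: "U n \<in> sets ?\<mu>" for n
   proof -
   have "from_nat_into \<D> k \<in> sets ?\<mu>" for k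
   using K[OF from_nat_into[OF False]] by (metis atLeastAtMost_borel sets_interval_measure)
   then show ?thesis unfolding U_def by auto
   qed
   have "emeasure ?\<mu> (N \<inter> {A..B}) <= emeasure ?\<mu> (\<Union>n. U n)"
   using D(6) Um unfolding D_eq by (intro emeasure_mono) auto
   also have "... = (SUP n. emeasure ?\<mu> (U n))"
   proof (rule SUP_emeasure_incseq[symmetric])
   show "incseq U" unfolding incseq_def U_def by (intro allI impI Union_mono image_mono) auto
   qed (use Um in auto)
   also have "... <= ennreal \<epsilon>"
   unfolding U_def by (intro SUP_least fin) (auto intro: from_nat_into[OF False])
   finally show ?thesis by simp
   qed
  qed
  have "emeasure ?\<mu> (N \<inter> {A..B}) <= 0" by (rule ennreal_le_epsilon) (rule small)
  then have 1: "N \<inter> {A..B} \<in> null_sets ?\<mu>" using Nm by (auto simp: null_sets_def)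
  have "- {A..B} \<in> null_sets ?\<mu>" using outer_null by auto
  with 1 have "(N \<inter> {A..B}) \<union> - {A..B} \<in> null_sets ?\<mu>" by (rule null_sets.Un)
  then show "N \<in> null_sets ?\<mu>" by (rule null_sets_subset) (use Nm in auto)
 qed
qed

text \<open>By the previous lemma the Stieltjes measure of \<open>f\<close> is absolutely continuous with respect to Lebesgue measure,
so its Radon-Nikodym density is the required integrand.\<close>

lemma absolutely_continuous_mono_density:
 fixes H :: "real => real"
 assumes AB: "A <= B" and mono: "!!x y. x <= y ==> H x <= H y"
  and cont: "continuous_on UNIV H"
  and out: "!!x. x <= A ==> H x = H A" "!!x. B <= x ==> H x = H B"
  and ac: "!!\<epsilon>. \<epsilon> > 0 ==> \<exists>\<delta>>0. \<forall>(I::nat set) a b. nonoverlapping {A..B} I a b & (\<Sum>k\<in>I. b k - a k) < \<delta>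
   --> (\<Sum>k\<in>I. H (b k) - H (a k)) <= \<epsilon>"
 obtains g where "integrable lborel g" "!!x y. x <= y ==> H y - H x = (LBINT t:{x..y}. g t)"
proof -
 let ?\<mu> = "interval_measure H"
 note abc = interval_measure_absolutely_continuous[OF assms]
 obtain f where f: "f \<in> borel_measurable lborel" "density lborel f = ?\<mu>"
  using sigma_finite_measure.Radon_Nikodym[OF lborel.sigma_finite_measure_axioms abc(1)] by auto
 have Icc: "(\<integral>\<^sup>+t. f t * indicator {x..y} t \<partial>lborel) = ennreal (H y - H x)" if "x <= y" for x y
  using emeasure_interval_measure_Icc[OF that mono cont] f(1)
  by (simp add: f(2)[symmetric] emeasure_density)
 have tot: "(\<integral>\<^sup>+t. f t \<partial>lborel) = ennreal (H B - H A)"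
  using abc(2) f(1) by (simp add: f(2)[symmetric] emeasure_density)
 have fin: "AE t in lborel. f t < \<top>"
  using nn_integral_PInf_AE[OF f(1)] tot by (auto simp: top.not_eq_extremum)
 show thesis
 proof (rule that[of "%t. enn2real (f t)"])
  have "(\<integral>\<^sup>+t. ennreal (enn2real (f t)) \<partial>lborel) = (\<integral>\<^sup>+t. f t \<partial>lborel)"
   by (rule nn_integral_cong_AE) (use fin in \<open>eventually_elim, simp\<close>)
  then show "integrable lborel (%t. enn2real (f t))"
   using tot f(1) by (intro integrableI_nonneg) auto
  show "H y - H x = (LBINT t:{x..y}. enn2real (f t))" if "x <= y" for x y
  proof -
   have "(LBINT t:{x..y}. enn2real (f t)) = enn2real (\<integral>\<^sup>+t. ennreal (indicator {x..y} t * enn2real (f t)) \<partial>lborel)"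
   unfolding set_lebesgue_integral_def using f(1) by (subst integral_eq_nn_integral) auto
   also have "(\<integral>\<^sup>+t. ennreal (indicator {x..y} t * enn2real (f t)) \<partial>lborel) = (\<integral>\<^sup>+t. f t * indicator {x..y} t \<partial>lborel)"
   by (rule nn_integral_cong_AE) (use fin in \<open>eventually_elim, auto split: split_indicator\<close>)
   finally show ?thesis using Icc[OF that] mono[OF that] by simp
  qed
 qed
qed

definition oscillations :: "(real => real) => real => real => real set" where
 "oscillations f x y = {(\<Sum>k\<in>I. \<bar>f (b k) - f (a k)\<bar>) | (I :: nat set) a b. nonoverlapping {x..y} I a b}"

definition variation :: "(real => real) => real => real => real" where
 "variation f x y = Sup (oscillations f x y)"

lemma abs_continuous_on_nonoverlapping:
 "abs_continuous_on S f \<longleftrightarrow> (\<forall>\<epsilon>>0. \<exists>\<delta>>0. \<forall>(I::nat set) a b. nonoverlapping S I a b & (\<Sum>k\<in>I. b k - a k) < \<delta>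
   --> (\<Sum>k\<in>I. \<bar>f (b k) - f (a k)\<bar>) < \<epsilon>)"
 unfolding abs_continuous_on_def nonoverlapping_def by (simp add: conj_assoc)

lemma oscillations_ne: "oscillations f x y ~= {}"
proof -
 have "nonoverlapping {x..y} ({} :: nat set) (%_. 0) (%_. 0)"
  by (simp add: nonoverlapping_def disjoint_family_on_def)
 then show ?thesis unfolding oscillations_def by blast
qed

lemma oscillation_in:
 assumes "nonoverlapping {x..y} (J :: 'i set) a b"
 shows "(\<Sum>k\<in>J. \<bar>f (b k) - f (a k)\<bar>) \<in> oscillations f x y"
proof -
 obtain I :: "nat set" and h where I: "nonoverlapping {x..y} I (a \<circ> h) (b \<circ> h)"
  "\<forall>G :: 'i => real. (\<Sum>k\<in>I. G (h k)) = (\<Sum>k\<in>J. G k)"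
  using nonoverlapping_reindex[OF assms] by blast
 have "(\<Sum>k\<in>J. \<bar>f (b k) - f (a k)\<bar>) = (\<Sum>k\<in>I. \<bar>f ((b \<circ> h) k) - f ((a \<circ> h) k)\<bar>)"
  using I(2)[rule_format, of "%k. \<bar>f (b k) - f (a k)\<bar>"] by simp
 then show ?thesis unfolding oscillations_def using I(1) by blast
qed

lemma oscillation_le_variation:
 assumes "bdd_above (oscillations f x y)" "nonoverlapping {x..y} (J :: 'i set) a b"
 shows "(\<Sum>k\<in>J. \<bar>f (b k) - f (a k)\<bar>) <= variation f x y"
 unfolding variation_def by (rule cSup_upper[OF oscillation_in[OF assms(2)] assms(1)])

lemma nonoverlapping_single: "x <= a ==> a <= b ==> b <= y ==> nonoverlapping {x..y} {0::nat} (%_. a) (%_. b)"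
 by (auto simp: nonoverlapping_def disjoint_family_on_def)

lemma increment_le_variation:
 assumes "bdd_above (oscillations f x y)" "x <= a" "a <= b" "b <= y"
 shows "\<bar>f b - f a\<bar> <= variation f x y"
 using oscillation_le_variation[OF assms(1) nonoverlapping_single[OF assms(2-4)]] by simp

lemma variation_least:
 assumes "!!(I :: nat set) a b. nonoverlapping {x..y} I a b ==> (\<Sum>k\<in>I. \<bar>f (b k) - f (a k)\<bar>) <= C"
 shows "bdd_above (oscillations f x y)" "variation f x y <= C"
proof -
 show "bdd_above (oscillations f x y)" unfolding oscillations_def bdd_above_def using assms by blast
 show "variation f x y <= C" unfolding variation_def
  by (rule cSup_least[OF oscillations_ne]) (use assms in \<open>auto simp: oscillations_def\<close>)
qed

lemma bdd_oscillations_mono: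
 assumes "bdd_above (oscillations f x y)" "x <= x'" "y' <= y"
 shows "bdd_above (oscillations f x' y')"
proof -
 have "oscillations f x' y' \<subseteq> oscillations f x y"
  unfolding oscillations_def nonoverlapping_def using assms(2,3) by fastforce
 then show ?thesis using assms(1) by (rule bdd_above_mono[rotated])
qed

text \<open>Cutting every interval of a family at \<open>y\<close> only increases the oscillation sum.\<close>

lemma variation_split_le:
 assumes xy: "x <= y" "y <= z" and b1: "bdd_above (oscillations f x y)" and b2: "bdd_above (oscillations f y z)"
 shows "bdd_above (oscillations f x z)" "variation f x z <= variation f x y + variation f y z"
proof -
 have *: "(\<Sum>k\<in>I. \<bar>f (b k) - f (a k)\<bar>) <= variation f x y + variation f y z"
  if no: "nonoverlapping {x..z} (I :: nat set) a b" for I a b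
 proof -
  have sub: "disjoint_family_on (%k. {min (a k) y<..<min (b k) y}) I" "disjoint_family_on (%k. {max (a k) y<..<max (b k) y}) I"
  proof -
   have d: "disjoint_family_on (%k. {a k<..<b k}) I" using no by (simp add: nonoverlapping_def)
   have "{min (a k) y<..<min (b k) y} \<subseteq> {a k<..<b k}" "{max (a k) y<..<max (b k) y} \<subseteq> {a k<..<b k}" for k by auto
   then show "disjoint_family_on (%k. {min (a k) y<..<min (b k) y}) I" "disjoint_family_on (%k. {max (a k) y<..<max (b k) y}) I"
   using d unfolding disjoint_family_on_def by blast+
  qed
  have ab: "finite I" "!!k. k \<in> I ==> a k <= b k & x <= a k & b k <= z"
   using no by (auto simp: nonoverlapping_def)
  have n1: "nonoverlapping {x..y} I (%k. min (a k) y) (%k. min (b k) y)"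
   unfolding nonoverlapping_def
  proof (intro conjI ballI ab(1) sub)
   fix k assume "k \<in> I"
   from ab(2)[OF this] xy show "min (a k) y <= min (b k) y" "{min (a k) y..min (b k) y} \<subseteq> {x..y}" by auto
  qed
  have n2: "nonoverlapping {y..z} I (%k. max (a k) y) (%k. max (b k) y)"
   unfolding nonoverlapping_def
  proof (intro conjI ballI ab(1) sub)
   fix k assume "k \<in> I"
   from ab(2)[OF this] xy show "max (a k) y <= max (b k) y" "{max (a k) y..max (b k) y} \<subseteq> {y..z}" by auto
  qed
  have "(\<Sum>k\<in>I. \<bar>f (b k) - f (a k)\<bar>) <= (\<Sum>k\<in>I. \<bar>f (min (b k) y) - f (min (a k) y)\<bar> + \<bar>f (max (b k) y) - f (max (a k) y)\<bar>)"
   by (rule sum_mono) (auto simp: min_def max_def)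
  also have "... <= variation f x y + variation f y z"
   unfolding sum.distrib by (intro add_mono oscillation_le_variation b1 b2 n1 n2)
  finally show ?thesis .
 qed
 show "bdd_above (oscillations f x z)" "variation f x z <= variation f x y + variation f y z"
  using variation_least[OF *] by auto
qed

text \<open>On each interval of the family choose a finite subdivision that nearly realises its variation.  Together
these subdivisions form one nonoverlapping family, to which the assumed bound applies.\<close>

lemma variation_sum_le:
 assumes no: "nonoverlapping {x..y} (J :: 'i set) a b" and bd: "bdd_above (oscillations f x y)"
  and C: "!!(I :: ('i \<times> nat) set) a' b'. nonoverlapping {x..y} I a' b' ==> (\<Sum>k\<in>I. b' k - a' k) <= (\<Sum>k\<in>J. b k - a k) ==>
   (\<Sum>k\<in>I. \<bar>f (b' k) - f (a' k)\<bar>) <= C"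
 shows "(\<Sum>k\<in>J. variation f (a k) (b k)) <= C"
proof (rule field_le_epsilon)
 fix e :: real assume e: "e > 0"
 have J: "finite J" "!!k. k \<in> J ==> a k <= b k & x <= a k & b k <= y"
  "disjoint_family_on (%k. {a k<..<b k}) J"
  using no by (auto simp: nonoverlapping_def)
 define e' where "e' = e / (real (card J) + 1)"
 have e': "e' > 0" using e by (simp add: e'_def)
 have "\<exists>(I :: nat set) a' b'. nonoverlapping {a k..b k} I a' b' & variation f (a k) (b k) - e' < (\<Sum>i\<in>I. \<bar>f (b' i) - f (a' i)\<bar>)" for k
 proof -
  have "\<exists>v\<in>oscillations f (a k) (b k). Sup (oscillations f (a k) (b k)) - e' < v"
   by (rule less_cSupE[of "Sup (oscillations f (a k) (b k)) - e'" "oscillations f (a k) (b k)"]) (use e' oscillations_ne in auto)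
  then show ?thesis unfolding variation_def by (auto simp: oscillations_def)
 qed
 then obtain I a' b' where I: "!!k. nonoverlapping {a k..b k} (I k :: nat set) (a' k) (b' k)"
  "!!k. variation f (a k) (b k) - e' < (\<Sum>i\<in>I k. \<bar>f (b' k i) - f (a' k i)\<bar>)"
  by metis
 have If: "finite (I k)" "!!i. i \<in> I k ==> a' k i <= b' k i & a k <= a' k i & b' k i <= b k" for k
  using I(1)[of k] by (auto simp: nonoverlapping_def)
 have Id: "disjoint_family_on (%i. {a' k i<..<b' k i}) (I k)" for k
  using I(1)[of k] by (auto simp: nonoverlapping_def)
 have no': "nonoverlapping {x..y} (Sigma J I) (%(k, i). a' k i) (%(k, i). b' k i)"
  unfolding nonoverlapping_def
 proof (intro conjI ballI)
  show "finite (Sigma J I)" using J If by auto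
  fix p assume "p \<in> Sigma J I"
  then show "(case p of (k, i) => a' k i) <= (case p of (k, i) => b' k i)"
   "{case p of (k, i) => a' k i..case p of (k, i) => b' k i} \<subseteq> {x..y}"
   using J(2) If(2) by fastforce+
 next
  show "disjoint_family_on (%p. {case p of (k, i) => a' k i<..<case p of (k, i) => b' k i}) (Sigma J I)"
   unfolding disjoint_family_on_def
  proof (intro ballI impI)
   fix p q assume pq: "p \<in> Sigma J I" "q \<in> Sigma J I" "p ~= q"
   obtain k i l j where p: "p = (k, i)" and q: "q = (l, j)" by fastforce
   show "{case p of (k, i) => a' k i<..<case p of (k, i) => b' k i} \<inter> {case q of (k, i) => a' k i<..<case q of (k, i) => b' k i} = {}"
   proof (cases "k = l")
   case True
   then have "i ~= j" "i \<in> I k" "j \<in> I k" using pq p q by auto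
   then show ?thesis using Id[of k] True unfolding disjoint_family_on_def p q prod.case by blast
   next
   case False
   then have "{a k<..<b k} \<inter> {a l<..<b l} = {}" using J(3) pq p q unfolding disjoint_family_on_def by auto
   moreover have "{a' k i<..<b' k i} \<subseteq> {a k<..<b k}" "{a' l j<..<b' l j} \<subseteq> {a l<..<b l}"
   using If(2)[of i k] If(2)[of j l] pq p q by auto
   ultimately show ?thesis unfolding p q prod.case by blast
   qed
  qed
 qed
 have len: "(\<Sum>i\<in>I k. b' k i - a' k i) <= b k - a k" if k: "k \<in> J" for k
 proof -
  have "ennreal (\<Sum>i\<in>I k. b' k i - a' k i) = (\<Sum>i\<in>I k. ennreal (b' k i - a' k i))"
   by (rule sum_ennreal[symmetric]) (use If in auto)
  also have "... = (\<Sum>i\<in>I k. emeasure lborel {a' k i<..<b' k i})"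
   by (rule sum.cong) (use If in auto)
  also have "... = emeasure lborel (\<Union>i\<in>I k. {a' k i<..<b' k i})"
   using If Id by (intro sum_emeasure) auto
  also have "... <= emeasure lborel {a k..b k}"
   using If by (intro emeasure_mono) fastforce+
  also have "... = ennreal (b k - a k)" using J(2)[OF k] by simp
  finally show ?thesis using J(2)[OF k] by (simp add: ennreal_le_iff)
 qed
 have "(\<Sum>p\<in>Sigma J I. (case p of (k, i) => b' k i) - (case p of (k, i) => a' k i)) = (\<Sum>k\<in>J. \<Sum>i\<in>I k. b' k i - a' k i)"
  using J If by (simp add: sum.Sigma case_prod_unfold)
 also have "... <= (\<Sum>k\<in>J. b k - a k)" by (rule sum_mono) (rule len)
 finally have lenle: "(\<Sum>p\<in>Sigma J I. (case p of (k, i) => b' k i) - (case p of (k, i) => a' k i)) <= (\<Sum>k\<in>J. b k - a k)" .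
 have "(\<Sum>k\<in>J. variation f (a k) (b k)) <= (\<Sum>k\<in>J. (\<Sum>i\<in>I k. \<bar>f (b' k i) - f (a' k i)\<bar>) + e')"
  by (rule sum_mono) (use I(2) in \<open>simp add: less_imp_le algebra_simps\<close>)
 also have "... = (\<Sum>p\<in>Sigma J I. \<bar>f (case p of (k, i) => b' k i) - f (case p of (k, i) => a' k i)\<bar>) + real (card J) * e'"
  using J If by (simp add: sum.distrib sum.Sigma case_prod_unfold)
 also have "... <= C + e"
 proof (rule add_mono)
  show "(\<Sum>p\<in>Sigma J I. \<bar>f (case p of (k, i) => b' k i) - f (case p of (k, i) => a' k i)\<bar>) <= C"
   by (rule C[OF no' lenle])
  show "real (card J) * e' <= e" using e by (simp add: e'_def field_simps)
 qed
 finally show "(\<Sum>k\<in>J. variation f (a k) (b k)) <= C + e" .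
qed

lemma variation_additive:
 assumes xy: "x <= y" "y <= z" and bd: "bdd_above (oscillations f x z)"
 shows "variation f x z = variation f x y + variation f y z"
proof (rule antisym)
 show "variation f x z <= variation f x y + variation f y z"
  by (rule variation_split_le[OF xy]) (use bd xy in \<open>auto intro: bdd_oscillations_mono\<close>)
 have no: "nonoverlapping {x..z} {0::nat, 1} (%k. if k = 0 then x else y) (%k. if k = 0 then y else z)"
  using xy by (auto simp: nonoverlapping_def disjoint_family_on_def)
 have "(\<Sum>k\<in>{0::nat, 1}. variation f (if k = 0 then x else y) (if k = 0 then y else z)) <= variation f x z"
  by (rule variation_sum_le[OF no bd]) (rule oscillation_le_variation[OF bd])
 then show "variation f x y + variation f y z <= variation f x z" by simp
qed

lemma variation_nonneg: "bdd_above (oscillations f x y) ==> 0 <= variation f x y"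
 using oscillation_le_variation[of f x y "{}::nat set"] by (simp add: nonoverlapping_def disjoint_family_on_def)

lemma abs_continuous_on_variation_bound:
 assumes d: "\<delta> > 0" "\<forall>(I::nat set) a b. nonoverlapping S I a b & (\<Sum>k\<in>I. b k - a k) < \<delta>
   --> (\<Sum>k\<in>I. \<bar>f (b k) - f (a k)\<bar>) < \<epsilon>"
  and xy: "{x..y} \<subseteq> S" "x <= y" "y - x < \<delta>"
 shows "bdd_above (oscillations f x y) & variation f x y <= \<epsilon>"
proof -
 have "(\<Sum>k\<in>I. \<bar>f (b k) - f (a k)\<bar>) <= \<epsilon>" if no: "nonoverlapping {x..y} (I :: nat set) a b" for I a b
 proof -
  have I: "finite I" "!!k. k \<in> I ==> a k <= b k & x <= a k & b k <= y" "disjoint_family_on (%k. {a k<..<b k}) I"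
   using no by (auto simp: nonoverlapping_def)
  have "ennreal (\<Sum>k\<in>I. b k - a k) = (\<Sum>k\<in>I. ennreal (b k - a k))"
   by (rule sum_ennreal[symmetric]) (use I in auto)
  also have "... = (\<Sum>k\<in>I. emeasure lborel {a k<..<b k})"
   by (rule sum.cong) (use I in auto)
  also have "... = emeasure lborel (\<Union>k\<in>I. {a k<..<b k})"
   using I by (intro sum_emeasure) auto
  also have "... <= emeasure lborel {x..y}"
   using I by (intro emeasure_mono) fastforce+
  also have "... = ennreal (y - x)" using xy by simp
  finally have "(\<Sum>k\<in>I. b k - a k) < \<delta>" using xy by (simp add: ennreal_le_iff)
  moreover have "nonoverlapping S I a b" using no xy(1) unfolding nonoverlapping_def by blast
  ultimately show ?thesis using d(2) by (auto simp: less_imp_le)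
 qed
 from variation_least[OF this] show ?thesis by auto
qed

text \<open>A long interval is cut into pieces shorter than \<open>\<delta>\<close>, each of which contributes at most a fixed amount.\<close>

lemma abs_continuous_on_variation_linear:
 assumes d: "\<delta> > 0" "\<forall>(I::nat set) a b. nonoverlapping S I a b & (\<Sum>k\<in>I. b k - a k) < \<delta>
   --> (\<Sum>k\<in>I. \<bar>f (b k) - f (a k)\<bar>) < \<epsilon>"
 shows "x <= y ==> {x..y} \<subseteq> S ==> y - x <= real n * (\<delta>/2) ==> bdd_above (oscillations f x y) & variation f x y <= real n * \<epsilon>"
proof (induction n arbitrary: y)
 case 0
 then have "y = x" by simp
 have "(\<Sum>k\<in>I. \<bar>f (b k) - f (a k)\<bar>) <= 0" if no: "nonoverlapping {x..y} I a b" for I :: "nat set" and a b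
 proof (rule sum_nonpos)
  fix k assume "k \<in> I"
  then have "a k <= b k" "{a k..b k} \<subseteq> {x}" using no \<open>y = x\<close> by (auto simp: nonoverlapping_def)
  then have "a k = x" "b k = x" by (metis atLeastAtMost_iff order_refl singletonD subsetD)+
  then show "\<bar>f (b k) - f (a k)\<bar> <= 0" by simp
 qed
 from variation_least[OF this] show ?case by simp
next
 case (Suc n)
 define m where "m = max x (y - \<delta>/2)"
 have m: "x <= m" "m <= y" "y - m < \<delta>" "m - x <= real n * (\<delta>/2)"
  using Suc.prems d(1) by (auto simp: m_def max_def field_simps)
 have 1: "bdd_above (oscillations f x m) & variation f x m <= real n * \<epsilon>"
  using Suc.prems m by (intro Suc.IH) auto
 have 2: "bdd_above (oscillations f m y) & variation f m y <= \<epsilon>"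
  using Suc.prems m by (intro abs_continuous_on_variation_bound[OF d]) auto
 show ?case using variation_split_le[OF m(1,2), of f] 1 2 by (auto simp: algebra_simps)
qed

text \<open>Because \<open>f\<close> is continuous near \<open>0\<close>, its difference quotients satisfy the Cauchy criterion as soon as they
satisfy it for rational steps.  This turns differentiability into a countable condition, and so makes the set
of differentiability points measurable.\<close>

lemma differentiable_iff_rational_quotients:
 fixes f :: "real => real"
 assumes d: "d > 0" and cont: "continuous_on {-d<..<d} f"
 defines "Q \<equiv> %h. (f h - f 0) / h"
 shows "f differentiable (at 0) \<longleftrightarrow>
  (\<forall>j::nat. \<exists>i::nat. \<forall>h\<in>\<rat>. \<forall>k\<in>\<rat>. 0 < \<bar>h\<bar> & \<bar>h\<bar> < 1 / real (Suc i) & 0 < \<bar>k\<bar> & \<bar>k\<bar> < 1 / real (Suc i)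
   --> \<bar>Q h - Q k\<bar> <= 1 / real (Suc j))" (is "_ \<longleftrightarrow> ?crit")
proof
 assume "f differentiable (at 0)"
 then obtain D where "DERIV f 0 :> D" using real_differentiable_def by blast
 then have lim: "Q \<midarrow>0\<rightarrow> D" unfolding Q_def DERIV_def by simp
 show ?crit
 proof
  fix j :: nat
  define r where "r = 1 / (2 * real (Suc j))"
  have r: "r > 0" "r + r = 1 / real (Suc j)" by (simp_all add: r_def field_simps)
  from LIM_D[OF lim r(1)] obtain s where s: "s > 0" "!!h. h ~= 0 & norm (h - 0) < s ==> norm (Q h - D) < r"
   by blast
  obtain i :: nat where i: "1 / real (Suc i) < s" using nat_approx_posE[OF s(1)] by blast
  have "\<bar>Q h - Q k\<bar> <= 1 / real (Suc j)" if hk: "0 < \<bar>h\<bar>" "\<bar>h\<bar> < 1 / real (Suc i)" "0 < \<bar>k\<bar>" "\<bar>k\<bar> < 1 / real (Suc i)" for h k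
  proof -
   have "\<bar>Q h - D\<bar> < r" "\<bar>Q k - D\<bar> < r"
   using s(2)[of h] s(2)[of k] hk i by auto
   then show ?thesis unfolding r(2)[symmetric] by linarith
  qed
  then show "\<exists>i::nat. \<forall>h\<in>\<rat>. \<forall>k\<in>\<rat>. 0 < \<bar>h\<bar> & \<bar>h\<bar> < 1 / real (Suc i) & 0 < \<bar>k\<bar> & \<bar>k\<bar> < 1 / real (Suc i)
   --> \<bar>Q h - Q k\<bar> <= 1 / real (Suc j)" by blast
 qed
next
 assume c: ?crit
 have Qc: "isCont Q h" if "h ~= 0" "\<bar>h\<bar> < d" for h
 proof -
  have "isCont f h" using cont that by (auto simp: continuous_on_eq_continuous_at abs_less_iff)
  then show ?thesis unfolding Q_def using that by (intro continuous_intros) auto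
 qed
 have dense: "\<exists>q\<in>\<rat>. 0 < \<bar>q\<bar> & \<bar>q\<bar> < r & \<bar>Q h - Q q\<bar> < e"
  if h: "h ~= 0" "\<bar>h\<bar> < d" "\<bar>h\<bar> < r" and e: "e > 0" for h r e
 proof -
  obtain s where s: "s > 0" "!!y. \<bar>y - h\<bar> < s ==> \<bar>Q y - Q h\<bar> < e"
   using Qc[OF h(1,2)] e unfolding continuous_at_eps_delta dist_real_def by blast
  define t where "t = min s (min \<bar>h\<bar> (r - \<bar>h\<bar>))"
  have t: "t > 0" "t <= s" "t <= \<bar>h\<bar>" "t <= r - \<bar>h\<bar>" using s h by (auto simp: t_def)
  obtain q where q: "q \<in> \<rat>" "h < q" "q < h + t" using Rats_dense_in_real[of h "h + t"] t by auto
  show ?thesis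
   using q t s(2)[of q] by (intro bexI[of _ q]) (auto simp: abs_minus_commute)
 qed
 have bound: "\<exists>r>0. \<forall>h k. 0 < \<bar>h\<bar> & \<bar>h\<bar> < r & 0 < \<bar>k\<bar> & \<bar>k\<bar> < r --> \<bar>Q h - Q k\<bar> <= 1 / real (Suc j)" for j
 proof -
  obtain i :: nat where i: "!!h k. h \<in> \<rat> ==> k \<in> \<rat> ==> 0 < \<bar>h\<bar> ==> \<bar>h\<bar> < 1 / real (Suc i) ==> 0 < \<bar>k\<bar> ==> \<bar>k\<bar> < 1 / real (Suc i)
   ==> \<bar>Q h - Q k\<bar> <= 1 / real (Suc j)"
   using c by meson
  define r where "r = min d (1 / real (Suc i))"
  have "\<bar>Q h - Q k\<bar> <= 1 / real (Suc j)" if hk: "0 < \<bar>h\<bar>" "\<bar>h\<bar> < r" "0 < \<bar>k\<bar>" "\<bar>k\<bar> < r" for h k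
  proof (rule field_le_epsilon)
   fix e :: real assume e: "e > 0"
   obtain p where p: "p \<in> \<rat>" "0 < \<bar>p\<bar>" "\<bar>p\<bar> < 1 / real (Suc i)" "\<bar>Q h - Q p\<bar> < e/2"
   using dense[of h "1 / real (Suc i)" "e/2"] hk e by (auto simp: r_def)
   obtain q where q: "q \<in> \<rat>" "0 < \<bar>q\<bar>" "\<bar>q\<bar> < 1 / real (Suc i)" "\<bar>Q k - Q q\<bar> < e/2"
   using dense[of k "1 / real (Suc i)" "e/2"] hk e by (auto simp: r_def)
   show "\<bar>Q h - Q k\<bar> <= 1 / real (Suc j) + e" using i[of p q] p q by linarith
  qed
  then show ?thesis using d by (intro exI[of _ r]) (auto simp: r_def)
 qed
 have "Cauchy (%n. Q (1 / real (Suc n)))"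
  unfolding Cauchy_def
 proof (intro allI impI)
  fix e :: real assume "e > 0"
  then obtain j :: nat where j: "1 / real (Suc j) < e" using nat_approx_posE by blast
  from bound[of j] obtain r where rr: "r > 0 & (\<forall>h k. 0 < \<bar>h\<bar> & \<bar>h\<bar> < r & 0 < \<bar>k\<bar> & \<bar>k\<bar> < r --> \<bar>Q h - Q k\<bar> <= 1 / real (Suc j))"
   by (rule exE)
  have r: "r > 0" "!!h k. 0 < \<bar>h\<bar> ==> \<bar>h\<bar> < r ==> 0 < \<bar>k\<bar> ==> \<bar>k\<bar> < r ==> \<bar>Q h - Q k\<bar> <= 1 / real (Suc j)"
   by (rule rr[THEN conjunct1], rule rr[THEN conjunct2, rule_format], intro conjI)
  obtain N :: nat where N: "1 / real (Suc N) < r" using nat_approx_posE[OF r(1)] by blast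
  have "\<bar>1 / real (Suc n)\<bar> < r" if "n >= N" for n
  proof -
   have "1 / real (Suc n) <= 1 / real (Suc N)" using that by (intro divide_left_mono) auto
   then show ?thesis using N by simp
  qed
  then show "\<exists>M. \<forall>m\<ge>M. \<forall>n\<ge>M. dist (Q (1 / real (Suc m))) (Q (1 / real (Suc n))) < e"
   using r(2) j unfolding dist_real_def by (intro exI[of _ N] allI impI) (rule le_less_trans[OF _ j], auto)
 qed
 then obtain D where D: "(%n. Q (1 / real (Suc n))) \<longlonglongrightarrow> D"
  using Cauchy_convergent_iff convergent_def by blast
 have "Q \<midarrow>0\<rightarrow> D"
  unfolding LIM_eq
 proof (intro allI impI)
  fix e :: real assume "e > 0"
  then obtain j :: nat where j: "1 / real (Suc j) < e" using nat_approx_posE by blast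
  from bound[of j] obtain r where rr: "r > 0 & (\<forall>h k. 0 < \<bar>h\<bar> & \<bar>h\<bar> < r & 0 < \<bar>k\<bar> & \<bar>k\<bar> < r --> \<bar>Q h - Q k\<bar> <= 1 / real (Suc j))"
   by (rule exE)
  have r: "r > 0" "!!h k. 0 < \<bar>h\<bar> ==> \<bar>h\<bar> < r ==> 0 < \<bar>k\<bar> ==> \<bar>k\<bar> < r ==> \<bar>Q h - Q k\<bar> <= 1 / real (Suc j)"
   by (rule rr[THEN conjunct1], rule rr[THEN conjunct2, rule_format], intro conjI)
  obtain N :: nat where N: "1 / real (Suc N) < r" using nat_approx_posE[OF r(1)] by blast
  have "\<bar>Q h - D\<bar> <= 1 / real (Suc j)" if h: "0 < \<bar>h\<bar>" "\<bar>h\<bar> < r" for h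
  proof (rule LIMSEQ_le_const2)
   show "(%n. \<bar>Q h - Q (1 / real (Suc n))\<bar>) \<longlonglongrightarrow> \<bar>Q h - D\<bar>" by (intro tendsto_intros D)
   have "\<bar>Q h - Q (1 / real (Suc n))\<bar> <= 1 / real (Suc j)" if "n >= N" for n
   proof -
   have "1 / real (Suc n) <= 1 / real (Suc N)" using that by (intro divide_left_mono) auto
   then show ?thesis using N h by (intro r(2)) auto
   qed
   then show "\<exists>N. \<forall>n\<ge>N. \<bar>Q h - Q (1 / real (Suc n))\<bar> <= 1 / real (Suc j)" by blast
  qed
  then show "\<exists>s>0. \<forall>x. x ~= 0 & norm (x - 0) < s --> norm (Q x - D) < e"
   using r(1) j by (intro exI[of _ r]) (auto intro: le_less_trans)
 qed
 then have "DERIV f 0 :> D" unfolding Q_def DERIV_def by simp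
 then show "f differentiable (at 0)" using real_differentiable_def by blast
qed

lemma
 fixes \<phi> :: "'a => real => real"
 assumes meas: "!!h. (%x. \<phi> x h) \<in> borel_measurable M"
  and cont: "!!x. x \<in> space M ==> \<exists>d>0. continuous_on {-d<..<d} (\<phi> x)"
 shows measurable_differentiable_at_0: "{x \<in> space M. \<phi> x differentiable (at 0)} \<in> sets M"
  and measurable_deriv_at_0: "(%x. deriv (\<phi> x) 0) \<in> borel_measurable M"
proof -
 note [measurable] = meas
 define Q where "Q x h = (\<phi> x h - \<phi> x 0) / h" for x h
 have [measurable]: "(%x. Q x h) \<in> borel_measurable M" for h unfolding Q_def by measurable
 have eq: "{x \<in> space M. \<phi> x differentiable (at 0)} = {x \<in> space M.
  (\<forall>j::nat. \<exists>i::nat. \<forall>h\<in>\<rat>. \<forall>k\<in>\<rat>. 0 < \<bar>h\<bar> & \<bar>h\<bar> < 1 / real (Suc i) & 0 < \<bar>k\<bar> & \<bar>k\<bar> < 1 / real (Suc i)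
   --> \<bar>Q x h - Q x k\<bar> <= 1 / real (Suc j))}"
  unfolding Q_def using cont differentiable_iff_rational_quotients by (intro Collect_cong conj_cong refl) blast
 have rat: "(\<forall>h\<in>\<rat>. P h) \<longleftrightarrow> (\<forall>p :: rat. P (of_rat p))" for P :: "real => bool"
  unfolding Rats_def by blast
 show S: "{x \<in> space M. \<phi> x differentiable (at 0)} \<in> sets M"
  unfolding eq rat by measurable
 have "(%x. if \<phi> x differentiable (at 0) then lim (%n. Q x (1 / real (Suc n))) else (SOME D. False)) \<in> borel_measurable M"
 proof (rule measurable_If)
  show "(%x. lim (%n. Q x (1 / real (Suc n)))) \<in> borel_measurable M"
   by (rule borel_measurable_lim_metric) measurable
 qed (use S in auto)
 moreover have "deriv (\<phi> x) 0 = (if \<phi> x differentiable (at 0) then lim (%n. Q x (1 / real (Suc n))) else (SOME D. False))" for x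
 proof (cases "\<phi> x differentiable (at 0)")
  case True
  then obtain D where D: "DERIV (\<phi> x) 0 :> D" using real_differentiable_def by blast
  then have "Q x \<midarrow>0\<rightarrow> D" unfolding Q_def DERIV_def by simp
  then have "(%n. Q x (1 / real (Suc n))) \<longlonglongrightarrow> D"
   unfolding LIMSEQ_SEQ_conv[symmetric] by (elim allE[of _ "%n. 1 / real (Suc n)"]) (use LIMSEQ_inverse_real_of_nat in \<open>auto simp: inverse_eq_divide\<close>)
  then show ?thesis using True DERIV_imp_deriv[OF D] by (simp add: limI)
 next
  case False
  then have "~ DERIV (\<phi> x) 0 :> D" for D using real_differentiable_def by blast
  then show ?thesis using False by (simp add: deriv_def)
 qed
 ultimately show "(%x. deriv (\<phi> x) 0) \<in> borel_measurable M" by simp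
qed

lemma DERIV_shift_iff: "(f has_real_derivative D) (at t) \<longleftrightarrow> ((%h. f (t + h)) has_real_derivative D) (at 0)"
 using DERIV_shift[of f D 0 t] by (simp add: add.commute)

lemma deriv_shift_0: "deriv f t = deriv (%h. f (t + h)) (0::real)" for f :: "real => real"
 unfolding deriv_def DERIV_shift_iff[of f _ t] ..

text \<open>Where \<open>f\<close> is not differentiable, \<open>deriv\<close> returns one fixed value, so the previous measurability statements
apply without an exceptional set.\<close>

lemma borel_measurable_deriv:
 fixes f :: "real => real"
 assumes cont: "continuous_on UNIV f"
 shows "deriv f \<in> borel_measurable borel"
proof -
 have "(%t. deriv (%h. f (t + h)) 0) \<in> borel_measurable borel"
 proof (rule measurable_deriv_at_0)
  show "(%t. f (t + h)) \<in> borel_measurable borel" for h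
   by (rule borel_measurable_continuous_onI, rule continuous_on_compose2[OF cont], intro continuous_intros, simp)
  have "continuous_on {-1<..<1} (%h. f (t + h))" for t
   by (rule continuous_on_compose2[OF cont], intro continuous_intros, simp)
  then show "\<exists>d>0. continuous_on {-d<..<d} (%h. f (t + h))" for t
   using zero_less_one by blast
 qed
 then show ?thesis unfolding deriv_shift_0[symmetric] .
qed

text \<open>Jordan decomposition: both \<open>f + variation\<close> and \<open>variation\<close> are nondecreasing and absolutely continuous, hence
indefinite integrals, and the derivative of \<open>f\<close> is almost everywhere the difference of the two densities.\<close>

theorem abs_continuous_on_integral_representation:
 fixes f :: "real => real"
 assumes AB: "A <= B" and ac: "abs_continuous_on {A..B} f"
 obtains g where "integrable lborel g"
  "!!x y. A <= x ==> x <= y ==> y <= B ==> f y - f x = (LBINT t:{x..y}. g t)"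
  "AE x in lborel. A < x & x < B --> (f has_real_derivative g x) (at x)"
  "!!x y. A <= x ==> x <= y ==> y <= B ==> (LBINT t:{x..y}. \<bar>g t\<bar>) <= variation f x y"
proof -
 note ac' = ac[unfolded abs_continuous_on_nonoverlapping, rule_format]
 have bd: "bdd_above (oscillations f x y)" if "A <= x" "y <= B" for x y
 proof -
  obtain \<delta> where d: "\<delta> > 0" "\<forall>(I::nat set) a b. nonoverlapping {A..B} I a b & (\<Sum>k\<in>I. b k - a k) < \<delta>
   --> (\<Sum>k\<in>I. \<bar>f (b k) - f (a k)\<bar>) < 1" using ac'[of 1] by auto
  obtain n :: nat where n: "B - A <= real n * (\<delta>/2)"
   using d(1) reals_Archimedean3[of "\<delta>/2"] by (metis half_gt_zero less_imp_le)
  have "bdd_above (oscillations f A B)"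
   using abs_continuous_on_variation_linear[OF d AB _ n] by auto
  then show ?thesis by (rule bdd_oscillations_mono) (use that in auto)
 qed
 define cl where "cl x = max A (min B x)" for x
 have cl: "A <= cl x" "cl x <= B" "x <= y ==> cl x <= cl y" "x <= y ==> cl y - cl x <= y - x" for x y
  using AB by (auto simp: cl_def max_def min_def)
 have cl_id: "A <= x ==> x <= B ==> cl x = x" for x by (auto simp: cl_def)
 have cl_out: "x <= A ==> cl x = cl A" "B <= x ==> cl x = cl B" for x using AB by (auto simp: cl_def)
 define V where "V x = variation f A (cl x)" for x
 define F where "F x = f (cl x)" for x
 have V_diff: "V y - V x = variation f (cl x) (cl y)" if "x <= y" for x y
  using variation_additive[of A "cl x" "cl y" f] cl[of x] cl[of y] cl(3)[OF that] bd by (simp add: V_def)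
 have V_mono: "V x <= V y" if "x <= y" for x y
  using V_diff[OF that] variation_nonneg[OF bd[of "cl x" "cl y"]] cl by simp
 have FV: "\<bar>F y - F x\<bar> <= V y - V x" if "x <= y" for x y
  unfolding V_diff[OF that] F_def using cl that by (intro increment_le_variation bd) auto
 have V_ac: "\<exists>\<delta>>0. \<forall>(I::nat set) a b. nonoverlapping {A..B} I a b & (\<Sum>k\<in>I. b k - a k) < \<delta>
   --> (\<Sum>k\<in>I. V (b k) - V (a k)) <= \<epsilon>" if e: "\<epsilon> > 0" for \<epsilon>
 proof -
  obtain \<delta> where d: "\<delta> > 0" "\<forall>(I::nat set) a b. nonoverlapping {A..B} I a b & (\<Sum>k\<in>I. b k - a k) < \<delta>
   --> (\<Sum>k\<in>I. \<bar>f (b k) - f (a k)\<bar>) < \<epsilon>" using ac'[OF e] by auto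
  have "(\<Sum>k\<in>I. V (b k) - V (a k)) <= \<epsilon>" if no: "nonoverlapping {A..B} (I::nat set) a b" and len: "(\<Sum>k\<in>I. b k - a k) < \<delta>" for I a b
  proof -
   have "(\<Sum>k\<in>I. V (b k) - V (a k)) = (\<Sum>k\<in>I. variation f (a k) (b k))"
   using no by (intro sum.cong refl) (auto simp: nonoverlapping_def V_diff cl_id)
   also have "... <= \<epsilon>"
   proof (rule variation_sum_le[OF no bd])
   fix I' :: "(nat \<times> nat) set" and a' b'
   assume no': "nonoverlapping {A..B} I' a' b'" and le: "(\<Sum>k\<in>I'. b' k - a' k) <= (\<Sum>k\<in>I. b k - a k)"
   obtain K :: "nat set" and h where K: "nonoverlapping {A..B} K (a' \<circ> h) (b' \<circ> h)"
   "\<forall>G :: nat \<times> nat => real. (\<Sum>k\<in>K. G (h k)) = (\<Sum>k\<in>I'. G k)"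
   using nonoverlapping_reindex[OF no'] by blast
   have "(\<Sum>k\<in>K. \<bar>f ((b' \<circ> h) k) - f ((a' \<circ> h) k)\<bar>) < \<epsilon>"
   using d(2)[rule_format, OF conjI, OF K(1)] K(2)[rule_format, of "%k. b' k - a' k"] le len by simp
   then show "(\<Sum>k\<in>I'. \<bar>f (b' k) - f (a' k)\<bar>) <= \<epsilon>"
   using K(2)[rule_format, of "%k. \<bar>f (b' k) - f (a' k)\<bar>"] by simp
   qed auto
   finally show ?thesis .
  qed
  then show ?thesis using d(1) by blast
 qed
 have V_small: "\<exists>\<delta>>0. \<forall>x y. x <= y & y - x < \<delta> --> V y - V x <= \<epsilon>" if e: "\<epsilon> > 0" for \<epsilon>
 proof -
  obtain \<delta> where d: "\<delta> > 0" "\<forall>(I::nat set) a b. nonoverlapping {A..B} I a b & (\<Sum>k\<in>I. b k - a k) < \<delta>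
   --> (\<Sum>k\<in>I. \<bar>f (b k) - f (a k)\<bar>) < \<epsilon>" using ac'[OF e] by auto
  have "V y - V x <= \<epsilon>" if xy: "x <= y" "y - x < \<delta>" for x y
  proof -
   have "cl y - cl x < \<delta>" using cl(4)[of x y] xy by simp
   moreover have "{cl x..cl y} \<subseteq> {A..B}" using cl(1)[of x] cl(2)[of y] by auto
   ultimately show ?thesis unfolding V_diff[OF xy(1)]
   using abs_continuous_on_variation_bound[OF d, of "cl x" "cl y"] cl(3)[OF xy(1)] by simp
  qed
  then show ?thesis using d(1) by blast
 qed
 have cont: "continuous_on UNIV H" if H: "!!x y. x <= y ==> \<bar>H y - H x\<bar> <= 2 * (V y - V x)" for H :: "real => real"
  unfolding continuous_on_iff
 proof (intro ballI allI impI)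
  fix x e :: real assume e: "0 < e"
  obtain \<delta> where d: "\<delta> > 0" "!!x y. x <= y ==> y - x < \<delta> ==> V y - V x <= e/3" using V_small[of "e/3"] e by auto
  have "\<bar>H y - H x\<bar> < e" if "\<bar>y - x\<bar> < \<delta>" for y
   using H[of x y] H[of y x] d(2)[of x y] d(2)[of y x] that e by (cases "x <= y") auto
  then show "\<exists>d>0. \<forall>x'\<in>UNIV. dist x' x < d --> dist (H x') (H x) < e"
   using d(1) by (auto simp: dist_real_def)
 qed
 have dens: "\<exists>g. integrable lborel g & (\<forall>x y. x <= y --> H y - H x = (LBINT t:{x..y}. g t))"
  if H: "!!x y. x <= y ==> 0 <= H y - H x" "!!x y. x <= y ==> H y - H x <= 2 * (V y - V x)"
   "!!x y. cl x = cl y ==> H x = H y" for H :: "real => real"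
 proof -
  have ac2: "\<exists>\<delta>>0. \<forall>(I::nat set) a b. nonoverlapping {A..B} I a b & (\<Sum>k\<in>I. b k - a k) < \<delta>
   --> (\<Sum>k\<in>I. H (b k) - H (a k)) <= \<epsilon>" if e: "\<epsilon> > 0" for \<epsilon>
  proof -
   obtain \<delta> where d: "\<delta> > 0" "\<forall>(I::nat set) a b. nonoverlapping {A..B} I a b & (\<Sum>k\<in>I. b k - a k) < \<delta>
   --> (\<Sum>k\<in>I. V (b k) - V (a k)) <= \<epsilon>/2" using V_ac[of "\<epsilon>/2"] e by auto
   have "(\<Sum>k\<in>I. H (b k) - H (a k)) <= \<epsilon>" if no: "nonoverlapping {A..B} (I::nat set) a b" and len: "(\<Sum>k\<in>I. b k - a k) < \<delta>" for I a b
   proof -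
   have "(\<Sum>k\<in>I. H (b k) - H (a k)) <= (\<Sum>k\<in>I. 2 * (V (b k) - V (a k)))"
   using no H(2) by (intro sum_mono) (auto simp: nonoverlapping_def)
   also have "... <= \<epsilon>" using d(2)[rule_format, OF conjI, OF no len] unfolding sum_distrib_left[symmetric] by simp
   finally show ?thesis .
   qed
   then show ?thesis using d(1) by blast
  qed
  have cH: "continuous_on UNIV H"
  proof (rule cont)
   show "\<bar>H y - H x\<bar> <= 2 * (V y - V x)" if "x <= y" for x y using H(1,2)[OF that] by linarith
  qed
  have mH: "H x <= H y" if "x <= y" for x y using H(1)[OF that] by simp
  obtain g where "integrable lborel g" "!!x y. x <= y ==> H y - H x = (LBINT t:{x..y}. g t)"
   by (rule absolutely_continuous_mono_density[OF AB mH cH H(3)[OF cl_out(1)] H(3)[OF cl_out(2)] ac2]) (assumption | rule that)+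
  then show ?thesis by blast
 qed
 have "\<exists>g. integrable lborel g & (\<forall>x y. x <= y --> V y - V x = (LBINT t:{x..y}. g t))"
 proof (rule dens[of V])
  show "0 <= V y - V x" "V y - V x <= 2 * (V y - V x)" if "x <= y" for x y using V_mono[OF that] by simp_all
 qed (simp add: V_def)
 then obtain gV where gV: "integrable lborel gV" "!!x y. x <= y ==> V y - V x = (LBINT t:{x..y}. gV t)"
  by blast
 have "\<exists>g. integrable lborel g & (\<forall>x y. x <= y --> (V y - F y) - (V x - F x) = (LBINT t:{x..y}. g t))"
 proof (rule dens[of "%x. V x - F x"])
  show "0 <= (V y - F y) - (V x - F x)" "(V y - F y) - (V x - F x) <= 2 * (V y - V x)" if "x <= y" for x y
   using FV[OF that] by (simp_all add: abs_le_iff)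
 qed (simp add: V_def F_def)
 then obtain g2 where g2: "integrable lborel g2" "!!x y. x <= y ==> (V y - F y) - (V x - F x) = (LBINT t:{x..y}. g2 t)"
  by blast
 define g where "g t = gV t - g2 t" for t
 have g: "integrable lborel g" unfolding g_def using gV g2 by auto
 have gF: "F y - F x = (LBINT t:{x..y}. g t)" if "x <= y" for x y
 proof -
  have "(LBINT t:{x..y}. g t) = (LBINT t:{x..y}. gV t) - (LBINT t:{x..y}. g2 t)"
   unfolding g_def by (intro set_integral_diff set_integrable_Icc gV g2)
  then show ?thesis using gV(2)[OF that] g2(2)[OF that] by simp
 qed
 have dF: "AE x in lborel. (F has_real_derivative g x) (at x)" by (rule AE_has_derivative_indefinite_integral[OF g gF])
 have dV: "AE x in lborel. (V has_real_derivative gV x) (at x)" by (rule AE_has_derivative_indefinite_integral[OF gV])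
 have le: "AE x in lborel. \<bar>g x\<bar> <= gV x"
  using dF dV
 proof eventually_elim
  case (elim x)
  show ?case
  proof (rule tendsto_le[of "at x"])
   show "((%y. (V y - V x) / (y - x)) \<longlongrightarrow> gV x) (at x)" using elim(2) by (simp add: has_field_derivative_iff)
   show "((%y. \<bar>(F y - F x) / (y - x)\<bar>) \<longlongrightarrow> \<bar>g x\<bar>) (at x)"
   using elim(1) by (intro tendsto_rabs) (simp add: has_field_derivative_iff)
   have "\<bar>(F y - F x) / (y - x)\<bar> <= (V y - V x) / (y - x)" if "y ~= x" for y
   proof (cases "x < y")
   case True then show ?thesis using FV[of x y] by (simp add: divide_right_mono)
   next
   case False
   then have yx: "y < x" using that by auto
   have "\<bar>(F y - F x) / (y - x)\<bar> = \<bar>F x - F y\<bar> / (x - y)" using yx by (simp add: abs_minus_commute)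
   also have "... <= (V x - V y) / (x - y)" using FV[of y x] yx by (intro divide_right_mono) auto
   also have "... = (V y - V x) / (y - x)" by (metis minus_diff_eq minus_divide_divide)
   finally show ?thesis .
   qed
   then show "\<forall>\<^sub>F y in at x. \<bar>(F y - F x) / (y - x)\<bar> <= (V y - V x) / (y - x)"
   unfolding eventually_at_filter by (intro always_eventually allI impI)
  qed simp
 qed
 show thesis
 proof (rule that[OF g])
  fix x y assume xy: "A <= x" "x <= y" "y <= B"
  show "f y - f x = (LBINT t:{x..y}. g t)" using gF[OF xy(2)] xy by (simp add: F_def cl_id)
  have "(LBINT t:{x..y}. \<bar>g t\<bar>) <= (LBINT t:{x..y}. gV t)"
   unfolding set_lebesgue_integral_def
   by (rule integral_mono_AE) (use le g gV set_integrable_Icc[OF integrable_abs[OF g]] set_integrable_Icc[OF gV(1)] in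
   \<open>auto simp: set_integrable_def split: split_indicator\<close>)
  also have "... = variation f x y" using gV(2)[OF xy(2)] V_diff[OF xy(2)] xy by (simp add: cl_id)
  finally show "(LBINT t:{x..y}. \<bar>g t\<bar>) <= variation f x y" .
 next
  show "AE x in lborel. A < x & x < B --> (f has_real_derivative g x) (at x)"
   using dF
  proof eventually_elim
   case (elim x)
   show ?case
   proof
   assume x: "A < x & x < B"
   show "(f has_real_derivative g x) (at x)"
   by (rule has_field_derivative_transform_within_open[OF elim, of "{A<..<B}"]) (use x in \<open>auto simp: F_def cl_id\<close>)
   qed
  qed
 qed
qed

lemma abs_continuous_on_subset:
 assumes "abs_continuous_on S f" "T \<subseteq> S"
 shows "abs_continuous_on T f"
 unfolding abs_continuous_on_nonoverlapping
proof (intro allI impI)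
 fix \<epsilon> :: real assume "\<epsilon> > 0"
 then obtain \<delta> where d: "\<delta> > 0" "\<forall>(I::nat set) a b. nonoverlapping S I a b & (\<Sum>k\<in>I. b k - a k) < \<delta>
   --> (\<Sum>k\<in>I. \<bar>f (b k) - f (a k)\<bar>) < \<epsilon>"
  using assms(1)[unfolded abs_continuous_on_nonoverlapping] by blast
 have "nonoverlapping S I a b" if "nonoverlapping T I a b" for I :: "nat set" and a b
  using that assms(2) unfolding nonoverlapping_def by blast
 then show "\<exists>\<delta>>0. \<forall>(I::nat set) a b. nonoverlapping T I a b & (\<Sum>k\<in>I. b k - a k) < \<delta>
   --> (\<Sum>k\<in>I. \<bar>f (b k) - f (a k)\<bar>) < \<epsilon>"
  using d by blast
qed

lemma abs_continuous_on_AE_differentiable: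
 assumes "!!T. T > 0 ==> abs_continuous_on {0..T} f"
 shows "AE t in lborel. 0 < t --> f differentiable (at t)"
proof -
 have "AE t in lborel. 0 < t & t < real (Suc n) --> f differentiable (at t)" for n
 proof -
  have "0 <= real (Suc n)" "abs_continuous_on {0..real (Suc n)} f" using assms by auto
  then obtain g where "AE x in lborel. 0 < x & x < real (Suc n) --> (f has_real_derivative g x) (at x)"
   using abs_continuous_on_integral_representation by metis
  then show ?thesis by eventually_elim (auto simp: real_differentiable_def)
 qed
 then have "AE t in lborel. \<forall>n. 0 < t & t < real (Suc n) --> f differentiable (at t)"
  by (intro AE_all_countable[THEN iffD2] allI)
 then show ?thesis
 proof eventually_elim
  case (elim t)
  obtain n :: nat where "t < real n" using reals_Archimedean2 by blast
  then have "t < real (Suc n)" by simp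
  then show ?case using elim by blast
 qed
qed

text \<open>\<open>J\<close> is the indefinite integral of \<open>\<bar>deriv f\<bar>\<close>.  The whole construction below sees the initial velocity only
through this majorant: it controls the velocity gap of two particles by an additive function of their labels.\<close>

lemma abs_continuous_antiderivative:
 assumes ac: "abs_continuous_on UNIV f"
 obtains J where "!!a b. a <= b ==> J b - J a = (LBINT x:{a..b}. \<bar>deriv f x\<bar>)"
  "!!a b. a <= b ==> \<bar>f b - f a\<bar> <= J b - J a"
  "!!\<epsilon>. \<epsilon> > 0 ==> \<exists>\<delta>>0. \<forall>a b. a <= b & b - a < \<delta> --> J b - J a <= \<epsilon>"
proof -
 have small: "\<exists>\<delta>>0. \<forall>a b. a <= b & b - a < \<delta> --> bdd_above (oscillations f a b) & variation f a b <= \<epsilon>" if e: "\<epsilon> > 0" for \<epsilon>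
 proof -
  obtain \<delta> where d: "\<delta> > 0" "\<forall>(I::nat set) a b. nonoverlapping UNIV I a b & (\<Sum>k\<in>I. b k - a k) < \<delta>
   --> (\<Sum>k\<in>I. \<bar>f (b k) - f (a k)\<bar>) < \<epsilon>"
   using ac[unfolded abs_continuous_on_nonoverlapping] e by blast
  have "bdd_above (oscillations f a b) & variation f a b <= \<epsilon>" if "a <= b" "b - a < \<delta>" for a b
   by (rule abs_continuous_on_variation_bound[OF d]) (use that in auto)
  then show ?thesis using d(1) by (intro exI[of _ \<delta>]) simp
 qed
 have cont: "continuous_on UNIV f"
  unfolding continuous_on_iff
 proof (intro ballI allI impI)
  fix x e :: real assume e: "0 < e"
  obtain \<delta> where d: "\<delta> > 0" "!!a b. a <= b ==> b - a < \<delta> ==> bdd_above (oscillations f a b) & variation f a b <= e/2"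
  proof -
   from e have "e/2 > 0" by simp
   from small[OF this] show ?thesis using that by (elim exE conjE) simp
  qed
  have *: "\<bar>f b - f a\<bar> < e" if "a <= b" "b - a < \<delta>" for a b
   using increment_le_variation[of f a b a b] d(2)[OF that] that e by auto
  have "\<bar>f y - f x\<bar> < e" if "\<bar>y - x\<bar> < \<delta>" for y
   using *[of x y] *[of y x] that by (cases "x <= y") auto
  then show "\<exists>d>0. \<forall>x'\<in>UNIV. dist x' x < d --> dist (f x') (f x) < e"
   using d(1) by (auto simp: dist_real_def)
 qed
 have dm[measurable]: "deriv f \<in> borel_measurable borel" by (rule borel_measurable_deriv[OF cont])
 define I where "I a b = (LBINT x:{a..b}. \<bar>deriv f x\<bar>)" for a b
 have key: "set_integrable lborel {a..b} (%x. \<bar>deriv f x\<bar>) & \<bar>f b - f a\<bar> <= I a b & I a b <= variation f a b"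
  if ab: "a <= b" for a b
 proof -
  have "a - 1 <= b + 1" "abs_continuous_on {a - 1..b + 1} f" using ab abs_continuous_on_subset[OF ac] by auto
  then obtain g where g: "integrable lborel g"
   "!!x y. a - 1 <= x ==> x <= y ==> y <= b + 1 ==> f y - f x = (LBINT t:{x..y}. g t)"
   "AE x in lborel. a - 1 < x & x < b + 1 --> (f has_real_derivative g x) (at x)"
   "!!x y. a - 1 <= x ==> x <= y ==> y <= b + 1 ==> (LBINT t:{x..y}. \<bar>g t\<bar>) <= variation f x y"
   by (rule abs_continuous_on_integral_representation) (rule that)
  have eq: "AE x in lborel. indicator {a..b} x *\<^sub>R \<bar>deriv f x\<bar> = indicator {a..b} x *\<^sub>R \<bar>g x\<bar>"
   using g(3) by eventually_elim (auto simp: DERIV_imp_deriv split: split_indicator)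
  have gi: "set_integrable lborel {a..b} (%x. \<bar>g x\<bar>)" by (rule set_integrable_Icc) (use g in auto)
  have gm[measurable]: "g \<in> borel_measurable borel" using borel_measurable_integrable[OF g(1)] by simp
  have "set_integrable lborel {a..b} (%x. \<bar>deriv f x\<bar>) \<longleftrightarrow> set_integrable lborel {a..b} (%x. \<bar>g x\<bar>)"
   unfolding set_integrable_def by (rule integrable_cong_AE) (use eq in auto)
  moreover have "I a b = (LBINT x:{a..b}. \<bar>g x\<bar>)"
   unfolding I_def set_lebesgue_integral_def by (rule integral_cong_AE) (use eq in auto)
  moreover have "\<bar>f b - f a\<bar> <= (LBINT x:{a..b}. \<bar>g x\<bar>)"
   unfolding g(2)[of a b, OF _ ab _, simplified] set_lebesgue_integral_def
   by (rule order_trans[OF integral_abs_bound]) (simp add: abs_mult)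
  moreover have "(LBINT x:{a..b}. \<bar>g x\<bar>) <= variation f a b" using g(4)[of a b] ab by simp
  ultimately show ?thesis using gi by simp
 qed
 have add: "I a c = I a b + I b c" if "a <= b" "b <= c" for a b c
 proof -
  have "{a..c} = {a..b} \<union> {b..c}" using that by auto
  moreover have "(LBINT x:{a..b} \<union> {b..c}. \<bar>deriv f x\<bar>) = I a b + I b c"
   unfolding I_def
  proof (rule set_integral_Un_AE)
   show "AE x in lborel. ~ (x \<in> {a..b} & x \<in> {b..c})"
   using AE_lborel_singleton[of b] by eventually_elim auto
  qed (use key that in auto)
  ultimately show ?thesis by (simp add: I_def)
 qed
 have I0: "I a a = 0" for a using add[of a a a] by simp
 define J where "J x = (if 0 <= x then I 0 x else - I x 0)" for x
 have J: "J b - J a = I a b" if "a <= b" for a b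
  using add[of 0 a b] add[of a 0 b] add[of a b 0] that by (auto simp: J_def)
 show thesis
 proof (rule that[of J])
  show "J b - J a = (LBINT x:{a..b}. \<bar>deriv f x\<bar>)" if "a <= b" for a b using J[OF that] by (simp add: I_def)
  show "\<bar>f b - f a\<bar> <= J b - J a" if "a <= b" for a b using J[OF that] key[OF that] by simp
  show "\<exists>\<delta>>0. \<forall>a b. a <= b & b - a < \<delta> --> J b - J a <= \<epsilon>" if e: "\<epsilon> > 0" for \<epsilon>
  proof -
   from small[OF e] obtain \<delta> where d: "\<delta> > 0 & (\<forall>a b. a <= b & b - a < \<delta> --> bdd_above (oscillations f a b) & variation f a b <= \<epsilon>)"
   by (rule exE)
   have "J b - J a <= \<epsilon>" if ab: "a <= b" "b - a < \<delta>" for a b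
   using J[OF ab(1)] key[OF ab(1)] d[THEN conjunct2, rule_format, OF conjI[OF ab]] by simp
   then show ?thesis using d[THEN conjunct1] by (intro exI[of _ \<delta>]) simp
  qed
 qed
qed

section \<open>Monotone projection on a finite set\<close>

text \<open>The weighted projection of \<open>U\<close> onto nondecreasing functions, written with its variational inequality instead
of as a minimiser.  The last clause says that \<open>x\<close> is the mean of \<open>U\<close> over each of its level sets.\<close>

definition isotonic_regression :: "real set => (real => real) => (real => real) => (real => real) => bool" where
 "isotonic_regression A m U x \<longleftrightarrow> mono_on A x &
   (\<forall>g. mono_on A g --> (\<Sum>a\<in>A. m a * (U a - x a) * g a) <= 0) &
   (\<forall>g. (\<forall>a\<in>A. \<forall>b\<in>A. x a = x b --> g a = g b) --> (\<Sum>a\<in>A. m a * (U a - x a) * g a) = 0)"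

lemma isotonic_regressionD:
 assumes "isotonic_regression A m U x"
 shows isotonic_regression_mono: "mono_on A x"
  and isotonic_regression_le: "mono_on A g ==> (\<Sum>a\<in>A. m a * (U a - x a) * g a) <= 0"
  and isotonic_regression_eq: "(!!a b. a \<in> A ==> b \<in> A ==> x a = x b ==> g a = g b) ==> (\<Sum>a\<in>A. m a * (U a - x a) * g a) = 0"
 using assms unfolding isotonic_regression_def by blast+

lemma isotonic_regression_exists:
 fixes A :: "real set"
 assumes "finite A" "!!a. a \<in> A ==> m a > 0"
 shows "\<exists>x. isotonic_regression A m U x"
 using assms
proof (induction A rule: finite_linorder_max_induct)
 case empty
 show ?case by (auto simp: isotonic_regression_def mono_on_def)
next
 case (insert b A)
 then obtain x where x: "isotonic_regression A m U x" by auto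
 have bA: "b \<notin> A" using insert.hyps by auto
 have fin: "finite A" by fact
 have mb: "m b > 0" and mA: "!!a. a \<in> A ==> m a > 0" using insert.prems by auto
 have x1: "(\<Sum>a\<in>A. m a * (U a - x a)) = 0"
  using isotonic_regression_eq[OF x, of "%_. 1"] by simp
 define \<Phi> where "\<Phi> z = (\<Sum>a\<in>A. m a * (U a - min (x a) z)) + m b * (U b - z)" for z
 define z0 where "z0 = Min (insert (U b) (U ` A \<union> x ` A))"
 define z1 where "z1 = Max (insert (U b) (x ` A))"
 have z0: "z0 <= U b" "!!a. a \<in> A ==> z0 <= U a" "!!a. a \<in> A ==> z0 <= x a"
  using fin by (auto simp: z0_def)
 have z1: "U b <= z1" "!!a. a \<in> A ==> x a <= z1"
  using fin by (auto simp: z1_def)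
 have "0 <= \<Phi> z0"
 proof -
  have "0 <= m a * (U a - min (x a) z0)" if "a \<in> A" for a
   using mA[OF that] z0(2,3)[OF that] by (intro mult_nonneg_nonneg) auto
  moreover have "0 <= m b * (U b - z0)" using mb z0(1) by (intro mult_nonneg_nonneg) auto
  ultimately show ?thesis unfolding \<Phi>_def by (intro add_nonneg_nonneg sum_nonneg)
 qed
 moreover have "\<Phi> z1 <= 0"
 proof -
  have "(\<Sum>a\<in>A. m a * (U a - min (x a) z1)) = (\<Sum>a\<in>A. m a * (U a - x a))"
   by (rule sum.cong) (use z1 in \<open>auto simp: min_def\<close>)
  then show ?thesis unfolding \<Phi>_def using x1 z1(1) mb by (simp add: mult_nonneg_nonpos)
 qed
 moreover have "z0 <= z1" using z0 z1 by linarith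
 moreover have "continuous_on {z0..z1} \<Phi>" unfolding \<Phi>_def by (intro continuous_intros)
 ultimately obtain z where z: "\<Phi> z = 0" using IVT2'[of \<Phi> z1 0 z0] by auto
 define x' where "x' a = (if a = b then z else min (x a) z)" for a
 have x'A: "x' a = min (x a) z" if "a \<in> A" for a using that bA by (auto simp: x'_def)
 have x'b: "x' b = z" by (simp add: x'_def)
 have bal: "(\<Sum>a\<in>A. m a * (x a - min (x a) z)) + m b * (U b - z) = 0"
 proof -
  have "\<Phi> z = (\<Sum>a\<in>A. m a * (U a - x a) + m a * (x a - min (x a) z)) + m b * (U b - z)"
   unfolding \<Phi>_def by (simp add: algebra_simps)
  then show ?thesis using z x1 by (simp add: sum.distrib)
 qed
 have split: "(\<Sum>a\<in>insert b A. m a * (U a - x' a) * g a)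
   = (\<Sum>a\<in>A. m a * (U a - x a) * g a) + ((\<Sum>a\<in>A. m a * (x a - min (x a) z) * g a) + m b * (U b - z) * g b)" for g
 proof -
  have "(\<Sum>a\<in>insert b A. m a * (U a - x' a) * g a) = (\<Sum>a\<in>A. m a * (U a - x' a) * g a) + m b * (U b - z) * g b"
   using fin bA by (simp add: x'b)
  also have "(\<Sum>a\<in>A. m a * (U a - x' a) * g a) = (\<Sum>a\<in>A. m a * (U a - x a) * g a + m a * (x a - min (x a) z) * g a)"
   by (rule sum.cong) (auto simp: x'A algebra_simps)
  finally show ?thesis by (simp add: sum.distrib)
 qed
 have "isotonic_regression (insert b A) m U x'"
  unfolding isotonic_regression_def
 proof (intro conjI allI impI)
  show "mono_on (insert b A) x'"
  proof (rule mono_onI)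
   fix r s assume rs: "r \<in> insert b A" "s \<in> insert b A" "r <= s"
   have "mono_on A x" using isotonic_regression_mono[OF x] .
   then show "x' r <= x' s" using rs insert.hyps(2)
   by (cases "r = b"; cases "s = b") (auto simp: x'A x'b mono_on_def min_le_iff_disj)
  qed
 next
  fix g :: "real => real" assume g: "mono_on (insert b A) g"
  have "mono_on A g" using g by (auto simp: mono_on_def)
  then have 1: "(\<Sum>a\<in>A. m a * (U a - x a) * g a) <= 0" by (rule isotonic_regression_le[OF x])
  have "(\<Sum>a\<in>A. m a * (x a - min (x a) z) * g a) <= (\<Sum>a\<in>A. m a * (x a - min (x a) z) * g b)"
  proof (rule sum_mono)
   fix a assume a: "a \<in> A"
   then have "a <= b" using insert.hyps(2) by (simp add: less_imp_le)
   then have "g a <= g b" using mono_onD[OF g, of a b] a by simp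
   then show "m a * (x a - min (x a) z) * g a <= m a * (x a - min (x a) z) * g b"
   using mA[OF a] by (intro mult_left_mono mult_nonneg_nonneg) auto
  qed
  also have "... = (\<Sum>a\<in>A. m a * (x a - min (x a) z)) * g b" by (simp add: sum_distrib_right)
  finally have "(\<Sum>a\<in>A. m a * (x a - min (x a) z) * g a) + m b * (U b - z) * g b
   <= ((\<Sum>a\<in>A. m a * (x a - min (x a) z)) + m b * (U b - z)) * g b" by (simp add: algebra_simps)
  then show "(\<Sum>a\<in>insert b A. m a * (U a - x' a) * g a) <= 0" unfolding split bal using 1 by simp
 next
  fix g :: "real => real" assume g: "\<forall>c\<in>insert b A. \<forall>d\<in>insert b A. x' c = x' d --> g c = g d"
  have 1: "(\<Sum>a\<in>A. m a * (U a - x a) * g a) = 0"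
  proof (rule isotonic_regression_eq[OF x])
   fix c d assume "c \<in> A" "d \<in> A" "x c = x d"
   moreover from this have "x' c = x' d" by (simp add: x'A)
   ultimately show "g c = g d" using g by blast
  qed
  have "(\<Sum>a\<in>A. m a * (x a - min (x a) z) * g a) = (\<Sum>a\<in>A. m a * (x a - min (x a) z) * g b)"
  proof (rule sum.cong[OF refl])
   fix a assume a: "a \<in> A"
   show "m a * (x a - min (x a) z) * g a = m a * (x a - min (x a) z) * g b"
   proof (cases "x a <= z")
   case False
   then have "x' a = x' b" using a by (simp add: x'A x'b)
   then have "g a = g b" using g a by blast
   then show ?thesis by simp
   qed simp
  qed
  also have "... = (\<Sum>a\<in>A. m a * (x a - min (x a) z)) * g b" by (simp add: sum_distrib_right)
  finally have "(\<Sum>a\<in>A. m a * (x a - min (x a) z) * g a) + m b * (U b - z) * g b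
   = ((\<Sum>a\<in>A. m a * (x a - min (x a) z)) + m b * (U b - z)) * g b" by (simp add: algebra_simps)
  then show "(\<Sum>a\<in>insert b A. m a * (U a - x' a) * g a) = 0" unfolding split bal using 1 by simp
 qed
 then show ?case by blast
qed

text \<open>A relation that is compatible with adding gaps holds for all pairs once it holds for neighbours.\<close>

lemma consecutive_induct:
 fixes A :: "real set"
 assumes fin: "finite A" and ab: "a \<in> A" "b \<in> A" "a <= b"
  and refl: "!!x. x \<in> A ==> R x x"
  and step: "!!x y. x \<in> A ==> y \<in> A ==> x < y ==> {x<..<y} \<inter> A = {} ==> R x y"
  and trans: "!!x y z. x \<in> A ==> y \<in> A ==> z \<in> A ==> x <= y ==> y <= z ==> R x y ==> R y z ==> R x z"
 shows "R a b"
 using ab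
proof (induction "card ({a<..b} \<inter> A)" arbitrary: a rule: less_induct)
 case less
 show ?case
 proof (cases "a = b")
  case True then show ?thesis using refl less.prems by simp
 next
  case False
  then have "b \<in> {a<..b} \<inter> A" using less.prems by simp
  then have ne: "{a<..b} \<inter> A ~= {}" by blast
  define y where "y = Min ({a<..b} \<inter> A)"
  have y: "y \<in> {a<..b} \<inter> A" unfolding y_def using ne fin by (intro Min_in) auto
  have ymin: "y <= e" if "e \<in> {a<..b} \<inter> A" for e unfolding y_def using that fin by auto
  have "R a y"
  proof (rule step)
   show "{a<..<y} \<inter> A = {}"
   proof (rule ccontr)
   assume "{a<..<y} \<inter> A ~= {}"
   then obtain e where "a < e" "e < y" "e \<in> A" by auto
   then show False using ymin[of e] y by auto
   qed
  qed (use y less.prems in auto)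
  moreover have "R y b"
  proof (rule less.hyps)
   have "y \<in> {a<..b} \<inter> A" "y \<notin> {y<..b} \<inter> A" "{y<..b} \<inter> A \<subseteq> {a<..b} \<inter> A" using y by auto
   then have "{y<..b} \<inter> A \<subset> {a<..b} \<inter> A" by blast
   then show "card ({y<..b} \<inter> A) < card ({a<..b} \<inter> A)"
   using fin by (intro psubset_card_mono) auto
  qed (use y less.prems in auto)
  ultimately show ?thesis using trans[of a y b] y less.prems by auto
 qed
qed

text \<open>Where the projection jumps, the test functions \<open>of_bool (e \<le> a)\<close> may be added and subtracted, so the averages
of \<open>U - x\<close> on both sides vanish and \<open>U\<close> must itself jump at least as far.\<close>

lemma isotonic_regression_jump:
 assumes fin: "finite A" and m: "!!a. a \<in> A ==> m a > 0" and x: "isotonic_regression A m U x"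
  and ab: "a \<in> A" "b \<in> A" "a < b" "{a<..<b} \<inter> A = {}" "x a < x b"
 shows "U a <= x a" "x b <= U b"
proof -
 let ?D = "%g. \<Sum>e\<in>A. m e * (U e - x e) * g e"
 note mono = isotonic_regression_mono[OF x]
 have V1: "?D g <= 0" if "mono_on A g" for g using isotonic_regression_le[OF x that] .
 have V2: "?D (%e. of_bool (e <= a)) = 0"
 proof -
  have "e <= a \<longleftrightarrow> x e <= x a" if e: "e \<in> A" for e
  proof
   assume "e <= a" then show "x e <= x a" using mono_onD[OF mono, of e a] e ab by simp
  next
   assume le: "x e <= x a"
   show "e <= a"
   proof (rule ccontr)
   assume "~ e <= a"
   then have "b <= e" using ab(4) e by (metis disjoint_iff greaterThanLessThan_iff not_le)
   then have "x b <= x e" using mono_onD[OF mono, of b e] e ab by simp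
   then show False using le ab(5) by simp
   qed
  qed
  then show ?thesis by (intro isotonic_regression_eq[OF x]) simp
 qed
 have Dadd: "?D g + m d * (U d - x d) = ?D (%e. g e + of_bool (e = d))" if "d \<in> A" for g d
  using that fin by (simp add: distrib_left sum.distrib of_bool_def if_distrib[of "(*) _"] sum.delta cong: if_cong)
 have "?D (\<lambda>e. - of_bool (e < a)) \<le> 0" by (rule V1) (auto simp: mono_on_def)
 then have "?D (\<lambda>e. of_bool (e < a)) \<ge> 0" by (simp add: sum_negf)
 moreover have "?D (\<lambda>e. of_bool (e < a)) + m a * (U a - x a) = ?D (\<lambda>e. of_bool (e \<le> a))"
  unfolding Dadd[OF ab(1)] by (rule sum.cong) (auto simp: of_bool_def)
 ultimately have "m a * (U a - x a) \<le> 0" using V2 by linarith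
 then show "U a \<le> x a" using m[OF ab(1)] by (simp add: mult_le_0_iff)
 have "?D (\<lambda>e. - of_bool (e \<le> b)) \<le> 0" by (rule V1) (auto simp: mono_on_def)
 then have "?D (\<lambda>e. of_bool (e \<le> b)) \<ge> 0" by (simp add: sum_negf)
 moreover have "?D (\<lambda>e. of_bool (e \<le> a)) + m b * (U b - x b) = ?D (\<lambda>e. of_bool (e \<le> b))"
  unfolding Dadd[OF ab(2)]
 proof (rule sum.cong[OF refl])
  fix e assume "e \<in> A"
  then have "e \<le> a \<or> b \<le> e" using ab(4) by (metis disjoint_iff greaterThanLessThan_iff not_le)
  then show "m e * (U e - x e) * (of_bool (e \<le> a) + of_bool (e = b)) = m e * (U e - x e) * of_bool (e \<le> b)"
   using ab(3) by (auto simp: of_bool_def)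
 qed
 ultimately have "m b * (U b - x b) \<ge> 0" using V2 by linarith
 then show "x b \<le> U b" using m[OF ab(2)] by (simp add: zero_le_mult_iff)
qed

lemma isotonic_regression_const:
 assumes fin: "finite A" and m: "\<And>a. a \<in> A \<Longrightarrow> m a > 0" and x: "isotonic_regression A m U x"
  and ab: "a \<in> A" "b \<in> A" "a \<le> b" and U: "\<And>e. e \<in> A \<Longrightarrow> a \<le> e \<Longrightarrow> e \<le> b \<Longrightarrow> U e = U a"
 shows "x a = x b"
proof (rule consecutive_induct[of "A \<inter> {a..b}" a b "\<lambda>a b. x a = x b"])
 fix p q assume pq: "p \<in> A \<inter> {a..b}" "q \<in> A \<inter> {a..b}" "p < q" "{p<..<q} \<inter> (A \<inter> {a..b}) = {}"
 have e: "{p<..<q} \<inter> A = {}" using pq by (auto simp: disjoint_iff)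
 have "\<not> x p < x q"
 proof
  assume "x p < x q"
  from isotonic_regression_jump[OF fin m x _ _ pq(3) e this] pq have "U p \<le> x p" "x q \<le> U q" by auto
  with \<open>x p < x q\<close> U[of p] U[of q] pq show False by auto
 qed
 moreover have "x p \<le> x q" using mono_onD[OF isotonic_regression_mono[OF x], of p q] pq by simp
 ultimately show "x p = x q" by simp
qed (use fin ab in auto)

text \<open>The projection onto a convex cone does not increase the distance to a point of the cone.\<close>

lemma isotonic_regression_contraction:
 assumes m: "\<And>a. a \<in> A \<Longrightarrow> m a > 0" and x: "isotonic_regression A m U x" and g: "mono_on A g"
 shows "(\<Sum>a\<in>A. m a * (x a - g a)\<^sup>2) \<le> (\<Sum>a\<in>A. m a * (U a - g a)\<^sup>2)"
proof -
 have 1: "(\<Sum>a\<in>A. m a * (U a - x a) * g a) \<le> 0" "(\<Sum>a\<in>A. m a * (U a - x a) * x a) = 0"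
  using isotonic_regression_le[OF x g] isotonic_regression_eq[OF x, of x] by auto
 have "(\<Sum>a\<in>A. m a * (U a - g a)\<^sup>2) = (\<Sum>a\<in>A. m a * (U a - x a)\<^sup>2 + m a * (x a - g a)\<^sup>2
   + 2 * (m a * (U a - x a) * x a) - 2 * (m a * (U a - x a) * g a))"
  by (rule sum.cong) (auto simp: power2_eq_square algebra_simps)
 also have "\<dots> = (\<Sum>a\<in>A. m a * (U a - x a)\<^sup>2) + (\<Sum>a\<in>A. m a * (x a - g a)\<^sup>2)
   + 2 * (\<Sum>a\<in>A. m a * (U a - x a) * x a) - 2 * (\<Sum>a\<in>A. m a * (U a - x a) * g a)"
  by (simp add: sum.distrib sum_subtractf sum_distrib_left)
 moreover have "(\<Sum>a\<in>A. m a * (U a - x a)\<^sup>2) \<ge> 0" using m by (intro sum_nonneg) (auto simp: less_imp_le)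
 ultimately show ?thesis using 1 by linarith
qed

section \<open>Sticky particles in discrete time\<close>

lemma cosh_ge_quadratic: "2 + z\<^sup>2 <= 2 * cosh (z :: real)"
proof -
 have s: "\<bar>y\<bar> <= \<bar>sinh y\<bar>" for y :: real using real_le_abs_sinh[of y] unfolding sinh_field_def exp_minus .
 have "cosh z = 1 + 2 * (sinh (z/2))\<^sup>2"
  using cosh_double[of "z/2"] cosh_square_eq[of "z/2"] by simp
 moreover have "(z/2)\<^sup>2 <= (sinh (z/2))\<^sup>2" using s[of "z/2"] by (simp only: abs_le_square_iff)
 ultimately show ?thesis by (simp add: power_divide)
qed

lemma sinh_ge_self: "0 <= z ==> z <= sinh (z :: real)"
 using real_le_x_sinh[of z] unfolding sinh_field_def exp_minus .

lemma sinh_recurrence: "sinh (x + z) + sinh (x - z) = 2 * cosh z * sinh (x :: real)"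
 unfolding sinh_add sinh_diff by algebra

lemma cosh_recurrence: "cosh (x + z) + cosh (x - z) = 2 * cosh z * cosh (x :: real)"
 unfolding cosh_add cosh_diff by algebra

text \<open>Finitely many particles with labels \<open>A\<close> (their initial positions) and masses \<open>m\<close>, observed at multiples of the
time step \<open>\<tau>\<close>.  In each step the particles move freely and the result is projected back onto ordered
configurations; particles that the projection merges stay together.\<close>

locale particles =
 fixes A :: "real set" and m v0 J w :: "real => real" and \<tau> c L :: real
 assumes fin: "finite A"
  and m_pos: "!!a. a \<in> A ==> m a > 0"
  and mass: "(\<Sum>a\<in>A. m a) = 1"
  and tau: "0 < \<tau>" "\<tau> <= 1"
  and c_pos: "0 < c"
  and v0_J: "!!a b. a <= b ==> \<bar>v0 b - v0 a\<bar> <= J b - J a"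
  and w_semi: "!!x y. x <= y ==> w x - w y <= c * (y - x)"
  and w_growth: "!!x. \<bar>w x\<bar> <= L * (1 + \<bar>x\<bar>)"
begin

definition cluster :: "(real => real) => real => real set" where
 "cluster p a = {e \<in> A. p e = p a}"

definition cluster_mean :: "(real => real) => (real => real) => real => real" where
 "cluster_mean p f a = (\<Sum>e\<in>cluster p a. m e * f e) / (\<Sum>e\<in>cluster p a. m e)"

definition force :: "(real => real) => real => real" where
 "force p a = - (\<Sum>b\<in>A. m b * w (p a - p b))"

definition iso :: "(real => real) => real => real" where
 "iso U = (SOME x. isotonic_regression A m U x)"

text \<open>Velocity Verlet without velocities: \<open>pos (k+1) - pos k\<close> is the last displacement plus \<open>\<tau>\<^sup>2\<close> times the force.  The
previous position enters averaged over the present cluster, so that merged particles share one velocity.\<close>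

fun pos :: "nat => real => real" where
 "pos 0 = (%a. a)"
| "pos (Suc 0) = iso (%a. a + \<tau> * v0 a)"
| "pos (Suc (Suc k)) = iso (%a. 2 * pos (Suc k) a - cluster_mean (pos (Suc k)) (pos k) a + \<tau>\<^sup>2 * force (pos (Suc k)) a)"

fun proposal :: "nat => real => real" where
 "proposal 0 = (%a. a + \<tau> * v0 a)"
| "proposal (Suc k) = (%a. 2 * pos (Suc k) a - cluster_mean (pos (Suc k)) (pos k) a + \<tau>\<^sup>2 * force (pos (Suc k)) a)"

text \<open>The same recursion without projection and without averaging.  It keeps the forces of the sticky system, and
the difference \<open>pos - free\<close> is orthogonal to all functions of the cluster.\<close>

fun free :: "nat => real => real" where
 "free 0 = (%a. a)"
| "free (Suc 0) = (%a. a + \<tau> * v0 a)"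
| "free (Suc (Suc k)) = (%a. 2 * free (Suc k) a - free k a + \<tau>\<^sup>2 * force (pos (Suc k)) a)"

lemma iso: "isotonic_regression A m U (iso U)"
 unfolding iso_def by (rule someI_ex[of "isotonic_regression A m U"], rule isotonic_regression_exists[OF fin m_pos])

lemma pos_Suc: "isotonic_regression A m (proposal k) (pos (Suc k))"
 by (cases k) (simp_all add: iso)

declare pos.simps(2,3) [simp del]

lemma pos_mono: "mono_on A (pos k)"
 using isotonic_regression_mono[OF pos_Suc] by (cases k) (simp_all add: mono_on_def)

lemma pos_monoD: "a \<in> A ==> b \<in> A ==> a <= b ==> pos k a <= pos k b"
 using pos_mono by (auto simp: mono_on_def)

lemma cluster_mass_pos: "a \<in> A ==> (\<Sum>e\<in>cluster p a. m e) > 0"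
 using fin m_pos by (intro sum_pos) (auto simp: cluster_def)

lemma cluster_mean_cong: "p a = p b ==> cluster_mean p f a = cluster_mean p f b"
 by (simp add: cluster_mean_def cluster_def)

lemma cluster_mean_le:
 assumes "a \<in> A" "!!e. e \<in> A ==> p e = p a ==> f e <= C"
 shows "cluster_mean p f a <= C"
proof -
 have "(\<Sum>e\<in>cluster p a. m e * f e) <= (\<Sum>e\<in>cluster p a. m e * C)"
  using assms m_pos by (intro sum_mono mult_left_mono) (auto simp: cluster_def less_imp_le)
 then show ?thesis
  unfolding cluster_mean_def using cluster_mass_pos[OF assms(1), of p]
  by (simp add: pos_divide_le_eq sum_distrib_left mult.commute)
qed

lemma cluster_mean_uminus: "cluster_mean p (%e. - f e) a = - cluster_mean p f a"
 by (simp add: cluster_mean_def sum_negf)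

lemma cluster_mean_ge:
 assumes "a \<in> A" "!!e. e \<in> A ==> p e = p a ==> C <= f e"
 shows "C <= cluster_mean p f a"
 using cluster_mean_le[of a p "%e. - f e" "- C"] assms by (simp add: cluster_mean_uminus)

lemma sum_cluster_mean:
 assumes g: "!!a b. a \<in> A ==> b \<in> A ==> p a = p b ==> g a = g b"
 shows "(\<Sum>a\<in>A. m a * cluster_mean p f a * g a) = (\<Sum>a\<in>A. m a * f a * g a)"
proof -
 have cl: "cluster p a \<subseteq> A" "finite (cluster p a)" for a using fin by (auto simp: cluster_def)
 let ?M = "%a. \<Sum>e\<in>cluster p a. m e"
 have "(\<Sum>a\<in>A. m a * cluster_mean p f a * g a) = (\<Sum>a\<in>A. \<Sum>e\<in>A. if p e = p a then m a * g a / ?M a * (m e * f e) else 0)"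
 proof (rule sum.cong[OF refl])
  fix a assume "a \<in> A"
  have "m a * cluster_mean p f a * g a = (\<Sum>e\<in>cluster p a. m a * g a / ?M a * (m e * f e))"
   by (simp add: cluster_mean_def sum_distrib_left sum_distrib_right sum_divide_distrib mult_ac)
  also have "... = (\<Sum>e\<in>A. if p e = p a then m a * g a / ?M a * (m e * f e) else 0)"
   unfolding cluster_def by (rule sum.inter_filter[OF fin])
  finally show "m a * cluster_mean p f a * g a = ..." .
 qed
 also have "... = (\<Sum>e\<in>A. \<Sum>a\<in>A. if p e = p a then m a * g a / ?M a * (m e * f e) else 0)"
  by (rule sum.swap)
 also have "... = (\<Sum>e\<in>A. m e * f e * g e)"
 proof (rule sum.cong[OF refl])
  fix e assume e: "e \<in> A"
  have "(\<Sum>a\<in>A. if p e = p a then m a * g a / ?M a * (m e * f e) else 0)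
   = (\<Sum>a\<in>A. if p a = p e then m a * (g e / ?M e * (m e * f e)) else 0)"
  proof (rule sum.cong[OF refl])
   fix a assume a: "a \<in> A"
   show "(if p e = p a then m a * g a / ?M a * (m e * f e) else 0) = (if p a = p e then m a * (g e / ?M e * (m e * f e)) else 0)"
   proof (cases "p a = p e")
   case True
   then have "g a = g e" "?M a = ?M e" using g[OF a e] by (simp_all add: cluster_def)
   then show ?thesis using True by simp
   qed auto
  qed
  also have "... = (\<Sum>a\<in>cluster p e. m a * (g e / ?M e * (m e * f e)))"
   unfolding cluster_def by (rule sum.inter_filter[OF fin, symmetric])
  also have "... = ?M e * (g e / ?M e * (m e * f e))" by (rule sum_distrib_right[symmetric])
  also have "... = m e * f e * g e" using cluster_mass_pos[OF e, of p] by simp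
  finally show "(\<Sum>a\<in>A. if p e = p a then m a * g a / ?M a * (m e * f e) else 0) = m e * f e * g e" .
 qed
 finally show ?thesis .
qed

lemma force_cong: "p a = p b ==> force p a = force p b"
 by (simp add: force_def)

lemma force_gap:
 assumes "p a <= p b" shows "force p b - force p a <= c * (p b - p a)"
proof -
 have "force p b - force p a = (\<Sum>e\<in>A. m e * (w (p a - p e) - w (p b - p e)))"
  by (simp add: force_def sum_subtractf right_diff_distrib)
 also have "... <= (\<Sum>e\<in>A. m e * (c * (p b - p a)))"
 proof (intro sum_mono mult_left_mono)
  show "w (p a - p e) - w (p b - p e) <= c * (p b - p a)" for e
   using w_semi[of "p a - p e" "p b - p e"] assms by simp
 qed (use m_pos in \<open>auto simp: less_imp_le\<close>)
 also have "... = c * (p b - p a)" using mass by (simp flip: sum_distrib_right)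
 finally show ?thesis .
qed

text \<open>On a level set of \<open>pos k\<close> the proposal is constant, and by monotonicity the same holds for everything between
\<open>a\<close> and \<open>b\<close>; the projection of a constant stretch is constant.\<close>

lemma sticky_aux:
 assumes ab: "a \<in> A" "b \<in> A" "a <= b" "pos k a = pos k b"
 shows "pos (Suc k) a = pos (Suc k) b"
proof (rule isotonic_regression_const[OF fin m_pos pos_Suc ab(1-3)])
 fix e assume e: "e \<in> A" "a <= e" "e <= b"
 have eq: "pos k e = pos k a" using pos_monoD[of a e k] pos_monoD[of e b k] e ab by auto
 show "proposal k e = proposal k a"
 proof (cases k)
  case 0 then show ?thesis using eq by simp
 next
  case (Suc j) then show ?thesis using eq cluster_mean_cong[of "pos k" e a] force_cong[of "pos k" e a] by simp
 qed
qed

lemma sticky: "j <= k ==> a \<in> A ==> b \<in> A ==> pos j a = pos j b ==> pos k a = pos k b"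
proof (induction k rule: dec_induct)
 case (step n)
 then have eq: "pos n a = pos n b" by blast
 show ?case
 proof (cases "a <= b")
  case True then show ?thesis using sticky_aux[OF step.prems(1,2) _ eq] by blast
 next
  case False then show ?thesis using sticky_aux[OF step.prems(2,1) _ eq[symmetric]] by simp
 qed
qed simp

text \<open>If two neighbours are still apart after the step, the projection has only pushed them together
(\<open>isotonic_regression_jump\<close>), and the semiconvexity of the potential bounds the gap of the forces by \<open>c\<close>
times the gap of the positions.\<close>

lemma gap_step:
 assumes ab: "a \<in> A" "b \<in> A" "a < b" "{a<..<b} \<inter> A = {}" and lt: "pos (Suc (Suc k)) a < pos (Suc (Suc k)) b"
 shows "pos (Suc (Suc k)) b - pos (Suc (Suc k)) a
  <= (2 + c * \<tau>\<^sup>2) * (pos (Suc k) b - pos (Suc k) a) - (pos k b - pos k a)"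
proof -
 let ?p = "pos (Suc k)"
 have lt1: "?p a < ?p b"
 proof -
  have "?p a ~= ?p b" using sticky[of "Suc k" "Suc (Suc k)" a b] ab lt by auto
  then show ?thesis using pos_monoD[of a b "Suc k"] ab by simp
 qed
 have side: "e <= a \<or> b <= e" if "e \<in> A" for e
  using ab(4) that by (metis disjoint_iff greaterThanLessThan_iff not_le)
 have m1: "cluster_mean ?p (pos k) a <= pos k a"
 proof (rule cluster_mean_le[OF ab(1)])
  fix e assume e: "e \<in> A" "?p e = ?p a"
  then have "~ b <= e" using pos_monoD[of b e "Suc k"] lt1 ab by auto
  then show "pos k e <= pos k a" using side[of e] pos_monoD e ab by auto
 qed
 have m2: "pos k b <= cluster_mean ?p (pos k) b"
 proof (rule cluster_mean_ge[OF ab(2)])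
  fix e assume e: "e \<in> A" "?p e = ?p b"
  then have "~ e <= a" using pos_monoD[of e a "Suc k"] lt1 ab by auto
  then show "pos k b <= pos k e" using side[of e] pos_monoD e ab by auto
 qed
 note j = isotonic_regression_jump[OF fin m_pos pos_Suc ab lt]
 have f: "\<tau>\<^sup>2 * (force ?p b - force ?p a) <= \<tau>\<^sup>2 * (c * (?p b - ?p a))"
  using force_gap[of ?p a b] lt1 by (intro mult_left_mono) auto
 have "pos (Suc (Suc k)) b - pos (Suc (Suc k)) a <= proposal (Suc k) b - proposal (Suc k) a" using j by simp
 also have "... <= (2 + c * \<tau>\<^sup>2) * (?p b - ?p a) - (pos k b - pos k a)"
  using m1 m2 f by (simp add: algebra_simps)
 finally show ?thesis .
qed

lemma gap_one:
 assumes ab: "a \<in> A" "b \<in> A" "a < b" "{a<..<b} \<inter> A = {}" and lt: "pos 1 a < pos 1 b"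
 shows "pos 1 b - pos 1 a <= (b - a) + \<tau> * (J b - J a)"
proof -
 note j = isotonic_regression_jump[OF fin m_pos pos_Suc ab, of 0]
 have "pos 1 b - pos 1 a <= (b + \<tau> * v0 b) - (a + \<tau> * v0 a)" using j lt by simp
 also have "... = (b - a) + \<tau> * (v0 b - v0 a)" by (simp add: algebra_simps)
 also have "... <= (b - a) + \<tau> * (J b - J a)"
  using v0_J[of a b] ab tau by (intro add_left_mono mult_left_mono) auto
 finally show ?thesis .
qed

abbreviation S :: "nat => real" where "S k \<equiv> sinh (sqrt c * (real k * \<tau>))"

lemma S_rec: "S (Suc (Suc k)) = 2 * cosh (sqrt c * \<tau>) * S (Suc k) - S k"
 using sinh_recurrence[of "sqrt c * (real (Suc k) * \<tau>)" "sqrt c * \<tau>"] by (simp add: algebra_simps)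

lemma cosh_rec: "cosh (sqrt c * (real (Suc (Suc k)) * \<tau>)) =
  2 * cosh (sqrt c * \<tau>) * cosh (sqrt c * (real (Suc k) * \<tau>)) - cosh (sqrt c * (real k * \<tau>))"
 using cosh_recurrence[of "sqrt c * (real (Suc k) * \<tau>)" "sqrt c * \<tau>"] by (simp add: algebra_simps)

lemma S_nonneg: "0 <= S k" and S_pos: "0 < k ==> 0 < S k"
 using c_pos tau by auto

lemma rec_le: "2 + c * \<tau>\<^sup>2 <= 2 * cosh (sqrt c * \<tau>)"
 using cosh_ge_quadratic[of "sqrt c * \<tau>"] c_pos by (simp add: power_mult_distrib)

lemma gap_step':
 assumes ab: "a \<in> A" "b \<in> A" "a < b" "{a<..<b} \<inter> A = {}" and lt: "pos (Suc (Suc k)) a < pos (Suc (Suc k)) b"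
 shows "pos (Suc (Suc k)) b - pos (Suc (Suc k)) a
  <= 2 * cosh (sqrt c * \<tau>) * (pos (Suc k) b - pos (Suc k) a) - (pos k b - pos k a)"
proof -
 have "(2 + c * \<tau>\<^sup>2) * (pos (Suc k) b - pos (Suc k) a) <= 2 * cosh (sqrt c * \<tau>) * (pos (Suc k) b - pos (Suc k) a)"
  using rec_le pos_monoD[of a b "Suc k"] ab by (intro mult_right_mono) auto
 then show ?thesis using gap_step[OF ab lt] by linarith
qed

text \<open>The gap \<open>d\<close> of neighbours satisfies \<open>d (k+2) \<le> 2 * cosh h * d (k+1) - d k\<close> as long as they are apart, while the
sampled \<open>sinh\<close> satisfies the same recursion with equality.  Hence the discrete Wronskian of the two sequences
is nonincreasing; it starts at \<open>0\<close>.  Time enters through \<open>sinh\<close> because \<open>2 + c * \<tau>\<^sup>2 \<le> 2 * cosh (sqrt c * \<tau>)\<close>.\<close>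

lemma gap_ratio_Suc:
 assumes ab: "a \<in> A" "b \<in> A" "a < b" "{a<..<b} \<inter> A = {}"
 shows "(pos (Suc k) b - pos (Suc k) a) * S k <= (pos k b - pos k a) * S (Suc k)"
proof (induction k)
 case 0
 then show ?case using ab c_pos tau by simp
next
 case (Suc k)
 let ?d = "%k. pos k b - pos k a"
 have d0: "0 <= ?d k" for k using pos_monoD[of a b k] ab by simp
 show ?case
 proof (cases "pos (Suc (Suc k)) a < pos (Suc (Suc k)) b")
  case True
  have "?d (Suc (Suc k)) * S (Suc k) <= (2 * cosh (sqrt c * \<tau>) * ?d (Suc k) - ?d k) * S (Suc k)"
   using gap_step'[OF ab True] S_nonneg by (intro mult_right_mono)
  also have "... <= 2 * cosh (sqrt c * \<tau>) * ?d (Suc k) * S (Suc k) - ?d (Suc k) * S k"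
   using Suc.IH by (simp add: algebra_simps)
  also have "... = ?d (Suc k) * S (Suc (Suc k))" unfolding S_rec by (simp add: algebra_simps)
  finally show ?thesis .
 next
  case False
  then have "?d (Suc (Suc k)) = 0" using d0[of "Suc (Suc k)"] by simp
  then show ?thesis using d0[of "Suc k"] S_nonneg[of "Suc (Suc k)"] by simp
 qed
qed

lemma gap_ratio:
 assumes ab: "a \<in> A" "b \<in> A" "a <= b" and jk: "1 <= j" "j <= k"
 shows "(pos k b - pos k a) * S j <= (pos j b - pos j a) * S k"
proof (rule consecutive_induct[OF fin ab, where R = "%a b. (pos k b - pos k a) * S j <= (pos j b - pos j a) * S k"])
 fix a b assume ab: "a \<in> A" "b \<in> A" "a < b" "{a<..<b} \<inter> A = {}"
 show "(pos k b - pos k a) * S j <= (pos j b - pos j a) * S k"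
  using jk(2)
 proof (induction k rule: dec_induct)
  case (step n)
  let ?d = "%k. pos k b - pos k a"
  have n: "0 < S n" using step jk by (intro S_pos) auto
  have "(?d (Suc n) * S j) * S n = (?d (Suc n) * S n) * S j" by simp
  also have "... <= (?d n * S (Suc n)) * S j"
   using gap_ratio_Suc[OF ab] S_nonneg by (intro mult_right_mono)
  also have "... = (?d n * S j) * S (Suc n)" by simp
  also have "... <= (?d j * S n) * S (Suc n)"
   using step S_nonneg by (intro mult_right_mono)
  also have "... = (?d j * S (Suc n)) * S n" by simp
  finally show ?case using n by (simp add: mult_le_cancel_right)
 qed simp
qed (simp_all add: left_diff_distrib)

text \<open>The same comparison against the combination of \<open>cosh\<close> and \<open>sinh\<close> whose first two samples dominate the
initial gap and the gap after one free step.\<close>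

lemma gap_bound:
 assumes ab: "a \<in> A" "b \<in> A" "a <= b"
 shows "pos k b - pos k a <= cosh (sqrt c * (real k * \<tau>)) * (b - a) + 1 / sqrt c * S k * (J b - J a)"
proof (rule consecutive_induct[OF fin ab, where R = "%a b. pos k b - pos k a <= cosh (sqrt c * (real k * \<tau>)) * (b - a) + 1 / sqrt c * S k * (J b - J a)"])
 fix a b assume ab: "a \<in> A" "b \<in> A" "a < b" "{a<..<b} \<inter> A = {}"
 let ?d = "%k. pos k b - pos k a"
 let ?C = "cosh (sqrt c * \<tau>)"
 define \<beta> where "\<beta> = (J b - J a) / sqrt c"
 have J: "0 <= J b - J a" using v0_J[of a b] ab by linarith
 then have \<beta>: "\<beta> >= 0" using c_pos by (simp add: \<beta>_def)
 define z where "z k = cosh (sqrt c * (real k * \<tau>)) * (b - a) + \<beta> * S k" for k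
 have z0: "0 <= z k" for k unfolding z_def using ab \<beta> S_nonneg by (intro add_nonneg_nonneg mult_nonneg_nonneg) auto
 have z_rec: "z (Suc (Suc k)) = 2 * ?C * z (Suc k) - z k" for k
  unfolding z_def S_rec cosh_rec by algebra
 have d0: "0 <= ?d k" for k using pos_monoD[of a b k] ab by simp
 have one: "0 <= z 1 - ?d 1"
 proof (cases "pos 1 a < pos 1 b")
  case True
  have "?d 1 <= (b - a) + \<tau> * (J b - J a)" by (rule gap_one[OF ab True])
  also have "\<tau> * (J b - J a) = (sqrt c * \<tau>) * \<beta>" using c_pos by (simp add: \<beta>_def)
  also have "... <= S 1 * \<beta>" using sinh_ge_self[of "sqrt c * \<tau>"] \<beta> c_pos tau by (intro mult_right_mono) auto
  also have "(b - a) <= cosh (sqrt c * (real 1 * \<tau>)) * (b - a)"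
   using ab cosh_real_ge_1[of "sqrt c * (real 1 * \<tau>)"] mult_right_mono[of 1 "cosh (sqrt c * (real 1 * \<tau>))" "b - a"] by simp
  finally show ?thesis by (simp add: z_def algebra_simps)
 qed (use z0[of 1] in linarith)
 have "0 <= z k - ?d k & (0 < ?d (Suc k) --> (z k - ?d k) * S (Suc k) <= (z (Suc k) - ?d (Suc k)) * S k)"
 proof (induction k)
  case 0 then show ?case by (simp add: z_def)
 next
  case (Suc k)
  have nn: "0 <= z (Suc k) - ?d (Suc k)"
  proof (cases "k = 0")
   case True then show ?thesis using one by simp
  next
   case False
   then have Sk: "0 < S k" using S_pos by simp
   show ?thesis
   proof (cases "0 < ?d (Suc k)")
   case True
   then have "0 <= (z k - ?d k) * S (Suc k)" "(z k - ?d k) * S (Suc k) <= (z (Suc k) - ?d (Suc k)) * S k"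
   using Suc.IH S_nonneg[of "Suc k"] by (auto intro!: mult_nonneg_nonneg)
   then have "0 <= (z (Suc k) - ?d (Suc k)) * S k" by linarith
   then show ?thesis using Sk by (simp add: zero_le_mult_iff)
   qed (use z0[of "Suc k"] in linarith)
  qed
  have "(z (Suc k) - ?d (Suc k)) * S (Suc (Suc k)) <= (z (Suc (Suc k)) - ?d (Suc (Suc k))) * S (Suc k)"
   if pos2: "0 < ?d (Suc (Suc k))"
  proof -
   have pos1: "0 < ?d (Suc k)"
   proof -
   have "pos (Suc k) a ~= pos (Suc k) b" using sticky[of "Suc k" "Suc (Suc k)" a b] ab pos2 by auto
   then show ?thesis using d0[of "Suc k"] by simp
   qed
   have IH: "(z k - ?d k) * S (Suc k) <= (z (Suc k) - ?d (Suc k)) * S k" using Suc.IH pos1 by blast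
   have "2 * ?C * (z (Suc k) - ?d (Suc k)) - (z k - ?d k) <= z (Suc (Suc k)) - ?d (Suc (Suc k))"
   proof -
   have "?d (Suc (Suc k)) <= 2 * ?C * ?d (Suc k) - ?d k" using gap_step'[OF ab, of k] pos2 by simp
   then show ?thesis unfolding z_rec right_diff_distrib by linarith
   qed
   then have "(2 * ?C * (z (Suc k) - ?d (Suc k)) - (z k - ?d k)) * S (Suc k) <= (z (Suc (Suc k)) - ?d (Suc (Suc k))) * S (Suc k)"
   using S_nonneg by (rule mult_right_mono)
   moreover have "(z (Suc k) - ?d (Suc k)) * S (Suc (Suc k)) = (2 * ?C * (z (Suc k) - ?d (Suc k))) * S (Suc k) - (z (Suc k) - ?d (Suc k)) * S k"
   unfolding S_rec by algebra
   ultimately show ?thesis using IH unfolding left_diff_distrib by linarith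
  qed
  then show ?case using nn by blast
 qed
 then have "?d k <= z k" by simp
 also have "z k = cosh (sqrt c * (real k * \<tau>)) * (b - a) + 1 / sqrt c * S k * (J b - J a)"
  by (simp add: z_def \<beta>_def)
 finally show "?d k <= cosh (sqrt c * (real k * \<tau>)) * (b - a) + 1 / sqrt c * S k * (J b - J a)" .
next
 fix x y z assume 1: "pos k y - pos k x <= cosh (sqrt c * (real k * \<tau>)) * (y - x) + 1 / sqrt c * S k * (J y - J x)"
  and 2: "pos k z - pos k y <= cosh (sqrt c * (real k * \<tau>)) * (z - y) + 1 / sqrt c * S k * (J z - J y)"
 have "cosh (sqrt c * (real k * \<tau>)) * (z - x) + 1 / sqrt c * S k * (J z - J x) =
  (cosh (sqrt c * (real k * \<tau>)) * (y - x) + 1 / sqrt c * S k * (J y - J x)) + (cosh (sqrt c * (real k * \<tau>)) * (z - y) + 1 / sqrt c * S k * (J z - J y))"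
  by (simp only: algebra_simps)
 with 1 2 show "pos k z - pos k x <= cosh (sqrt c * (real k * \<tau>)) * (z - x) + 1 / sqrt c * S k * (J z - J x)" by linarith
qed simp

text \<open>Induction over the recursion: a function that is constant on the clusters at time \<open>k\<close> is constant on the
earlier, finer clusters, and on such functions both the projection and the averaging act like the identity.\<close>

lemma momentum_balance:
 "(!!a b. a \<in> A ==> b \<in> A ==> pos k a = pos k b ==> g a = g b) ==> (\<Sum>a\<in>A. m a * (pos k a - free k a) * g a) = 0"
proof (induction k arbitrary: g rule: less_induct)
 case (less k)
 have V2: "(\<Sum>a\<in>A. m a * (proposal j a - pos k a) * g a) = 0" if "k = Suc j" for j
  using isotonic_regression_eq[OF pos_Suc[of j], of g] less.prems that by blast
 consider "k = 0" | "k = Suc 0" | j where "k = Suc (Suc j)" by (metis not0_implies_Suc)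
 then show ?case
 proof cases
  case 1 then show ?thesis by simp
 next
  case 2
  have "(\<Sum>a\<in>A. m a * (pos k a - free k a) * g a) = - (\<Sum>a\<in>A. m a * (proposal 0 a - pos k a) * g a)"
   unfolding sum_negf[symmetric] 2 by (intro sum.cong refl) (simp add: algebra_simps)
  then show ?thesis using V2[of 0] 2 by simp
 next
  case 3
  have g1: "g a = g b" if "a \<in> A" "b \<in> A" "pos (Suc j) a = pos (Suc j) b" for a b
   by (rule less.prems[OF that(1,2) sticky[OF _ that]]) (simp add: 3)
  have g0: "g a = g b" if "a \<in> A" "b \<in> A" "pos j a = pos j b" for a b
   by (rule less.prems[OF that(1,2) sticky[OF _ that]]) (simp add: 3)
  have IH1: "(\<Sum>a\<in>A. m a * (pos (Suc j) a - free (Suc j) a) * g a) = 0"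
   by (rule less.IH) (simp add: 3, rule g1)
  have IH0: "(\<Sum>a\<in>A. m a * (pos j a - free j a) * g a) = 0"
   by (rule less.IH) (simp add: 3, rule g0)
  have mean: "(\<Sum>a\<in>A. m a * cluster_mean (pos (Suc j)) (pos j) a * g a) = (\<Sum>a\<in>A. m a * pos j a * g a)"
   by (rule sum_cluster_mean) (rule g1)
  have "(\<Sum>a\<in>A. m a * (pos k a - free k a) * g a)
   = (\<Sum>a\<in>A. 2 * (m a * (pos (Suc j) a - free (Suc j) a) * g a) - m a * (pos j a - free j a) * g a
   + m a * pos j a * g a - m a * cluster_mean (pos (Suc j)) (pos j) a * g a - m a * (proposal (Suc j) a - pos k a) * g a)"
   unfolding 3 by (intro sum.cong refl) (simp add: algebra_simps)
  also have "... = 0"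
   using IH1 IH0 mean V2[OF 3] by (simp add: sum.distrib sum_subtractf flip: sum_distrib_left)
  finally show ?thesis .
 qed
qed

lemma free_Suc: "free (Suc k) a = free k a + \<tau> * (v0 a + \<tau> * (\<Sum>i\<in>{1..k}. force (pos i) a))"
proof (induction k)
 case (Suc k)
 have "free (Suc (Suc k)) a = free (Suc k) a + (free (Suc k) a - free k a) + \<tau>\<^sup>2 * force (pos (Suc k)) a" by simp
 then show ?case unfolding Suc.IH by (simp add: algebra_simps power2_eq_square)
qed simp

lemma free_eq: "free k a = a + real k * \<tau> * v0 a + \<tau>\<^sup>2 * (\<Sum>i\<in>{1..<k}. real (k - i) * force (pos i) a)"
proof (induction k)
 case (Suc k)
 have "(\<Sum>i\<in>{1..<Suc k}. real (Suc k - i) * force (pos i) a) = (\<Sum>i\<in>{1..k}. real (k - i) * force (pos i) a + force (pos i) a)"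
  unfolding atLeastLessThanSuc_atLeastAtMost by (rule sum.cong) (auto simp: of_nat_diff algebra_simps Suc_diff_le)
 also have "... = (\<Sum>i\<in>{1..<k}. real (k - i) * force (pos i) a) + (\<Sum>i\<in>{1..k}. force (pos i) a)"
  unfolding sum.distrib by (cases k) (auto simp: atLeastLessThanSuc_atLeastAtMost[symmetric])
 finally have s: "(\<Sum>i\<in>{1..<Suc k}. real (Suc k - i) * force (pos i) a) = ..." .
 show ?case unfolding free_Suc s Suc.IH by (simp add: algebra_simps power2_eq_square)
qed simp

definition sqnorm :: "(real => real) => real" where
 "sqnorm f = (\<Sum>a\<in>A. m a * (f a)\<^sup>2)"

lemma sqnorm_nonneg: "0 <= sqnorm f"
 unfolding sqnorm_def using m_pos by (intro sum_nonneg) (auto simp: less_imp_le)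

lemma sqnorm_add_le: "sqnorm (%a. f a + g a) <= (1 + \<tau>) * sqnorm f + (1 + 1/\<tau>) * sqnorm g"
proof -
 have "(x + y)\<^sup>2 <= (1 + \<tau>) * x\<^sup>2 + (1 + 1/\<tau>) * y\<^sup>2" for x y :: real
 proof -
  have "0 <= (\<tau> * x - y)\<^sup>2 / \<tau>" using tau by simp
  also have "... = \<tau> * x\<^sup>2 + y\<^sup>2 / \<tau> - 2 * x * y" using tau by (simp add: power2_eq_square field_simps)
  finally show ?thesis by (simp add: power2_eq_square algebra_simps)
 qed
 then have "sqnorm (%a. f a + g a) <= (\<Sum>a\<in>A. m a * ((1 + \<tau>) * (f a)\<^sup>2 + (1 + 1/\<tau>) * (g a)\<^sup>2))"
  unfolding sqnorm_def using m_pos by (intro sum_mono mult_left_mono) (auto simp: less_imp_le)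
 also have "... = (1 + \<tau>) * sqnorm f + (1 + 1/\<tau>) * sqnorm g"
  unfolding sqnorm_def by (simp add: sum.distrib sum_distrib_left algebra_simps)
 finally show ?thesis .
qed

lemma sqnorm_cluster_mean: "sqnorm (cluster_mean p f) <= sqnorm f"
proof -
 have "(\<Sum>a\<in>A. m a * cluster_mean p f a * cluster_mean p f a) = (\<Sum>a\<in>A. m a * f a * cluster_mean p f a)"
  by (rule sum_cluster_mean) (rule cluster_mean_cong)
 then have "2 * sqnorm (cluster_mean p f) = (\<Sum>a\<in>A. m a * (2 * f a * cluster_mean p f a))"
  by (simp add: sqnorm_def power2_eq_square sum_distrib_left mult_ac)
 also have "... <= (\<Sum>a\<in>A. m a * ((f a)\<^sup>2 + (cluster_mean p f a)\<^sup>2))"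
 proof (intro sum_mono mult_left_mono)
  fix a
  have "0 <= (f a - cluster_mean p f a)\<^sup>2" by simp
  then show "2 * f a * cluster_mean p f a <= (f a)\<^sup>2 + (cluster_mean p f a)\<^sup>2"
   by (simp add: power2_eq_square algebra_simps)
 qed (use m_pos in \<open>auto simp: less_imp_le\<close>)
 also have "... = sqnorm f + sqnorm (cluster_mean p f)"
  by (simp add: sqnorm_def sum.distrib distrib_left)
 finally show ?thesis by simp
qed

lemma mean_square: "(\<Sum>a\<in>A. m a * \<bar>f a\<bar>)\<^sup>2 <= sqnorm f"
proof -
 define e where "e = (\<Sum>a\<in>A. m a * \<bar>f a\<bar>)"
 have "0 <= (\<Sum>a\<in>A. m a * (\<bar>f a\<bar> - e)\<^sup>2)" using m_pos by (intro sum_nonneg) (auto simp: less_imp_le)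
 also have "... = (\<Sum>a\<in>A. m a * (f a)\<^sup>2 - 2 * e * (m a * \<bar>f a\<bar>) + e\<^sup>2 * m a)"
  by (rule sum.cong) (auto simp: power2_eq_square algebra_simps)
 also have "... = sqnorm f - 2 * e * e + e\<^sup>2"
  using mass by (simp add: sum.distrib sum_subtractf sqnorm_def e_def flip: sum_distrib_left)
 finally show ?thesis by (simp add: e_def power2_eq_square)
qed

lemma L_nonneg: "0 <= L" using w_growth[of 0] by (metis abs_ge_zero abs_zero add.right_neutral mult.right_neutral order_trans)

lemma sqnorm_force: "sqnorm (force p) <= 3 * L\<^sup>2 * (1 + 2 * sqnorm p)"
proof -
 define e where "e = (\<Sum>a\<in>A. m a * \<bar>p a\<bar>)"
 have b: "(force p a)\<^sup>2 <= 3 * L\<^sup>2 * (1 + (p a)\<^sup>2 + e\<^sup>2)" for a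
 proof -
  have "\<bar>force p a\<bar> <= (\<Sum>b\<in>A. m b * (L * (1 + \<bar>p a\<bar> + \<bar>p b\<bar>)))"
   unfolding force_def abs_minus_cancel
  proof (rule order_trans[OF sum_abs], rule sum_mono)
   fix b assume b: "b \<in> A"
   have "\<bar>w (p a - p b)\<bar> <= L * (1 + \<bar>p a - p b\<bar>)" by (rule w_growth)
   also have "... <= L * (1 + \<bar>p a\<bar> + \<bar>p b\<bar>)" using L_nonneg by (intro mult_left_mono) auto
   finally show "\<bar>m b * w (p a - p b)\<bar> <= m b * (L * (1 + \<bar>p a\<bar> + \<bar>p b\<bar>))"
   using m_pos[OF b] by (simp add: abs_mult)
  qed
  also have "... = (\<Sum>b\<in>A. L * (1 + \<bar>p a\<bar>) * m b + L * (m b * \<bar>p b\<bar>))"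
   by (rule sum.cong) (auto simp: algebra_simps)
  also have "... = L * (1 + \<bar>p a\<bar> + e)"
   using mass by (simp add: sum.distrib e_def flip: sum_distrib_left) (simp add: algebra_simps)
  finally have "(force p a)\<^sup>2 <= (L * (1 + \<bar>p a\<bar> + e))\<^sup>2" by (metis abs_ge_zero power2_abs power_mono)
  also have "... = L\<^sup>2 * (1 + \<bar>p a\<bar> + e)\<^sup>2" by (simp add: power_mult_distrib)
  also have "... <= L\<^sup>2 * (3 * (1 + (p a)\<^sup>2 + e\<^sup>2))"
  proof (rule mult_left_mono)
   have "0 <= (1 - \<bar>p a\<bar>)\<^sup>2 + (1 - e)\<^sup>2 + (\<bar>p a\<bar> - e)\<^sup>2" by simp
   then show "(1 + \<bar>p a\<bar> + e)\<^sup>2 <= 3 * (1 + (p a)\<^sup>2 + e\<^sup>2)" by (simp add: power2_eq_square algebra_simps)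
  qed simp
  finally show ?thesis by (simp add: algebra_simps)
 qed
 have "sqnorm (force p) <= (\<Sum>a\<in>A. m a * (3 * L\<^sup>2 * (1 + (p a)\<^sup>2 + e\<^sup>2)))"
  unfolding sqnorm_def using m_pos b by (intro sum_mono mult_left_mono) (auto simp: less_imp_le)
 also have "... = (\<Sum>a\<in>A. 3 * L\<^sup>2 * (1 + e\<^sup>2) * m a + 3 * L\<^sup>2 * (m a * (p a)\<^sup>2))"
  by (rule sum.cong) (auto simp: algebra_simps)
 also have "... = 3 * L\<^sup>2 * (1 + e\<^sup>2) + 3 * L\<^sup>2 * sqnorm p"
  using mass by (simp add: sum.distrib sqnorm_def flip: sum_distrib_left)
 also have "... = 3 * L\<^sup>2 * (1 + e\<^sup>2 + sqnorm p)" by (simp add: algebra_simps)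
 also have "... <= 3 * L\<^sup>2 * (1 + 2 * sqnorm p)"
  using mean_square[of p] unfolding e_def by (intro mult_left_mono) auto
 finally show ?thesis .
qed

lemma sqnorm_scale: "sqnorm (%a. r * f a) = r\<^sup>2 * sqnorm f"
 by (simp add: sqnorm_def power_mult_distrib sum_distrib_left mult_ac)

lemma displacement_Suc:
 "sqnorm (%a. pos (Suc (Suc k)) a - pos (Suc k) a) <=
   (1 + \<tau>) * sqnorm (%a. pos (Suc k) a - pos k a) + (1 + 1/\<tau>) * (\<tau>\<^sup>2)\<^sup>2 * sqnorm (force (pos (Suc k)))"
proof -
 have "sqnorm (%a. pos (Suc (Suc k)) a - pos (Suc k) a) <= sqnorm (%a. proposal (Suc k) a - pos (Suc k) a)"
  unfolding sqnorm_def by (rule isotonic_regression_contraction[OF m_pos pos_Suc pos_mono])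
 also have "... = sqnorm (%a. cluster_mean (pos (Suc k)) (%e. pos (Suc k) e - pos k e) a + \<tau>\<^sup>2 * force (pos (Suc k)) a)"
  unfolding sqnorm_def
 proof (rule sum.cong[OF refl])
  fix a assume a: "a \<in> A"
  have "cluster_mean (pos (Suc k)) (pos (Suc k)) a = pos (Suc k) a"
   by (rule antisym) (auto intro: cluster_mean_le[OF a] cluster_mean_ge[OF a])
  moreover have "cluster_mean (pos (Suc k)) (%e. pos (Suc k) e - pos k e) a
   = cluster_mean (pos (Suc k)) (pos (Suc k)) a - cluster_mean (pos (Suc k)) (pos k) a"
   by (simp add: cluster_mean_def sum_subtractf right_diff_distrib diff_divide_distrib)
  ultimately have eq: "proposal (Suc k) a - pos (Suc k) a
   = cluster_mean (pos (Suc k)) (%e. pos (Suc k) e - pos k e) a + \<tau>\<^sup>2 * force (pos (Suc k)) a"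
   by simp
  show "m a * (proposal (Suc k) a - pos (Suc k) a)\<^sup>2 = m a * (cluster_mean (pos (Suc k)) (%e. pos (Suc k) e - pos k e) a + \<tau>\<^sup>2 * force (pos (Suc k)) a)\<^sup>2"
   unfolding eq ..
 qed
 also have "... <= (1 + \<tau>) * sqnorm (cluster_mean (pos (Suc k)) (%e. pos (Suc k) e - pos k e)) + (1 + 1/\<tau>) * sqnorm (%a. \<tau>\<^sup>2 * force (pos (Suc k)) a)"
  by (rule sqnorm_add_le)
 also have "... <= (1 + \<tau>) * sqnorm (%a. pos (Suc k) a - pos k a) + (1 + 1/\<tau>) * (\<tau>\<^sup>2)\<^sup>2 * sqnorm (force (pos (Suc k)))"
  unfolding sqnorm_scale using tau sqnorm_cluster_mean by (intro add_mono mult_left_mono) (auto simp: mult.assoc)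
 finally show ?thesis .
qed

definition growth_rate :: real where "growth_rate = 3 + 36 * L\<^sup>2"

text \<open>Projection and averaging are contractions, so position and discrete velocity grow at most as for the free
recursion with linearly bounded force; the Young inequality with weight \<open>\<tau>\<close> keeps the rate uniform in \<open>\<tau>\<close>.\<close>

lemma energy_bound:
 defines "E \<equiv> 1 + sqnorm (%a. a) + sqnorm v0"
 shows "sqnorm (pos k) + sqnorm (%a. pos (Suc k) a - pos k a) / \<tau>\<^sup>2 <= E * exp (growth_rate * (real k * \<tau>))"
proof -
 define s where "s k = sqnorm (pos k)" for k
 define e where "e k = sqnorm (%a. pos (Suc k) a - pos k a) / \<tau>\<^sup>2" for k
 have s0: "0 <= s k" and e0: "0 <= e k" for k using sqnorm_nonneg by (auto simp: s_def e_def)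
 have "1 + s k + e k <= E * exp (growth_rate * (real k * \<tau>))"
 proof (induction k)
  case 0
  have "sqnorm (%a. pos 1 a - pos 0 a) <= sqnorm (%a. proposal 0 a - pos 0 a)"
   unfolding sqnorm_def using isotonic_regression_contraction[OF m_pos pos_Suc pos_mono, of 0 0] by simp
  also have "... = sqnorm (%a. \<tau> * v0 a)" by simp
  also have "... = \<tau>\<^sup>2 * sqnorm v0" by (rule sqnorm_scale)
  finally have "e 0 <= sqnorm v0" using tau by (simp add: e_def field_simps)
  then show ?case by (simp add: E_def s_def)
 next
  case (Suc k)
  have "sqnorm (%a. pos k a + (pos (Suc k) a - pos k a)) <= (1 + \<tau>) * sqnorm (pos k) + (1 + 1/\<tau>) * sqnorm (%a. pos (Suc k) a - pos k a)"
   by (rule sqnorm_add_le)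
  also have "(1 + 1/\<tau>) * sqnorm (%a. pos (Suc k) a - pos k a) = (\<tau>\<^sup>2 + \<tau>) * e k"
   using tau by (simp add: e_def power2_eq_square field_simps)
  also have "... <= (2 * \<tau>) * e k" using e0 tau by (intro mult_right_mono) (auto simp: power2_eq_square mult_left_le)
  finally have s1: "s (Suc k) <= s k + \<tau> * s k + 2 * \<tau> * e k" by (simp add: s_def algebra_simps)
  define q where "q = 1 + s k + e k"
  have q: "1 <= q" "s k <= q" "e k <= q" using s0 e0 by (auto simp: q_def)
  have \<tau>q: "\<tau> * q <= q" using tau q mult_right_mono[of \<tau> 1 q] by simp
  have \<tau>s: "0 <= \<tau> * s k" "0 <= \<tau> * e k" using s0 e0 tau by auto
  have "\<tau> * s k + \<tau> * e k <= \<tau> * q" using tau unfolding q_def by (simp add: algebra_simps)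
  then have s2: "s (Suc k) <= s k + 2 * (\<tau> * q)" using s1 \<tau>s by (simp add: algebra_simps)
  have "1 + 2 * s k <= 2 * q" using e0[of k] by (simp add: q_def)
  then have s3: "1 + 2 * s (Suc k) <= 6 * q" using s2 \<tau>q by linarith
  have "e (Suc k) <= ((1 + \<tau>) * sqnorm (%a. pos (Suc k) a - pos k a) + (1 + 1/\<tau>) * (\<tau>\<^sup>2)\<^sup>2 * sqnorm (force (pos (Suc k)))) / \<tau>\<^sup>2"
   unfolding e_def using displacement_Suc tau by (intro divide_right_mono) auto
  also have "... = (1 + \<tau>) * e k + (\<tau>\<^sup>2 + \<tau>) * sqnorm (force (pos (Suc k)))"
   using tau by (simp add: e_def power2_eq_square field_simps)
  also have "... <= (1 + \<tau>) * e k + (2 * \<tau>) * (3 * L\<^sup>2 * (6 * q))"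
  proof (intro add_left_mono mult_mono)
   show "sqnorm (force (pos (Suc k))) <= 3 * L\<^sup>2 * (6 * q)"
   using order_trans[OF sqnorm_force[of "pos (Suc k)"] mult_left_mono[OF s3[unfolded s_def]]] by simp
  qed (use tau sqnorm_nonneg in \<open>auto simp: power2_eq_square mult_left_le\<close>)
  also have "... <= e k + \<tau> * q + 36 * L\<^sup>2 * (\<tau> * q)"
   using q tau by (simp add: algebra_simps)
  finally have e1: "e (Suc k) <= e k + \<tau> * q + 36 * L\<^sup>2 * (\<tau> * q)" .
  have "1 + s (Suc k) + e (Suc k) <= q * (1 + growth_rate * \<tau>)"
   using s2 e1 unfolding q_def growth_rate_def by (simp add: algebra_simps)
  also have "... <= q * exp (growth_rate * \<tau>)" using q exp_ge_add_one_self[of "growth_rate * \<tau>"] by (intro mult_left_mono) auto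
  also have "... <= E * exp (growth_rate * (real k * \<tau>)) * exp (growth_rate * \<tau>)"
   using Suc.IH unfolding q_def by (intro mult_right_mono) auto
  also have "... = E * exp (growth_rate * (real (Suc k) * \<tau>))"
   by (simp add: exp_add[symmetric] algebra_simps)
  finally show ?case .
 qed
 then show ?thesis by (simp add: s_def e_def)
qed

end

section \<open>Discretising the initial distribution\<close>

text \<open>Arzela-Ascoli by a diagonal sequence over a countable dense set.  The functions \<open>f n\<close> need not be continuous:
oscillations that vanish as \<open>n\<close> grows are enough, which is what step functions in time and in the label provide.\<close>

lemma asymptotically_equicontinuous_subsequence:
 fixes f :: "nat => 'a :: {metric_space, second_countable_topology} => real" and Z :: "'a set"
 assumes bdd: "!!z. z \<in> Z ==> \<exists>B. \<forall>n. \<bar>f n z\<bar> <= B"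
  and eq: "!!z e. z \<in> Z ==> e > 0 ==> \<exists>d>0. \<exists>N. \<forall>n\<ge>N. \<forall>z'\<in>Z. dist z' z < d --> \<bar>f n z' - f n z\<bar> <= e"
 obtains r g where "strict_mono (r :: nat => nat)" "!!z. z \<in> Z ==> (%n. f (r n) z) \<longlonglongrightarrow> g z" "continuous_on Z g"
proof -
 obtain B where B: "!!z n. z \<in> Z ==> \<bar>f n z\<bar> <= B z" using bdd by metis
 obtain D where D: "countable D" "D \<subseteq> Z" "Z \<subseteq> closure D" by (rule separable)
 have pos: "0 < B z + 1" if "z \<in> Z" for z using B[OF that, of 0] by linarith
 have "norm (f n z / (B z + 1)) <= 1" if "z \<in> D" for n z
  using pos[of z] B[of z n] that D(2) by (auto simp: divide_le_eq_1)
 then obtain r where r: "strict_mono (r :: nat => nat)" "!!z. z \<in> D ==> \<exists>l. (%n. f (r n) z / (B z + 1)) \<longlonglongrightarrow> l"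
  using function_convergent_subsequence[of D "%n z. f n z / (B z + 1)" 1] D(1) by metis
 have cD: "Cauchy (%n. f (r n) z)" if z: "z \<in> D" for z
 proof -
  from r(2)[OF z] obtain l where "(%n. f (r n) z / (B z + 1)) \<longlonglongrightarrow> l" ..
  then have "(%n. f (r n) z / (B z + 1) * (B z + 1)) \<longlonglongrightarrow> l * (B z + 1)" by (intro tendsto_intros)
  moreover have "B z + 1 ~= 0" using pos[of z] z D(2) by auto
  ultimately have "(%n. f (r n) z) \<longlonglongrightarrow> l * (B z + 1)" by simp
  then show ?thesis by (rule LIMSEQ_imp_Cauchy)
 qed
 have rn: "n <= r n" for n using r(1) by (rule seq_suble)
 have conv: "\<exists>l. (%n. f (r n) z) \<longlonglongrightarrow> l" if z: "z \<in> Z" for z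
 proof -
  have "Cauchy (%n. f (r n) z)"
   unfolding Cauchy_def
  proof (intro allI impI)
   fix e :: real assume e: "e > 0"
   obtain d N where dN: "d > 0" "\<forall>n\<ge>N. \<forall>z'\<in>Z. dist z' z < d --> \<bar>f n z' - f n z\<bar> <= e/4"
   using eq[OF z, of "e/4"] e by auto
   obtain p where p: "p \<in> D" "dist p z < d" using D(3) z dN(1) by (meson closure_approachable subsetD)
   obtain M where M: "!!m n. m >= M ==> n >= M ==> dist (f (r m) p) (f (r n) p) < e/4"
   using cD[OF p(1)] e unfolding Cauchy_def by (metis zero_less_divide_iff zero_less_numeral)
   have "dist (f (r m) z) (f (r n) z) < e" if mn: "m >= max M N" "n >= max M N" for m n
   proof -
   have "N <= r m" "N <= r n" using rn[of m] rn[of n] mn by auto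
   then have "\<bar>f (r m) p - f (r m) z\<bar> <= e/4" "\<bar>f (r n) p - f (r n) z\<bar> <= e/4"
   using dN(2) p D(2) by blast+
   moreover have "\<bar>f (r m) p - f (r n) p\<bar> < e/4" using M[of m n] mn by (simp add: dist_real_def)
   ultimately show ?thesis using e unfolding dist_real_def by linarith
   qed
   then show "\<exists>M. \<forall>m\<ge>M. \<forall>n\<ge>M. dist (f (r m) z) (f (r n) z) < e" by blast
  qed
  then show ?thesis by (simp add: Cauchy_convergent_iff convergent_def)
 qed
 define g where "g z = lim (%n. f (r n) z)" for z
 have g: "(%n. f (r n) z) \<longlonglongrightarrow> g z" if "z \<in> Z" for z
  using conv[OF that] unfolding g_def by (metis limI)
 have "continuous_on Z g"
  unfolding continuous_on_iff
 proof (intro ballI allI impI)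
  fix z e assume z: "z \<in> Z" and e: "0 < (e::real)"
  obtain d N where dN: "d > 0" "\<forall>n\<ge>N. \<forall>z'\<in>Z. dist z' z < d --> \<bar>f n z' - f n z\<bar> <= e/2"
   using eq[OF z, of "e/2"] e by auto
  have "dist (g z') (g z) < e" if z': "z' \<in> Z" "dist z' z < d" for z'
  proof -
   have "\<bar>g z' - g z\<bar> <= e/2"
   proof (rule LIMSEQ_le_const2)
   show "(%n. \<bar>f (r n) z' - f (r n) z\<bar>) \<longlonglongrightarrow> \<bar>g z' - g z\<bar>" by (intro tendsto_intros g z z')
   have "\<bar>f (r n) z' - f (r n) z\<bar> <= e/2" if "n >= N" for n
   using dN(2) z' that rn[of n] by (meson order_trans)
   then show "\<exists>N. \<forall>n\<ge>N. \<bar>f (r n) z' - f (r n) z\<bar> <= e/2" by blast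
   qed
   then show ?thesis using e by (simp add: dist_real_def)
  qed
  then show "\<exists>d>0. \<forall>x'\<in>Z. dist x' z < d --> dist (g x') (g z) < e" using dN(1) by blast
 qed
 with r(1) g show thesis by (rule that)
qed

lemma closed_supp: "closed (supp M)"
proof -
 have "open (- supp M)"
 proof (subst open_subopen, intro ballI)
  fix x assume "x \<in> - supp M"
  then obtain U where U: "open U" "x \<in> U" "~ emeasure M U > 0" by (auto simp: supp_def)
  then have "U \<subseteq> - supp M" by (auto simp: supp_def)
  then show "\<exists>T. open T & x \<in> T & T \<subseteq> - supp M" using U by blast
 qed
 then show ?thesis by (simp add: closed_def)
qed

lemma AE_in_supp:
 fixes M :: "'a :: second_countable_topology measure"
 assumes sets: "sets M = sets borel"
 shows "AE x in M. x \<in> supp M"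
proof -
 obtain B :: "'a set set" where B: "countable B" "topological_basis B" using ex_countable_basis by blast
 define N where "N = \<Union>{U \<in> B. emeasure M U = 0}"
 have "N \<in> null_sets M"
  unfolding N_def
 proof (rule null_sets_UN'[of "{U \<in> B. emeasure M U = 0}" id, simplified])
  show "countable {U \<in> B. emeasure M U = 0}" using B(1) by auto
  show "U \<in> null_sets M" if "U \<in> B & emeasure M U = 0" for U
   using that B(2) sets by (auto simp: null_sets_def topological_basis_open)
 qed
 moreover have "- supp M \<subseteq> N"
 proof
  fix x assume "x \<in> - supp M"
  then obtain U where U: "open U" "x \<in> U" "emeasure M U = 0" by (auto simp: supp_def zero_less_iff_neq_zero)
  obtain V where V: "V \<in> B" "x \<in> V" "V \<subseteq> U" using topological_basisE[OF B(2) U(1,2)] by blast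
  have "emeasure M V <= emeasure M U" using V(3) U(1) sets by (intro emeasure_mono) auto
  then show "x \<in> N" unfolding N_def using V U(3) by auto
 qed
 ultimately show ?thesis by (intro AE_I'[of N]) auto
qed

text \<open>The nearest of the first \<open>n + 1\<close> points of the sequence, ties going to the earliest one.  Rounding to these
points pushes \<open>\<rho>\<close> to finitely many atoms that all lie in the support of \<open>\<rho>\<close>.\<close>

fun nearest :: "(nat => real) => nat => real => real" where
 "nearest q 0 x = q 0"
| "nearest q (Suc n) x = (if \<bar>x - q (Suc n)\<bar> < \<bar>x - nearest q n x\<bar> then q (Suc n) else nearest q n x)"

lemma nearest_in: "nearest q n x \<in> q ` {..n}"
proof (induction n)
 case (Suc n)
 have "q ` {..n} \<subseteq> q ` {..Suc n}" by (intro image_mono) auto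
 then show ?case using Suc by auto
qed simp

lemma nearest_le: "k <= n ==> \<bar>x - nearest q n x\<bar> <= \<bar>x - q k\<bar>"
proof (induction n)
 case (Suc n)
 then show ?case by (cases "k = Suc n") auto
qed simp

lemma nearest_measurable [measurable]: "nearest q n \<in> borel_measurable borel"
proof (induction n)
 case 0
 have "nearest q 0 = (%x. q 0)" by auto
 then show ?case by simp
next
 case (Suc n)
 note [measurable] = Suc
 have "nearest q (Suc n) = (%x. if \<bar>x - q (Suc n)\<bar> < \<bar>x - nearest q n x\<bar> then q (Suc n) else nearest q n x)" by auto
 then show ?case by simp
qed

lemma nearest_eq:
 assumes "a \<in> q ` {..n}" "!!b. b \<in> q ` {..n} ==> b ~= a ==> \<bar>x - a\<bar> < \<bar>x - b\<bar>"
 shows "nearest q n x = a"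
proof (rule ccontr)
 assume ne: "nearest q n x ~= a"
 obtain k where "k <= n" "a = q k" using assms(1) by auto
 then have "\<bar>x - nearest q n x\<bar> <= \<bar>x - a\<bar>" using nearest_le by simp
 then show False using assms(2)[OF nearest_in ne] by linarith
qed

text \<open>\<open>w\<close> is the derivative of the interaction potential and \<open>J\<close> the majorant of the initial velocity.  From here on
particles are labelled by their starting points in the support \<open>S\<close>.\<close>

locale interaction =
 fixes \<rho> :: "real measure" and v0 J w :: "real => real" and c L :: real
 assumes prob: "prob_space \<rho>" and sets_rho: "sets \<rho> = sets borel"
  and moment: "integrable \<rho> (%x. x\<^sup>2)"
  and c_pos: "0 < c"
  and v0_J: "!!a b. a <= b ==> \<bar>v0 b - v0 a\<bar> <= J b - J a"
  and J_uniform: "!!\<epsilon>. \<epsilon> > 0 ==> \<exists>\<delta>>0. \<forall>a b. a <= b & b - a < \<delta> --> J b - J a <= \<epsilon>"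
  and w_cont: "continuous_on UNIV w"
  and w_semi: "!!x y. x <= y ==> w x - w y <= c * (y - x)"
  and w_growth: "!!x. \<bar>w x\<bar> <= L * (1 + \<bar>x\<bar>)"
begin

sublocale prob_space \<rho> by (rule prob)

declare sets_rho [measurable_cong, simp]

lemma space_rho [simp]: "space \<rho> = UNIV"
 using sets_eq_imp_space_eq[OF sets_rho] by simp

lemma prob_UNIV [simp]: "prob UNIV = 1"
 using prob_space by simp

abbreviation S :: "real set" where "S \<equiv> supp \<rho>"

lemma AE_S: "AE x in \<rho>. x \<in> S"
 by (rule AE_in_supp[OF sets_rho])

lemma S_sets [measurable]: "S \<in> sets borel"
 by (rule borel_closed[OF closed_supp])

lemma S_nonempty: "S ~= {}"
proof
 assume "S = {}"
 then have "AE x in \<rho>. False" using AE_S by simp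
 then show False by (simp add: AE_False)
qed

lemma ball_mass: "x \<in> S ==> r > 0 ==> measure \<rho> (ball x r) > 0"
proof -
 assume "x \<in> S" "r > 0"
 then have "0 < emeasure \<rho> (ball x r)" unfolding supp_def mem_Collect_eq by (metis centre_in_ball open_ball)
 then show "measure \<rho> (ball x r) > 0" by (simp add: emeasure_eq_measure)
qed

lemma dense_sequence: "\<exists>q :: nat => real. range q \<subseteq> S & S \<subseteq> closure (range q)"
proof -
 obtain D where D: "countable D" "D \<subseteq> S" "S \<subseteq> closure D" by (rule separable)
 then have "D ~= {}" using S_nonempty by auto
 then have "range (from_nat_into D) = D" using D(1) by (rule range_from_nat_into)
 then show ?thesis using D by metis
qed

definition q :: "nat => real" where
 "q = (SOME q. range q \<subseteq> S & S \<subseteq> closure (range q))"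

lemma q: "range q \<subseteq> S" "S \<subseteq> closure (range q)"
 using someI_ex[OF dense_sequence] unfolding q_def by blast+

definition sites :: "nat => real set" where "sites n = q ` {..n}"
definition site :: "nat => real => real" where "site n = nearest q n"
definition site_mass :: "nat => real => real" where "site_mass n a = measure \<rho> {x. site n x = a}"
definition \<tau> :: "nat => real" where "\<tau> n = 1 / real (Suc n)"

lemma site_measurable [measurable]: "site n \<in> borel_measurable borel"
 unfolding site_def by (rule nearest_measurable)

lemma site_in: "site n x \<in> sites n"
 unfolding site_def sites_def by (rule nearest_in)

lemma site_dist: "\<bar>x - site n x\<bar> <= \<bar>x - q 0\<bar>"
 unfolding site_def by (rule nearest_le) simp

lemma site_bound: "\<bar>site n x\<bar> <= 2 * \<bar>x\<bar> + \<bar>q 0\<bar>"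
 using site_dist[of x n] by linarith

lemma site_tendsto:
 assumes "x \<in> S" shows "(%n. site n x) \<longlonglongrightarrow> x"
proof (rule LIMSEQ_I)
 fix e :: real assume e: "0 < e"
 have "x \<in> closure (range q)" using q(2) assms by blast
 then obtain k where k: "dist (q k) x < e" using e by (metis closure_approachable rangeE)
 have "norm (site n x - x) < e" if "n >= k" for n
  using nearest_le[OF that, of x q] k by (simp add: site_def dist_real_def abs_minus_commute)
 then show "\<exists>no. \<forall>n\<ge>no. norm (site n x - x) < e" by blast
qed

lemma site_dist_two:
 assumes "x' \<in> S" shows "\<bar>site n x' - site n x\<bar> <= 2 * \<bar>site n x - x\<bar> + 2 * \<bar>x' - x\<bar>"
proof -
 obtain k where k: "k <= n" "site n x = q k" using site_in[of n x] by (auto simp: sites_def)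
 have "\<bar>x' - site n x'\<bar> <= \<bar>x' - site n x\<bar>" using nearest_le[OF k(1), of x' q] k(2) by (simp add: site_def)
 moreover have "\<bar>site n x' - site n x\<bar> <= \<bar>x' - site n x'\<bar> + \<bar>x' - site n x\<bar>" by linarith
 moreover have "\<bar>x' - site n x\<bar> <= \<bar>site n x - x\<bar> + \<bar>x' - x\<bar>" by linarith
 ultimately show ?thesis by linarith
qed

lemma sites_finite: "finite (sites n)" by (simp add: sites_def)

text \<open>Strict positivity is needed by the particle system and holds because the atoms lie in the support.\<close>

lemma site_mass_pos: assumes a: "a \<in> sites n" shows "site_mass n a > 0"
proof -
 have aS: "a \<in> S" using a q(1) by (auto simp: sites_def)
 obtain d where d: "d > 0" "\<forall>x\<in>sites n. x ~= a --> d <= dist a x"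
  using finite_set_avoid[OF sites_finite] by blast
 have "ball a (d/2) \<subseteq> {x. site n x = a}"
 proof
  fix x assume x: "x \<in> ball a (d/2)"
  have "site n x = a"
   unfolding site_def
  proof (rule nearest_eq)
   show "a \<in> q ` {..n}" using a by (simp add: sites_def)
   fix b assume "b \<in> q ` {..n}" "b ~= a"
   then have "d <= \<bar>a - b\<bar>" using d(2) by (auto simp: sites_def dist_real_def)
   moreover have "\<bar>a - x\<bar> < d / 2" using x by (simp add: dist_real_def)
   moreover have "\<bar>a - b\<bar> <= \<bar>a - x\<bar> + \<bar>x - b\<bar>" by linarith
   ultimately show "\<bar>x - a\<bar> < \<bar>x - b\<bar>" by linarith
  qed
  then show "x \<in> {x. site n x = a}" by simp
 qed
 then have "measure \<rho> (ball a (d/2)) <= site_mass n a"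
  unfolding site_mass_def by (intro finite_measure_mono) measurable
 then show ?thesis using ball_mass[OF aS, of "d/2"] d(1) by simp
qed

lemma site_sum:
 shows site_fun_measurable [measurable]: "(%x. f (site n x)) \<in> borel_measurable borel"
  and site_integrable: "integrable \<rho> (%x. f (site n x) :: real)"
  and site_integral: "(\<integral>x. f (site n x) \<partial>\<rho>) = (\<Sum>a\<in>sites n. site_mass n a * f a)"
proof -
 have eq: "(%x. f (site n x)) = (%x. \<Sum>a\<in>sites n. indicator {x. site n x = a} x * f a)"
 proof
  fix x
  have "(\<Sum>a\<in>sites n. indicator {x. site n x = a} x * f a) = (\<Sum>a\<in>sites n. if site n x = a then f a else 0)"
   by (intro sum.cong refl) (auto simp: indicator_def)
  also have "... = f (site n x)" using site_in[of n x] sites_finite by (simp add: sum.delta)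
  finally show "f (site n x) = (\<Sum>a\<in>sites n. indicator {x. site n x = a} x * f a)" by simp
 qed
 have [measurable]: "{x. site n x = a} \<in> sets borel" for a by measurable
 show "(%x. f (site n x)) \<in> borel_measurable borel" unfolding eq by measurable
 have i: "integrable \<rho> (%x. indicator {x. site n x = a} x * f a)" for a
  by (intro integrable_mult_left integrable_real_indicator) (auto simp: emeasure_eq_measure)
 show "integrable \<rho> (%x. f (site n x))" unfolding eq by (intro Bochner_Integration.integrable_sum i)
 show "(\<integral>x. f (site n x) \<partial>\<rho>) = (\<Sum>a\<in>sites n. site_mass n a * f a)"
  unfolding eq by (subst Bochner_Integration.integral_sum[OF i]) (simp add: site_mass_def)
qed

lemma site_total: "(\<Sum>a\<in>sites n. site_mass n a) = 1"
 using site_integral[of "%_. 1" n] by simp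

lemma tau_pos: "0 < \<tau> n" and tau_le1: "\<tau> n <= 1" and tau_tendsto: "\<tau> \<longlonglongrightarrow> 0"
proof -
 show "0 < \<tau> n" "\<tau> n <= 1" by (auto simp: \<tau>_def)
 show "\<tau> \<longlonglongrightarrow> 0" unfolding \<tau>_def using LIMSEQ_inverse_real_of_nat by (simp add: inverse_eq_divide)
qed

sublocale p: particles "sites n" "site_mass n" v0 J w "\<tau> n" c L for n
 by unfold_locales (auto simp: sites_finite site_mass_pos site_total tau_pos tau_le1 c_pos v0_J w_semi w_growth)

definition grid :: "nat => real => nat" where "grid n t = nat \<lfloor>t / \<tau> n\<rfloor>"

lemma grid_le: "0 <= t ==> real (grid n t) * \<tau> n <= t"
 and grid_gt: "0 <= t ==> t < real (grid n t) * \<tau> n + \<tau> n"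
proof -
 assume t: "0 <= t"
 have f: "real (grid n t) = of_int \<lfloor>t / \<tau> n\<rfloor>" using t tau_pos[of n] by (simp add: grid_def)
 show "real (grid n t) * \<tau> n <= t"
  unfolding f by (rule pos_le_divide_eq[OF tau_pos, THEN iffD1, OF of_int_floor_le])
 have "t / \<tau> n < of_int \<lfloor>t / \<tau> n\<rfloor> + 1" by linarith
 from pos_divide_less_eq[OF tau_pos, THEN iffD1, OF this]
 show "t < real (grid n t) * \<tau> n + \<tau> n" unfolding f by (simp add: distrib_right)
qed

lemma grid_mono: "s <= t ==> grid n s <= grid n t"
 unfolding grid_def using tau_pos[of n] by (intro nat_mono floor_mono divide_right_mono) auto

lemma grid_tendsto: assumes t: "0 <= t" shows "(%n. real (grid n t) * \<tau> n) \<longlonglongrightarrow> t"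
proof (rule tendsto_sandwich)
 show "\<forall>\<^sub>F n in sequentially. t - \<tau> n <= real (grid n t) * \<tau> n"
  using grid_gt[OF t] by (intro always_eventually allI) (simp add: less_imp_le algebra_simps)
 show "\<forall>\<^sub>F n in sequentially. real (grid n t) * \<tau> n <= t" using grid_le[OF t] by simp
 show "(%n. t - \<tau> n) \<longlonglongrightarrow> t" using tendsto_diff[OF tendsto_const[of t] tau_tendsto] by simp
qed simp

lemma grid_unique: "real k * \<tau> n <= s ==> s < real (Suc k) * \<tau> n ==> grid n s = k"
proof -
 assume s: "real k * \<tau> n <= s" "s < real (Suc k) * \<tau> n"
 then have "\<lfloor>s / \<tau> n\<rfloor> = int k" using tau_pos[of n] by (intro floor_unique) (auto simp: pos_le_divide_eq pos_divide_less_eq add.commute)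
 then show ?thesis by (simp add: grid_def)
qed

text \<open>Position at time \<open>t\<close> of the particle that represents the label \<open>x\<close> in the \<open>n\<close>-th discretisation.\<close>

definition Xn :: "nat => real => real => real" where
 "Xn n x t = p.pos n (grid n t) (site n x)"

lemma Xn_measurable [measurable]: "(%x. Xn n x t) \<in> borel_measurable borel"
 unfolding Xn_def by (rule site_fun_measurable)

lemma Xn_integral: "(\<integral>x. f (Xn n x t) \<partial>\<rho>) = (\<Sum>a\<in>sites n. site_mass n a * f (p.pos n (grid n t) a))"
 unfolding Xn_def by (rule site_integral)

end

lemma (in particles) displacement_multi:
 assumes jk: "j <= k"
 shows "sqnorm (%a. pos k a - pos j a) <= (real (k - j) * \<tau>)\<^sup>2 * ((1 + sqnorm (%a. a) + sqnorm v0) * exp (growth_rate * (real k * \<tau>)))"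
proof -
 let ?B = "(1 + sqnorm (%a. a) + sqnorm v0) * exp (growth_rate * (real k * \<tau>))"
 have g: "0 <= growth_rate" by (simp add: growth_rate_def)
 have step: "sqnorm (%a. pos (Suc i) a - pos i a) <= \<tau>\<^sup>2 * ?B" if i: "i < k" for i
 proof -
  have "sqnorm (%a. pos (Suc i) a - pos i a) / \<tau>\<^sup>2 <= (1 + sqnorm (%a. a) + sqnorm v0) * exp (growth_rate * (real i * \<tau>))"
   using energy_bound[of i] sqnorm_nonneg[of "pos i"] by linarith
  also have "... <= ?B"
   using i g tau sqnorm_nonneg[of v0] sqnorm_nonneg[of "%a. a"] by (intro mult_left_mono) (auto intro!: mult_left_mono mult_right_mono)
  finally show ?thesis using tau by (simp add: pos_divide_le_eq mult.commute)
 qed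
 have pw: "(pos k a - pos j a)\<^sup>2 <= real (k - j) * (\<Sum>i\<in>{j..<k}. (pos (Suc i) a - pos i a)\<^sup>2)" for a
 proof -
  have "pos k a - pos j a = (\<Sum>i\<in>{j..<k}. 1 * (pos (Suc i) a - pos i a))"
   using sum_Suc_diff'[OF jk, of "%i. pos i a"] by simp
  then have "(pos k a - pos j a)\<^sup>2 <= (\<Sum>i\<in>{j..<k}. 1\<^sup>2) * (\<Sum>i\<in>{j..<k}. (pos (Suc i) a - pos i a)\<^sup>2)"
   by (simp only: Cauchy_Schwarz_ineq_sum)
  then show ?thesis by simp
 qed
 have "sqnorm (%a. pos k a - pos j a) <= (\<Sum>a\<in>A. m a * (real (k - j) * (\<Sum>i\<in>{j..<k}. (pos (Suc i) a - pos i a)\<^sup>2)))"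
  unfolding sqnorm_def using m_pos pw by (intro sum_mono mult_left_mono) (auto simp: less_imp_le)
 also have "... = real (k - j) * (\<Sum>a\<in>A. \<Sum>i\<in>{j..<k}. m a * (pos (Suc i) a - pos i a)\<^sup>2)"
  by (simp add: sum_distrib_left mult_ac)
 also have "... = real (k - j) * (\<Sum>i\<in>{j..<k}. sqnorm (%a. pos (Suc i) a - pos i a))"
  unfolding sqnorm_def by (subst sum.swap) simp
 also have "... <= real (k - j) * (\<Sum>i\<in>{j..<k}. \<tau>\<^sup>2 * ?B)"
  using step by (intro mult_left_mono sum_mono) auto
 also have "... = (real (k - j) * \<tau>)\<^sup>2 * ?B"
  by (simp add: power2_eq_square)
 finally show ?thesis .
qed

context interaction
begin

lemma J_mono: "a <= b ==> J a <= J b"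
 using v0_J[of a b] by linarith

lemma J_linear: "\<exists>C\<ge>0. \<forall>a b. \<bar>J b - J a\<bar> <= C * (1 + \<bar>b - a\<bar>)"
proof -
 from J_uniform[of 1] obtain \<delta> where d: "\<delta> > 0" "\<forall>a b. a <= b & b - a < \<delta> --> J b - J a <= 1" by auto
 have step: "J b - J a <= real n" if "a <= b" "b - a <= real n * (\<delta>/2)" for n a b
  using that
 proof (induction n arbitrary: b)
  case (Suc n)
  define e where "e = max a (b - \<delta>/2)"
  have e: "a <= e" "e <= b" "b - e < \<delta>" "e - a <= real n * (\<delta>/2)"
   using Suc.prems d(1) by (auto simp: e_def max_def field_simps)
  have "J b - J e <= 1" using d(2) e(2,3) by blast
  moreover have "J e - J a <= real n" using Suc.IH[of e] e by simp
  ultimately show ?case by simp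
 qed simp
 have *: "J b - J a <= (1 + 2/\<delta>) * (1 + \<bar>b - a\<bar>)" if ab: "a <= b" for a b
 proof -
  define n where "n = nat \<lceil>(b - a) / (\<delta>/2)\<rceil>"
  define \<kappa> where "\<kappa> = 2/\<delta>"
  have k: "0 <= \<kappa>" "(b - a) / (\<delta>/2) = \<kappa> * (b - a)" using d(1) by (auto simp: \<kappa>_def)
  have 0: "0 <= \<kappa> * (b - a)" using ab k(1) by simp
  have n1: "(b - a) / (\<delta>/2) <= real n" unfolding n_def by linarith
  have n2: "real n <= \<kappa> * (b - a) + 1" unfolding n_def k(2) using 0 by linarith
  have "b - a <= real n * (\<delta>/2)" using n1 d(1) by (simp add: pos_divide_le_eq)
  then have "J b - J a <= real n" by (rule step[OF ab])
  also have "... <= 1 + \<kappa> * (b - a)" using n2 by simp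
  also have "... <= 1 + \<kappa> * (b - a) + (\<kappa> + (b - a))" using ab k(1) by simp
  also have "... = (1 + \<kappa>) * (1 + \<bar>b - a\<bar>)" using ab by (simp add: algebra_simps)
  also have "... = (1 + 2/\<delta>) * (1 + \<bar>b - a\<bar>)" by (simp add: \<kappa>_def)
  finally show ?thesis .
 qed
 have "\<bar>J b - J a\<bar> <= (1 + 2/\<delta>) * (1 + \<bar>b - a\<bar>)" for a b
  using *[of a b] *[of b a] J_mono[of a b] J_mono[of b a] by (cases "a <= b") (auto simp: abs_minus_commute)
 then show ?thesis using d(1) by (intro exI[of _ "1 + 2/\<delta>"]) auto
qed

lemma J_cont: "continuous_on UNIV J"
 unfolding continuous_on_iff
proof (intro ballI allI impI)
 fix x e :: real assume e: "0 < e"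
 from J_uniform[of "e/2"] e obtain \<delta> where d: "\<delta> > 0" "\<forall>a b. a <= b & b - a < \<delta> --> J b - J a <= e/2" by auto
 have "\<bar>J y - J x\<bar> < e" if y: "\<bar>y - x\<bar> < \<delta>" for y
 proof (cases "x <= y")
  case True
  then have "J y - J x <= e/2" using d(2) y by simp
  then show ?thesis using J_mono[OF True] e by simp
 next
  case False
  then have "J x - J y <= e/2" using d(2) y by simp
  then show ?thesis using J_mono[of y x] False e by simp
 qed
 then show "\<exists>d>0. \<forall>x'\<in>UNIV. dist x' x < d --> dist (J x') (J x) < e"
  using d(1) by (auto simp: dist_real_def)
qed

lemma v0_abs: "\<bar>v0 b - v0 a\<bar> <= \<bar>J b - J a\<bar>"
 using v0_J[of a b] v0_J[of b a] by (cases "a <= b") auto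

lemma v0_cont: "continuous_on UNIV v0"
 unfolding continuous_on_iff
proof (intro ballI allI impI)
 fix x e :: real assume "0 < e"
 then obtain d where d: "d > 0" "\<forall>x'\<in>UNIV. dist x' x < d --> dist (J x') (J x) < e"
  using J_cont[unfolded continuous_on_iff] by blast
 have "dist (v0 y) (v0 x) < e" if "dist y x < d" for y
  using d(2) that v0_abs[of y x] unfolding dist_real_def by (meson UNIV_I le_less_trans)
 then show "\<exists>d>0. \<forall>x'\<in>UNIV. dist x' x < d --> dist (v0 x') (v0 x) < e" using d(1) by blast
qed

lemma v0_measurable [measurable]: "v0 \<in> borel_measurable borel"
 by (rule borel_measurable_continuous_onI[OF v0_cont])

lemma w_measurable [measurable]: "w \<in> borel_measurable borel"
 by (rule borel_measurable_continuous_onI[OF w_cont])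

lemma v0_linear: "\<exists>C\<ge>0. \<forall>a. \<bar>v0 a\<bar> <= C * (1 + \<bar>a\<bar>)"
proof -
 from J_linear obtain C where C': "C >= 0 & (\<forall>a b. \<bar>J b - J a\<bar> <= C * (1 + \<bar>b - a\<bar>))" by (rule exE)
 note C = conjunct1[OF C'] conjunct2[OF C', rule_format]
 have "\<bar>v0 a\<bar> <= (\<bar>v0 0\<bar> + C) * (1 + \<bar>a\<bar>)" for a
 proof -
  have "\<bar>v0 a\<bar> <= \<bar>v0 0\<bar> + \<bar>J a - J 0\<bar>" using v0_abs[of a 0] by linarith
  also have "... <= \<bar>v0 0\<bar> + C * (1 + \<bar>a - 0\<bar>)" using C(2)[of a 0] by (rule add_left_mono)
  also have "... <= (\<bar>v0 0\<bar> + C) * (1 + \<bar>a\<bar>)" by (simp add: algebra_simps)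
  finally show ?thesis .
 qed
 then show ?thesis using C(1) by (intro exI[of _ "\<bar>v0 0\<bar> + C"]) auto
qed

lemma square_integrable_affine: "integrable \<rho> (%x. (C * (1 + \<bar>x\<bar>))\<^sup>2)"
proof (rule Bochner_Integration.integrable_bound)
 show "integrable \<rho> (%x. 2 * C\<^sup>2 * (1 + x\<^sup>2))" using moment by auto
 show "AE x in \<rho>. norm ((C * (1 + \<bar>x\<bar>))\<^sup>2) <= norm (2 * C\<^sup>2 * (1 + x\<^sup>2))"
 proof (rule AE_I2)
  fix x :: real
  have "0 <= (1 - \<bar>x\<bar>)\<^sup>2" by simp
  then have "(1 + \<bar>x\<bar>)\<^sup>2 <= 2 * (1 + x\<^sup>2)" by (simp add: power2_eq_square algebra_simps)
  then have "C\<^sup>2 * (1 + \<bar>x\<bar>)\<^sup>2 <= C\<^sup>2 * (2 * (1 + x\<^sup>2))" by (intro mult_left_mono) auto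
  also have "... = 2 * C\<^sup>2 * (1 + x\<^sup>2)" by (simp only: mult_ac)
  finally have "(C * (1 + \<bar>x\<bar>))\<^sup>2 <= 2 * C\<^sup>2 * (1 + x\<^sup>2)" by (simp only: power_mult_distrib)
  moreover have "0 <= 2 * C\<^sup>2 * (1 + x\<^sup>2)" by simp
  ultimately show "norm ((C * (1 + \<bar>x\<bar>))\<^sup>2) <= norm (2 * C\<^sup>2 * (1 + x\<^sup>2))" by (simp only: real_norm_def abs_of_nonneg zero_le_power2)
 qed
qed measurable

lemma integrable_affine: "integrable \<rho> (%x. C * (1 + \<bar>x\<bar>))"
proof (rule Bochner_Integration.integrable_bound)
 show "integrable \<rho> (%x. 1 + (C * (1 + \<bar>x\<bar>))\<^sup>2)" using square_integrable_affine by auto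
 show "AE x in \<rho>. norm (C * (1 + \<bar>x\<bar>)) <= norm (1 + (C * (1 + \<bar>x\<bar>))\<^sup>2)"
 proof (rule AE_I2)
  fix x :: real
  have "\<bar>y\<bar> <= 1 + y\<^sup>2" for y :: real
  proof -
   have "0 <= (1 - \<bar>y\<bar>)\<^sup>2" by simp
   then have "2 * \<bar>y\<bar> <= 1 + y\<^sup>2" by (simp add: power2_eq_square algebra_simps)
   then show ?thesis by linarith
  qed
  then show "norm (C * (1 + \<bar>x\<bar>)) <= norm (1 + (C * (1 + \<bar>x\<bar>))\<^sup>2)" by simp
 qed
qed measurable

text \<open>A bound, uniform in the discretisation, for the initial second moments.\<close>

lemma initial_energy: "\<exists>E\<ge>0. \<forall>n. 1 + p.sqnorm n (%a. a) + p.sqnorm n v0 <= E"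
proof -
 from v0_linear obtain C where C': "C >= 0 & (\<forall>a. \<bar>v0 a\<bar> <= C * (1 + \<bar>a\<bar>))" by (rule exE)
 note C = conjunct1[OF C'] conjunct2[OF C', rule_format]
 define D where "D = 2 + \<bar>q 0\<bar>"
 have D: "1 + \<bar>site n x\<bar> <= D * (1 + \<bar>x\<bar>)" for n x
 proof -
  have "1 + \<bar>site n x\<bar> <= 1 + 2 * \<bar>x\<bar> + \<bar>q 0\<bar>" using site_bound[of n x] by linarith
  also have "... <= D * (1 + \<bar>x\<bar>)" unfolding D_def by (simp add: algebra_simps)
  finally show ?thesis .
 qed
 have "1 + p.sqnorm n (%a. a) + p.sqnorm n v0 <= 1 + (\<integral>x. (D * (1 + \<bar>x\<bar>))\<^sup>2 \<partial>\<rho>) + (\<integral>x. (C * D * (1 + \<bar>x\<bar>))\<^sup>2 \<partial>\<rho>)" for n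
 proof (intro add_mono order_refl)
  have "p.sqnorm n (%a. a) = (\<integral>x. (site n x)\<^sup>2 \<partial>\<rho>)" unfolding p.sqnorm_def by (rule site_integral[symmetric])
  also have "... <= (\<integral>x. (D * (1 + \<bar>x\<bar>))\<^sup>2 \<partial>\<rho>)"
  proof (rule integral_mono)
   fix x
   have "\<bar>site n x\<bar> <= D * (1 + \<bar>x\<bar>)" using D[of n x] by linarith
   then show "(site n x)\<^sup>2 <= (D * (1 + \<bar>x\<bar>))\<^sup>2" by (metis abs_ge_zero power2_abs power_mono)
  qed (rule site_integrable square_integrable_affine)+
  finally show "p.sqnorm n (%a. a) <= (\<integral>x. (D * (1 + \<bar>x\<bar>))\<^sup>2 \<partial>\<rho>)" .
  have "p.sqnorm n v0 = (\<integral>x. (v0 (site n x))\<^sup>2 \<partial>\<rho>)" unfolding p.sqnorm_def by (rule site_integral[symmetric])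
  also have "... <= (\<integral>x. (C * D * (1 + \<bar>x\<bar>))\<^sup>2 \<partial>\<rho>)"
  proof (rule integral_mono)
   fix x
   have "\<bar>v0 (site n x)\<bar> <= C * (1 + \<bar>site n x\<bar>)" by (rule C(2))
   also have "... <= C * (D * (1 + \<bar>x\<bar>))" using D C(1) by (rule mult_left_mono)
   finally have "\<bar>v0 (site n x)\<bar> <= C * D * (1 + \<bar>x\<bar>)" by (simp add: mult_ac)
   then show "(v0 (site n x))\<^sup>2 <= (C * D * (1 + \<bar>x\<bar>))\<^sup>2" by (metis abs_ge_zero power2_abs power_mono)
  qed (rule site_integrable[of "%a. (v0 a)\<^sup>2"] square_integrable_affine)+
  finally show "p.sqnorm n v0 <= (\<integral>x. (C * D * (1 + \<bar>x\<bar>))\<^sup>2 \<partial>\<rho>)" .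
 qed
 moreover have "0 <= 1 + (\<integral>x. (D * (1 + \<bar>x\<bar>))\<^sup>2 \<partial>\<rho>) + (\<integral>x. (C * D * (1 + \<bar>x\<bar>))\<^sup>2 \<partial>\<rho>)"
  by (intro add_nonneg_nonneg Bochner_Integration.integral_nonneg) auto
 ultimately show ?thesis by blast
qed

definition E0 :: real where "E0 = (SOME E. E >= 0 & (\<forall>n. 1 + p.sqnorm n (%a. a) + p.sqnorm n v0 <= E))"

lemma E0: "0 <= E0" "1 + p.sqnorm n (%a. a) + p.sqnorm n v0 <= E0"
 using someI_ex[OF initial_energy[unfolded Bex_def]] unfolding E0_def by blast+

definition rate :: real where "rate = 3 + 36 * L\<^sup>2"

lemma rate_nonneg: "0 <= rate" by (simp add: rate_def)

lemma rate_eq: "p.growth_rate = rate" by (simp add: p.growth_rate_def rate_def)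

lemma Xn_second_moment:
 assumes t: "0 <= t" shows "(\<integral>x. (Xn n x t)\<^sup>2 \<partial>\<rho>) <= E0 * exp (rate * t)"
proof -
 have "(\<integral>x. (Xn n x t)\<^sup>2 \<partial>\<rho>) = p.sqnorm n (p.pos n (grid n t))"
  unfolding p.sqnorm_def by (rule Xn_integral)
 also have "... <= (1 + p.sqnorm n (%a. a) + p.sqnorm n v0) * exp (p.growth_rate * (real (grid n t) * \<tau> n))"
  using p.energy_bound[of n "grid n t"] p.sqnorm_nonneg[of n "%a. p.pos n (Suc (grid n t)) a - p.pos n (grid n t) a"]
   divide_nonneg_nonneg[OF p.sqnorm_nonneg[of n "%a. p.pos n (Suc (grid n t)) a - p.pos n (grid n t) a"] zero_le_power2[of "\<tau> n"]] by linarith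
 also have "... <= E0 * exp (rate * t)"
  unfolding rate_eq using E0 grid_le[OF t] rate_nonneg by (intro mult_mono) (auto intro!: mult_left_mono)
 finally show ?thesis .
qed

lemma Xn_displacement:
 assumes st: "0 <= s" "s <= t"
 shows "(\<integral>x. (Xn n x t - Xn n x s)\<^sup>2 \<partial>\<rho>) <= (t - s + \<tau> n)\<^sup>2 * (E0 * exp (rate * t))"
proof -
 let ?j = "grid n s" and ?k = "grid n t"
 have jk: "?j <= ?k" by (rule grid_mono[OF st(2)])
 have "(\<integral>x. (Xn n x t - Xn n x s)\<^sup>2 \<partial>\<rho>) = p.sqnorm n (%a. p.pos n ?k a - p.pos n ?j a)"
  unfolding p.sqnorm_def Xn_def by (rule site_integral)
 also have "... <= (real (?k - ?j) * \<tau> n)\<^sup>2 * ((1 + p.sqnorm n (%a. a) + p.sqnorm n v0) * exp (p.growth_rate * (real ?k * \<tau> n)))"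
  by (rule p.displacement_multi[OF jk])
 also have "... <= (t - s + \<tau> n)\<^sup>2 * (E0 * exp (rate * t))"
 proof (intro mult_mono power_mono)
  have "real (?k - ?j) * \<tau> n = real ?k * \<tau> n - real ?j * \<tau> n" using jk by (simp add: of_nat_diff left_diff_distrib)
  also have "... <= t - s + \<tau> n" using grid_le[of t n] grid_gt[of s n] st by linarith
  finally show "real (?k - ?j) * \<tau> n <= t - s + \<tau> n" .
  show "exp (p.growth_rate * (real ?k * \<tau> n)) <= exp (rate * t)"
   unfolding rate_eq using grid_le[of t n] rate_nonneg st by (auto intro!: mult_left_mono)
 qed (use E0 tau_pos[of n] in \<open>auto simp: less_imp_le p.sqnorm_nonneg intro!: add_nonneg_nonneg mult_nonneg_nonneg\<close>)
 finally show ?thesis .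
qed

lemma sinh_le_exp: "sinh x <= exp x" and cosh_le_exp: "0 <= x ==> cosh x <= exp x" for x :: real
proof -
 show "sinh x <= exp x" using sinh_plus_cosh[of x] cosh_real_nonneg[of x] by linarith
 assume "0 <= x"
 then show "cosh x <= exp x" using sinh_plus_cosh[of x] sinh_real_nonneg_iff[of x] by linarith
qed

lemma Xn_mono: "site n x <= site n y ==> Xn n x t <= Xn n y t"
 unfolding Xn_def by (intro p.pos_monoD site_in)

lemma Xn_contraction:
 assumes "site n x <= site n y" "1 <= grid n s" "s <= t"
 shows "(Xn n y t - Xn n x t) * sinh (sqrt c * (real (grid n s) * \<tau> n)) <= (Xn n y s - Xn n x s) * sinh (sqrt c * (real (grid n t) * \<tau> n))"
 unfolding Xn_def by (rule p.gap_ratio[OF site_in site_in assms(1,2) grid_mono[OF assms(3)]])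

lemma Xn_gap:
 assumes "site n x <= site n y"
 shows "Xn n y t - Xn n x t <= cosh (sqrt c * (real (grid n t) * \<tau> n)) * (site n y - site n x)
  + 1 / sqrt c * sinh (sqrt c * (real (grid n t) * \<tau> n)) * (J (site n y) - J (site n x))"
 unfolding Xn_def by (rule p.gap_bound[OF site_in site_in assms])

lemma Xn_gap_abs:
 assumes t: "0 <= t"
 shows "\<bar>Xn n y t - Xn n x t\<bar> <= (1 + 1 / sqrt c) * exp (sqrt c * t) * (\<bar>site n y - site n x\<bar> + \<bar>J (site n y) - J (site n x)\<bar>)"
proof -
 have *: "\<bar>Xn n y t - Xn n x t\<bar> <= (1 + 1 / sqrt c) * exp (sqrt c * t) * (\<bar>site n y - site n x\<bar> + \<bar>J (site n y) - J (site n x)\<bar>)"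
  if le: "site n x <= site n y" for x y
 proof -
  let ?g = "sqrt c * (real (grid n t) * \<tau> n)"
  let ?a = "site n y - site n x" and ?b = "J (site n y) - J (site n x)"
  have g: "0 <= ?g" "?g <= sqrt c * t" using grid_le[OF t, of n] c_pos tau_pos[of n] by (auto simp: less_imp_le intro!: mult_left_mono)
  have e: "cosh ?g <= exp (sqrt c * t)" "sinh ?g <= exp (sqrt c * t)"
   using cosh_le_exp[OF g(1)] sinh_le_exp[of ?g] g(2) by (auto intro: order_trans)
  have ab: "0 <= ?a" "0 <= ?b" using le J_mono[OF le] by auto
  have "Xn n y t - Xn n x t <= cosh ?g * ?a + 1 / sqrt c * sinh ?g * ?b" by (rule Xn_gap[OF le])
  also have "... <= exp (sqrt c * t) * ?a + 1 / sqrt c * exp (sqrt c * t) * ?b"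
   using e ab c_pos by (intro add_mono mult_right_mono mult_left_mono) auto
  also have "... <= (1 + 1 / sqrt c) * exp (sqrt c * t) * (?a + ?b)"
  proof -
   have arith: "e * a + r * e * b <= (1 + r) * e * (a + b)" if "0 <= e" "0 <= r" "0 <= a" "0 <= b" for e r a b :: real
   proof -
   have "0 <= r * e * a" "0 <= e * b" using that by auto
   then show ?thesis by (simp add: algebra_simps)
   qed
   show ?thesis by (rule arith) (use ab c_pos in auto)
  qed
  finally have "Xn n y t - Xn n x t <= (1 + 1 / sqrt c) * exp (sqrt c * t) * (?a + ?b)" .
  moreover have "\<bar>Xn n y t - Xn n x t\<bar> = Xn n y t - Xn n x t" "\<bar>?a\<bar> = ?a" "\<bar>?b\<bar> = ?b"
   using Xn_mono[OF le, of t] ab by simp_all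
  ultimately show ?thesis by (simp only:)
 qed
 show ?thesis
  using *[of x y] *[of y x] by (cases "site n x <= site n y") (auto simp: abs_minus_commute)
qed

lemma Xn_growth: "\<exists>B\<ge>0. \<forall>n x t. 0 <= t & t <= T --> \<bar>Xn n x t\<bar> <= B * (1 + \<bar>x\<bar>)"
proof -
 from J_linear obtain C where C': "C >= 0 & (\<forall>a b. \<bar>J b - J a\<bar> <= C * (1 + \<bar>b - a\<bar>))" by (rule exE)
 note C = conjunct1[OF C'] conjunct2[OF C', rule_format]
 define D where "D = (1 + 1 / sqrt c) * exp (sqrt c * \<bar>T\<bar>) * (1 + C) * (1 + 2 * \<bar>q 0\<bar> + 2)"
 have D0: "0 <= D" unfolding D_def using c_pos C(1) by (intro mult_nonneg_nonneg) auto
 have gap: "\<bar>Xn n x t - Xn n y t\<bar> <= D * (1 + \<bar>x\<bar>) + D * (1 + \<bar>y\<bar>)" if t: "0 <= t" "t <= T" for n x y t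
 proof -
  have "\<bar>Xn n x t - Xn n y t\<bar> <= (1 + 1 / sqrt c) * exp (sqrt c * t) * (\<bar>site n x - site n y\<bar> + \<bar>J (site n x) - J (site n y)\<bar>)"
   by (rule Xn_gap_abs[OF t(1)])
  also have "... <= (1 + 1 / sqrt c) * exp (sqrt c * \<bar>T\<bar>) * ((1 + C) * (1 + \<bar>site n x - site n y\<bar>))"
  proof (intro mult_mono)
   have "\<bar>site n x - site n y\<bar> + \<bar>J (site n x) - J (site n y)\<bar> <= \<bar>site n x - site n y\<bar> + C * (1 + \<bar>site n x - site n y\<bar>)"
   by (rule add_left_mono[OF C(2)])
   also have "... <= (1 + C) * (1 + \<bar>site n x - site n y\<bar>)" by (simp add: algebra_simps)
   finally show "\<bar>site n x - site n y\<bar> + \<bar>J (site n x) - J (site n y)\<bar> <= ..." .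
  qed (use c_pos C(1) t in auto)
  also have "... <= (1 + 1 / sqrt c) * exp (sqrt c * \<bar>T\<bar>) * ((1 + C) * ((1 + 2 * \<bar>q 0\<bar> + 2) * ((1 + \<bar>x\<bar>) + (1 + \<bar>y\<bar>))))"
  proof (intro mult_left_mono)
   have "1 + \<bar>site n x - site n y\<bar> <= 1 + 2 * \<bar>q 0\<bar> + 2 * \<bar>x\<bar> + 2 * \<bar>y\<bar>"
   using site_bound[of n x] site_bound[of n y] by linarith
   also have "... <= (1 + 2 * \<bar>q 0\<bar> + 2) * ((1 + \<bar>x\<bar>) + (1 + \<bar>y\<bar>))"
   by (simp add: algebra_simps)
   finally show "1 + \<bar>site n x - site n y\<bar> <= (1 + 2 * \<bar>q 0\<bar> + 2) * ((1 + \<bar>x\<bar>) + (1 + \<bar>y\<bar>))" .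
  qed (use c_pos C(1) in auto)
  also have "... = D * ((1 + \<bar>x\<bar>) + (1 + \<bar>y\<bar>))" by (simp add: D_def mult_ac)
  finally show ?thesis by (simp only: distrib_left)
 qed
 define M where "M = 1 + E0 * exp (rate * \<bar>T\<bar>)"
 have M0: "0 <= M" using E0 by (simp add: M_def)
 define I where "I = (\<integral>y. D * (1 + \<bar>y\<bar>) \<partial>\<rho>)"
 have I0: "0 <= I" unfolding I_def using D0 by (intro Bochner_Integration.integral_nonneg) auto
 have "\<bar>Xn n x t\<bar> <= (D + I + M) * (1 + \<bar>x\<bar>)" if t: "0 <= t" "t <= T" for n x t
 proof -
  have iX: "integrable \<rho> (%y. (Xn n y t)\<^sup>2)" unfolding Xn_def by (rule site_integrable)
  have "\<bar>Xn n x t\<bar> = (\<integral>y. \<bar>Xn n x t\<bar> \<partial>\<rho>)" by simp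
  also have "... <= (\<integral>y. D * (1 + \<bar>x\<bar>) + D * (1 + \<bar>y\<bar>) + (1 + (Xn n y t)\<^sup>2) \<partial>\<rho>)"
  proof (rule integral_mono)
   show "integrable \<rho> (%y. D * (1 + \<bar>x\<bar>) + D * (1 + \<bar>y\<bar>) + (1 + (Xn n y t)\<^sup>2))"
   using integrable_affine[of D] iX by auto
   fix y
   have "0 <= (1 - \<bar>Xn n y t\<bar>)\<^sup>2" by simp
   then have "2 * \<bar>Xn n y t\<bar> <= 1 + (Xn n y t)\<^sup>2" by (simp add: power2_eq_square algebra_simps)
   then show "\<bar>Xn n x t\<bar> <= D * (1 + \<bar>x\<bar>) + D * (1 + \<bar>y\<bar>) + (1 + (Xn n y t)\<^sup>2)"
   using gap[OF t, of n x y] by linarith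
  qed simp
  also have "... = D * (1 + \<bar>x\<bar>) + I + (1 + (\<integral>y. (Xn n y t)\<^sup>2 \<partial>\<rho>))"
   using integrable_affine[of D] iX by (simp add: I_def)
  also have "... <= D * (1 + \<bar>x\<bar>) + I + M"
  proof -
   have "exp (rate * t) <= exp (rate * \<bar>T\<bar>)" using t rate_nonneg by (auto intro!: mult_left_mono)
   then have "E0 * exp (rate * t) <= E0 * exp (rate * \<bar>T\<bar>)" using E0(1) by (rule mult_left_mono)
   then show ?thesis using Xn_second_moment[OF t(1), of n] by (simp add: M_def)
  qed
  also have "... <= (D + I + M) * (1 + \<bar>x\<bar>)"
  proof -
   have "0 <= (I + M) * \<bar>x\<bar>" using I0 M0 by simp
   then show ?thesis by (simp add: algebra_simps)
  qed
  finally show ?thesis .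
 qed
 then show ?thesis using D0 I0 M0 by (intro exI[of _ "D + I + M"]) auto
qed

section \<open>The limiting flow\<close>

text \<open>In the label the gap bound gives a modulus of continuity.  In time a single label has positive distance
control only in \<open>L\<^sup>2\<close>; but a ball around it carries positive mass, and on this ball all particles are close to
one another, so the \<open>L\<^sup>2\<close> bound on displacements becomes a pointwise one.\<close>

lemma Xn_equicontinuous:
 assumes x: "x \<in> S" and t: "0 <= t" and e: "e > 0"
 shows "\<exists>d>0. \<exists>N. \<forall>n\<ge>N. \<forall>x'\<in>S. \<forall>t'\<ge>0. \<bar>x' - x\<bar> < d & \<bar>t' - t\<bar> < d --> \<bar>Xn n x' t' - Xn n x t\<bar> <= e"
proof -
 define T where "T = t + 1"
 define K where "K = (1 + 1 / sqrt c) * exp (sqrt c * T)"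
 have K: "K > 0" unfolding K_def using c_pos by (intro mult_pos_pos add_pos_pos) auto
 define e' where "e' = e / (16 * K)"
 have e': "e' > 0" using e K by (simp add: e'_def)
 from J_uniform[OF e'] obtain \<delta> where \<delta>: "\<delta> > 0 & (\<forall>a b. a <= b & b - a < \<delta> --> J b - J a <= e')" by (rule exE)
 define r where "r = min \<delta> e' / 4"
 have r: "r > 0" "4 * r <= \<delta>" "4 * r <= e'" using \<delta> e' by (auto simp: r_def)
 have Jsmall: "\<bar>J b - J a\<bar> <= e'" if ab: "\<bar>b - a\<bar> < \<delta>" for a b
 proof (cases "a <= b")
  case True
  then have "J b - J a <= e'" using \<delta> ab by simp
  then show ?thesis using J_mono[OF True] by simp
 next
  case False
  then have "J a - J b <= e'" using \<delta> ab by simp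
  then show ?thesis using J_mono[of b a] False by simp
 qed
 have "eventually (%n. \<bar>site n x - x\<bar> < r) sequentially"
  using tendstoD[OF site_tendsto[OF x] r(1)] by (simp add: dist_real_def)
 then obtain N1 where N1: "!!n. n >= N1 ==> \<bar>site n x - x\<bar> < r" by (auto simp: eventually_sequentially)
 have space: "\<bar>Xn n y s - Xn n x s\<bar> <= e / 8" if n: "n >= N1" and y: "y \<in> S" "\<bar>y - x\<bar> < r" and s: "0 <= s" "s <= T" for n y s
 proof -
  have "\<bar>site n y - site n x\<bar> <= 2 * \<bar>site n x - x\<bar> + 2 * \<bar>y - x\<bar>" by (rule site_dist_two[OF y(1)])
  also have "... < 4 * r" using add_strict_mono[OF N1[OF n] y(2)] by simp
  finally have d: "\<bar>site n y - site n x\<bar> < 4 * r" .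
  have "\<bar>Xn n y s - Xn n x s\<bar> <= (1 + 1 / sqrt c) * exp (sqrt c * s) * (\<bar>site n y - site n x\<bar> + \<bar>J (site n y) - J (site n x)\<bar>)"
   by (rule Xn_gap_abs[OF s(1)])
  also have "... <= K * (e' + e')"
   unfolding K_def
  proof (intro mult_mono add_mono)
   show "\<bar>site n y - site n x\<bar> <= e'" "\<bar>J (site n y) - J (site n x)\<bar> <= e'"
   using d r Jsmall[of "site n y" "site n x"] by auto
  qed (use c_pos s in auto)
  also have "... = e / 8" using K by (simp add: e'_def)
  finally show ?thesis .
 qed
 define \<beta> where "\<beta> = measure \<rho> (ball x r)"
 have \<beta>: "\<beta> > 0" unfolding \<beta>_def by (rule ball_mass[OF x r(1)])
 define M where "M = E0 * exp (rate * T) + 1"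
 have M: "M > 0" unfolding M_def using E0(1) by (simp add: add_nonneg_pos)
 define d2 where "d2 = sqrt (\<beta> * e\<^sup>2 / (64 * M))"
 have d2: "d2 > 0" "8 * M * d2\<^sup>2 = \<beta> * e\<^sup>2 / 8" using \<beta> e M by (auto simp: d2_def)
 have "eventually (%n. \<bar>\<tau> n\<bar> < d2) sequentially" using tendstoD[OF tau_tendsto d2(1)] by (simp add: dist_real_def)
 then obtain N2 where N2: "!!n. n >= N2 ==> \<tau> n < d2" using tau_pos by (auto simp: eventually_sequentially less_imp_le)
 have time: "\<bar>Xn n x b - Xn n x a\<bar> <= e / 2" if n: "n >= N1" "n >= N2" and ab: "0 <= a" "a <= b" "b <= T" "b - a < d2" for n a b
 proof -
  let ?D = "\<bar>Xn n x b - Xn n x a\<bar>"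
  have "\<beta> * ?D\<^sup>2 = (\<integral>y. indicator (ball x r) y * ?D\<^sup>2 \<partial>\<rho>)" by (simp add: \<beta>_def)
  also have "... <= (\<integral>y. 2 * (Xn n y b - Xn n y a)\<^sup>2 + indicator (ball x r) y * (2 * (e/4)\<^sup>2) \<partial>\<rho>)"
  proof (rule integral_mono_AE)
   show "integrable \<rho> (%y. indicator (ball x r) y * ?D\<^sup>2)"
   by (intro integrable_mult_left integrable_real_indicator) (auto simp: emeasure_eq_measure)
   have "integrable \<rho> (%y. (Xn n y b - Xn n y a)\<^sup>2)"
   unfolding Xn_def by (rule site_integrable[of "%u. (p.pos n (grid n b) u - p.pos n (grid n a) u)\<^sup>2"])
   then show "integrable \<rho> (%y. 2 * (Xn n y b - Xn n y a)\<^sup>2 + indicator (ball x r) y * (2 * (e/4)\<^sup>2))"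
   by (intro Bochner_Integration.integrable_add integrable_mult_right integrable_mult_left integrable_real_indicator) (auto simp: emeasure_eq_measure)
   show "AE y in \<rho>. indicator (ball x r) y * ?D\<^sup>2 <= 2 * (Xn n y b - Xn n y a)\<^sup>2 + indicator (ball x r) y * (2 * (e/4)\<^sup>2)"
   using AE_S
   proof eventually_elim
   case (elim y)
   show ?case
   proof (cases "y \<in> ball x r")
   case True
   then have y: "\<bar>y - x\<bar> < r" by (simp add: dist_real_def)
   have "\<bar>Xn n y b - Xn n x b\<bar> <= e / 8" "\<bar>Xn n y a - Xn n x a\<bar> <= e / 8"
   using space[OF n(1) elim y] ab by auto
   then have "?D <= \<bar>Xn n y b - Xn n y a\<bar> + e/4" by linarith
   then have "?D\<^sup>2 <= (\<bar>Xn n y b - Xn n y a\<bar> + e/4)\<^sup>2" by (intro power_mono) auto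
   also have "... <= 2 * (Xn n y b - Xn n y a)\<^sup>2 + 2 * (e/4)\<^sup>2"
   proof -
   have "(p + s)\<^sup>2 <= 2 * p\<^sup>2 + 2 * s\<^sup>2" for p s :: real
   using zero_le_power2[of "p - s"] by (simp add: power2_eq_square algebra_simps)
   from this[of "\<bar>Xn n y b - Xn n y a\<bar>" "e/4"] show ?thesis by simp
   qed
   finally show ?thesis using True by simp
   qed simp
   qed
  qed
  also have "... = 2 * (\<integral>y. (Xn n y b - Xn n y a)\<^sup>2 \<partial>\<rho>) + \<beta> * (2 * (e/4)\<^sup>2)"
  proof -
   have i: "integrable \<rho> (%y. (Xn n y b - Xn n y a)\<^sup>2)"
   unfolding Xn_def by (rule site_integrable[of "%u. (p.pos n (grid n b) u - p.pos n (grid n a) u)\<^sup>2"])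
   have j: "integrable \<rho> (%y. indicator (ball x r) y * (2 * (e/4)\<^sup>2))"
   by (intro integrable_mult_left integrable_real_indicator) (auto simp: emeasure_eq_measure)
   show ?thesis
   by (subst Bochner_Integration.integral_add[OF integrable_mult_right[OF i] j]) (simp add: \<beta>_def)
  qed
  also have "... <= 2 * ((2 * d2)\<^sup>2 * M) + \<beta> * (2 * (e/4)\<^sup>2)"
  proof (intro add_mono mult_left_mono order_refl)
   have "(\<integral>y. (Xn n y b - Xn n y a)\<^sup>2 \<partial>\<rho>) <= (b - a + \<tau> n)\<^sup>2 * (E0 * exp (rate * b))"
   by (rule Xn_displacement[OF ab(1,2)])
   also have "... <= (2 * d2)\<^sup>2 * M"
   proof (intro mult_mono power_mono)
   show "E0 * exp (rate * b) <= M"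
   proof -
   have "rate * b <= rate * T" using ab(3) rate_nonneg by (rule mult_left_mono)
   then have "E0 * exp (rate * b) <= E0 * exp (rate * T)" using E0(1) by (intro mult_left_mono) auto
   then show ?thesis by (simp add: M_def)
   qed
   qed (use ab N2[OF n(2)] tau_pos[of n] E0(1) in auto)
   finally show "(\<integral>y. (Xn n y b - Xn n y a)\<^sup>2 \<partial>\<rho>) <= (2 * d2)\<^sup>2 * M" .
  qed (use \<beta> in auto)
  also have "... = \<beta> * (e/2)\<^sup>2" using d2(2) by (simp add: power2_eq_square algebra_simps)
  finally have "?D\<^sup>2 <= (e/2)\<^sup>2" using \<beta> by (simp add: mult_le_cancel_left_pos)
  then show ?thesis using e by (intro power2_le_imp_le[of ?D "e/2"]) auto
 qed
 define d where "d = min r (min d2 1)"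
 have "\<bar>Xn n x' t' - Xn n x t\<bar> <= e" if n: "n >= max N1 N2" and x': "x' \<in> S" "\<bar>x' - x\<bar> < d" and t': "0 <= t'" "\<bar>t' - t\<bar> < d" for n x' t'
 proof -
  have tT: "t' <= T" "t <= T" using t' by (auto simp: d_def T_def)
  have "\<bar>Xn n x' t' - Xn n x t'\<bar> <= e / 8" using n x' t' tT by (intro space) (auto simp: d_def)
  moreover have "\<bar>Xn n x t' - Xn n x t\<bar> <= e / 2"
  proof (cases "t <= t'")
   case True then show ?thesis using n t t' tT by (intro time) (auto simp: d_def)
  next
   case False
   then have "\<bar>Xn n x t - Xn n x t'\<bar> <= e / 2" using n t t' tT by (intro time) (auto simp: d_def)
   then show ?thesis by (simp add: abs_minus_commute)
  qed
  ultimately show ?thesis using e by linarith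
 qed
 moreover have "d > 0" using r(1) d2(1) by (simp add: d_def)
 ultimately show ?thesis by blast
qed

lemma limit_exists:
 "\<exists>(r :: nat => nat) g. strict_mono r & (\<forall>x\<in>S. \<forall>t\<ge>0. (%n. Xn (r n) x t) \<longlonglongrightarrow> g (x, t)) & continuous_on (S \<times> {0..}) g"
proof -
 obtain r g where rg: "strict_mono (r :: nat => nat)" "!!z. z \<in> S \<times> {0..} ==> (%n. Xn (r n) (fst z) (snd z)) \<longlonglongrightarrow> g z"
  "continuous_on (S \<times> {0..}) g"
 proof (rule asymptotically_equicontinuous_subsequence[of "S \<times> {0..}" "%n z. Xn n (fst z) (snd z)"])
  fix z :: "real \<times> real" assume z: "z \<in> S \<times> {0..}"
  from Xn_growth[of "snd z"] obtain B where "B >= 0 & (\<forall>n x t. 0 <= t & t <= snd z --> \<bar>Xn n x t\<bar> <= B * (1 + \<bar>x\<bar>))" by (rule exE)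
  then have "\<bar>Xn n (fst z) (snd z)\<bar> <= B * (1 + \<bar>fst z\<bar>)" for n using z by auto
  then show "\<exists>B. \<forall>n. \<bar>Xn n (fst z) (snd z)\<bar> <= B" by blast
  fix e :: real assume e: "e > 0"
  from Xn_equicontinuous[of "fst z" "snd z", OF _ _ e] z obtain d where
   d: "d > 0 & (\<exists>N. \<forall>n\<ge>N. \<forall>x'\<in>S. \<forall>t'\<ge>0. \<bar>x' - fst z\<bar> < d & \<bar>t' - snd z\<bar> < d --> \<bar>Xn n x' t' - Xn n (fst z) (snd z)\<bar> <= e)"
   by (auto simp: mem_Times_iff)
  from conjunct2[OF d] obtain N where N: "\<forall>n\<ge>N. \<forall>x'\<in>S. \<forall>t'\<ge>0. \<bar>x' - fst z\<bar> < d & \<bar>t' - snd z\<bar> < d --> \<bar>Xn n x' t' - Xn n (fst z) (snd z)\<bar> <= e"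
   by (rule exE)
  have "\<bar>Xn n (fst z') (snd z') - Xn n (fst z) (snd z)\<bar> <= e" if "n >= N" "z' \<in> S \<times> {0..}" "dist z' z < d" for n z'
  proof -
   have "\<bar>fst z' - fst z\<bar> < d" "\<bar>snd z' - snd z\<bar> < d"
   using that(3) dist_fst_le[of z' z] dist_snd_le[of z' z] by (auto simp: dist_real_def)
   then show ?thesis using N that(1,2) by (auto simp: mem_Times_iff)
  qed
  then show "\<exists>d>0. \<exists>N. \<forall>n\<ge>N. \<forall>z'\<in>S \<times> {0..}. dist z' z < d --> \<bar>Xn n (fst z') (snd z') - Xn n (fst z) (snd z)\<bar> <= e"
   using conjunct1[OF d] by blast
 qed (rule that)
 have "\<forall>x\<in>S. \<forall>t\<ge>0. (%n. Xn (r n) x t) \<longlonglongrightarrow> g (x, t)" using rg(2) by force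
 then show ?thesis using rg by blast
qed

text \<open>One subsequence along which all trajectories converge, fixed once and for all.\<close>

definition sub :: "nat => nat" where
 "sub = (SOME r. \<exists>g. strict_mono r & (\<forall>x\<in>S. \<forall>t\<ge>0. (%n. Xn (r n) x t) \<longlonglongrightarrow> g (x, t)) & continuous_on (S \<times> {0..}) g)"

definition X :: "real => real => real" where
 "X x t = (if x \<in> S & 0 <= t then lim (%n. Xn (sub n) x t) else 0)"

lemma sub_mono: "strict_mono sub"
 and X_lim: "x \<in> S ==> 0 <= t ==> (%n. Xn (sub n) x t) \<longlonglongrightarrow> X x t"
 and X_cont: "continuous_on (S \<times> {0..}) (%z. X (fst z) (snd z))"
proof -
 obtain g where g: "strict_mono sub & (\<forall>x\<in>S. \<forall>t\<ge>0. (%n. Xn (sub n) x t) \<longlonglongrightarrow> g (x, t)) & continuous_on (S \<times> {0..}) g"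
  using someI_ex[OF limit_exists, folded sub_def] by (rule exE)
 have lim: "lim (%n. Xn (sub n) x t) = g (x, t)" if "x \<in> S" "0 <= t" for x t
  using g that by (intro limI) blast
 show "strict_mono sub" using g by blast
 show "(%n. Xn (sub n) x t) \<longlonglongrightarrow> X x t" if "x \<in> S" "0 <= t" for x t
  using g lim[OF that] that by (simp add: X_def)
 have "X (fst z) (snd z) = g z" if "z \<in> S \<times> {0..}" for z using that lim by (auto simp: X_def)
 then show "continuous_on (S \<times> {0..}) (%z. X (fst z) (snd z))"
  using g by (simp cong: continuous_on_cong)
qed

lemma sub_compose: "f \<longlonglongrightarrow> l ==> (%n. f (sub n)) \<longlonglongrightarrow> l"
 using LIMSEQ_subseq_LIMSEQ[OF _ sub_mono, of f l] by (simp add: o_def)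

lemma X_outside: "x \<notin> S ==> X x t = 0" by (simp add: X_def)

lemma X_initial: assumes x: "x \<in> S" shows "X x 0 = x"
proof -
 have "(%n. Xn (sub n) x 0) \<longlonglongrightarrow> x"
  using sub_compose[OF site_tendsto[OF x]] by (simp add: Xn_def grid_def)
 then show ?thesis using X_lim[OF x, of 0] LIMSEQ_unique by auto
qed

lemma eventually_site_le:
 assumes "x \<in> S" "y \<in> S" "x < y" shows "\<forall>\<^sub>F n in sequentially. site (sub n) x <= site (sub n) y"
proof -
 have "\<forall>\<^sub>F n in sequentially. site (sub n) x < (x + y)/2" "\<forall>\<^sub>F n in sequentially. (x + y)/2 < site (sub n) y"
  using order_tendstoD(2)[OF sub_compose[OF site_tendsto[OF assms(1)]], of "(x+y)/2"]
   order_tendstoD(1)[OF sub_compose[OF site_tendsto[OF assms(2)]], of "(x+y)/2"] assms(3) by auto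
 then show ?thesis by eventually_elim auto
qed

lemma X_mono:
 assumes xy: "x \<in> S" "y \<in> S" "x <= y" and t: "0 <= t" shows "X x t <= X y t"
proof (cases "x = y")
 case False
 then have "\<forall>\<^sub>F n in sequentially. Xn (sub n) x t <= Xn (sub n) y t"
  using eventually_site_le[of x y] xy by (auto elim!: eventually_mono intro: Xn_mono)
 then show ?thesis using X_lim xy t by (intro tendsto_le[OF _ X_lim[of y t] X_lim[of x t]]) auto
qed simp

lemma grid_sub_tendsto: "0 <= t ==> (%n. real (grid (sub n) t) * \<tau> (sub n)) \<longlonglongrightarrow> t"
 by (rule sub_compose[OF grid_tendsto])

text \<open>Passage to the limit in the discrete ratio bound; \<open>x \<le> y\<close> gives \<open>site n x \<le> site n y\<close> for large \<open>n\<close>.\<close>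

lemma X_contraction:
 assumes xy: "x \<in> S" "y \<in> S" "x <= y" and st: "0 < s" "s <= t"
 shows "(X y t - X x t) * sinh (sqrt c * s) <= (X y s - X x s) * sinh (sqrt c * t)"
proof (cases "x = y")
 case False
 have gs: "(%n. real (grid (sub n) s) * \<tau> (sub n)) \<longlonglongrightarrow> s" and gt: "(%n. real (grid (sub n) t) * \<tau> (sub n)) \<longlonglongrightarrow> t"
  using st by (auto intro: grid_sub_tendsto)
 have ev: "\<forall>\<^sub>F n in sequentially. 0 < real (grid (sub n) s) * \<tau> (sub n)" using order_tendstoD(1)[OF gs st(1)] .
 have ev2: "\<forall>\<^sub>F n in sequentially. site (sub n) x <= site (sub n) y" using eventually_site_le[of x y] xy False by simp
 have "\<forall>\<^sub>F n in sequentially. (Xn (sub n) y t - Xn (sub n) x t) * sinh (sqrt c * (real (grid (sub n) s) * \<tau> (sub n)))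
  <= (Xn (sub n) y s - Xn (sub n) x s) * sinh (sqrt c * (real (grid (sub n) t) * \<tau> (sub n)))"
  using ev ev2
 proof eventually_elim
  case (elim n)
  have "grid (sub n) s ~= 0" using elim(1) by (intro notI) simp
  then show ?case using elim st by (intro Xn_contraction) auto
 qed
 moreover have "(%n. (Xn (sub n) y t - Xn (sub n) x t) * sinh (sqrt c * (real (grid (sub n) s) * \<tau> (sub n)))) \<longlonglongrightarrow> (X y t - X x t) * sinh (sqrt c * s)"
  using xy st by (intro tendsto_intros X_lim gs) auto
 moreover have "(%n. (Xn (sub n) y s - Xn (sub n) x s) * sinh (sqrt c * (real (grid (sub n) t) * \<tau> (sub n)))) \<longlonglongrightarrow> (X y s - X x s) * sinh (sqrt c * t)"
  using xy st by (intro tendsto_intros X_lim gt) auto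
 ultimately show ?thesis by (intro tendsto_le) auto
qed simp

lemma X_gap:
 assumes xy: "x \<in> S" "y \<in> S" "x <= y" and t: "0 <= t"
 shows "X y t - X x t <= cosh (sqrt c * t) * (y - x) + 1 / sqrt c * sinh (sqrt c * t) * (J y - J x)"
proof (cases "x = y")
 case False
 have gt: "(%n. real (grid (sub n) t) * \<tau> (sub n)) \<longlonglongrightarrow> t" using t by (rule grid_sub_tendsto)
 have Jl: "(%n. J (site (sub n) z)) \<longlonglongrightarrow> J z" if "z \<in> S" for z
 proof -
  have "isCont J z" using J_cont by (simp add: continuous_on_eq_continuous_at)
  then show ?thesis using sub_compose[OF site_tendsto[OF that]] by (rule isCont_tendsto_compose)
 qed
 let ?R = "%n. cosh (sqrt c * (real (grid (sub n) t) * \<tau> (sub n))) * (site (sub n) y - site (sub n) x)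
  + 1 / sqrt c * sinh (sqrt c * (real (grid (sub n) t) * \<tau> (sub n))) * (J (site (sub n) y) - J (site (sub n) x))"
 have "\<forall>\<^sub>F n in sequentially. Xn (sub n) y t - Xn (sub n) x t <= ?R n"
 proof -
  have "\<forall>\<^sub>F n in sequentially. site (sub n) x <= site (sub n) y" using eventually_site_le[of x y] xy False by simp
  then show ?thesis by (rule eventually_mono) (rule Xn_gap)
 qed
 moreover have "(%n. Xn (sub n) y t - Xn (sub n) x t) \<longlonglongrightarrow> X y t - X x t"
  using xy t by (intro tendsto_intros X_lim)
 moreover have "?R \<longlonglongrightarrow> cosh (sqrt c * t) * (y - x) + 1 / sqrt c * sinh (sqrt c * t) * (J y - J x)"
  using xy by (intro tendsto_intros gt Jl sub_compose[OF site_tendsto])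
 ultimately show ?thesis by (intro tendsto_le) auto
qed simp

lemma X_measurable [measurable]: "(%x. X x t) \<in> borel_measurable borel"
proof (cases "0 <= t")
 case True
 show ?thesis
 proof (rule borel_measurable_LIMSEQ_real)
  show "(%n. indicator S x * Xn (sub n) x t) \<longlonglongrightarrow> X x t" for x
  proof (cases "x \<in> S")
   case True then show ?thesis using X_lim[OF True \<open>0 <= t\<close>] by simp
  qed (simp add: X_outside)
 qed measurable
qed (simp add: X_def)

definition growth :: "real => real" where
 "growth T = (SOME B. B >= 0 & (\<forall>n x t. 0 <= t & t <= T --> \<bar>Xn n x t\<bar> <= B * (1 + \<bar>x\<bar>)))"

lemma growth_nonneg: "0 <= growth T"
 and Xn_bound: "0 <= t ==> t <= T ==> \<bar>Xn n x t\<bar> <= growth T * (1 + \<bar>x\<bar>)"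
 using someI_ex[OF Xn_growth[of T, unfolded Bex_def]] unfolding growth_def by blast+

lemma X_bound: assumes "0 <= t" "t <= T" shows "\<bar>X x t\<bar> <= growth T * (1 + \<bar>x\<bar>)"
proof (cases "x \<in> S")
 case True
 show ?thesis
  by (rule LIMSEQ_le_const2[OF tendsto_rabs[OF X_lim[OF True assms(1)]]]) (use Xn_bound assms in blast)
qed (use growth_nonneg in \<open>simp add: X_outside\<close>)

lemma square_integrableI:
 assumes [measurable]: "f \<in> borel_measurable borel" and "!!x. \<bar>f x\<bar> <= C * (1 + \<bar>x\<bar>)"
 shows "integrable \<rho> (%x. (f x)\<^sup>2)"
proof (rule Bochner_Integration.integrable_bound[OF square_integrable_affine[of C]])
 show "AE x in \<rho>. norm ((f x)\<^sup>2) <= norm ((C * (1 + \<bar>x\<bar>))\<^sup>2)"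
 proof (rule AE_I2)
  fix x
  have "\<bar>f x\<bar> <= \<bar>C * (1 + \<bar>x\<bar>)\<bar>" using assms(2)[of x] by linarith
  then show "norm ((f x)\<^sup>2) <= norm ((C * (1 + \<bar>x\<bar>))\<^sup>2)" by (simp add: abs_le_square_iff)
 qed
qed measurable

text \<open>The growth bound dominates all displacements, so the discrete \<open>L\<^sup>2\<close> bounds survive in the limit.\<close>

lemma X_displacement:
 assumes st: "0 <= s" "s <= t"
 shows "(\<integral>x. (X x t - X x s)\<^sup>2 \<partial>\<rho>) <= (t - s)\<^sup>2 * (E0 * exp (rate * t))"
proof (rule LIMSEQ_le)
 show "(%n. \<integral>x. (Xn (sub n) x t - Xn (sub n) x s)\<^sup>2 \<partial>\<rho>) \<longlonglongrightarrow> (\<integral>x. (X x t - X x s)\<^sup>2 \<partial>\<rho>)"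
 proof (rule integral_dominated_convergence[where w="%x. (2 * growth t * (1 + \<bar>x\<bar>))\<^sup>2"])
  show "AE x in \<rho>. (%n. (Xn (sub n) x t - Xn (sub n) x s)\<^sup>2) \<longlonglongrightarrow> (X x t - X x s)\<^sup>2"
   using AE_S
  proof eventually_elim
   case (elim x)
   show ?case using elim st by (intro tendsto_intros X_lim) auto
  qed
  show "AE x in \<rho>. norm ((Xn (sub n) x t - Xn (sub n) x s)\<^sup>2) <= (2 * growth t * (1 + \<bar>x\<bar>))\<^sup>2" for n
  proof (rule AE_I2)
   fix x
   have "\<bar>Xn (sub n) x t - Xn (sub n) x s\<bar> <= 2 * growth t * (1 + \<bar>x\<bar>)"
   using Xn_bound[of t t "sub n" x] Xn_bound[of s t "sub n" x] st by auto
   then have "\<bar>Xn (sub n) x t - Xn (sub n) x s\<bar> <= \<bar>2 * growth t * (1 + \<bar>x\<bar>)\<bar>" by linarith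
   then show "norm ((Xn (sub n) x t - Xn (sub n) x s)\<^sup>2) <= (2 * growth t * (1 + \<bar>x\<bar>))\<^sup>2"
   by (simp add: abs_le_square_iff)
  qed
 qed (auto intro: square_integrable_affine)
 show "(%n. (t - s + \<tau> (sub n))\<^sup>2 * (E0 * exp (rate * t))) \<longlonglongrightarrow> (t - s)\<^sup>2 * (E0 * exp (rate * t))"
  by (rule tendsto_eq_intros sub_compose[OF tau_tendsto] refl)+ simp
 show "\<exists>N. \<forall>n\<ge>N. (\<integral>x. (Xn (sub n) x t - Xn (sub n) x s)\<^sup>2 \<partial>\<rho>) <= (t - s + \<tau> (sub n))\<^sup>2 * (E0 * exp (rate * t))"
  using Xn_displacement[OF st] by blast
qed

section \<open>Momentum balance of the limit\<close>

text \<open>Force on the particle with label \<open>x\<close> at time \<open>s\<close>.\<close>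

definition G :: "real => real => real" where
 "G x s = - (\<integral>y. w (X x s - X y s) \<partial>\<rho>)"

definition Gn :: "nat => real => real => real" where
 "Gn n x s = - (\<integral>y. w (Xn n x s - Xn n y s) \<partial>\<rho>)"

text \<open>The trajectory the particle would follow under the same forces if it never collided: two integrations of the
force with initial data \<open>x\<close> and \<open>v0 x\<close>, written as a single integral.\<close>

definition Y :: "real => real => real" where
 "Y x u = (if x \<in> S then x + u * v0 x + (LBINT s:{0..u}. (u - s) * G x s) else 0)"

lemma Y_eq: "x \<in> S ==> Y x u = x + u * v0 x + (LBINT s:{0..u}. (u - s) * G x s)"
 by (simp add: Y_def)

lemma L_nonneg: "0 <= L" using w_growth[of 0] by simp

lemma w_difference_bound:
 assumes "\<bar>a\<bar> <= B * (1 + \<bar>x\<bar>)" "\<bar>b\<bar> <= B * (1 + \<bar>y\<bar>)"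
 shows "\<bar>w (a - b)\<bar> <= L * (1 + B * (1 + \<bar>x\<bar>)) + L * B * (1 + \<bar>y\<bar>)"
proof -
 have "\<bar>w (a - b)\<bar> <= L * (1 + \<bar>a - b\<bar>)" by (rule w_growth)
 also have "... <= L * (1 + (B * (1 + \<bar>x\<bar>) + B * (1 + \<bar>y\<bar>)))"
  using assms by (intro mult_left_mono L_nonneg) linarith
 also have "... = L * (1 + B * (1 + \<bar>x\<bar>)) + L * B * (1 + \<bar>y\<bar>)" by (simp add: algebra_simps)
 finally show ?thesis .
qed

lemma integrable_w_bound: "integrable \<rho> (%y. L * (1 + B * (1 + \<bar>x\<bar>)) + L * B * (1 + \<bar>y\<bar>))"
 by (intro Bochner_Integration.integrable_add integrable_const integrable_affine)

definition force_growth :: "real => real" where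
 "force_growth T = L * (1 + growth T) + L * growth T * (\<integral>y. 1 + \<bar>y\<bar> \<partial>\<rho>)"

lemma one_abs_integral: "1 <= (\<integral>y. 1 + \<bar>y\<bar> \<partial>\<rho>)"
proof -
 have "(\<integral>y. 1 \<partial>\<rho>) <= (\<integral>y. 1 + \<bar>y\<bar> \<partial>\<rho>)"
  using integrable_affine[of 1] by (intro integral_mono) auto
 then show ?thesis by simp
qed

lemma force_growth_nonneg: "0 <= force_growth T"
 unfolding force_growth_def using L_nonneg growth_nonneg one_abs_integral
 by (intro add_nonneg_nonneg mult_nonneg_nonneg) (auto intro: order_trans[OF zero_le_one])

lemma force_bound_aux:
 assumes B: "0 <= growth T" and f: "!!y. \<bar>f y\<bar> <= L * (1 + growth T * (1 + \<bar>x\<bar>)) + L * growth T * (1 + \<bar>y\<bar>)"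
  and [measurable]: "f \<in> borel_measurable borel"
 shows "\<bar>\<integral>y. f y \<partial>\<rho>\<bar> <= force_growth T * (1 + \<bar>x\<bar>)"
proof -
 have "\<bar>\<integral>y. f y \<partial>\<rho>\<bar> <= (\<integral>y. L * (1 + growth T * (1 + \<bar>x\<bar>)) + L * growth T * (1 + \<bar>y\<bar>) \<partial>\<rho>)"
 proof (rule order_trans[OF integral_abs_bound], rule integral_mono)
  show "integrable \<rho> (%y. \<bar>f y\<bar>)"
   by (rule Bochner_Integration.integrable_bound[OF integrable_w_bound[of "growth T" x]]) (use order_trans[OF f abs_ge_self] in auto)
 qed (use f integrable_w_bound in auto)
 also have "... = L * (1 + growth T * (1 + \<bar>x\<bar>)) + L * growth T * (\<integral>y. 1 + \<bar>y\<bar> \<partial>\<rho>)"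
  using integrable_affine[of 1] integrable_affine[of "L * growth T"]
  by (subst Bochner_Integration.integral_add) auto
 also have "... <= force_growth T * (1 + \<bar>x\<bar>)"
 proof -
  let ?m = "\<integral>y. 1 + \<bar>y\<bar> \<partial>\<rho>"
  have "0 <= L * \<bar>x\<bar>" "0 <= L * growth T * ?m * \<bar>x\<bar>"
   using L_nonneg growth_nonneg one_abs_integral by (auto intro!: mult_nonneg_nonneg intro: order_trans[OF zero_le_one])
  then show ?thesis unfolding force_growth_def by (simp add: algebra_simps)
 qed
 finally show ?thesis .
qed

lemma Gn_bound: assumes "0 <= s" "s <= T" shows "\<bar>Gn n x s\<bar> <= force_growth T * (1 + \<bar>x\<bar>)"
 unfolding Gn_def abs_minus_cancel
 by (rule force_bound_aux[OF growth_nonneg w_difference_bound]) (use Xn_bound assms in auto)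

lemma G_bound: assumes "0 <= s" "s <= T" shows "\<bar>G x s\<bar> <= force_growth T * (1 + \<bar>x\<bar>)"
 unfolding G_def abs_minus_cancel
 by (rule force_bound_aux[OF growth_nonneg w_difference_bound]) (use X_bound assms in auto)

lemma w_isCont: "isCont w z"
 using w_cont by (simp add: continuous_on_eq_continuous_at)

lemma Gn_tendsto:
 assumes x: "x \<in> S" and s: "0 <= s"
 shows "(%n. Gn (sub n) x s) \<longlonglongrightarrow> G x s"
 unfolding Gn_def G_def
proof (rule tendsto_minus, rule integral_dominated_convergence)
 show "integrable \<rho> (%y. L * (1 + growth s * (1 + \<bar>x\<bar>)) + L * growth s * (1 + \<bar>y\<bar>))"
  by (rule integrable_w_bound)
 show "AE y in \<rho>. (%n. w (Xn (sub n) x s - Xn (sub n) y s)) \<longlonglongrightarrow> w (X x s - X y s)"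
  using AE_S
 proof eventually_elim
  case (elim y)
  show ?case by (rule isCont_tendsto_compose[OF w_isCont]) (intro tendsto_intros X_lim x s elim)
 qed
 show "AE y in \<rho>. norm (w (Xn (sub n) x s - Xn (sub n) y s)) <= L * (1 + growth s * (1 + \<bar>x\<bar>)) + L * growth s * (1 + \<bar>y\<bar>)" for n
  unfolding real_norm_def by (intro AE_I2 w_difference_bound Xn_bound s order_refl)
qed measurable

lemma X_path_cont: assumes x: "x \<in> S" shows "continuous_on {0..} (X x)"
proof -
 have "continuous_on {0..} (%t. (%z. X (fst z) (snd z)) (x, t))"
  by (rule continuous_on_compose2[OF X_cont]) (use x in \<open>auto intro!: continuous_intros\<close>)
 then show ?thesis by simp
qed

lemma X_path_tendsto:
 assumes x: "x \<in> S" and u: "u \<longlonglongrightarrow> s" and nn: "!!n. 0 <= u n" "0 <= s"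
 shows "(%n. X x (u n)) \<longlonglongrightarrow> X x s"
 by (rule continuous_on_tendsto_compose[OF X_path_cont[OF x] u]) (use nn in auto)

lemma G_cont: assumes x: "x \<in> S" shows "continuous_on {0..} (G x)"
 unfolding continuous_on_sequentially
proof (intro allI ballI impI, elim conjE)
 fix u :: "nat => real" and s assume s: "s \<in> {0..}" and u: "\<forall>n. u n \<in> {0..}" and lim: "u \<longlonglongrightarrow> s"
 obtain T where T: "!!n. u n <= T" "s <= T"
 proof -
  have "Bseq u" using lim by (intro convergent_imp_Bseq) (auto simp: convergent_def)
  then obtain K where K: "!!n. \<bar>u n\<bar> <= K" by (auto simp: Bseq_def)
  show ?thesis by (rule that[of "max K s"]) (use K in \<open>auto intro: order_trans[OF abs_ge_self] simp: le_max_iff_disj\<close>)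
 qed
 show "(G x \<circ> u) \<longlonglongrightarrow> G x s"
  unfolding G_def o_def
 proof (rule tendsto_minus, rule integral_dominated_convergence)
  show "integrable \<rho> (%y. L * (1 + growth T * (1 + \<bar>x\<bar>)) + L * growth T * (1 + \<bar>y\<bar>))"
   by (rule integrable_w_bound)
  show "AE y in \<rho>. (%n. w (X x (u n) - X y (u n))) \<longlonglongrightarrow> w (X x s - X y s)"
   using AE_S
  proof eventually_elim
   case (elim y)
   show ?case by (rule isCont_tendsto_compose[OF w_isCont]) (use s u lim x elim in \<open>auto intro!: tendsto_intros X_path_tendsto\<close>)
  qed
  show "AE y in \<rho>. norm (w (X x (u n) - X y (u n))) <= L * (1 + growth T * (1 + \<bar>x\<bar>)) + L * growth T * (1 + \<bar>y\<bar>)" for n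
   unfolding real_norm_def using u T by (intro AE_I2 w_difference_bound X_bound) auto
 qed measurable
qed

lemma grid_measurable [measurable]: "grid n \<in> measurable borel (count_space UNIV)"
 unfolding grid_def by measurable

lemma grid_step_integral:
 fixes \<phi> :: "nat => real"
 shows "set_integrable lborel {\<tau> n..<real k * \<tau> n} (%s. \<phi> (grid n s)) &
  (LBINT s:{\<tau> n..<real k * \<tau> n}. \<phi> (grid n s)) = \<tau> n * (\<Sum>i\<in>{1..<k}. \<phi> i)"
proof (induction k)
 case 0
 have e: "{\<tau> n..<real 0 * \<tau> n} = {}" using tau_pos[of n] by auto
 show ?case unfolding e by (simp add: set_integrable_def set_lebesgue_integral_def)
next
 case (Suc k)
 show ?case
 proof (cases "k = 0")
  case True
  then have e: "{\<tau> n..<real (Suc k) * \<tau> n} = {}" by auto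
  show ?thesis unfolding e using True by (simp add: set_integrable_def set_lebesgue_integral_def)
 next
  case False
  let ?I = "{real k * \<tau> n..<real (Suc k) * \<tau> n}"
  have k1: "\<tau> n <= real k * \<tau> n" "real k * \<tau> n <= real (Suc k) * \<tau> n"
   using False tau_pos[of n] by auto
  have un: "{\<tau> n..<real (Suc k) * \<tau> n} = {\<tau> n..<real k * \<tau> n} \<union> ?I"
   using ivl_disj_un_two(3)[OF k1] by simp
  have const: "indicator ?I s *\<^sub>R \<phi> (grid n s) = indicator ?I s *\<^sub>R \<phi> k" for s
   using grid_unique[of k n s] by (auto split: split_indicator)
  have i: "set_integrable lborel ?I (%s. \<phi> (grid n s))"
   unfolding set_integrable_def const using k1 by (simp add: integrable_real_indicator)
  have v: "(LBINT s:?I. \<phi> (grid n s)) = \<tau> n * \<phi> k"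
   unfolding set_lebesgue_integral_def const using k1 by (simp add: algebra_simps)
  have "set_integrable lborel {\<tau> n..<real (Suc k) * \<tau> n} (%s. \<phi> (grid n s))"
   unfolding un using Suc i by (intro set_integrable_Un) auto
  moreover have "(LBINT s:{\<tau> n..<real (Suc k) * \<tau> n}. \<phi> (grid n s)) = (LBINT s:{\<tau> n..<real k * \<tau> n}. \<phi> (grid n s)) + (LBINT s:?I. \<phi> (grid n s))"
   unfolding un using Suc i by (intro set_integral_Un) auto
  moreover have "{1..<Suc k} = insert k {1..<k}" using False by auto
  ultimately show ?thesis using Suc v by (simp add: distrib_left)
 qed
qed

definition Yn :: "nat => real => real => real" where
 "Yn n x u = p.free n (grid n u) (site n x)"

lemma force_eq: "p.force n (p.pos n (grid n s)) (site n x) = Gn n x s"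
 unfolding p.force_def Gn_def Xn_def
 using site_integral[of "%b. w (p.pos n (grid n s) (site n x) - p.pos n (grid n s) b)" n] by simp

lemma Yn_eq:
 "Yn n x u = site n x + real (grid n u) * \<tau> n * v0 (site n x)
   + (LBINT s:{\<tau> n..<real (grid n u) * \<tau> n}. (real (grid n u) * \<tau> n - real (grid n s) * \<tau> n) * Gn n x s)"
proof -
 let ?k = "grid n u"
 have "(LBINT s:{\<tau> n..<real ?k * \<tau> n}. (real ?k * \<tau> n - real (grid n s) * \<tau> n) * Gn n x s)
   = \<tau> n * (\<Sum>i\<in>{1..<?k}. (real ?k * \<tau> n - real i * \<tau> n) * p.force n (p.pos n i) (site n x))"
  using grid_step_integral[of n ?k "%i. (real ?k * \<tau> n - real i * \<tau> n) * p.force n (p.pos n i) (site n x)"]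
  by (simp add: force_eq)
 also have "... = (\<tau> n)\<^sup>2 * (\<Sum>i\<in>{1..<?k}. real (?k - i) * p.force n (p.pos n i) (site n x))"
  unfolding sum_distrib_left by (rule sum.cong) (auto simp: of_nat_diff power2_eq_square algebra_simps)
 finally show ?thesis unfolding Yn_def p.free_eq by simp
qed

lemma Yn_tendsto:
 assumes x: "x \<in> S" and u: "0 <= u"
 shows "(%n. Yn (sub n) x u) \<longlonglongrightarrow> Y x u"
 unfolding Yn_eq Y_eq[OF x]
proof (intro tendsto_add tendsto_mult)
 show "(%n. site (sub n) x) \<longlonglongrightarrow> x" by (rule sub_compose[OF site_tendsto[OF x]])
 show g: "(%n. real (grid (sub n) u) * \<tau> (sub n)) \<longlonglongrightarrow> u" by (rule grid_sub_tendsto[OF u])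
 have "isCont v0 x" using v0_cont by (simp add: continuous_on_eq_continuous_at)
 then show "(%n. v0 (site (sub n) x)) \<longlonglongrightarrow> v0 x"
  using sub_compose[OF site_tendsto[OF x]] by (rule isCont_tendsto_compose)
 show "(%n. LBINT s:{\<tau> (sub n)..<real (grid (sub n) u) * \<tau> (sub n)}. (real (grid (sub n) u) * \<tau> (sub n) - real (grid (sub n) s) * \<tau> (sub n)) * Gn (sub n) x s)
  \<longlonglongrightarrow> (LBINT s:{0..u}. (u - s) * G x s)"
  unfolding set_lebesgue_integral_def
 proof (rule integral_dominated_convergence[where w="%s. indicator {0..u} s * (u * (force_growth u * (1 + \<bar>x\<bar>)))"])
  have [measurable]: "(%s. indicator {0..u} s *\<^sub>R G x s) \<in> borel_measurable borel"
   by (rule borel_measurable_continuous_on_indicator[of "{0..u}" "G x"])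
   (auto intro: continuous_on_subset[OF G_cont[OF x]])
  have e1: "(%s. indicator {0..u} s *\<^sub>R ((u - s) * G x s)) = (%s. (u - s) * (indicator {0..u} s *\<^sub>R G x s))" by auto
  show "(%s. indicator {0..u} s *\<^sub>R ((u - s) * G x s)) \<in> borel_measurable lborel" unfolding e1 by measurable
  show "(%s. indicator {\<tau> (sub n)..<real (grid (sub n) u) * \<tau> (sub n)} s *\<^sub>R ((real (grid (sub n) u) * \<tau> (sub n) - real (grid (sub n) s) * \<tau> (sub n)) * Gn (sub n) x s)) \<in> borel_measurable lborel" for n
  proof -
   have "(%s. Gn (sub n) x s) = (%s. (%i. p.force (sub n) (p.pos (sub n) i) (site (sub n) x)) (grid (sub n) s))"
   by (simp add: force_eq)
   also have "... \<in> borel_measurable borel" by measurable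
   finally have [measurable]: "(%s. Gn (sub n) x s) \<in> borel_measurable borel" .
   show ?thesis by measurable
  qed
  show "integrable lborel (%s. indicator {0..u} s * (u * (force_growth u * (1 + \<bar>x\<bar>))))"
   by (intro integrable_mult_left integrable_real_indicator) (use u in auto)
  have 0: "AE s in lborel. s ~= 0" "AE s in lborel. s ~= u" by (rule AE_lborel_singleton)+
  then show "AE s in lborel. (%n. indicator {\<tau> (sub n)..<real (grid (sub n) u) * \<tau> (sub n)} s *\<^sub>R ((real (grid (sub n) u) * \<tau> (sub n) - real (grid (sub n) s) * \<tau> (sub n)) * Gn (sub n) x s))
   \<longlonglongrightarrow> indicator {0..u} s *\<^sub>R ((u - s) * G x s)"
  proof eventually_elim
   case (elim s)
   have t0: "(%n. \<tau> (sub n)) \<longlonglongrightarrow> 0" by (rule sub_compose[OF tau_tendsto])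
   show ?case
   proof (cases "0 < s & s < u")
   case True
   have "\<forall>\<^sub>F n in sequentially. \<tau> (sub n) < s" "\<forall>\<^sub>F n in sequentially. s < real (grid (sub n) u) * \<tau> (sub n)"
   using order_tendstoD(2)[OF t0, of s] order_tendstoD(1)[OF g, of s] True by auto
   then have ev: "\<forall>\<^sub>F n in sequentially. indicator {\<tau> (sub n)..<real (grid (sub n) u) * \<tau> (sub n)} s = (1::real)"
   by eventually_elim auto
   have "(%n. (real (grid (sub n) u) * \<tau> (sub n) - real (grid (sub n) s) * \<tau> (sub n)) * Gn (sub n) x s) \<longlonglongrightarrow> (u - s) * G x s"
   using True by (intro tendsto_intros g grid_sub_tendsto Gn_tendsto x) auto
   from tendsto_scaleR[OF tendsto_eventually[OF ev] this] show ?thesis using True by simp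
   next
   case False
   have "indicator {\<tau> (sub n)..<real (grid (sub n) u) * \<tau> (sub n)} s = (0::real)" for n
   using False elim tau_pos[of "sub n"] grid_le[OF u, of "sub n"] by (auto split: split_indicator)
   moreover have "indicator {0..u} s = (0::real)" using False elim by (auto split: split_indicator)
   ultimately show ?thesis by simp
   qed
  qed
  show "AE s in lborel. norm (indicator {\<tau> (sub n)..<real (grid (sub n) u) * \<tau> (sub n)} s *\<^sub>R ((real (grid (sub n) u) * \<tau> (sub n) - real (grid (sub n) s) * \<tau> (sub n)) * Gn (sub n) x s))
   <= indicator {0..u} s * (u * (force_growth u * (1 + \<bar>x\<bar>)))" for n
  proof (rule AE_I2)
   fix s
   show "norm (indicator {\<tau> (sub n)..<real (grid (sub n) u) * \<tau> (sub n)} s *\<^sub>R ((real (grid (sub n) u) * \<tau> (sub n) - real (grid (sub n) s) * \<tau> (sub n)) * Gn (sub n) x s))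
   <= indicator {0..u} s * (u * (force_growth u * (1 + \<bar>x\<bar>)))"
   proof (cases "s \<in> {\<tau> (sub n)..<real (grid (sub n) u) * \<tau> (sub n)}")
   case True
   then have s: "0 <= s" "s <= u" using tau_pos[of "sub n"] grid_le[OF u, of "sub n"] by auto
   have "0 <= real (grid (sub n) u) * \<tau> (sub n) - real (grid (sub n) s) * \<tau> (sub n)"
   using grid_le[OF s(1), of "sub n"] True by auto
   moreover have "real (grid (sub n) u) * \<tau> (sub n) - real (grid (sub n) s) * \<tau> (sub n) <= u"
   using grid_le[OF u, of "sub n"] tau_pos[of "sub n"] by (intro order_trans[OF _ grid_le[OF u, of "sub n"]]) simp
   ultimately have "\<bar>(real (grid (sub n) u) * \<tau> (sub n) - real (grid (sub n) s) * \<tau> (sub n)) * Gn (sub n) x s\<bar> <= u * (force_growth u * (1 + \<bar>x\<bar>))"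
   unfolding abs_mult using Gn_bound[OF s] by (intro mult_mono) auto
   then show ?thesis using True s by simp
   qed (use u force_growth_nonneg in simp)
  qed
 qed
qed

lemma Yn_bound: assumes u: "0 <= u" and C: "!!a. \<bar>v0 a\<bar> <= C * (1 + \<bar>a\<bar>)" "0 <= C"
 shows "\<bar>Yn n x u\<bar> <= ((1 + u * C) * (3 + \<bar>q 0\<bar>) + u * (u * force_growth u)) * (1 + \<bar>x\<bar>)"
proof -
 let ?k = "real (grid n u) * \<tau> n"
 have k: "0 <= ?k" "?k <= u" using grid_le[OF u, of n] tau_pos[of n] by auto
 have s1: "1 + \<bar>site n x\<bar> <= (3 + \<bar>q 0\<bar>) * (1 + \<bar>x\<bar>)"
  using site_bound[of n x] by (simp add: algebra_simps) (smt (verit) mult_nonneg_nonneg abs_ge_zero)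
 have "\<bar>LBINT s:{\<tau> n..<?k}. (?k - real (grid n s) * \<tau> n) * Gn n x s\<bar> <= (LBINT s:{0..u}. u * (force_growth u * (1 + \<bar>x\<bar>)))"
  unfolding set_lebesgue_integral_def
 proof (rule order_trans[OF integral_abs_bound], rule integral_mono_AE')
  show "integrable lborel (%s. indicator {0..u} s *\<^sub>R (u * (force_growth u * (1 + \<bar>x\<bar>))))"
   unfolding real_scaleR_def by (intro integrable_mult_left integrable_real_indicator) (use u in auto)
  show "AE s in lborel. \<bar>indicator {\<tau> n..<?k} s *\<^sub>R ((?k - real (grid n s) * \<tau> n) * Gn n x s)\<bar> <= indicator {0..u} s *\<^sub>R (u * (force_growth u * (1 + \<bar>x\<bar>)))"
  proof (rule AE_I2)
   fix s
   show "\<bar>indicator {\<tau> n..<?k} s *\<^sub>R ((?k - real (grid n s) * \<tau> n) * Gn n x s)\<bar> <= indicator {0..u} s *\<^sub>R (u * (force_growth u * (1 + \<bar>x\<bar>)))"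
   proof (cases "s \<in> {\<tau> n..<?k}")
   case True
   then have s: "0 <= s" "s <= u" using tau_pos[of n] k by auto
   have "0 <= ?k - real (grid n s) * \<tau> n" using grid_le[OF s(1), of n] True by auto
   moreover have "?k - real (grid n s) * \<tau> n <= u"
   using k tau_pos[of n] by (intro order_trans[OF _ k(2)]) simp
   ultimately have "\<bar>(?k - real (grid n s) * \<tau> n) * Gn n x s\<bar> <= u * (force_growth u * (1 + \<bar>x\<bar>))"
   unfolding abs_mult using Gn_bound[OF s] by (intro mult_mono) auto
   then show ?thesis using True s by simp
   qed (use u force_growth_nonneg in simp)
  qed
  show "AE s in lborel. 0 <= indicator {0..u} s *\<^sub>R (u * (force_growth u * (1 + \<bar>x\<bar>)))"
   using u force_growth_nonneg by (intro AE_I2) simp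
 qed
 also have "... = u * (u * (force_growth u * (1 + \<bar>x\<bar>)))" using u by (simp add: set_lebesgue_integral_def)
 finally have I: "\<bar>LBINT s:{\<tau> n..<?k}. (?k - real (grid n s) * \<tau> n) * Gn n x s\<bar> <= u * (u * (force_growth u * (1 + \<bar>x\<bar>)))" .
 have "\<bar>?k * v0 (site n x)\<bar> <= u * (C * (1 + \<bar>site n x\<bar>))"
  unfolding abs_mult using k C by (intro mult_mono) auto
 then have "\<bar>site n x + ?k * v0 (site n x)\<bar> <= (1 + u * C) * (1 + \<bar>site n x\<bar>)"
  using abs_triangle_ineq[of "site n x" "?k * v0 (site n x)"] by (simp add: algebra_simps)
 also have "... <= (1 + u * C) * ((3 + \<bar>q 0\<bar>) * (1 + \<bar>x\<bar>))" using s1 u C(2) by (intro mult_left_mono) auto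
 finally have A: "\<bar>site n x + ?k * v0 (site n x)\<bar> <= (1 + u * C) * ((3 + \<bar>q 0\<bar>) * (1 + \<bar>x\<bar>))" .
 have "\<bar>Yn n x u\<bar> <= (1 + u * C) * ((3 + \<bar>q 0\<bar>) * (1 + \<bar>x\<bar>)) + u * (u * (force_growth u * (1 + \<bar>x\<bar>)))"
  unfolding Yn_eq by (rule order_trans[OF abs_triangle_ineq add_mono[OF A I]])
 also have "... = ((1 + u * C) * (3 + \<bar>q 0\<bar>) + u * (u * force_growth u)) * (1 + \<bar>x\<bar>)"
  by (simp add: algebra_simps)
 finally show ?thesis .
qed

lemma Yn_measurable [measurable]: "(%x. Yn n x u) \<in> borel_measurable borel"
 unfolding Yn_def by (rule site_fun_measurable)

lemma balance_n:
 assumes u: "u <= t"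
 shows "(\<integral>x. (Xn n x u - Yn n x u) * h (Xn n x t) \<partial>\<rho>) = 0"
proof -
 have "(\<integral>x. (Xn n x u - Yn n x u) * h (Xn n x t) \<partial>\<rho>)
  = (\<Sum>a\<in>sites n. site_mass n a * ((p.pos n (grid n u) a - p.free n (grid n u) a) * h (p.pos n (grid n t) a)))"
  unfolding Xn_def Yn_def by (rule site_integral)
 also have "... = (\<Sum>a\<in>sites n. site_mass n a * (p.pos n (grid n u) a - p.free n (grid n u) a) * h (p.pos n (grid n t) a))"
  by (simp add: mult.assoc)
 also have "... = 0"
  by (rule p.momentum_balance) (metis p.sticky grid_mono[OF u])
 finally show ?thesis .
qed

lemma Y_measurable [measurable]: assumes u: "0 <= u" shows "(%x. Y x u) \<in> borel_measurable borel"
proof (rule borel_measurable_LIMSEQ_real)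
 show "(%n. indicator S x * Yn (sub n) x u) \<longlonglongrightarrow> Y x u" for x
  using Yn_tendsto[OF _ u, of x] by (cases "x \<in> S") (auto simp: Y_def)
qed measurable

text \<open>Collisions only redistribute momentum inside clusters, and clusters never split.  So \<open>X u - Y u\<close> has mean zero
on every set of particles that share their position at a later time \<open>t\<close>.  This is the limit of the discrete
identity; for continuous bounded \<open>h\<close> the growth bounds provide a dominating function.\<close>

theorem balance:
 assumes u: "0 <= u" "u <= t" and h: "continuous_on UNIV h" and hB: "!!z. \<bar>h z\<bar> <= (B::real)"
 shows "(\<integral>x. (X x u - Y x u) * h (X x t) \<partial>\<rho>) = 0"
proof -
 from v0_linear obtain C where C': "C >= 0 & (\<forall>a. \<bar>v0 a\<bar> <= C * (1 + \<bar>a\<bar>))" by (rule exE)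
 note C = conjunct2[OF C', rule_format] conjunct1[OF C']
 define D where "D = growth u + ((1 + u * C) * (3 + \<bar>q 0\<bar>) + u * (u * force_growth u))"
 have [measurable]: "h \<in> borel_measurable borel" by (rule borel_measurable_continuous_onI[OF h])
 have B0: "0 <= B" using hB[of 0] by (meson abs_ge_zero order_trans)
 have "(%n. \<integral>x. indicator S x * ((Xn (sub n) x u - Yn (sub n) x u) * h (Xn (sub n) x t)) \<partial>\<rho>) \<longlonglongrightarrow> (\<integral>x. indicator S x * ((X x u - Y x u) * h (X x t)) \<partial>\<rho>)"
 proof (rule integral_dominated_convergence[where w="%x. (B * D) * (1 + \<bar>x\<bar>)"])
  have lim: "(%n. indicator S x * ((Xn (sub n) x u - Yn (sub n) x u) * h (Xn (sub n) x t))) \<longlonglongrightarrow> indicator S x * ((X x u - Y x u) * h (X x t))" for x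
  proof (cases "x \<in> S")
   case True
   have "isCont h (X x t)" using h by (simp add: continuous_on_eq_continuous_at)
   then show ?thesis using True u
   by (intro tendsto_intros X_lim Yn_tendsto isCont_tendsto_compose[of "X x t" h]) auto
  qed simp
  then show "AE x in \<rho>. (%n. indicator S x * ((Xn (sub n) x u - Yn (sub n) x u) * h (Xn (sub n) x t))) \<longlonglongrightarrow> indicator S x * ((X x u - Y x u) * h (X x t))" by simp
  note [measurable] = Y_measurable[OF u(1)]
  show "(%x. indicator S x * ((X x u - Y x u) * h (X x t))) \<in> borel_measurable \<rho>" by measurable
  show "AE x in \<rho>. norm (indicator S x * ((Xn (sub n) x u - Yn (sub n) x u) * h (Xn (sub n) x t))) <= (B * D) * (1 + \<bar>x\<bar>)" for n
  proof (rule AE_I2)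
   fix x
   have "\<bar>Xn (sub n) x u - Yn (sub n) x u\<bar> <= D * (1 + \<bar>x\<bar>)"
   using Xn_bound[OF u(1) order_refl, of "sub n" x] Yn_bound[OF u(1) C, of "sub n" x]
   abs_triangle_ineq4[of "Xn (sub n) x u" "Yn (sub n) x u"] unfolding D_def distrib_right by linarith
   then have "\<bar>(Xn (sub n) x u - Yn (sub n) x u) * h (Xn (sub n) x t)\<bar> <= (D * (1 + \<bar>x\<bar>)) * B"
   unfolding abs_mult by (intro mult_mono hB) auto
   moreover have "\<bar>indicator S x * ((Xn (sub n) x u - Yn (sub n) x u) * h (Xn (sub n) x t))\<bar> <= \<bar>(Xn (sub n) x u - Yn (sub n) x u) * h (Xn (sub n) x t)\<bar>"
   by (simp split: split_indicator)
   moreover have "(D * (1 + \<bar>x\<bar>)) * B = (B * D) * (1 + \<bar>x\<bar>)" by (simp only: mult_ac)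
   ultimately show "norm (indicator S x * ((Xn (sub n) x u - Yn (sub n) x u) * h (Xn (sub n) x t))) <= (B * D) * (1 + \<bar>x\<bar>)"
   unfolding real_norm_def by linarith
  qed
 qed (measurable, rule integrable_affine)
 moreover have "(\<integral>x. indicator S x * ((Xn (sub n) x u - Yn (sub n) x u) * h (Xn (sub n) x t)) \<partial>\<rho>) = 0" for n
 proof -
  have "(\<integral>x. indicator S x * ((Xn (sub n) x u - Yn (sub n) x u) * h (Xn (sub n) x t)) \<partial>\<rho>) = (\<integral>x. (Xn (sub n) x u - Yn (sub n) x u) * h (Xn (sub n) x t) \<partial>\<rho>)"
   by (rule integral_cong_AE) (use AE_S in auto)
  then show ?thesis using balance_n[OF u(2)] by simp
 qed
 ultimately have "(%n::nat. 0) \<longlonglongrightarrow> (\<integral>x. indicator S x * ((X x u - Y x u) * h (X x t)) \<partial>\<rho>)" by simp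
 then have "(\<integral>x. indicator S x * ((X x u - Y x u) * h (X x t)) \<partial>\<rho>) = 0" by (simp add: LIMSEQ_const_iff)
 moreover have "indicator S x * ((X x u - Y x u) * h (X x t)) = (X x u - Y x u) * h (X x t)" for x
  by (cases "x \<in> S") (auto simp: X_outside Y_def)
 ultimately show ?thesis by simp
qed

end

section \<open>Evaluation, difference quotients and energy of paths\<close>

abbreviation (input) ev :: "cpath => real => real" where "ev \<equiv> apply_cpath"

lemma maxdist_mono: "m <= n ==> maxdist m \<gamma> \<xi> <= maxdist n \<gamma> \<xi>"
 by (rule maxdist_least, rule maxdist_upper) auto

lemma summable_half_powers: "summable (%n. 1 / 2 ^ Suc n :: real)"
 using summable_mult[OF summable_geometric[of "1/2::real"], of "1/2"] by (simp add: power_divide)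

lemma dist_cpath_term:
 shows summable_dist_cpath: "summable (%n. 1 / 2 ^ Suc n * (maxdist (Suc n) \<gamma> \<xi> / (1 + maxdist (Suc n) \<gamma> \<xi>)))"
  and dist_cpath_term_nonneg: "0 <= 1 / 2 ^ Suc n * (maxdist (Suc n) \<gamma> \<xi> / (1 + maxdist (Suc n) \<gamma> \<xi>))"
  and dist_cpath_term_le: "1 / 2 ^ Suc n * (maxdist (Suc n) \<gamma> \<xi> / (1 + maxdist (Suc n) \<gamma> \<xi>)) <= 1 / 2 ^ Suc n"
  and dist_cpath_term_le': "1 / 2 ^ Suc n * (maxdist (Suc n) \<gamma> \<xi> / (1 + maxdist (Suc n) \<gamma> \<xi>)) <= 1 / 2 ^ Suc n * maxdist (Suc n) \<gamma> \<xi>"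
proof -
 have m: "0 <= maxdist (Suc n) \<gamma> \<xi>" for n by (rule maxdist_nonneg)
 show nn: "0 <= 1 / 2 ^ Suc n * (maxdist (Suc n) \<gamma> \<xi> / (1 + maxdist (Suc n) \<gamma> \<xi>))" for n
  using m[of n] by simp
 have "maxdist (Suc n) \<gamma> \<xi> / (1 + maxdist (Suc n) \<gamma> \<xi>) <= 1" for n using m[of n] by simp
 from mult_left_mono[OF this, of "1 / 2 ^ Suc _"]
 show le: "1 / 2 ^ Suc n * (maxdist (Suc n) \<gamma> \<xi> / (1 + maxdist (Suc n) \<gamma> \<xi>)) <= 1 / 2 ^ Suc n" for n by simp
 have "maxdist (Suc n) \<gamma> \<xi> / (1 + maxdist (Suc n) \<gamma> \<xi>) <= maxdist (Suc n) \<gamma> \<xi> / 1" for n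
  using m[of n] by (intro divide_left_mono) auto
 from mult_left_mono[OF this, of "1 / 2 ^ Suc _"]
 show "1 / 2 ^ Suc n * (maxdist (Suc n) \<gamma> \<xi> / (1 + maxdist (Suc n) \<gamma> \<xi>)) <= 1 / 2 ^ Suc n * maxdist (Suc n) \<gamma> \<xi>" by simp
 show "summable (%n. 1 / 2 ^ Suc n * (maxdist (Suc n) \<gamma> \<xi> / (1 + maxdist (Suc n) \<gamma> \<xi>)))"
  by (rule summable_comparison_test'[OF summable_half_powers]) (use nn le in \<open>simp only: real_norm_def abs_of_nonneg\<close>)
qed

lemma suminf_half_powers: "(\<Sum>n. 1 / 2 ^ Suc n :: real) = 1"
proof -
 have "(\<Sum>n. 1/2 * (1/2) ^ n :: real) = 1/2 * (1 / (1 - 1/2))"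
  by (subst suminf_mult) (simp_all add: suminf_geometric)
 then show ?thesis by (simp add: power_divide)
qed

lemma dist_cpath_le: "dist \<gamma> \<xi> <= maxdist N \<gamma> \<xi> + 1 / 2 ^ N"
proof -
 let ?s = "%n. 1 / 2 ^ Suc n * (maxdist (Suc n) \<gamma> \<xi> / (1 + maxdist (Suc n) \<gamma> \<xi>))"
 have "dist \<gamma> \<xi> = (\<Sum>n. ?s (n + N)) + (\<Sum>n<N. ?s n)"
  unfolding dist_cpath_def by (rule suminf_split_initial_segment[OF summable_dist_cpath])
 also have "... <= 1 / 2 ^ N + maxdist N \<gamma> \<xi>"
 proof (rule add_mono)
  have "(\<Sum>n. ?s (n + N)) <= (\<Sum>n. 1 / 2 ^ N * (1 / 2 ^ Suc n))"
  proof (rule suminf_le)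
   show "?s (n + N) <= 1 / 2 ^ N * (1 / 2 ^ Suc n)" for n
   using dist_cpath_term_le[of "n + N" \<gamma> \<xi>] by (simp add: power_add mult_ac)
   show "summable (%n. ?s (n + N))" using summable_ignore_initial_segment[OF summable_dist_cpath[of \<gamma> \<xi>], of N] .
   show "summable (%n. 1 / 2 ^ N * (1 / 2 ^ Suc n) :: real)" by (rule summable_mult[OF summable_half_powers])
  qed
  also have "... = 1 / 2 ^ N * (\<Sum>n. 1 / 2 ^ Suc n :: real)" by (rule suminf_mult[OF summable_half_powers])
  finally show "(\<Sum>n. ?s (n + N)) <= 1 / 2 ^ N" unfolding suminf_half_powers by simp
  have "(\<Sum>n<N. ?s n) <= (\<Sum>n<N. 1 / 2 ^ Suc n * maxdist N \<gamma> \<xi>)"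
  proof (rule sum_mono)
   fix n assume "n \<in> {..<N}"
   then have "1 / 2 ^ Suc n * maxdist (Suc n) \<gamma> \<xi> <= 1 / 2 ^ Suc n * maxdist N \<gamma> \<xi>"
   by (intro mult_left_mono maxdist_mono) auto
   then show "?s n <= 1 / 2 ^ Suc n * maxdist N \<gamma> \<xi>" using dist_cpath_term_le'[of n \<gamma> \<xi>] by linarith
  qed
  also have "... = (\<Sum>n<N. 1 / 2 ^ Suc n) * maxdist N \<gamma> \<xi>" by (rule sum_distrib_right[symmetric])
  also have "... <= 1 * maxdist N \<gamma> \<xi>"
  proof (rule mult_right_mono[OF _ maxdist_nonneg])
   have "(\<Sum>n<N. 1 / 2 ^ Suc n :: real) <= (\<Sum>n. 1 / 2 ^ Suc n)" by (rule sum_le_suminf[OF summable_half_powers]) auto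
   then show "(\<Sum>n<N. 1 / 2 ^ Suc n :: real) <= 1" unfolding suminf_half_powers .
  qed
  finally show "(\<Sum>n<N. ?s n) <= maxdist N \<gamma> \<xi>" by simp
 qed
 finally show ?thesis by simp
qed

lemma eval_continuous: assumes t: "0 <= t" shows "continuous_on UNIV (%\<gamma>::cpath. ev \<gamma> t)"
 unfolding continuous_on_iff
proof (intro ballI allI impI)
 fix \<gamma> :: cpath and e :: real assume e: "0 < e"
 obtain n :: nat where n: "t <= real n" using real_arch_simple by blast
 define d where "d = 1 / 2 ^ Suc n * (e / (1 + e))"
 have "\<bar>ev \<xi> t - ev \<gamma> t\<bar> < e" if x: "dist \<xi> \<gamma> < d" for \<xi>
 proof -
  let ?m = "maxdist (Suc n) \<xi> \<gamma>"
  let ?s = "%n. 1 / 2 ^ Suc n * (maxdist (Suc n) \<xi> \<gamma> / (1 + maxdist (Suc n) \<xi> \<gamma>))"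
  have m0: "0 <= ?m" by (rule maxdist_nonneg)
  have "sum ?s {n} <= suminf ?s"
   by (rule sum_le_suminf[OF summable_dist_cpath]) (simp, rule dist_cpath_term_nonneg)
  moreover have "sum ?s {n} = ?s n" by (simp only: sum.insert finite.emptyI empty_iff not_False_eq_True sum.empty add_0_right)
  ultimately have "?s n <= dist \<xi> \<gamma>" unfolding dist_cpath_def by (simp only:)
  then have "1 / 2 ^ Suc n * (?m / (1 + ?m)) < 1 / 2 ^ Suc n * (e / (1 + e))" using x unfolding d_def by linarith
  then have "?m / (1 + ?m) < e / (1 + e)" by (rule mult_left_less_imp_less) simp
  then have "?m * (1 + e) < e * (1 + ?m)" using m0 e by (simp add: divide_less_eq less_divide_eq mult_ac)
  then have "?m < e" by (simp add: algebra_simps)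
  moreover have "\<bar>ev \<xi> t - ev \<gamma> t\<bar> <= ?m" using n t by (intro maxdist_upper) auto
  ultimately show ?thesis by simp
 qed
 then show "\<exists>d>0. \<forall>\<xi>\<in>UNIV. dist \<xi> \<gamma> < d --> dist (ev \<xi> t) (ev \<gamma> t) < e"
  using e by (intro exI[of _ d]) (auto simp: d_def dist_real_def)
qed

lemma cpath_negative: "t < 0 ==> ev \<gamma> t = undefined"
 using apply_cpath[of \<gamma>] by (auto simp: extensional_def)

lemma eval_measurable [measurable]: "(%\<gamma>. ev \<gamma> t) \<in> borel_measurable borel"
proof (cases "0 <= t")
 case True
 then show ?thesis by (intro borel_measurable_continuous_onI eval_continuous)
next
 case False
 then have "(%\<gamma>. ev \<gamma> t) = (%\<gamma>. undefined)" using cpath_negative by auto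
 then show ?thesis by simp
qed

lemma cpath_tendsto:
 assumes "u \<longlonglongrightarrow> t" "!!n. 0 <= u n" shows "(%n. ev \<gamma> (u n)) \<longlonglongrightarrow> ev \<gamma> t"
proof (rule continuous_on_tendsto_compose[OF continuous_on_apply_cpath assms(1)])
 show "t \<in> {0..}" using LIMSEQ_le_const[OF assms(1)] assms(2) by auto
qed (use assms(2) in auto)

text \<open>A path is the limit of its piecewise constant samples, and these are measurable in path and time together.\<close>

lemma joint_eval_measurable: "(%z. ev (fst z) (snd z)) \<in> borel_measurable (borel \<Otimes>\<^sub>M borel)"
proof -
 let ?k = "%n (t::real). nat \<lfloor>real (Suc n) * t\<rfloor>"
 have [measurable]: "(%z::cpath \<times> real. ev (fst z) (real (?k n (snd z)) / real (Suc n))) \<in> borel_measurable (borel \<Otimes>\<^sub>M borel)" for n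
 proof (rule measurable_compose_countable[where f="%i z. ev (fst z) (real i / real (Suc n))" and g="%z. ?k n (snd z)"])
  show "(%z. ev (fst z) (real i / real (Suc n))) \<in> borel_measurable (borel \<Otimes>\<^sub>M borel)" for i
   by (rule measurable_compose[OF measurable_fst eval_measurable])
 qed measurable
 have lim: "(%n. if 0 <= snd z then ev (fst z) (real (?k n (snd z)) / real (Suc n)) else undefined) \<longlonglongrightarrow> ev (fst z) (snd z)" for z
 proof (cases "0 <= snd z")
  case True
  let ?t = "snd z"
  have "(%n. real (?k n ?t) / real (Suc n)) \<longlonglongrightarrow> ?t"
  proof (rule tendsto_sandwich)
   have f: "real (?k n ?t) = of_int \<lfloor>real (Suc n) * ?t\<rfloor>" for n using True by simp
   show "\<forall>\<^sub>F n in sequentially. ?t - 1 / real (Suc n) <= real (?k n ?t) / real (Suc n)"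
   proof (intro always_eventually allI)
   fix n
   have "real (Suc n) * ?t - 1 <= of_int \<lfloor>real (Suc n) * ?t\<rfloor>" by linarith
   then have "(real (Suc n) * ?t - 1) / real (Suc n) <= of_int \<lfloor>real (Suc n) * ?t\<rfloor> / real (Suc n)" by (intro divide_right_mono) auto
   then show "?t - 1 / real (Suc n) <= real (?k n ?t) / real (Suc n)" unfolding f by (simp add: diff_divide_distrib)
   qed
   show "\<forall>\<^sub>F n in sequentially. real (?k n ?t) / real (Suc n) <= ?t"
   proof (intro always_eventually allI)
   fix n
   have "of_int \<lfloor>real (Suc n) * ?t\<rfloor> <= real (Suc n) * ?t" by (rule of_int_floor_le)
   then have "of_int \<lfloor>real (Suc n) * ?t\<rfloor> / real (Suc n) <= real (Suc n) * ?t / real (Suc n)" by (intro divide_right_mono) auto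
   then show "real (?k n ?t) / real (Suc n) <= ?t" unfolding f by simp
   qed
   have "(%n. 1 / real (Suc n)) \<longlonglongrightarrow> 0" using LIMSEQ_inverse_real_of_nat by (simp add: inverse_eq_divide)
   from tendsto_diff[OF tendsto_const[of ?t] this] show "(%n. ?t - 1 / real (Suc n)) \<longlonglongrightarrow> ?t" by simp
  qed simp
  from cpath_tendsto[OF this] show ?thesis using True by simp
 qed (simp add: cpath_negative)
 show ?thesis by (rule borel_measurable_LIMSEQ_real[OF lim]) measurable
qed

lemma joint_eval_measurable' [measurable (raw)]:
 assumes "f \<in> measurable M (borel :: cpath measure)" "g \<in> borel_measurable M"
 shows "(%z. ev (f z) (g z)) \<in> borel_measurable M"
 using measurable_compose[OF measurable_Pair[OF assms] joint_eval_measurable] by simp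

lemma cpath_shift_continuous: assumes "0 < t" shows "\<exists>d>0. continuous_on {-d<..<d} (%h. ev \<gamma> (t + h))"
proof (intro exI[of _ t] conjI assms)
 show "continuous_on {-t<..<t} (%h. ev \<gamma> (t + h))"
  by (rule continuous_on_compose2[OF continuous_on_apply_cpath[of \<gamma>]]) (auto intro!: continuous_on_add continuous_on_const continuous_on_id)
qed

lemma differentiable_shift_iff: "(f :: real => real) differentiable (at t) \<longleftrightarrow> (%h. f (t + h)) differentiable (at 0)"
 unfolding real_differentiable_def DERIV_shift_iff[of f _ t] ..

lemma differentiable_set_measurable:
 "{z \<in> space (borel \<Otimes>\<^sub>M lborel). 0 < snd z --> ev (fst z) differentiable (at (snd z))} \<in> sets (borel \<Otimes>\<^sub>M lborel)"
proof -
 let ?B = "borel \<Otimes>\<^sub>M lborel :: (cpath \<times> real) measure"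
 let ?M = "restrict_space ?B {z. 0 < snd z}"
 have "{z \<in> space ?M. (%h. ev (fst z) (snd z + h)) differentiable (at 0)} \<in> sets ?M"
 proof (rule measurable_differentiable_at_0)
  show "(%z. ev (fst z) (snd z + h)) \<in> borel_measurable ?M" for h
   by (rule measurable_restrict_space1) measurable
  show "\<exists>d>0. continuous_on {-d<..<d} (%h. ev (fst z) (snd z + h))" if "z \<in> space ?M" for z
   using that by (intro cpath_shift_continuous) (auto simp: space_restrict_space)
 qed
 moreover have om: "{z. 0 < snd z} \<inter> space ?B \<in> sets ?B" by measurable
 ultimately have A: "{z \<in> space ?M. (%h. ev (fst z) (snd z + h)) differentiable (at 0)} \<in> sets ?B"
  using sets_restrict_space_iff[OF om] by blast
 have "{z \<in> space ?B. 0 < snd z --> ev (fst z) differentiable (at (snd z))}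
   = {z \<in> space ?M. (%h. ev (fst z) (snd z + h)) differentiable (at 0)} \<union> (space ?B - {z \<in> space ?B. 0 < snd z})"
  using differentiable_shift_iff by (auto simp: space_restrict_space)
 also have "... \<in> sets ?B"
 proof (rule sets.Un[OF A sets.Diff[OF sets.top]])
  show "{z \<in> space ?B. 0 < snd z} \<in> sets ?B" by measurable
 qed
 finally show ?thesis .
qed

lemma deriv_cpath_measurable: assumes t: "0 < t" shows "(%\<gamma>. deriv (ev \<gamma>) t) \<in> borel_measurable borel"
 unfolding deriv_shift_0[of _ t]
 by (rule measurable_deriv_at_0) (auto intro: cpath_shift_continuous[OF t])

text \<open>Difference quotients of a path with step \<open>1 / (m + 1)\<close>, and their energy.\<close>

definition path_slope :: "nat => cpath => real => real" where
 "path_slope m \<gamma> t = real (Suc m) * (ev \<gamma> (t + 1 / real (Suc m)) - ev \<gamma> t)"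

definition quotient_energy :: "nat => nat => cpath => ennreal" where
 "quotient_energy m n \<gamma> = (\<integral>\<^sup>+t. ennreal ((path_slope m \<gamma> t)\<^sup>2) * indicator {0..real n} t \<partial>lborel)"

lemma quotient_measurable [measurable (raw)]:
 assumes "f \<in> measurable M (borel :: cpath measure)" "g \<in> borel_measurable M"
 shows "(%z. path_slope m (f z) (g z)) \<in> borel_measurable M"
 unfolding path_slope_def using assms by measurable

lemma quotient_energy_measurable [measurable]: "quotient_energy m n \<in> borel_measurable borel"
 unfolding quotient_energy_def by measurable

lemma quotient_sequence:
 fixes f :: "real => real"
 assumes "f \<midarrow>0\<rightarrow> l" "(%m. 1 / real (Suc m)) \<longlonglongrightarrow> 0"
 shows "(%m. f (1 / real (Suc m))) \<longlonglongrightarrow> l"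
 by (rule filterlim_compose[OF assms(1)]) (use assms(2) in \<open>auto simp: filterlim_at\<close>)

lemma average_quotient_tendsto:
 assumes ab: "0 <= a" "a <= b"
 shows "(%m. LBINT t:{a..b}. path_slope m \<gamma> t) \<longlonglongrightarrow> ev \<gamma> b - ev \<gamma> a"
proof -
 define f where "f t = ev \<gamma> (max 0 t)" for t
 have fc: "continuous_on UNIV f"
  unfolding f_def by (rule continuous_on_compose2[OF continuous_on_apply_cpath[of \<gamma>]]) (auto intro!: continuous_on_max continuous_on_const continuous_on_id)
 define F where "F x = integral {-1..x} f" for x
 have dF: "DERIV F x :> f x" if x: "-1 < x" "x < b + 2" for x
 proof -
  have "(F has_real_derivative f x) (at x within {-1..b+2})"
   unfolding F_def by (rule integral_has_real_derivative) (use x fc in \<open>auto intro: continuous_on_subset\<close>)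
  then show ?thesis using x by (simp add: at_within_Icc_at)
 qed
 have val: "(LBINT t:{a..b}. path_slope m \<gamma> t) = (F (b + 1 / real (Suc m)) - F b) / (1 / real (Suc m)) - (F (a + 1 / real (Suc m)) - F a) / (1 / real (Suc m))" for m
 proof -
  let ?h = "1 / real (Suc m)"
  have h: "0 < ?h" "?h <= 1" by auto
  have "(LBINT t:{a..b}. path_slope m \<gamma> t) = (LBINT t. (real (Suc m) * (f (t + ?h) - f t)) * indicator {a..b} t)"
   unfolding set_lebesgue_integral_def
   by (rule Bochner_Integration.integral_cong) (use ab h in \<open>auto simp: path_slope_def f_def split: split_indicator\<close>)
  also have "... = real (Suc m) * (F (b + ?h) - F b) - real (Suc m) * (F (a + ?h) - F a)"
  proof (rule integral_FTC_Icc_real[OF ab(2)])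
   fix x assume x: "a <= x" "x <= b"
   have "-1 < x + ?h" "x + ?h < b + 2" using x ab h by linarith+
   note dF[OF this]
   moreover have "((%y. y + ?h) has_real_derivative (1 + 0)) (at x)" by (intro derivative_intros)
   ultimately have "DERIV (%y. F (y + ?h)) x :> f (x + ?h) * (1 + 0)" by (rule DERIV_chain2)
   then show "DERIV (%x. real (Suc m) * (F (x + ?h) - F x)) x :> real (Suc m) * (f (x + ?h) - f x)"
   by (intro derivative_eq_intros) (use x ab dF[of x] in auto)
   have c: "isCont f y" for y using fc by (simp add: continuous_on_eq_continuous_at)
   have "isCont (%x. x + ?h) x" by (rule isCont_add) (rule continuous_ident, rule continuous_const)
   from isCont_o2[OF this c] have "isCont (%x. f (x + ?h)) x" .
   then show "isCont (%x. real (Suc m) * (f (x + ?h) - f x)) x"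
   by (rule isCont_mult[OF continuous_const isCont_diff[OF _ c]])
  qed
  finally show ?thesis by (simp add: mult.commute)
 qed
 have lim: "(%m. (F (x + 1 / real (Suc m)) - F x) / (1 / real (Suc m))) \<longlonglongrightarrow> f x" if "-1 < x" "x < b + 2" for x
 proof -
  have "(%h. (F (x + h) - F x) / h) \<midarrow>0\<rightarrow> f x" using dF[OF that] by (simp add: DERIV_def)
  moreover have "(%m. 1 / real (Suc m)) \<longlonglongrightarrow> 0" using LIMSEQ_inverse_real_of_nat by (simp add: inverse_eq_divide)
  ultimately show ?thesis by (rule quotient_sequence)
 qed
 have "(%m. LBINT t:{a..b}. path_slope m \<gamma> t) \<longlonglongrightarrow> f b - f a"
  unfolding val by (intro tendsto_diff lim) (use ab in auto)
 then show ?thesis using ab by (simp add: f_def)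
qed

lemma quotient_continuous: "continuous_on {0..} (path_slope m \<gamma>)"
proof -
 have "continuous_on {0..} (%t. ev \<gamma> (t + 1 / real (Suc m)))"
  by (rule continuous_on_compose2[OF continuous_on_apply_cpath[of \<gamma>]]) (auto intro!: continuous_on_add continuous_on_const continuous_on_id)
 then show ?thesis unfolding path_slope_def
  by (intro continuous_on_mult continuous_on_diff continuous_on_const continuous_on_apply_cpath)
qed

lemma quotient_set_integrable: "0 <= a ==> set_integrable lborel {a..b} (path_slope m \<gamma>)"
 by (rule borel_integrable_atLeastAtMost') (rule continuous_on_subset[OF quotient_continuous], auto)

text \<open>Increments of the path are limits of integrals of its difference quotients.  By the Young inequality with
weight \<open>l\<close> these integrals over a family of total length \<open>\<delta>\<close> are at most \<open>l/2 * C + \<delta> / (2 * l)\<close>, which is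
small when first \<open>l\<close> and then \<open>\<delta>\<close> is chosen small.\<close>

lemma quotient_energy_abs_continuous:
 assumes fr: "\<exists>\<^sub>F m in sequentially. quotient_energy m n \<gamma> <= ennreal C" and C: "0 <= C"
 shows "abs_continuous_on {0..real n} (ev \<gamma>)"
 unfolding abs_continuous_on_nonoverlapping
proof (intro allI impI)
 fix \<epsilon> :: real assume e: "\<epsilon> > 0"
 define l where "l = \<epsilon> / (2 * (C + 1))"
 have l: "l > 0" using e C by (simp add: l_def)
 define \<delta> where "\<delta> = l * \<epsilon> / 2"
 have d: "\<delta> > 0" using l e by (simp add: \<delta>_def)
 have "(\<Sum>k\<in>I. \<bar>ev \<gamma> (b k) - ev \<gamma> (a k)\<bar>) < \<epsilon>"
  if no: "nonoverlapping {0..real n} (I::nat set) a b" and len: "(\<Sum>k\<in>I. b k - a k) < \<delta>" for I a b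
 proof -
  have I: "finite I" "!!k. k \<in> I ==> a k <= b k & 0 <= a k & b k <= real n" "disjoint_family_on (%k. {a k<..<b k}) I"
   using no by (auto simp: nonoverlapping_def)
  have lim: "(%m. \<Sum>k\<in>I. \<bar>LBINT t:{a k..b k}. path_slope m \<gamma> t\<bar>) \<longlonglongrightarrow> (\<Sum>k\<in>I. \<bar>ev \<gamma> (b k) - ev \<gamma> (a k)\<bar>)"
   by (intro tendsto_sum tendsto_rabs average_quotient_tendsto) (use I in auto)
  have bnd: "(\<Sum>k\<in>I. \<bar>LBINT t:{a k..b k}. path_slope m \<gamma> t\<bar>) <= l / 2 * C + \<delta> / (2 * l)" if m: "quotient_energy m n \<gamma> <= ennreal C" for m
  proof -
   let ?q = "path_slope m \<gamma>"
   let ?U = "\<Union>k\<in>I. {a k<..<b k}"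
   have qi: "set_integrable lborel {0..real n} (%t. (?q t)\<^sup>2)"
   by (rule borel_integrable_atLeastAtMost') (intro continuous_on_power continuous_on_subset[OF quotient_continuous], auto)
   have U: "?U \<subseteq> {0..real n}" using I by fastforce
   have Um: "?U \<in> sets borel" using I by auto
   have q2: "(LBINT t:{0..real n}. (?q t)\<^sup>2) <= C"
   proof -
   have "ennreal (LBINT t:{0..real n}. (?q t)\<^sup>2) = (\<integral>\<^sup>+t. ennreal (indicator {0..real n} t * (?q t)\<^sup>2) \<partial>lborel)"
   unfolding set_lebesgue_integral_def real_scaleR_def
   by (rule nn_integral_eq_integral[symmetric]) (use qi in \<open>auto simp: set_integrable_def\<close>)
   also have "... = quotient_energy m n \<gamma>"
   unfolding quotient_energy_def by (rule nn_integral_cong) (auto split: split_indicator)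
   finally have "ennreal (LBINT t:{0..real n}. (?q t)\<^sup>2) <= ennreal C" using m by simp
   then show ?thesis using C by (simp add: ennreal_le_iff)
   qed
   have "(\<Sum>k\<in>I. \<bar>LBINT t:{a k..b k}. ?q t\<bar>) <= (\<Sum>k\<in>I. LBINT t:{a k<..<b k}. l/2 * (?q t)\<^sup>2 + 1 / (2 * l))"
   proof (rule sum_mono)
   fix k assume k: "k \<in> I"
   have sub: "{a k<..<b k} \<subseteq> {0..real n}" using I(2)[OF k] by auto
   have qk: "set_integrable lborel {a k..b k} ?q" using I(2)[OF k] by (intro quotient_set_integrable) auto
   have "(LBINT t:{a k..b k}. ?q t) = (LBINT t:{a k<..<b k}. ?q t)"
   unfolding set_lebesgue_integral_def
   proof (rule integral_cong_AE)
   show "(%t. indicator {a k..b k} t *\<^sub>R ?q t) \<in> borel_measurable lborel" using qk by (auto simp: set_integrable_def)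
   have "set_integrable lborel {a k<..<b k} ?q" by (rule set_integrable_subset[OF qk]) auto
   then show "(%t. indicator {a k<..<b k} t *\<^sub>R ?q t) \<in> borel_measurable lborel" by (auto simp: set_integrable_def)
   show "AE t in lborel. indicator {a k..b k} t *\<^sub>R ?q t = indicator {a k<..<b k} t *\<^sub>R ?q t"
   using AE_lborel_singleton[of "a k"] AE_lborel_singleton[of "b k"] by eventually_elim (auto split: split_indicator)
   qed
   also have "\<bar>...\<bar> <= (LBINT t:{a k<..<b k}. \<bar>?q t\<bar>)"
   unfolding set_lebesgue_integral_def by (rule order_trans[OF integral_abs_bound]) (simp add: abs_mult)
   also have "... <= (LBINT t:{a k<..<b k}. l/2 * (?q t)\<^sup>2 + 1 / (2 * l))"
   proof (rule set_integral_mono)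
   show "set_integrable lborel {a k<..<b k} (%t. \<bar>?q t\<bar>)"
   by (rule set_integrable_subset[of _ "{a k..b k}"]) (use qk in \<open>auto intro: set_integrable_abs\<close>)
   show "set_integrable lborel {a k<..<b k} (%t. l/2 * (?q t)\<^sup>2 + 1 / (2 * l))"
   using set_integrable_subset[OF qi _ sub] I(2)[OF k]
   by (intro set_integral_add set_integrable_mult_right) (auto simp: set_integrable_def integrable_real_indicator)
   fix t
   have "0 <= (l * \<bar>?q t\<bar> - 1)\<^sup>2 / (2 * l)" using l by simp
   also have "... = l/2 * (?q t)\<^sup>2 + 1 / (2 * l) - \<bar>?q t\<bar>" using l by (simp add: power2_eq_square field_simps)
   finally show "\<bar>?q t\<bar> <= l/2 * (?q t)\<^sup>2 + 1 / (2 * l)" by simp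
   qed
   finally show "\<bar>LBINT t:{a k..b k}. ?q t\<bar> <= (LBINT t:{a k<..<b k}. l/2 * (?q t)\<^sup>2 + 1 / (2 * l))" .
   qed
   also have "... = (\<Sum>k\<in>I. l/2 * (LBINT t:{a k<..<b k}. (?q t)\<^sup>2) + (b k - a k) / (2 * l))"
   proof (rule sum.cong[OF refl])
   fix k assume k: "k \<in> I"
   have sub: "{a k<..<b k} \<subseteq> {0..real n}" using I(2)[OF k] by auto
   have "(LBINT t:{a k<..<b k}. l/2 * (?q t)\<^sup>2 + 1 / (2 * l)) = (LBINT t:{a k<..<b k}. l/2 * (?q t)\<^sup>2) + (LBINT t:{a k<..<b k}. 1 / (2 * l))"
   using set_integrable_subset[OF qi _ sub] I(2)[OF k]
   by (intro set_integral_add set_integrable_mult_right) (auto simp: set_integrable_def integrable_real_indicator)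
   then show "(LBINT t:{a k<..<b k}. l/2 * (?q t)\<^sup>2 + 1 / (2 * l)) = l/2 * (LBINT t:{a k<..<b k}. (?q t)\<^sup>2) + (b k - a k) / (2 * l)"
   using I(2)[OF k] by (simp add: set_lebesgue_integral_def mult.left_commute)
   qed
   also have "... = l/2 * (\<Sum>k\<in>I. LBINT t:{a k<..<b k}. (?q t)\<^sup>2) + (\<Sum>k\<in>I. b k - a k) / (2 * l)"
   by (simp add: sum.distrib sum_distrib_left sum_divide_distrib)
   also have "(\<Sum>k\<in>I. LBINT t:{a k<..<b k}. (?q t)\<^sup>2) = (LBINT t:?U. (?q t)\<^sup>2)"
   proof (rule set_integral_finite_Union[symmetric])
   show "set_integrable lborel {a k<..<b k} (%t. (?q t)\<^sup>2)" if "k \<in> I" for k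
   by (rule set_integrable_subset[OF qi _ order_trans[OF _ U]]) (use that in auto)
   show "disjoint_family_on (%k. {a k<..<b k}) I" by (rule I(3))
   qed (use I(1) in auto)
   also have "(LBINT t:?U. (?q t)\<^sup>2) <= (LBINT t:{0..real n}. (?q t)\<^sup>2)"
   unfolding set_lebesgue_integral_def
   proof (rule integral_mono)
   show "integrable lborel (%t. indicator ?U t *\<^sub>R (?q t)\<^sup>2)"
   using set_integrable_subset[OF qi _ U] Um by (simp add: set_integrable_def)
   show "integrable lborel (%t. indicator {0..real n} t *\<^sub>R (?q t)\<^sup>2)"
   using qi by (simp add: set_integrable_def)
   show "indicator ?U t *\<^sub>R (?q t)\<^sup>2 <= indicator {0..real n} t *\<^sub>R (?q t)\<^sup>2" for t
   unfolding real_scaleR_def by (rule mult_right_mono[OF indicator_leI]) (use U in blast, simp)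
   qed
   finally have "(\<Sum>k\<in>I. \<bar>LBINT t:{a k..b k}. ?q t\<bar>) <= l/2 * (LBINT t:{0..real n}. (?q t)\<^sup>2) + (\<Sum>k\<in>I. b k - a k) / (2 * l)"
   using l by simp
   also have "... <= l/2 * C + \<delta> / (2 * l)"
   using l q2 len by (intro add_mono mult_left_mono divide_right_mono) auto
   finally show ?thesis .
  qed
  have "(\<Sum>k\<in>I. \<bar>ev \<gamma> (b k) - ev \<gamma> (a k)\<bar>) <= l / 2 * C + \<delta> / (2 * l)"
  proof (rule ccontr)
   assume "~ ?thesis"
   then have "\<forall>\<^sub>F m in sequentially. l / 2 * C + \<delta> / (2 * l) < (\<Sum>k\<in>I. \<bar>LBINT t:{a k..b k}. path_slope m \<gamma> t\<bar>)"
   by (intro order_tendstoD(1)[OF lim]) simp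
   then have "\<forall>\<^sub>F m in sequentially. ~ quotient_energy m n \<gamma> <= ennreal C"
   by (rule eventually_mono) (use bnd in \<open>auto simp: not_less[symmetric]\<close>)
   then show False using fr by (simp add: frequently_def)
  qed
  also have "... < \<epsilon>"
  proof -
   have "\<delta> / (2 * l) = \<epsilon> / 4" using l by (simp add: \<delta>_def)
   moreover have "l * C <= \<epsilon> / 2" using e C by (simp add: l_def field_simps)
   ultimately show ?thesis using e by simp
  qed
  finally show ?thesis .
 qed
 then show "\<exists>\<delta>>0. \<forall>(I::nat set) a b. nonoverlapping {0..real n} I a b & (\<Sum>k\<in>I. b k - a k) < \<delta>
   --> (\<Sum>k\<in>I. \<bar>ev \<gamma> (b k) - ev \<gamma> (a k)\<bar>) < \<epsilon>" using d by blast
qed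

lemma path_energy_le_liminf:
 assumes "AE t in lborel. 0 < t --> ev \<gamma> differentiable (at t)"
 shows "path_energy n \<gamma> <= liminf (%m. quotient_energy m n \<gamma>)"
proof -
 have "path_energy n \<gamma> <= (\<integral>\<^sup>+t. liminf (%m. ennreal ((path_slope m \<gamma> t)\<^sup>2) * indicator {0..real n} t) \<partial>lborel)"
  unfolding path_energy_def
 proof (rule nn_integral_mono_AE)
  show "AE t in lborel. ennreal ((deriv (ev \<gamma>) t)\<^sup>2) * indicator {0..real n} t <= liminf (%m. ennreal ((path_slope m \<gamma> t)\<^sup>2) * indicator {0..real n} t)"
   using assms AE_lborel_singleton[of 0]
  proof eventually_elim
   case (elim t)
   show ?case
   proof (cases "t \<in> {0..real n}")
   case True
   then have "ev \<gamma> differentiable (at t)" using elim by auto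
   then have "DERIV (ev \<gamma>) t :> deriv (ev \<gamma>) t" by (simp add: DERIV_deriv_iff_real_differentiable)
   then have "(%h. (ev \<gamma> (t + h) - ev \<gamma> t) / h) \<midarrow>0\<rightarrow> deriv (ev \<gamma>) t" by (simp add: DERIV_def)
   moreover have "(%m. 1 / real (Suc m)) \<longlonglongrightarrow> 0" using LIMSEQ_inverse_real_of_nat by (simp add: inverse_eq_divide)
   ultimately have "(%m. (ev \<gamma> (t + 1 / real (Suc m)) - ev \<gamma> t) / (1 / real (Suc m))) \<longlonglongrightarrow> deriv (ev \<gamma>) t"
   by (rule quotient_sequence)
   then have "(%m. path_slope m \<gamma> t) \<longlonglongrightarrow> deriv (ev \<gamma>) t" by (simp add: path_slope_def mult.commute)
   then have "(%m. ennreal ((path_slope m \<gamma> t)\<^sup>2)) \<longlonglongrightarrow> ennreal ((deriv (ev \<gamma>) t)\<^sup>2)" by (intro tendsto_intros)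
   then have "liminf (%m. ennreal ((path_slope m \<gamma> t)\<^sup>2)) = ennreal ((deriv (ev \<gamma>) t)\<^sup>2)"
   by (intro lim_imp_Liminf) auto
   then show ?thesis using True by simp
   qed simp
  qed
 qed
 also have "... <= liminf (%m. quotient_energy m n \<gamma>)"
  unfolding quotient_energy_def by (rule nn_integral_liminf) measurable
 finally show ?thesis .
qed

section \<open>The path measure\<close>

lemma liminf_frequently_le:
 fixes f :: "nat => ennreal"
 assumes "liminf f < \<top>"
 shows "\<exists>C\<ge>0. \<exists>\<^sub>F n in sequentially. f n <= ennreal C"
proof -
 obtain y where y: "liminf f < y" "y < \<top>" using dense[OF assms] by blast
 then have "~ y <= liminf f" by simp
 then obtain z where z: "z < y" "~ (\<forall>\<^sub>F n in sequentially. z < f n)" unfolding le_Liminf_iff by blast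
 then have "\<exists>\<^sub>F n in sequentially. f n <= z" by (simp add: frequently_def not_le)
 moreover have "z = ennreal (enn2real z)" using z(1) y(2) by (metis ennreal_enn2real_if less_trans less_irrefl)
 ultimately show ?thesis by (intro exI[of _ "enn2real z"]) auto
qed

lemma sqrt_c_sinh_pos: "0 < c ==> 0 < t ==> 0 < sinh (sqrt c * t)" for c t :: real
 by simp

context interaction
begin

lemma X_cont_all: "continuous_on {0..} (X x)"
proof (cases "x \<in> S")
 case True then show ?thesis by (rule X_path_cont)
next
 case False
 then have "X x = (%t. 0)" by (auto simp: X_outside)
 then show ?thesis by simp
qed

definition P :: "real => cpath" where
 "P x = Abs_cpath (restrict (X x) {0..})"

lemma P_apply: "0 <= t ==> ev (P x) t = X x t"
proof -
 assume t: "0 <= t"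
 have "restrict (X x) {0..} \<in> {f. continuous_on {0..} f & f \<in> extensional {0..}}"
  using X_cont_all[of x] by (simp cong: continuous_on_cong_simp)
 from Abs_cpath_inverse[OF this] show ?thesis unfolding P_def using t by simp
qed

lemma X_gap_abs:
 assumes xy: "x \<in> S" "y \<in> S" and t: "0 <= t" "t <= T"
 shows "\<bar>X y t - X x t\<bar> <= cosh (sqrt c * T) * \<bar>y - x\<bar> + 1 / sqrt c * sinh (sqrt c * T) * \<bar>J y - J x\<bar>"
proof -
 have st: "sqrt c * t <= sqrt c * T" "0 <= sqrt c * t" using t c_pos by (auto intro: mult_left_mono)
 have ch: "cosh (sqrt c * t) <= cosh (sqrt c * T)" "sinh (sqrt c * t) <= sinh (sqrt c * T)"
  using st by (auto simp: cosh_real_nonneg_le_iff)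
 have *: "\<bar>X y t - X x t\<bar> <= cosh (sqrt c * T) * \<bar>y - x\<bar> + 1 / sqrt c * sinh (sqrt c * T) * \<bar>J y - J x\<bar>"
  if "x \<in> S" "y \<in> S" "x <= y" for x y
 proof -
  have "\<bar>X y t - X x t\<bar> = X y t - X x t" using X_mono[OF that t(1)] by simp
  also have "... <= cosh (sqrt c * t) * (y - x) + 1 / sqrt c * sinh (sqrt c * t) * (J y - J x)" by (rule X_gap[OF that t(1)])
  also have "... <= cosh (sqrt c * T) * (y - x) + 1 / sqrt c * sinh (sqrt c * T) * (J y - J x)"
   using ch that(3) J_mono[OF that(3)] c_pos by (intro add_mono mult_right_mono mult_left_mono) auto
  finally show ?thesis using that(3) J_mono[OF that(3)] by simp
 qed
 show ?thesis using *[OF xy] *[OF xy(2,1)] by (cases "x <= y") (auto simp: abs_minus_commute)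
qed

lemma P_cont: "continuous_on S P"
 unfolding continuous_on_iff
proof (intro ballI allI impI)
 fix x e assume x: "x \<in> S" and e: "0 < (e::real)"
 have "(%N. 1 / 2 ^ N :: real) \<longlonglongrightarrow> 0" using LIMSEQ_realpow_zero[of "1/2::real"] by (simp add: power_divide)
 then have "eventually (%N. 1 / 2 ^ N < e/2) sequentially" using e by (intro order_tendstoD(2)) auto
 then obtain N :: nat where N: "1 / 2 ^ N < e/2" by (auto simp: eventually_sequentially)
 define g where "g y = cosh (sqrt c * real N) * \<bar>y - x\<bar> + 1 / sqrt c * sinh (sqrt c * real N) * \<bar>J y - J x\<bar>" for y
 have "continuous_on UNIV g" unfolding g_def by (intro continuous_intros J_cont)
 then have "isCont g x" by (simp add: continuous_on_eq_continuous_at)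
 then obtain d where d: "d > 0" "!!y. dist y x < d ==> dist (g y) (g x) < e/2"
  using e unfolding continuous_at_eps_delta by (metis half_gt_zero)
 have "dist (P y) (P x) < e" if y: "y \<in> S" "dist y x < d" for y
 proof -
  have "maxdist N (P y) (P x) <= g y"
  proof (rule maxdist_least)
   fix t assume t: "0 <= t" "t <= real N"
   show "\<bar>ev (P y) t - ev (P x) t\<bar> <= g y"
   unfolding P_apply[OF t(1)] g_def by (rule X_gap_abs[OF x y(1) t])
  qed
  moreover have "g x = 0" by (simp add: g_def)
  then have "g y < e/2" using d(2)[OF y(2)] by (simp add: dist_real_def)
  ultimately show ?thesis using dist_cpath_le[of "P y" "P x" N] N by linarith
 qed
 then show "\<exists>d>0. \<forall>x'\<in>S. dist x' x < d --> dist (P x') (P x) < e" using d(1) by blast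
qed

lemma P_measurable [measurable]: "P \<in> borel_measurable borel"
proof -
 have "P x = (if x \<in> S then P x else Abs_cpath (restrict (%_. 0) {0..}))" for x
  unfolding P_def by (auto simp: X_outside fun_eq_iff cong: restrict_cong)
 then have eq: "P = (%x. if x \<in> S then P x else Abs_cpath (restrict (%_. 0) {0..}))" by (rule ext)
 have "(%x. if x \<in> S then P x else Abs_cpath (restrict (%_. 0) {0..})) \<in> borel_measurable borel"
  by (subst measurable_If_restrict_space_iff)
   (auto simp: Collect_mem_eq intro!: borel_measurable_continuous_on_restrict P_cont)
 then show ?thesis by (subst eq)
qed

text \<open>The law of the trajectory of a particle that is drawn at random from \<open>\<rho>\<close>.\<close>

definition \<eta> :: "cpath measure" where "\<eta> = distr \<rho> borel P"

lemma sets_eta [simp, measurable_cong]: "sets \<eta> = sets borel" by (simp add: \<eta>_def)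
lemma space_eta [simp]: "space \<eta> = UNIV" by (simp add: \<eta>_def)

lemma prob_eta: "prob_space \<eta>" unfolding \<eta>_def by (rule prob_space_distr) simp

sublocale eta: prob_space \<eta> by (rule prob_eta)

lemma AE_eta_iff: "{\<gamma>. Q \<gamma>} \<in> sets borel ==> (AE \<gamma> in \<eta>. Q \<gamma>) \<longleftrightarrow> (AE x in \<rho>. Q (P x))"
 unfolding \<eta>_def by (rule AE_distr_iff) auto

lemma eval_distr_eq:
 assumes t: "0 <= t" shows "eval_distr t \<eta> = distr \<rho> borel (%x. X x t)"
 unfolding \<eta>_def by (subst distr_distr) (simp_all add: o_def P_apply[OF t])

lemma initial_distr: "\<rho> = eval_distr 0 \<eta>"
proof -
 have "distr \<rho> borel (%x. X x 0) = distr \<rho> \<rho> (%x. x)"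
  by (rule distr_cong_AE) (use AE_S X_initial in \<open>auto elim!: eventually_mono\<close>)
 then show ?thesis using eval_distr_eq[of 0] by simp
qed

text \<open>\<open>P\<close> is continuous on the closed set \<open>S\<close> and \<open>\<gamma> \<mapsto> \<gamma> 0\<close> is a continuous inverse, so the image of \<open>S\<close> is closed.\<close>

lemma supp_eta: assumes g: "\<gamma> \<in> supp \<eta>" shows "\<exists>x\<in>S. \<gamma> = P x"
proof -
 have "\<exists>x\<in>S. dist (P x) \<gamma> < 1 / real (Suc n)" for n
 proof -
  let ?A = "P -` ball \<gamma> (1 / real (Suc n))"
  have "emeasure \<eta> (ball \<gamma> (1 / real (Suc n))) > 0"
   by (rule g[unfolded supp_def mem_Collect_eq, rule_format]) simp
  then have pos: "emeasure \<rho> ?A > 0" unfolding \<eta>_def by (simp add: emeasure_distr)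
  have A: "?A \<in> sets \<rho>" using measurable_sets[OF P_measurable, of "ball \<gamma> (1 / real (Suc n))"] by simp
  have sp: "space \<rho> = UNIV" using sets_eq_imp_space_eq[OF sets_rho] by simp
  show ?thesis
  proof (rule ccontr)
   assume "~ ?thesis"
   then have n: "\<forall>x\<in>S. x \<notin> ?A" by (simp only: vimage_eq mem_ball dist_commute[of \<gamma>]) blast
   have "AE x in \<rho>. x \<notin> ?A" using AE_S by eventually_elim (use n in blast)
   moreover have "{x \<in> space \<rho>. ~ x \<notin> ?A} = ?A" unfolding sp by blast
   ultimately have "emeasure \<rho> ?A = 0" by (rule iffD1[OF AE_iff_measurable[OF A], rotated])
   then show False using pos by simp
  qed
 qed
 then have "\<forall>n. \<exists>x. x \<in> S & dist (P x) \<gamma> < 1 / real (Suc n)" by fast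
 from choice[OF this] obtain u where u0: "\<forall>n. u n \<in> S & dist (P (u n)) \<gamma> < 1 / real (Suc n)" by (rule exE)
 have u: "!!n. u n \<in> S" "!!n. dist (P (u n)) \<gamma> < 1 / real (Suc n)" using u0 by simp_all
 have "(%n. P (u n)) \<longlonglongrightarrow> \<gamma>"
 proof (rule metric_LIMSEQ_I)
  fix e :: real assume "0 < e"
  then obtain N :: nat where N: "1 / real (Suc N) < e" by (rule nat_approx_posE)
  have "dist (P (u n)) \<gamma> < e" if "n >= N" for n
  proof -
   have "1 / real (Suc n) <= 1 / real (Suc N)" using that by (simp add: frac_le)
   then show ?thesis using u(2)[of n] N by linarith
  qed
  then show "\<exists>no. \<forall>n\<ge>no. dist (P (u n)) \<gamma> < e" by blast
 qed
 moreover have "isCont (%\<gamma>. ev \<gamma> 0) \<gamma>" using eval_continuous[of 0] by (simp add: continuous_on_eq_continuous_at)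
 ultimately have "(%n. ev (P (u n)) 0) \<longlonglongrightarrow> ev \<gamma> 0" by (rule isCont_tendsto_compose[rotated])
 then have ul: "u \<longlonglongrightarrow> ev \<gamma> 0" using u(1) by (simp add: P_apply X_initial)
 then have S: "ev \<gamma> 0 \<in> S" using closed_sequentially[OF closed_supp] u(1) by blast
 have "(%n. P (u n)) \<longlonglongrightarrow> P (ev \<gamma> 0)"
  by (rule continuous_on_tendsto_compose[OF P_cont ul S]) (simp add: u(1))
 with \<open>(%n. P (u n)) \<longlonglongrightarrow> \<gamma>\<close> have "\<gamma> = P (ev \<gamma> 0)" by (rule LIMSEQ_unique)
 with S show ?thesis by blast
qed

lemma contraction_supp:
 assumes "\<gamma> \<in> supp \<eta>" "\<xi> \<in> supp \<eta>" "0 < s" "s <= t"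
 shows "\<bar>ev \<gamma> t - ev \<xi> t\<bar> / sinh (sqrt c * t) <= \<bar>ev \<gamma> s - ev \<xi> s\<bar> / sinh (sqrt c * s)"
proof -
 obtain x y where xy: "x \<in> S" "\<gamma> = P x" "y \<in> S" "\<xi> = P y" using supp_eta assms(1,2) by blast
 have t: "0 <= t" "0 <= s" "0 < t" using assms by auto
 have sp: "0 < sinh (sqrt c * t)" "0 < sinh (sqrt c * s)" using c_pos assms t by auto
 have *: "\<bar>X x t - X y t\<bar> * sinh (sqrt c * s) <= \<bar>X x s - X y s\<bar> * sinh (sqrt c * t)"
  if "x \<in> S" "y \<in> S" "x <= y" for x y
  using X_contraction[OF that assms(3,4)] X_mono[OF that t(1)] X_mono[OF that t(2)] by (simp add: abs_minus_commute)
 have "\<bar>X x t - X y t\<bar> * sinh (sqrt c * s) <= \<bar>X x s - X y s\<bar> * sinh (sqrt c * t)"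
  using *[OF xy(1,3)] *[OF xy(3,1)] by (cases "x <= y") (auto simp: abs_minus_commute)
 then show ?thesis using sp unfolding xy P_apply[OF t(1)] P_apply[OF t(2)] by (simp add: divide_le_eq le_divide_eq mult_ac)
qed

lemma gap_supp:
 assumes "\<gamma> \<in> supp \<eta>" "\<xi> \<in> supp \<eta>" "0 <= t" "ev \<gamma> 0 >= ev \<xi> 0"
 shows "0 <= ev \<gamma> t - ev \<xi> t"
  "ev \<gamma> t - ev \<xi> t <= cosh (sqrt c * t) * (ev \<gamma> 0 - ev \<xi> 0)
   + 1 / sqrt c * sinh (sqrt c * t) * (J (ev \<gamma> 0) - J (ev \<xi> 0))"
proof -
 obtain x y where xy: "x \<in> S" "\<gamma> = P x" "y \<in> S" "\<xi> = P y" using supp_eta assms(1,2) by blast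
 have le: "y <= x" using assms(4) xy by (simp add: P_apply X_initial)
 show "0 <= ev \<gamma> t - ev \<xi> t" using X_mono[OF xy(3,1) le assms(3)] xy by (simp add: P_apply assms(3))
 show "ev \<gamma> t - ev \<xi> t <= cosh (sqrt c * t) * (ev \<gamma> 0 - ev \<xi> 0)
   + 1 / sqrt c * sinh (sqrt c * t) * (J (ev \<gamma> 0) - J (ev \<xi> 0))"
  using X_gap[OF xy(3,1) le assms(3)] xy by (simp add: P_apply assms(3) X_initial)
qed

lemma slope_energy: "(\<integral>\<^sup>+\<gamma>. quotient_energy m n \<gamma> \<partial>\<eta>) <= ennreal (real n * (E0 * exp (rate * (real n + 1))))"
proof -
 interpret pp: pair_sigma_finite \<eta> lborel by unfold_locales
 let ?B = "E0 * exp (rate * (real n + 1))"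
 have B0: "0 <= ?B" using E0 by simp
 have inner: "(\<integral>\<^sup>+\<gamma>. ennreal ((path_slope m \<gamma> t)\<^sup>2) * indicator {0..real n} t \<partial>\<eta>) <= ennreal ?B * indicator {0..real n} t" for t
 proof (cases "t \<in> {0..real n}")
  case True
  let ?h = "1 / real (Suc m)"
  have th: "0 <= t" "t <= t + ?h" "0 <= t + ?h" "t + ?h <= real n + 1" using True by (auto intro: add_mono)
  have "(\<integral>\<^sup>+\<gamma>. ennreal ((path_slope m \<gamma> t)\<^sup>2) \<partial>\<eta>) = (\<integral>\<^sup>+x. ennreal ((path_slope m (P x) t)\<^sup>2) \<partial>\<rho>)"
   unfolding \<eta>_def by (subst nn_integral_distr) auto
  also have "... = (\<integral>\<^sup>+x. ennreal ((real (Suc m))\<^sup>2 * (X x (t + ?h) - X x t)\<^sup>2) \<partial>\<rho>)"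
   unfolding path_slope_def P_apply[OF th(1)] P_apply[OF th(3)] power_mult_distrib ..
  also have "... = ennreal (\<integral>x. (real (Suc m))\<^sup>2 * (X x (t + ?h) - X x t)\<^sup>2 \<partial>\<rho>)"
  proof (rule nn_integral_eq_integral)
   have "integrable \<rho> (%x. (X x (t + ?h) - X x t)\<^sup>2)"
   proof (rule square_integrableI)
   show "\<bar>X x (t + ?h) - X x t\<bar> <= 2 * growth (real n + 1) * (1 + \<bar>x\<bar>)" for x
   using X_bound[of "t + ?h" "real n + 1" x] X_bound[of t "real n + 1" x] th by auto
   qed measurable
   then show "integrable \<rho> (%x. (real (Suc m))\<^sup>2 * (X x (t + ?h) - X x t)\<^sup>2)" by (rule integrable_mult_right)
  qed auto
  also have "(\<integral>x. (real (Suc m))\<^sup>2 * (X x (t + ?h) - X x t)\<^sup>2 \<partial>\<rho>) <= ?B"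
  proof -
   have "(\<integral>x. (X x (t + ?h) - X x t)\<^sup>2 \<partial>\<rho>) <= ?h\<^sup>2 * (E0 * exp (rate * (t + ?h)))"
   using X_displacement[OF th(1,2)] by simp
   also have "... <= ?h\<^sup>2 * ?B"
   using th(4) rate_nonneg E0(1) by (intro mult_left_mono) (auto intro: mult_left_mono)
   finally have "(real (Suc m))\<^sup>2 * (\<integral>x. (X x (t + ?h) - X x t)\<^sup>2 \<partial>\<rho>) <= (real (Suc m))\<^sup>2 * (?h\<^sup>2 * ?B)"
   by (rule mult_left_mono) simp
   also have "... = ?B" by (simp add: power_divide)
   finally show ?thesis by simp
  qed
  finally show ?thesis using True by (simp add: ennreal_leI)
 qed simp
 have "(\<integral>\<^sup>+\<gamma>. quotient_energy m n \<gamma> \<partial>\<eta>) = (\<integral>\<^sup>+t. \<integral>\<^sup>+\<gamma>. ennreal ((path_slope m \<gamma> t)\<^sup>2) * indicator {0..real n} t \<partial>\<eta> \<partial>lborel)"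
  unfolding quotient_energy_def by (rule pp.Fubini'[symmetric]) measurable
 also have "... <= (\<integral>\<^sup>+t. ennreal ?B * indicator {0..real n} t \<partial>lborel)" by (rule nn_integral_mono) (rule inner)
 also have "... = ennreal ?B * emeasure lborel {0..real n}" by (rule nn_integral_cmult_indicator) simp
 also have "... = ennreal (real n * ?B)" using B0 by (simp add: ennreal_mult mult.commute)
 finally show ?thesis .
qed

lemma liminf_energy: "(\<integral>\<^sup>+\<gamma>. liminf (%m. quotient_energy m n \<gamma>) \<partial>\<eta>) <= ennreal (real n * (E0 * exp (rate * (real n + 1))))"
proof -
 have "(\<integral>\<^sup>+\<gamma>. liminf (%m. quotient_energy m n \<gamma>) \<partial>\<eta>) <= liminf (%m. \<integral>\<^sup>+\<gamma>. quotient_energy m n \<gamma> \<partial>\<eta>)"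
  by (rule nn_integral_liminf) measurable
 also have "... <= ennreal (real n * (E0 * exp (rate * (real n + 1))))"
  using slope_energy by (intro Liminf_le) auto
 finally show ?thesis .
qed

text \<open>The difference quotients have bounded mean energy, so by Fatou almost every path has difference quotients
with energy bounded along a subsequence.\<close>

lemma AE_abs_continuous:
 "AE \<gamma> in \<eta>. \<forall>n. liminf (%m. quotient_energy m n \<gamma>) < \<top> & abs_continuous_on {0..real n} (ev \<gamma>)"
proof -
 have "AE \<gamma> in \<eta>. liminf (%m. quotient_energy m n \<gamma>) < \<top>" for n
 proof -
  have "AE \<gamma> in \<eta>. liminf (%m. quotient_energy m n \<gamma>) ~= \<infinity>"
  proof (rule nn_integral_PInf_AE)
   show "(\<integral>\<^sup>+\<gamma>. liminf (%m. quotient_energy m n \<gamma>) \<partial>\<eta>) ~= \<infinity>"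
   using liminf_energy[of n] by (auto simp: top_unique)
  qed measurable
  then show ?thesis by eventually_elim (simp add: top.not_eq_extremum)
 qed
 then have "AE \<gamma> in \<eta>. \<forall>n. liminf (%m. quotient_energy m n \<gamma>) < \<top>" by (intro AE_all_countable[THEN iffD2] allI)
 then show ?thesis
 proof eventually_elim
  case (elim \<gamma>)
  have "abs_continuous_on {0..real n} (ev \<gamma>)" for n
  proof -
   from liminf_frequently_le[OF elim[rule_format, of n]] obtain C where
   "C >= 0 & (\<exists>\<^sub>F m in sequentially. quotient_energy m n \<gamma> <= ennreal C)" by (rule exE)
   then show ?thesis by (intro quotient_energy_abs_continuous[of n \<gamma> C]) auto
  qed
  then show ?case using elim by blast
 qed
qed

lemma AE_path_abs_continuous: "AE \<gamma> in \<eta>. \<forall>T>0. abs_continuous_on {0..T} (ev \<gamma>)"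
 using AE_abs_continuous
proof eventually_elim
 case (elim \<gamma>)
 show ?case
 proof (intro allI impI)
  fix T :: real assume "0 < T"
  from real_arch_simple[of T] obtain n :: nat where "T <= real n" by (rule exE)
  then have sub: "{0..T} \<subseteq> {0..real n}" by simp
  show "abs_continuous_on {0..T} (ev \<gamma>)"
   by (rule abs_continuous_on_subset[OF conjunct2[OF elim[rule_format]] sub])
 qed
qed

lemma AE_path_differentiable: "AE \<gamma> in \<eta>. AE t in lborel. 0 < t --> ev \<gamma> differentiable (at t)"
 using AE_path_abs_continuous by eventually_elim (rule abs_continuous_on_AE_differentiable, blast)

lemma AE_time_differentiable: "AE t in lborel. AE \<gamma> in \<eta>. 0 < t --> ev \<gamma> differentiable (at t)"
proof -
 interpret pp: pair_sigma_finite \<eta> lborel by unfold_locales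
 have se: "sets (\<eta> \<Otimes>\<^sub>M lborel) = sets (borel \<Otimes>\<^sub>M (lborel :: real measure))" by (rule sets_pair_measure_cong) simp_all
 have sp: "space (\<eta> \<Otimes>\<^sub>M lborel) = space (borel \<Otimes>\<^sub>M (lborel :: real measure))" by (rule sets_eq_imp_space_eq[OF se])
 show ?thesis
  by (rule iffD1[OF pp.AE_commute AE_path_differentiable])
   (unfold se sp, rule differentiable_set_measurable)
qed

lemma phi_lower: assumes n: "1 <= n" shows "exp ((c + 1) * (real n)\<^sup>2 - (c + 1)) <= phi c (real n)"
proof -
 have "exp (- (c + 1)) = (LBINT s:{0..1::real}. exp (- (c + 1)))" by (simp add: set_lebesgue_integral_def)
 also have "... <= (LBINT s:{0..1}. exp (- (c + 1) * s\<^sup>2))"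
 proof (rule set_integral_mono)
  show "set_integrable lborel {0..1::real} (%s. exp (- (c + 1)))"
   by (rule borel_integrable_atLeastAtMost') (intro continuous_intros)
  show "set_integrable lborel {0..1} (%s. exp (- (c + 1) * s\<^sup>2))"
   by (rule borel_integrable_atLeastAtMost') (intro continuous_intros)
  fix s :: real assume "s \<in> {0..1}"
  then have "s\<^sup>2 <= 1" by (simp add: power_le_one)
  then have "(c + 1) * s\<^sup>2 <= (c + 1) * 1" using c_pos by (intro mult_left_mono) auto
  then show "exp (- (c + 1)) <= exp (- (c + 1) * s\<^sup>2)"
   unfolding exp_le_cancel_iff mult_minus_left neg_le_iff_le by (simp only: mult_1_right)
 qed
 also have "... <= (LBINT s:{0..real n}. exp (- (c + 1) * s\<^sup>2))"
  unfolding set_lebesgue_integral_def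
 proof (rule integral_mono)
  have "set_integrable lborel {0..u} (%s. exp (- (c + 1) * s\<^sup>2))" for u :: real
   by (rule borel_integrable_atLeastAtMost') (intro continuous_intros)
  then show "integrable lborel (%s. indicator {0..1} s *\<^sub>R exp (- (c + 1) * s\<^sup>2))"
   "integrable lborel (%s. indicator {0..real n} s *\<^sub>R exp (- (c + 1) * s\<^sup>2))" by (auto simp: set_integrable_def)
 qed (use n in \<open>auto split: split_indicator\<close>)
 finally have "exp ((c + 1) * (real n)\<^sup>2) * exp (- (c + 1)) <= phi c (real n)"
  unfolding phi_def by (intro mult_left_mono) auto
 then show ?thesis by (simp only: exp_diff exp_minus divide_inverse)
qed

text \<open>\<open>phi\<close> grows like a Gaussian and beats the exponential growth of the kinetic energy.\<close>

lemma phi_ratio: "\<exists>K\<ge>0. \<forall>n\<ge>1. (real n * (E0 * exp (rate * (real n + 1))) + C) / phi c (real n) <= K" if C: "0 <= C"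
proof -
 define K where "K = (E0 + C) * exp ((1 + rate)\<^sup>2 / 4 + rate + c + 1)"
 have "(real n * (E0 * exp (rate * (real n + 1))) + C) / phi c (real n) <= K" if n: "1 <= n" for n
 proof -
  let ?r = "real n"
  have e1: "?r <= exp ?r" using exp_ge_add_one_self[of ?r] by linarith
  have "?r * (E0 * exp (rate * (?r + 1))) <= exp ?r * (E0 * exp (rate * (?r + 1)))"
   using e1 E0(1) by (intro mult_right_mono) auto
  also have "... = E0 * exp (?r + rate * (?r + 1))" by (simp add: exp_add)
  finally have "?r * (E0 * exp (rate * (?r + 1))) + C <= E0 * exp (?r + rate * (?r + 1)) + C * exp (?r + rate * (?r + 1))"
   using C rate_nonneg mult_left_mono[of 1 "exp (?r + rate * (?r + 1))" C] by simp
  also have "... = (E0 + C) * exp (?r + rate * (?r + 1))" by (simp add: distrib_right)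
  also have "... <= (E0 + C) * exp (((1 + rate)\<^sup>2 / 4 + rate + c + 1) + ((c + 1) * ?r\<^sup>2 - (c + 1)))"
  proof (intro mult_left_mono)
   have "0 <= (?r - (1 + rate) / 2)\<^sup>2" by simp
   then have "(1 + rate) * ?r <= ?r\<^sup>2 + (1 + rate)\<^sup>2 / 4" by (simp add: power2_eq_square field_simps)
   moreover have "0 <= c * ?r\<^sup>2" using c_pos by simp
   ultimately show "exp (?r + rate * (?r + 1)) <= exp (((1 + rate)\<^sup>2 / 4 + rate + c + 1) + ((c + 1) * ?r\<^sup>2 - (c + 1)))"
   by (simp add: algebra_simps)
  qed (use E0(1) C in auto)
  also have "... = K * exp ((c + 1) * ?r\<^sup>2 - (c + 1))" unfolding K_def exp_add[of "(1 + rate)\<^sup>2 / 4 + rate + c + 1"] by (simp only: mult.assoc)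
  also have "... <= K * phi c ?r"
   using phi_lower[OF n] E0(1) C by (intro mult_left_mono) (auto simp: K_def)
  finally have "?r * (E0 * exp (rate * (?r + 1))) + C <= K * phi c ?r" .
  moreover have "0 < phi c ?r" using phi_lower[OF n] exp_gt_zero by (rule less_le_trans[rotated])
  ultimately show ?thesis by (simp add: pos_divide_le_eq)
 qed
 moreover have "0 <= K" using E0(1) C by (simp add: K_def)
 ultimately show ?thesis by blast
qed

lemma Psi_finite: "AE \<gamma> in \<eta>. Psi c \<gamma> < \<infinity>"
proof -
 define C where "C = (\<integral>x. x\<^sup>2 \<partial>\<rho>)"
 have C: "0 <= C" unfolding C_def by (rule Bochner_Integration.integral_nonneg) simp
 have sq: "(\<integral>\<^sup>+\<gamma>. ennreal ((ev \<gamma> 0)\<^sup>2) \<partial>\<eta>) = ennreal C"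
 proof -
  have "(\<integral>\<^sup>+\<gamma>. ennreal ((ev \<gamma> 0)\<^sup>2) \<partial>\<eta>) = (\<integral>\<^sup>+x. ennreal ((X x 0)\<^sup>2) \<partial>\<rho>)"
   unfolding \<eta>_def by (subst nn_integral_distr) (auto simp: P_apply)
  also have "... = (\<integral>\<^sup>+x. ennreal (x\<^sup>2) \<partial>\<rho>)"
   by (rule nn_integral_cong_AE) (use AE_S in \<open>auto elim!: eventually_mono simp: X_initial\<close>)
  also have "... = ennreal C" unfolding C_def by (rule nn_integral_eq_integral[OF moment]) auto
  finally show ?thesis .
 qed
 from phi_ratio[OF C] obtain K where K: "K >= 0 & (\<forall>n\<ge>1. (real n * (E0 * exp (rate * (real n + 1))) + C) / phi c (real n) <= K)" by (rule exE)
 let ?w = "%n. ennreal (1 / (2 ^ Suc n * phi c (real (Suc n))))"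
 let ?L = "%n \<gamma>. liminf (%m. quotient_energy m (Suc n) \<gamma>) + ennreal ((ev \<gamma> 0)\<^sup>2)"
 have "(\<integral>\<^sup>+\<gamma>. (\<Sum>n. ?w n * ?L n \<gamma>) \<partial>\<eta>) = (\<Sum>n. \<integral>\<^sup>+\<gamma>. ?w n * ?L n \<gamma> \<partial>\<eta>)"
  by (rule nn_integral_suminf) measurable
 also have "... <= (\<Sum>n. ennreal (K * (1 / 2 ^ Suc n)))"
 proof (rule suminf_le)
  fix n
  have ph: "0 < phi c (real (Suc n))" using phi_lower[of "Suc n"] exp_gt_zero by (intro less_le_trans[OF exp_gt_zero]) auto
  let ?A = "real (Suc n) * (E0 * exp (rate * (real (Suc n) + 1)))"
  have A0: "0 <= ?A" using E0(1) by simp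
  have "(\<integral>\<^sup>+\<gamma>. ?w n * ?L n \<gamma> \<partial>\<eta>) = ?w n * (\<integral>\<^sup>+\<gamma>. ?L n \<gamma> \<partial>\<eta>)" by (rule nn_integral_cmult) measurable
  also have "(\<integral>\<^sup>+\<gamma>. ?L n \<gamma> \<partial>\<eta>) = (\<integral>\<^sup>+\<gamma>. liminf (%m. quotient_energy m (Suc n) \<gamma>) \<partial>\<eta>) + ennreal C"
   by (subst nn_integral_add) (auto simp: sq)
  also have "?w n * ((\<integral>\<^sup>+\<gamma>. liminf (%m. quotient_energy m (Suc n) \<gamma>) \<partial>\<eta>) + ennreal C) <= ?w n * (ennreal ?A + ennreal C)"
   by (intro mult_left_mono add_mono liminf_energy) auto
  also have "... = ennreal (1 / (2 ^ Suc n * phi c (real (Suc n))) * (?A + C))"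
   unfolding ennreal_plus[OF A0 C, symmetric]
   by (rule ennreal_mult[symmetric]) (use A0 C ph in auto)
  also have "... <= ennreal (K * (1 / 2 ^ Suc n))"
  proof (rule ennreal_leI)
   have "(?A + C) / phi c (real (Suc n)) <= K" using conjunct2[OF K, rule_format, of "Suc n"] by simp
   then have "(?A + C) / phi c (real (Suc n)) * (1 / 2 ^ Suc n) <= K * (1 / 2 ^ Suc n)" by (rule mult_right_mono) simp
   then show "1 / (2 ^ Suc n * phi c (real (Suc n))) * (?A + C) <= K * (1 / 2 ^ Suc n)" by (simp add: mult_ac)
  qed
  finally show "(\<integral>\<^sup>+\<gamma>. ?w n * ?L n \<gamma> \<partial>\<eta>) <= ennreal (K * (1 / 2 ^ Suc n))" .
 qed auto
 also have "... = ennreal (\<Sum>n. K * (1 / 2 ^ Suc n))"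
  by (rule suminf_ennreal2) (use K summable_mult[OF summable_half_powers, of K] in auto)
 also have "... < \<top>" by simp
 finally have "(\<integral>\<^sup>+\<gamma>. (\<Sum>n. ?w n * ?L n \<gamma>) \<partial>\<eta>) ~= \<infinity>" by simp
 then have fin: "AE \<gamma> in \<eta>. (\<Sum>n. ?w n * ?L n \<gamma>) ~= \<infinity>" by (intro nn_integral_PInf_AE) measurable
 show ?thesis
  using fin AE_abs_continuous AE_path_abs_continuous AE_path_differentiable
 proof eventually_elim
  case (elim \<gamma>)
  have pe: "path_energy n \<gamma> <= liminf (%m. quotient_energy m n \<gamma>)" for n
   by (rule path_energy_le_liminf[OF elim(4)])
  have "path_energy n \<gamma> < \<infinity>" for n using pe[of n] elim(2) by (auto intro: le_less_trans)
  then have ac: "\<gamma> \<in> ac_paths" using elim(3) by (simp add: ac_paths_def)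
  have "Psi c \<gamma> <= (\<Sum>n. ?w n * ?L n \<gamma>)"
   unfolding Psi_def using ac pe by (simp only: if_True) (intro suminf_le mult_left_mono add_mono, auto)
  then show ?case using elim(1) by (auto simp: top.not_eq_extremum intro: le_less_trans)
 qed
qed

section \<open>The velocity field\<close>

definition ratio :: "real => real => real" where
 "ratio s t = sinh (sqrt c * t) / sinh (sqrt c * s)"

lemma X_contraction_abs:
 assumes xy: "x \<in> S" "y \<in> S" and st: "0 < s" "s <= t"
 shows "\<bar>X y t - X x t\<bar> <= ratio s t * \<bar>X y s - X x s\<bar>"
proof -
 have sp: "0 < sinh (sqrt c * s)" by (rule sqrt_c_sinh_pos[OF c_pos st(1)])
 have *: "\<bar>X y t - X x t\<bar> <= ratio s t * \<bar>X y s - X x s\<bar>" if "x \<in> S" "y \<in> S" "x <= y" for x y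
 proof -
  have "0 <= X y t - X x t" "0 <= X y s - X x s" using X_mono[OF that] st by auto
  moreover have "X y t - X x t <= (X y s - X x s) * sinh (sqrt c * t) / sinh (sqrt c * s)"
   using X_contraction[OF that st] by (simp only: pos_le_divide_eq[OF sp])
  ultimately show ?thesis by (simp add: ratio_def mult.commute)
 qed
 show ?thesis
 proof (cases "x <= y")
  case True then show ?thesis using *[OF xy] by simp
 next
  case False then show ?thesis using *[OF xy(2,1)] by (simp add: abs_minus_commute)
 qed
qed

lemma ratio_nonneg: "0 < s ==> s <= t ==> 0 <= ratio s t"
 unfolding ratio_def using c_pos by (intro divide_nonneg_nonneg) auto

text \<open>The position at time \<open>s\<close> determines the position at a later time \<open>t\<close> in a Lipschitz way.  This formula is the
McShane extension from the positions that are actually occupied; the supremum over a dense sequence makes it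
Borel in all variables, and no selection of preimages is needed.\<close>

definition flow :: "real => real => real => real" where
 "flow s t z = (SUP k. X (q k) t - ratio s t * \<bar>z - X (q k) s\<bar>)"

lemma q_in: "q k \<in> S" using q(1) by blast

lemma flow_bdd:
 assumes st: "0 < s" "s <= t" shows "bdd_above (range (%k. X (q k) t - ratio s t * \<bar>z - X (q k) s\<bar>))"
proof (rule bdd_aboveI2)
 fix k
 have "X (q k) t - X (q 0) t <= ratio s t * \<bar>X (q k) s - X (q 0) s\<bar>"
  using X_contraction_abs[OF q_in q_in st, of k 0] by linarith
 also have "... <= ratio s t * (\<bar>z - X (q 0) s\<bar> + \<bar>z - X (q k) s\<bar>)"
  by (rule mult_left_mono[OF _ ratio_nonneg[OF st]]) linarith
 finally show "X (q k) t - ratio s t * \<bar>z - X (q k) s\<bar> <= X (q 0) t + ratio s t * \<bar>z - X (q 0) s\<bar>"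
  by (simp add: distrib_left)
qed

lemma X_tendsto_initial:
 assumes "!!n. u n \<in> S" "x \<in> S" "u \<longlonglongrightarrow> x" "0 <= t" shows "(%n. X (u n) t) \<longlonglongrightarrow> X x t"
proof -
 have "(%n. P (u n)) \<longlonglongrightarrow> P x" by (rule continuous_on_tendsto_compose[OF P_cont assms(3,2)]) (simp add: assms(1))
 moreover have "isCont (%\<gamma>. ev \<gamma> t) (P x)"
  using eval_continuous[OF assms(4)] by (simp add: continuous_on_eq_continuous_at)
 ultimately have "(%n. ev (P (u n)) t) \<longlonglongrightarrow> ev (P x) t" by (rule isCont_tendsto_compose[rotated])
 then show ?thesis by (simp add: P_apply assms(4))
qed

lemma flow_eq:
 assumes st: "0 < s" "s <= t" and x: "x \<in> S" shows "flow s t (X x s) = X x t"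
proof (rule antisym)
 show "flow s t (X x s) <= X x t"
  unfolding flow_def
 proof (rule cSUP_least)
  fix k
  show "X (q k) t - ratio s t * \<bar>X x s - X (q k) s\<bar> <= X x t"
   using X_contraction_abs[OF x q_in st, of k] by (simp add: abs_minus_commute)
 qed simp
 have "x \<in> closure (range q)" using q(2) x by blast
 from this[unfolded closure_sequential] obtain u where u': "(\<forall>n. u n \<in> range q) & u \<longlonglongrightarrow> x" by (rule exE)
 note u = conjunct1[OF u', rule_format] conjunct2[OF u']
 have uS: "u n \<in> S" for n using u(1)[of n] q(1) by blast
 have st0: "0 <= t" "0 <= s" using st by auto
 have "(%n. X (u n) t - ratio s t * \<bar>X x s - X (u n) s\<bar>) \<longlonglongrightarrow> X x t - ratio s t * \<bar>X x s - X x s\<bar>"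
  by (intro tendsto_intros X_tendsto_initial uS x u(2) st0)
 moreover have "X (u n) t - ratio s t * \<bar>X x s - X (u n) s\<bar> <= flow s t (X x s)" for n
 proof -
  from u(1)[of n] obtain k where "u n = q k" by (rule rangeE)
  then show ?thesis unfolding flow_def using cSUP_upper[OF UNIV_I flow_bdd[OF st], of k "X x s"] by simp
 qed
 ultimately show "X x t <= flow s t (X x s)" by (intro LIMSEQ_le_const2[where a="flow s t (X x s)"]) auto
qed

lemma flow_measurable: assumes "0 < s" "s <= t" shows "flow s t \<in> borel_measurable borel"
 unfolding flow_def[abs_def] by (rule borel_measurable_cSUP) (simp, simp, measurable, rule flow_bdd[OF assms])

lemma X_max_cont: "continuous_on UNIV (%t. X x (max 0 t))"
 by (rule continuous_on_compose2[OF X_cont_all[of x]]) (auto intro!: continuous_intros)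

lemma flow_joint_measurable:
 assumes h: "0 < h"
 shows "(%p. flow (snd p) (snd p + h) (fst p)) \<in> borel_measurable (restrict_space borel (UNIV \<times> {0<..}))"
  (is "_ \<in> borel_measurable ?M")
proof -
 have M: "space ?M = UNIV \<times> {0<..}" by (simp add: space_restrict_space)
 have [measurable]: "fst \<in> borel_measurable ?M" "snd \<in> borel_measurable ?M"
  by (auto intro!: measurable_restrict_space1 borel_measurable_continuous_onI continuous_intros)
 have [measurable]: "(%t. X x (max 0 t)) \<in> borel_measurable borel" for x
  by (rule borel_measurable_continuous_onI[OF X_max_cont])
 have [measurable]: "(%t. sinh (sqrt c * t)) \<in> borel_measurable borel"
  by (intro borel_measurable_continuous_onI continuous_intros)
 have eq: "X (q k) (snd p + h) - ratio (snd p) (snd p + h) * \<bar>fst p - X (q k) (snd p)\<bar> =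
   X (q k) (max 0 (snd p + h)) - sinh (sqrt c * (snd p + h)) / sinh (sqrt c * snd p) * \<bar>fst p - X (q k) (max 0 (snd p))\<bar>"
  if "p \<in> space ?M" for k p
  using that h by (auto simp: M ratio_def max_def)
 show ?thesis
  unfolding flow_def
 proof (rule borel_measurable_cSUP)
  fix k
  show "(%p. X (q k) (snd p + h) - ratio (snd p) (snd p + h) * \<bar>fst p - X (q k) (snd p)\<bar>) \<in> borel_measurable ?M"
  proof (rule measurable_cong[THEN iffD2])
   fix p assume "p \<in> space ?M"
   then show "X (q k) (snd p + h) - ratio (snd p) (snd p + h) * \<bar>fst p - X (q k) (snd p)\<bar> =
   X (q k) (max 0 (snd p + h)) - sinh (sqrt c * (snd p + h)) / sinh (sqrt c * snd p) * \<bar>fst p - X (q k) (max 0 (snd p))\<bar>"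
   by (rule eq)
  qed measurable
 next
  fix p assume "p \<in> space ?M"
  then have "0 < snd p" by (auto simp: M)
  then show "bdd_above (range (%k. X (q k) (snd p + h) - ratio (snd p) (snd p + h) * \<bar>fst p - X (q k) (snd p)\<bar>))"
   using h by (intro flow_bdd) auto
 qed auto
qed

text \<open>The right derivative of the flow.  The default value of \<open>lim\<close> at points without a limit does no harm, as Borel
measurability of \<open>lim\<close> holds everywhere.\<close>

definition velocity :: "real \<times> real => real" where
 "velocity p = lim (%n. real (Suc n) * (flow (snd p) (snd p + 1 / real (Suc n)) (fst p) - fst p))"

lemma velocity_measurable: "velocity \<in> borel_measurable (restrict_space borel (UNIV \<times> {0<..}))"
proof -
 have [measurable]: "fst \<in> borel_measurable (restrict_space (borel :: (real \<times> real) measure) (UNIV \<times> {0<..}))"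
  by (auto intro!: measurable_restrict_space1 borel_measurable_continuous_onI continuous_intros)
 have [measurable]: "(%p. flow (snd p) (snd p + 1 / real (Suc n)) (fst p)) \<in> borel_measurable (restrict_space borel (UNIV \<times> {0<..}))" for n
  by (rule flow_joint_measurable) simp
 show ?thesis unfolding velocity_def[abs_def] by (intro borel_measurable_lim_metric) measurable
qed

lemma inverse_Suc_tendsto: "(%n. 1 / real (Suc n)) \<longlonglongrightarrow> 0"
 using LIMSEQ_inverse_real_of_nat by (simp add: inverse_eq_divide)

lemma path_slope_tendsto_deriv:
 assumes "ev \<gamma> differentiable (at t)"
 shows "(%n. path_slope n \<gamma> t) \<longlonglongrightarrow> deriv (ev \<gamma>) t"
proof -
 have "(ev \<gamma> has_real_derivative deriv (ev \<gamma>) t) (at t)"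
  using assms by (simp add: DERIV_deriv_iff_real_differentiable)
 then have "(%h. (ev \<gamma> (t + h) - ev \<gamma> t) / h) \<midarrow>0\<rightarrow> deriv (ev \<gamma>) t"
  unfolding DERIV_def .
 from quotient_sequence[OF this inverse_Suc_tendsto] show ?thesis
  unfolding path_slope_def by (simp add: mult.commute)
qed

lemma velocity_eq:
 assumes x: "x \<in> S" and t: "0 < t" and d: "ev (P x) differentiable (at t)"
 shows "(ev (P x) has_real_derivative velocity (X x t, t)) (at t)"
proof -
 have "path_slope n (P x) t = real (Suc n) * (flow t (t + 1 / real (Suc n)) (X x t) - X x t)" for n
 proof -
  have "0 <= t + 1 / real (Suc n)" using t by simp
  then show ?thesis using t by (simp add: path_slope_def P_apply flow_eq[OF t _ x])
 qed
 then have "(%n. real (Suc n) * (flow t (t + 1 / real (Suc n)) (X x t) - X x t)) \<longlonglongrightarrow> deriv (ev (P x)) t"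
  using path_slope_tendsto_deriv[OF d] by simp
 then have "velocity (X x t, t) = deriv (ev (P x)) t" unfolding velocity_def by (simp add: limI)
 then show ?thesis using d by (simp add: DERIV_deriv_iff_real_differentiable)
qed

lemma AE_eta_range: "AE \<gamma> in \<eta>. \<exists>x\<in>S. \<gamma> = P x"
proof -
 have cl: "closed (P ` S)"
  unfolding closed_sequential_limits
 proof (intro allI impI)
  fix f \<gamma> assume "(\<forall>n. f n \<in> P ` S) & f \<longlonglongrightarrow> \<gamma>"
  then have f: "!!n. \<exists>x\<in>S. f n = P x" "f \<longlonglongrightarrow> \<gamma>" by auto
  have fu: "ev (f n) 0 \<in> S" "P (ev (f n) 0) = f n" for n
  proof -
   obtain x where x: "x \<in> S" "f n = P x" using f(1) by (rule bexE)
   show "ev (f n) 0 \<in> S" "P (ev (f n) 0) = f n" unfolding x(2) using x(1) by (simp_all add: P_apply X_initial)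
  qed
  have "isCont (%\<gamma>. ev \<gamma> 0) \<gamma>" using eval_continuous[of 0] by (simp add: continuous_on_eq_continuous_at)
  then have ul: "(%n. ev (f n) 0) \<longlonglongrightarrow> ev \<gamma> 0" using f(2) by (rule isCont_tendsto_compose)
  have S: "ev \<gamma> 0 \<in> S" by (rule closed_sequentially[OF closed_supp fu(1) ul])
  have "(%n. P (ev (f n) 0)) \<longlonglongrightarrow> P (ev \<gamma> 0)"
   by (rule continuous_on_tendsto_compose[OF P_cont ul S]) (simp add: fu(1))
  then have "f \<longlonglongrightarrow> P (ev \<gamma> 0)" unfolding fu(2) .
  then have "\<gamma> = P (ev \<gamma> 0)" by (rule LIMSEQ_unique[OF f(2)])
  then show "\<gamma> \<in> P ` S" using S by blast
 qed
 have "{\<gamma>. \<gamma> \<in> P ` S} \<in> sets borel" using borel_closed[OF cl] by simp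
 then have "(AE \<gamma> in \<eta>. \<gamma> \<in> P ` S) \<longleftrightarrow> (AE x in \<rho>. P x \<in> P ` S)" by (rule AE_eta_iff)
 moreover have "AE x in \<rho>. P x \<in> P ` S" using AE_S by eventually_elim blast
 ultimately have "AE \<gamma> in \<eta>. \<gamma> \<in> P ` S" by simp
 then show ?thesis by eventually_elim blast
qed

lemma velocity_field:
 "AE \<gamma> in \<eta>. AE t in lborel. t > 0 --> (ev \<gamma> has_real_derivative velocity (ev \<gamma> t, t)) (at t)"
 using AE_eta_range AE_path_differentiable
proof eventually_elim
 case (elim \<gamma>)
 then obtain x where x: "x \<in> S" "\<gamma> = P x" by blast
 from elim(2) show ?case
 proof eventually_elim
  case (elim t)
  show ?case
  proof
   assume t: "0 < t"
   have "(ev (P x) has_real_derivative velocity (X x t, t)) (at t)"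
   by (rule velocity_eq[OF x(1) t]) (use elim t x(2) in simp)
   then show "(ev \<gamma> has_real_derivative velocity (ev \<gamma> t, t)) (at t)"
   using t x(2) by (simp add: P_apply)
  qed
 qed
qed

end

context prob_space
begin

section \<open>Tools: square integrable limits and projections\<close>

lemma integrable_square_mult:
 fixes f g :: "'a => real"
 assumes [measurable]: "f \<in> borel_measurable M" "g \<in> borel_measurable M"
  and i: "integrable M (%x. (f x)\<^sup>2)" "integrable M (%x. (g x)\<^sup>2)"
 shows "integrable M (%x. f x * g x)"
proof (rule Bochner_Integration.integrable_bound)
 show "integrable M (%x. (f x)\<^sup>2 + (g x)\<^sup>2)" using i by (rule Bochner_Integration.integrable_add)
 have "\<bar>a * b\<bar> <= a\<^sup>2 + b\<^sup>2" for a b :: real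
 proof -
  have "0 <= (\<bar>a\<bar> - \<bar>b\<bar>)\<^sup>2" "0 <= a\<^sup>2" "0 <= b\<^sup>2" by simp_all
  moreover have "0 <= \<bar>a\<bar> * \<bar>b\<bar>" by simp
  ultimately show ?thesis unfolding power2_diff power2_abs abs_mult by linarith
 qed
 then show "AE x in M. norm (f x * g x) <= norm ((f x)\<^sup>2 + (g x)\<^sup>2)" by simp
qed measurable

lemma integrable_of_square:
 fixes f :: "'a => real"
 assumes "f \<in> borel_measurable M" "integrable M (%x. (f x)\<^sup>2)" shows "integrable M f"
 using integrable_square_mult[OF assms(1) _ assms(2), of "%_. 1"] by simp

lemma integrable_square_diff:
 fixes f g :: "'a => real"
 assumes "f \<in> borel_measurable M" "g \<in> borel_measurable M"
  and "integrable M (%x. (f x)\<^sup>2)" "integrable M (%x. (g x)\<^sup>2)"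
 shows "integrable M (%x. (f x - g x)\<^sup>2)"
proof -
 have "integrable M (%x. (f x)\<^sup>2 + (g x)\<^sup>2 - 2 * (f x * g x))"
  by (intro Bochner_Integration.integrable_diff Bochner_Integration.integrable_add integrable_mult_right integrable_square_mult assms)
 then show ?thesis by (simp add: power2_diff mult.assoc)
qed

lemma square_bound_limit:
 fixes f :: "nat => 'a => real"
 assumes [measurable]: "!!n. f n \<in> borel_measurable M" "g \<in> borel_measurable M"
  and i: "!!n. integrable M (%x. (f n x)\<^sup>2)" and K: "!!n. (\<integral>x. (f n x)\<^sup>2 \<partial>M) <= K"
  and lim: "AE x in M. (%n. f n x) \<longlonglongrightarrow> g x"
 shows "integrable M (%x. (g x)\<^sup>2)" "(\<integral>x. (g x)\<^sup>2 \<partial>M) <= K"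
proof -
 have K0: "0 <= K" by (rule order_trans[OF _ K]) simp
 have "(\<integral>\<^sup>+x. ennreal ((g x)\<^sup>2) \<partial>M) = (\<integral>\<^sup>+x. liminf (%n. ennreal ((f n x)\<^sup>2)) \<partial>M)"
 proof (rule nn_integral_cong_AE)
  show "AE x in M. ennreal ((g x)\<^sup>2) = liminf (%n. ennreal ((f n x)\<^sup>2))"
   using lim
  proof eventually_elim
   case (elim x)
   have "(%n. ennreal ((f n x)\<^sup>2)) \<longlonglongrightarrow> ennreal ((g x)\<^sup>2)" by (intro tendsto_ennrealI tendsto_power elim)
   from lim_imp_Liminf[OF _ this] show ?case by simp
  qed
 qed
 also have "... <= liminf (%n. \<integral>\<^sup>+x. ennreal ((f n x)\<^sup>2) \<partial>M)" by (rule nn_integral_liminf) measurable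
 also have "... <= ennreal K"
 proof -
  have "(\<integral>\<^sup>+x. ennreal ((f n x)\<^sup>2) \<partial>M) <= ennreal K" for n
   using nn_integral_eq_integral[OF i[of n]] K[of n] by (simp add: ennreal_leI)
  then show ?thesis by (intro Liminf_le) auto
 qed
 finally have b: "(\<integral>\<^sup>+x. ennreal ((g x)\<^sup>2) \<partial>M) <= ennreal K" .
 show gi: "integrable M (%x. (g x)\<^sup>2)"
  by (rule integrableI_bounded) (use b in \<open>auto intro: le_less_trans\<close>)
 show "(\<integral>x. (g x)\<^sup>2 \<partial>M) <= K"
  using b K0 unfolding nn_integral_eq_integral[OF gi, simplified] by (simp add: ennreal_le_iff)
qed

text \<open>Bounded second moments make the sequence uniformly integrable.  The truncation level is chosen such that the
part above it contributes at most half of the tolerance.\<close>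

lemma square_bound_L1_limit:
 fixes f :: "nat => 'a => real"
 assumes [measurable]: "!!n. f n \<in> borel_measurable M" "g \<in> borel_measurable M" "h \<in> borel_measurable M"
  and i: "!!n. integrable M (%x. (f n x)\<^sup>2)" and K: "!!n. (\<integral>x. (f n x)\<^sup>2 \<partial>M) <= K"
  and lim: "AE x in M. (%n. f n x) \<longlonglongrightarrow> g x"
  and B: "!!x. \<bar>h x\<bar> <= B"
 shows "(%n. \<integral>x. f n x * h x \<partial>M) \<longlonglongrightarrow> (\<integral>x. g x * h x \<partial>M)"
proof -
 have K0: "0 <= K" by (rule order_trans[OF _ K]) simp
 have B0: "0 <= B" using order_trans[OF abs_ge_zero B] .
 have g2: "integrable M (%x. (g x)\<^sup>2)" "(\<integral>x. (g x)\<^sup>2 \<partial>M) <= K"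
  by (rule square_bound_limit[OF _ _ i K lim]; measurable)+
 have fi: "integrable M (f n)" for n by (rule integrable_of_square[OF _ i]) measurable
 have gi: "integrable M g" by (rule integrable_of_square[OF _ g2(1)]) measurable
 have d2: "integrable M (%x. (f n x - g x)\<^sup>2)" for n by (rule integrable_square_diff[OF _ _ i g2(1)]) measurable
 have d2K: "(\<integral>x. (f n x - g x)\<^sup>2 \<partial>M) <= 4 * K" for n
 proof -
  have "(f n x - g x)\<^sup>2 <= 2 * (f n x)\<^sup>2 + 2 * (g x)\<^sup>2" for x
  proof -
   have "0 <= (f n x + g x)\<^sup>2" by simp
   then show ?thesis unfolding power2_sum power2_diff by linarith
  qed
  then have "(\<integral>x. (f n x - g x)\<^sup>2 \<partial>M) <= (\<integral>x. 2 * (f n x)\<^sup>2 + 2 * (g x)\<^sup>2 \<partial>M)"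
   by (intro integral_mono d2 Bochner_Integration.integrable_add integrable_mult_right i g2(1))
  also have "... = 2 * (\<integral>x. (f n x)\<^sup>2 \<partial>M) + 2 * (\<integral>x. (g x)\<^sup>2 \<partial>M)"
   by (subst Bochner_Integration.integral_add) (auto intro!: integrable_mult_right i g2(1))
  finally show ?thesis using K[of n] g2(2) by linarith
 qed
 have L1: "(%n. \<integral>x. \<bar>f n x - g x\<bar> \<partial>M) \<longlonglongrightarrow> 0"
 proof (rule LIMSEQ_I)
  fix e :: real assume e: "0 < e"
  define m where "m = 8 * (K + 1) / e"
  have m: "0 < m" using e K0 by (simp add: m_def)
  have "(%n. \<integral>x. min \<bar>f n x - g x\<bar> m \<partial>M) \<longlonglongrightarrow> (\<integral>x. 0 \<partial>M)"
  proof (rule integral_dominated_convergence[where w="%_. m"])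
   show "AE x in M. (%n. min \<bar>f n x - g x\<bar> m) \<longlonglongrightarrow> 0"
   using lim
   proof eventually_elim
   case (elim x)
   then have "(%n. min \<bar>f n x - g x\<bar> m) \<longlonglongrightarrow> min \<bar>g x - g x\<bar> m" by (intro tendsto_intros)
   then show ?case using m by simp
   qed
  qed (use m in auto)
  then have "\<forall>\<^sub>F n in sequentially. (\<integral>x. min \<bar>f n x - g x\<bar> m \<partial>M) < e / 2" using e by (intro order_tendstoD(2)) auto
  then obtain N where N: "!!n. n >= N ==> (\<integral>x. min \<bar>f n x - g x\<bar> m \<partial>M) < e / 2" by (auto simp: eventually_sequentially)
  have "norm ((\<integral>x. \<bar>f n x - g x\<bar> \<partial>M) - 0) < e" if n: "n >= N" for n
  proof -
   have mi: "integrable M (%x. min \<bar>f n x - g x\<bar> m)"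
   by (rule integrable_const_bound[where B=m]) (use m in auto)
   have ptw: "\<bar>f n x - g x\<bar> <= min \<bar>f n x - g x\<bar> m + 1 / m * (f n x - g x)\<^sup>2" for x
   proof (cases "\<bar>f n x - g x\<bar> <= m")
   case True then show ?thesis using m by simp
   next
   case False
   then have "m * \<bar>f n x - g x\<bar> <= \<bar>f n x - g x\<bar> * \<bar>f n x - g x\<bar>" by (intro mult_right_mono) auto
   then have "m * \<bar>f n x - g x\<bar> <= (f n x - g x)\<^sup>2" by (simp add: power2_eq_square)
   then have "\<bar>f n x - g x\<bar> <= 1 / m * (f n x - g x)\<^sup>2" using m by (simp add: field_simps)
   then show ?thesis using m by (simp add: min_def)
   qed
   have "(\<integral>x. \<bar>f n x - g x\<bar> \<partial>M) <= (\<integral>x. min \<bar>f n x - g x\<bar> m + 1 / m * (f n x - g x)\<^sup>2 \<partial>M)"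
   by (rule integral_mono[OF _ _ ptw])
   (intro integrable_abs Bochner_Integration.integrable_diff fi gi Bochner_Integration.integrable_add mi integrable_mult_right d2)+
   also have "... = (\<integral>x. min \<bar>f n x - g x\<bar> m \<partial>M) + 1 / m * (\<integral>x. (f n x - g x)\<^sup>2 \<partial>M)"
   by (subst Bochner_Integration.integral_add) (auto intro!: integrable_mult_right d2 mi)
   also have "... < e / 2 + 1 / m * (4 * (K + 1))"
   using N[OF n] d2K[of n] m by (intro add_less_le_mono mult_left_mono) auto
   also have "1 / m * (4 * (K + 1)) = e / 2" using e K0 by (simp add: m_def field_simps)
   finally have "(\<integral>x. \<bar>f n x - g x\<bar> \<partial>M) < e" by simp
   moreover have "0 <= (\<integral>x. \<bar>f n x - g x\<bar> \<partial>M)" by (rule Bochner_Integration.integral_nonneg) simp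
   ultimately show ?thesis by simp
  qed
  then show "\<exists>no. \<forall>n\<ge>no. norm ((\<integral>x. \<bar>f n x - g x\<bar> \<partial>M) - 0) < e" by blast
 qed
 have bi: "integrable M (%x. k x * h x)" if "integrable M k" "k \<in> borel_measurable M" for k :: "'a => real"
 proof (rule Bochner_Integration.integrable_bound)
  show "integrable M (%x. B * k x)" using that(1) by (rule integrable_mult_right)
  have "\<bar>k x * h x\<bar> <= \<bar>B * k x\<bar>" for x
   using mult_left_mono[OF B[of x], of "\<bar>k x\<bar>"] B0 by (simp add: abs_mult mult.commute)
  then show "AE x in M. norm (k x * h x) <= norm (B * k x)" by simp
 qed (use that(2) in measurable)
 have "(%n. (\<integral>x. f n x * h x \<partial>M) - (\<integral>x. g x * h x \<partial>M)) \<longlonglongrightarrow> 0"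
 proof (rule tendsto_0_le[OF L1, where K=B], intro always_eventually allI)
  fix n
  have "(\<integral>x. f n x * h x \<partial>M) - (\<integral>x. g x * h x \<partial>M) = (\<integral>x. (f n x - g x) * h x \<partial>M)"
   unfolding left_diff_distrib by (rule Bochner_Integration.integral_diff[symmetric]) (auto intro!: bi fi gi)
  also have "\<bar>...\<bar> <= (\<integral>x. \<bar>(f n x - g x) * h x\<bar> \<partial>M)" by (rule integral_abs_bound)
  also have "... <= (\<integral>x. B * \<bar>f n x - g x\<bar> \<partial>M)"
  proof (rule integral_mono)
   show "integrable M (%x. \<bar>(f n x - g x) * h x\<bar>)" by (intro integrable_abs bi Bochner_Integration.integrable_diff fi gi) measurable
   show "integrable M (%x. B * \<bar>f n x - g x\<bar>)" by (intro integrable_mult_right integrable_abs Bochner_Integration.integrable_diff fi gi)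
   show "\<bar>(f n x - g x) * h x\<bar> <= B * \<bar>f n x - g x\<bar>" for x
   using mult_left_mono[OF B[of x], of "\<bar>f n x - g x\<bar>"] by (simp add: abs_mult mult.commute)
  qed
  finally show "norm ((\<integral>x. f n x * h x \<partial>M) - (\<integral>x. g x * h x \<partial>M)) <= norm (\<integral>x. \<bar>f n x - g x\<bar> \<partial>M) * B"
   by (simp add: mult.commute)
 qed
 then show ?thesis by (rule LIM_zero_cancel)
qed

text \<open>The images under \<open>\<xi>\<close> of the measures with densities \<open>max 0 R\<close> and \<open>max 0 (- R)\<close> agree on rays, which are limits
of continuous functions, hence are equal; integrating \<open>h\<close> against them gives the claim for all Borel \<open>h\<close>.\<close>

lemma conditional_expectation_zero:
 fixes R \<xi> :: "'a => real"
 assumes [measurable]: "R \<in> borel_measurable M" "\<xi> \<in> borel_measurable M" "h \<in> borel_measurable borel"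
  and R2: "integrable M (%x. (R x)\<^sup>2)"
  and zero: "!!g. continuous_on UNIV g ==> (!!z. 0 <= g z & g z <= (1::real)) ==> (\<integral>x. R x * g (\<xi> x) \<partial>M) = 0"
  and h2: "integrable M (%x. (h (\<xi> x))\<^sup>2)"
 shows "(\<integral>x. R x * h (\<xi> x) \<partial>M) = 0"
proof -
 have Ri: "integrable M R" by (rule integrable_of_square[OF _ R2]) measurable
 have ray: "(\<integral>x. R x * indicator {a<..} (\<xi> x) \<partial>M) = 0" for a
 proof -
  define g where "g n z = min 1 (real n * max 0 (z - a))" for n and z :: real
  have lim: "(%n. g n z) \<longlonglongrightarrow> indicator {a<..} z" for z
  proof (cases "a < z")
   case True
   obtain N :: nat where N: "1 / (z - a) <= real N" using real_arch_simple by blast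
   have "g n z = 1" if "n >= N" for n
   proof -
   have "1 <= real N * (z - a)" using N True by (simp add: pos_divide_le_eq)
   also have "... <= real n * (z - a)" using that True by (intro mult_right_mono) auto
   finally show ?thesis using True by (simp add: g_def)
   qed
   then have "\<forall>\<^sub>F n in sequentially. g n z = 1" by (auto simp: eventually_sequentially)
   then show ?thesis using True by (simp add: tendsto_eventually)
  next
   case False then show ?thesis by (simp add: g_def max_def)
  qed
  have [measurable]: "g n \<in> borel_measurable borel" for n unfolding g_def[abs_def] by measurable
  have g01: "0 <= g n z & g n z <= 1" for n z by (auto simp: g_def)
  have "(%n. \<integral>x. R x * g n (\<xi> x) \<partial>M) \<longlonglongrightarrow> (\<integral>x. R x * indicator {a<..} (\<xi> x) \<partial>M)"
  proof (rule integral_dominated_convergence[where w="%x. \<bar>R x\<bar>"])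
   show "AE x in M. (%n. R x * g n (\<xi> x)) \<longlonglongrightarrow> R x * indicator {a<..} (\<xi> x)"
   by (intro AE_I2 tendsto_mult_left lim)
   show "AE x in M. norm (R x * g n (\<xi> x)) <= \<bar>R x\<bar>" for n
   using g01[of n] by (intro AE_I2) (auto simp: abs_mult intro: mult_right_le_one_le)
   show "integrable M (%x. \<bar>R x\<bar>)" by (rule integrable_abs[OF Ri])
  qed measurable
  moreover have "(\<integral>x. R x * g n (\<xi> x) \<partial>M) = 0" for n
  proof (rule zero)
   show "continuous_on UNIV (g n)" unfolding g_def[abs_def] by (intro continuous_intros)
  qed (rule g01)
  ultimately have "(%n::nat. 0::real) \<longlonglongrightarrow> (\<integral>x. R x * indicator {a<..} (\<xi> x) \<partial>M)" by simp
  then show ?thesis by (simp add: LIMSEQ_const_iff)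
 qed
 let ?p = "%x. max 0 (R x)" and ?m = "%x. max 0 (- R x)"
 have pi: "integrable M ?p" "integrable M ?m" using Ri by auto
 let ?N = "%r. distr (density M (%x. ennreal (r x))) borel \<xi>"
 have em: "emeasure (?N r) {a<..} = ennreal (\<integral>x. r x * indicator {a<..} (\<xi> x) \<partial>M)"
  if r: "integrable M r" "!!x. 0 <= r x" for r :: "'a => real" and a
 proof -
  have [measurable]: "r \<in> borel_measurable M" using r(1) by simp
  have "emeasure (?N r) {a<..} = (\<integral>\<^sup>+x. ennreal (r x) * indicator (\<xi> -` {a<..} \<inter> space M) x \<partial>M)"
   by (simp add: emeasure_distr emeasure_density)
  also have "... = (\<integral>\<^sup>+x. ennreal (r x * indicator {a<..} (\<xi> x)) \<partial>M)"
   by (rule nn_integral_cong) (auto split: split_indicator)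
  also have "... = ennreal (\<integral>x. r x * indicator {a<..} (\<xi> x) \<partial>M)"
  proof (rule nn_integral_eq_integral)
   show "integrable M (%x. r x * indicator {a<..} (\<xi> x))"
   by (rule Bochner_Integration.integrable_bound[OF r(1)]) (auto split: split_indicator)
  qed (use r(2) in auto)
  finally show ?thesis .
 qed
 have "?N ?p = ?N ?m"
 proof (rule measure_eqI_lessThan)
  fix a
  have ii: "integrable M (%x. r x * indicator {a<..} (\<xi> x))" if "integrable M r" for r :: "'a => real"
   by (rule Bochner_Integration.integrable_bound[OF that]) (use that in \<open>auto split: split_indicator\<close>)
  show "emeasure (?N ?p) {a<..} < \<infinity>" by (subst em[OF pi(1)]) auto
  have "(\<integral>x. ?p x * indicator {a<..} (\<xi> x) \<partial>M) - (\<integral>x. ?m x * indicator {a<..} (\<xi> x) \<partial>M)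
   = (\<integral>x. ?p x * indicator {a<..} (\<xi> x) - ?m x * indicator {a<..} (\<xi> x) \<partial>M)"
   by (rule Bochner_Integration.integral_diff[symmetric]) (intro ii pi)+
  also have "... = (\<integral>x. R x * indicator {a<..} (\<xi> x) \<partial>M)"
   by (rule Bochner_Integration.integral_cong[OF refl]) (auto simp: max_def)
  finally show "emeasure (?N ?p) {a<..} = emeasure (?N ?m) {a<..}"
   by (subst em[OF pi(1)], simp, subst em[OF pi(2)], simp) (simp add: ray)
 qed auto
 then have eq: "(\<integral>z. h z \<partial>?N ?p) = (\<integral>z. h z \<partial>?N ?m)" by (rule arg_cong)
 have tr: "(\<integral>z. h z \<partial>?N r) = (\<integral>x. r x * h (\<xi> x) \<partial>M)" if "!!x. 0 <= r x" "r \<in> borel_measurable M" for r :: "'a => real"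
  using that by (subst integral_distr) (auto simp: integral_density)
 have r2: "integrable M (%x. r x * h (\<xi> x))" if "!!x. \<bar>r x\<bar> <= \<bar>R x\<bar>" "r \<in> borel_measurable M" for r :: "'a => real"
 proof (rule Bochner_Integration.integrable_bound[OF integrable_square_mult[OF assms(1) _ R2 h2]])
  show "AE x in M. norm (r x * h (\<xi> x)) <= norm (R x * h (\<xi> x))"
   using that(1) by (simp add: abs_mult mult_right_mono)
 qed (use that(2) in measurable)
 have "(\<integral>x. R x * h (\<xi> x) \<partial>M) = (\<integral>x. ?p x * h (\<xi> x) - ?m x * h (\<xi> x) \<partial>M)"
  by (rule Bochner_Integration.integral_cong[OF refl]) (auto simp: max_def)
 also have "... = (\<integral>x. ?p x * h (\<xi> x) \<partial>M) - (\<integral>x. ?m x * h (\<xi> x) \<partial>M)"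
  by (rule Bochner_Integration.integral_diff) (rule r2; auto)+
 also have "... = 0" using eq tr[of ?p] tr[of ?m] by simp
 finally show ?thesis .
qed

lemma integrable_pair_sum_bound:
 fixes f :: "'a \<times> 'a => real"
 assumes f: "f \<in> borel_measurable (M \<Otimes>\<^sub>M M)" and a: "integrable M a"
  and bnd: "!!x y. \<bar>f (x, y)\<bar> <= a x + a y"
 shows "integrable (M \<Otimes>\<^sub>M M) f"
proof -
 interpret pair_sigma_finite M M by unfold_locales
 have 1: "integrable (M \<Otimes>\<^sub>M M) (%z. a (fst z))"
  by (rule integrable_distr[of fst _ M]) (simp_all add: distr_pair_fst a)
 have 2: "integrable (M \<Otimes>\<^sub>M M) (%z. a (snd z))"
  using integrable_product_swap[OF 1] by (simp add: case_prod_beta')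
 show ?thesis
 proof (rule Bochner_Integration.integrable_bound[OF Bochner_Integration.integrable_add[OF 1 2] f], rule AE_I2)
  fix z show "norm (f z) <= norm (a (fst z) + a (snd z))" using bnd[of "fst z" "snd z"] by simp
 qed
qed

end

text \<open>Dini's argument: if \<open>f t > f s\<close>, tilt \<open>f\<close> by a small positive slope \<open>e\<close>; to the right of the last point where the
tilted function is at most its initial value, all difference quotients of \<open>f\<close> exceed \<open>e\<close>.\<close>

lemma nonincreasing_of_sequential_slopes:
 fixes f :: "real => real"
 assumes st: "s <= t" and cont: "continuous_on {s..t} f"
  and step: "!!r u. s <= r ==> r < t ==> (!!n. 0 < u n) ==> (!!n. r + u n <= t) ==> u \<longlonglongrightarrow> 0 ==>
   \<exists>\<phi>. \<phi> \<longlonglongrightarrow> 0 & (\<forall>n::nat. f (r + u n) - f r <= u n * \<phi> n)"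
 shows "f t <= f s"
proof (rule ccontr)
 assume neg: "~ f t <= f s"
 then have lt: "s < t" using st by (cases "s = t") auto
 define e where "e = (f t - f s) / (2 * (t - s))"
 have e: "0 < e" using neg lt by (simp add: e_def)
 define g where "g r = f r - e * r" for r
 have "e * (t - s) = (f t - f s) / 2" using lt by (simp add: e_def field_simps)
 then have et: "e * t - e * s = (f t - f s) / 2" by (simp only: right_diff_distrib)
 have "g t - g s = f t - f s - (e * t - e * s)" by (simp add: g_def)
 also have "... = (f t - f s) / 2" unfolding et by (simp add: field_simps)
 finally have "0 < g t - g s" using neg by simp
 then have gt: "g s < g t" by simp
 let ?A = "{r \<in> {s..t}. g r <= g s}"
 have gc: "continuous_on {s..t} g" unfolding g_def[abs_def] by (intro continuous_intros cont)
 have "closed ?A" by (rule continuous_on_closed_Collect_le[OF gc]) auto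
 moreover have "bounded ?A" by (rule bounded_subset[OF bounded_closed_interval[of s t]]) auto
 ultimately have "compact ?A" by (simp add: compact_eq_bounded_closed)
 moreover have "s \<in> ?A" using st by simp
 ultimately obtain u where u: "u \<in> ?A" "!!r. r \<in> ?A ==> r <= u" using compact_attains_sup[of ?A] by blast
 have ut: "s <= u" "u < t" using u(1) gt by (auto simp: less_le)
 define k where "k n = (t - u) / real (Suc n)" for n
 have k: "0 < k n" "u + k n <= t" for n
 proof -
  show "0 < k n" using ut by (simp add: k_def)
  have "(t - u) * 1 <= (t - u) * real (Suc n)" using ut by (intro mult_left_mono) auto
  then have "k n <= t - u" unfolding k_def by (simp only: pos_divide_le_eq of_nat_0_less_iff zero_less_Suc mult_1_right)
  then show "u + k n <= t" by simp
 qed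
 have "(%n. (t - u) * inverse (real (Suc n))) \<longlonglongrightarrow> (t - u) * 0"
  by (intro tendsto_mult_left LIMSEQ_inverse_real_of_nat)
 then have k0: "k \<longlonglongrightarrow> 0" by (simp add: k_def[abs_def] divide_inverse)
 from step[of u k, OF ut k k0] obtain \<phi> where \<phi>: "\<phi> \<longlonglongrightarrow> 0" "\<forall>n. f (u + k n) - f u <= k n * \<phi> n" by blast
 have "e < \<phi> n" for n
 proof -
  have "~ g (u + k n) <= g s" using u(2)[of "u + k n"] k[of n] ut by auto
  then have "g u < g (u + k n)" using u(1) by auto
  then have "e * k n < f (u + k n) - f u" by (simp add: g_def distrib_left)
  also have "... <= k n * \<phi> n" using \<phi>(2) by blast
  finally have "k n * e < k n * \<phi> n" by (simp only: mult.commute)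
  then show ?thesis using k(1)[of n] by simp
 qed
 then have "e <= 0" by (intro LIMSEQ_le_const[OF \<phi>(1)]) (auto intro: less_imp_le)
 then show False using e by simp
qed

section \<open>The momentum equation\<close>

lemma slope_sequence:
 assumes d: "(f has_real_derivative D) (at t within {0..T})"
  and u: "u \<longlonglongrightarrow> 0" "!!n. u n ~= 0" "!!n. t + u n \<in> {0..T}"
 shows "(%n::nat. (f (t + u n) - f t) / u n) \<longlonglongrightarrow> D"
proof -
 have "((%y. (f y - f t) / (y - t)) \<longlongrightarrow> D) (at t within {0..T})"
  using d by (simp add: has_field_derivative_iff)
 moreover have "filterlim (%n. t + u n) (at t within {0..T}) sequentially"
  unfolding filterlim_at
 proof
  show "\<forall>\<^sub>F n in sequentially. t + u n \<in> {0..T} & t + u n ~= t" using u(2,3) by simp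
  show "(%n. t + u n) \<longlonglongrightarrow> t" using tendsto_add[OF tendsto_const u(1), of t] by simp
 qed
 ultimately have "(%n. (f (t + u n) - f t) / (t + u n - t)) \<longlonglongrightarrow> D" by (rule filterlim_compose)
 then show ?thesis by simp
qed

lemma LBINT_origin: "(LBINT s:{0..0::real}. (g s :: real)) = 0"
 unfolding set_lebesgue_integral_def
 by (rule integral_eq_zero_AE, rule eventually_mono[OF AE_lborel_singleton[of 0]]) (simp add: indicator_def)

context interaction
begin

text \<open>Velocity of the collisionless trajectory \<open>Y\<close>.\<close>

definition Z :: "real => real => real" where
 "Z x t = (if x \<in> S then v0 x + (LBINT s:{0..t}. G x s) else 0)"

lemma Z_eq: "x \<in> S ==> Z x t = v0 x + (LBINT s:{0..t}. G x s)"
 by (simp add: Z_def)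

lemma G_integrable: "x \<in> S ==> set_integrable lborel {0..t} (G x)"
 by (rule borel_integrable_atLeastAtMost'[OF continuous_on_subset[OF G_cont]]) auto

lemma primitive_derivative:
 assumes g: "continuous_on {0..} g" and r: "r \<in> {0..T}"
 shows "((%t. LBINT s:{0..t}. g s) has_real_derivative g r) (at r within {0..T})"
proof -
 have "set_integrable lborel {0..t} g" for t
  by (rule borel_integrable_atLeastAtMost'[OF continuous_on_subset[OF g]]) auto
 then have "(LBINT s:{0..t}. g s) = integral {0..t} g" for t by (rule set_borel_integral_eq_integral(2))
 moreover have "((%t. integral {0..t} g) has_real_derivative g r) (at r within {0..T})"
  by (rule integral_has_real_derivative[OF continuous_on_subset[OF g] r]) auto
 ultimately show ?thesis by simp
qed

lemma Z_derivative:
 assumes x: "x \<in> S" and r: "r \<in> {0..T}" shows "(Z x has_real_derivative G x r) (at r within {0..T})"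
 unfolding Z_eq[OF x, abs_def] using DERIV_add[OF DERIV_const primitive_derivative[OF G_cont[OF x] r], of "v0 x"] by simp

lemma Y_derivative:
 assumes x: "x \<in> S" and r: "r \<in> {0..T}" shows "(Y x has_real_derivative Z x r) (at r within {0..T})"
proof -
 have sc: "continuous_on {0..} (%s. s * G x s)" by (intro continuous_intros G_cont x)
 have si: "set_integrable lborel {0..u} (%s. s * G x s)" for u
  by (rule borel_integrable_atLeastAtMost'[OF continuous_on_subset[OF sc]]) auto
 have "Y x u = x + u * v0 x + (u * (LBINT s:{0..u}. G x s) - (LBINT s:{0..u}. s * G x s))" for u
 proof -
  have "(LBINT s:{0..u}. (u - s) * G x s) = (LBINT s:{0..u}. u * G x s - s * G x s)" by (simp add: left_diff_distrib)
  also have "... = (LBINT s:{0..u}. u * G x s) - (LBINT s:{0..u}. s * G x s)"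
   by (rule set_integral_diff(2)[OF set_integrable_mult_right si]) (simp add: G_integrable[OF x])
  finally show ?thesis by (simp add: Y_eq[OF x])
 qed
 then have Y: "Y x = (%u. x + u * v0 x + (u * (LBINT s:{0..u}. G x s) - (LBINT s:{0..u}. s * G x s)))" by (rule ext)
 show ?thesis
  unfolding Y Z_eq[OF x]
  by (rule derivative_eq_intros primitive_derivative[OF G_cont[OF x] r] primitive_derivative[OF sc r] refl)+
   (simp add: algebra_simps)
qed

lemma Z_increment:
 assumes ab: "0 <= a" "a <= b" "b <= T" shows "\<bar>Z x b - Z x a\<bar> <= (b - a) * (force_growth T * (1 + \<bar>x\<bar>))"
proof (cases "x \<in> S")
 case True
 have "norm (Z x b - Z x a) <= force_growth T * (1 + \<bar>x\<bar>) * norm (b - a)"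
 proof (rule field_differentiable_bound[of "{0..T}" "Z x" "G x"])
  fix r assume r: "r \<in> {0..T}"
  show "(Z x has_real_derivative G x r) (at r within {0..T})" by (rule Z_derivative[OF True r])
  show "norm (G x r) <= force_growth T * (1 + \<bar>x\<bar>)" using G_bound r by simp
 qed (use ab in auto)
 then show ?thesis using ab by (simp add: mult.commute)
next
 case False then show ?thesis using ab force_growth_nonneg[of T] by (simp add: Z_def)
qed

lemma Z_linear_growth: "\<exists>C\<ge>0. \<forall>r x. 0 <= r & r <= T --> \<bar>Z x r\<bar> <= C * (1 + \<bar>x\<bar>)"
proof (cases "0 <= T")
 case T: True
 from v0_linear obtain D where D: "D >= 0 & (\<forall>a. \<bar>v0 a\<bar> <= D * (1 + \<bar>a\<bar>))" by (rule exE)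
 let ?C = "D + T * force_growth T"
 have C0: "0 <= ?C" using D T force_growth_nonneg[of T] by simp
 have "\<bar>Z x r\<bar> <= ?C * (1 + \<bar>x\<bar>)" if r: "0 <= r" "r <= T" for r x
 proof (cases "x \<in> S")
  case True
  have "Z x 0 = v0 x" unfolding Z_eq[OF True] LBINT_origin by simp
  then have "\<bar>Z x r\<bar> <= \<bar>v0 x\<bar> + \<bar>Z x r - Z x 0\<bar>" by linarith
  also have "... <= D * (1 + \<bar>x\<bar>) + (r - 0) * (force_growth T * (1 + \<bar>x\<bar>))"
   using D Z_increment[of 0 r T x] r by (intro add_mono) auto
  also have "... <= D * (1 + \<bar>x\<bar>) + T * (force_growth T * (1 + \<bar>x\<bar>))"
   using r force_growth_nonneg[of T] by (intro add_mono mult_right_mono) auto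
  finally show ?thesis by (simp add: distrib_right mult.assoc)
 next
  case False then show ?thesis using C0 by (simp add: Z_def)
 qed
 then show ?thesis using C0 by (intro exI[of _ ?C]) auto
qed (auto intro!: exI[of _ 0])

definition Z_growth :: "real => real" where
 "Z_growth T = (SOME C. C >= 0 & (\<forall>r x. 0 <= r & r <= T --> \<bar>Z x r\<bar> <= C * (1 + \<bar>x\<bar>)))"

lemma Z_growth_nonneg: "0 <= Z_growth T"
 and Z_bound: "0 <= r ==> r <= T ==> \<bar>Z x r\<bar> <= Z_growth T * (1 + \<bar>x\<bar>)"
 using someI_ex[OF Z_linear_growth[of T]] unfolding Z_growth_def by blast+

lemma Y_increment:
 assumes ab: "0 <= a" "a <= b" "b <= T" shows "\<bar>Y x b - Y x a\<bar> <= (b - a) * (Z_growth T * (1 + \<bar>x\<bar>))"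
proof (cases "x \<in> S")
 case True
 have "norm (Y x b - Y x a) <= Z_growth T * (1 + \<bar>x\<bar>) * norm (b - a)"
 proof (rule field_differentiable_bound[of "{0..T}" "Y x" "Z x"])
  fix r assume r: "r \<in> {0..T}"
  show "(Y x has_real_derivative Z x r) (at r within {0..T})" by (rule Y_derivative[OF True r])
  show "norm (Z x r) <= Z_growth T * (1 + \<bar>x\<bar>)" using Z_bound r by simp
 qed (use ab in auto)
 then show ?thesis using ab by (simp add: mult.commute)
next
 case False then show ?thesis using ab Z_growth_nonneg[of T] by (simp add: Y_def)
qed

lemma Y_bound: assumes u: "0 <= u" "u <= T" shows "\<bar>Y x u\<bar> <= (1 + T * Z_growth T) * (1 + \<bar>x\<bar>)"
proof -
 have 0: "\<bar>Y x 0\<bar> <= \<bar>x\<bar>"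
 proof -
  have "(LBINT s:{0..0}. (0 - s) * G x s) = 0" by (rule LBINT_origin)
  then show ?thesis by (simp add: Y_def)
 qed
 have "\<bar>Y x u\<bar> <= \<bar>x\<bar> + (u - 0) * (Z_growth T * (1 + \<bar>x\<bar>))" using 0 Y_increment[of 0 u T x] u by linarith
 also have "... <= (1 + \<bar>x\<bar>) + T * (Z_growth T * (1 + \<bar>x\<bar>))"
  using u Z_growth_nonneg[of T] by (intro add_mono mult_right_mono) auto
 finally show ?thesis by (simp add: distrib_right mult.assoc)
qed

lemma right_slope_sequence:
 assumes "(f has_real_derivative D) (at t within {0..t + 1})" "0 <= t"
 shows "(%n. real (Suc n) * (f (t + 1 / real (Suc n)) - f t)) \<longlonglongrightarrow> D"
proof -
 have "(%n. (f (t + 1 / real (Suc n)) - f t) / (1 / real (Suc n))) \<longlonglongrightarrow> D"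
  by (rule slope_sequence[OF assms(1) inverse_Suc_tendsto]) (use assms(2) in auto)
 then show ?thesis by (simp add: mult.commute)
qed

lemma Z_measurable [measurable]: assumes t: "0 <= t" shows "(%x. Z x t) \<in> borel_measurable borel"
proof (rule borel_measurable_LIMSEQ_real)
 show "(%x. real (Suc n) * (Y x (t + 1 / real (Suc n)) - Y x t)) \<in> borel_measurable borel" for n
  using t Y_measurable[of t] Y_measurable[of "t + 1 / real (Suc n)"] by simp
 fix x show "(%n. real (Suc n) * (Y x (t + 1 / real (Suc n)) - Y x t)) \<longlonglongrightarrow> Z x t"
 proof (cases "x \<in> S")
  case True then show ?thesis by (intro right_slope_sequence Y_derivative t) (use t in auto)
 next
  case False then show ?thesis by (simp add: Z_def Y_def)
 qed
qed

lemma G_measurable [measurable]: "(%x. G x t) \<in> borel_measurable borel"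
proof -
 have [measurable]: "w \<in> borel_measurable borel" by (rule w_measurable)
 show ?thesis unfolding G_def by measurable
qed

lemma X_square: "0 <= t ==> integrable \<rho> (%x. (X x t)\<^sup>2)"
 by (rule square_integrableI[OF X_measurable X_bound[where T=t]]) auto
lemma Y_square: "0 <= t ==> integrable \<rho> (%x. (Y x t)\<^sup>2)"
 by (rule square_integrableI[OF Y_measurable Y_bound[where T=t]]) auto
lemma Z_square: "0 <= t ==> integrable \<rho> (%x. (Z x t)\<^sup>2)"
 by (rule square_integrableI[OF Z_measurable Z_bound[where T=t]]) auto
lemma G_square: "0 <= t ==> integrable \<rho> (%x. (G x t)\<^sup>2)"
 by (rule square_integrableI[OF G_measurable G_bound[where T=t]]) auto

lemma measurable_rho: "f \<in> borel_measurable borel ==> f \<in> borel_measurable \<rho>" by simp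

lemma balance_borel:
 assumes u: "0 <= u" "u <= t" and [measurable]: "h \<in> borel_measurable borel"
  and h2: "integrable \<rho> (%x. (h (X x t))\<^sup>2)"
 shows "(\<integral>x. (X x u - Y x u) * h (X x t) \<partial>\<rho>) = 0"
proof (rule conditional_expectation_zero[where \<xi>="%x. X x t" and h=h, OF _ _ _ _ _ h2])
 have [measurable]: "(%x. Y x u) \<in> borel_measurable borel" by (rule Y_measurable[OF u(1)])
 show "(%x. X x u - Y x u) \<in> borel_measurable \<rho>" by measurable
 show "integrable \<rho> (%x. (X x u - Y x u)\<^sup>2)"
  by (rule integrable_square_diff[OF _ _ X_square[OF u(1)] Y_square[OF u(1)]]) measurable
 show "(\<integral>x. (X x u - Y x u) * g (X x t) \<partial>\<rho>) = 0" if "continuous_on UNIV g" "!!z. 0 <= g z & g z <= 1" for g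
  by (rule balance[OF u that(1), of 1]) (use that(2) in auto)
qed measurable

text \<open>Times at which almost every particle has a velocity.\<close>

definition good :: "real => bool" where
 "good t \<longleftrightarrow> 0 < t & (AE x in \<rho>. ev (P x) differentiable (at t))"

definition V :: "real => real => real" where "V x t = deriv (ev (P x)) t"

lemma AE_good: "AE t in lborel. 0 < t --> good t"
 using AE_time_differentiable
proof eventually_elim
 case (elim t)
 have "AE x in \<rho>. 0 < t --> ev (P x) differentiable (at t)"
  using elim unfolding \<eta>_def by (rule AE_distrD[rotated]) simp
 then show ?case by (auto simp: good_def)
qed

lemma V_measurable: assumes t: "0 < t" shows "(%x. V x t) \<in> borel_measurable borel"
 unfolding V_def using measurable_compose[OF P_measurable deriv_cpath_measurable[OF t]] .

lemma V_within: assumes g: "good t" shows "AE x in \<rho>. x \<in> S & (X x has_real_derivative V x t) (at t within {0..T})"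
 using AE_S conjunct2[OF g[unfolded good_def]]
proof eventually_elim
 case (elim x)
 have t: "0 < t" using g by (simp add: good_def)
 have "(ev (P x) has_real_derivative V x t) (at t)"
  unfolding V_def using elim(2) by (simp add: DERIV_deriv_iff_real_differentiable)
 then have "(X x has_real_derivative V x t) (at t)"
  by (rule has_field_derivative_transform_within_open[where S="{0<..}"]) (use t in \<open>auto simp: P_apply\<close>)
 then show ?case using elim(1) by (simp add: has_field_derivative_at_within)
qed

lemma V_square: assumes g: "good t" shows "integrable \<rho> (%x. (V x t)\<^sup>2)"
proof -
 have t: "0 < t" using g by (simp add: good_def)
 let ?f = "%n x. real (Suc n) * (X x (t + 1 / real (Suc n)) - X x t)"
 have sq: "integrable \<rho> (%x. (X x (t + 1 / real (Suc n)) - X x t)\<^sup>2)" for n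
  using t by (intro integrable_square_diff X_square) auto
 show ?thesis
 proof (rule square_bound_limit(1)[of ?f])
  show "integrable \<rho> (%x. (?f n x)\<^sup>2)" for n
   unfolding power_mult_distrib by (rule integrable_mult_right[OF sq])
  show "(\<integral>x. (?f n x)\<^sup>2 \<partial>\<rho>) <= E0 * exp (rate * (t + 1))" for n
  proof -
   let ?h = "1 / real (Suc n)"
   have "(\<integral>x. (X x (t + ?h) - X x t)\<^sup>2 \<partial>\<rho>) <= ?h\<^sup>2 * (E0 * exp (rate * (t + ?h)))"
   using X_displacement[of t "t + ?h"] t by simp
   also have "... <= ?h\<^sup>2 * (E0 * exp (rate * (t + 1)))"
   using rate_nonneg E0(1) by (intro mult_left_mono) (auto intro: mult_left_mono)
   finally have "(real (Suc n))\<^sup>2 * (\<integral>x. (X x (t + ?h) - X x t)\<^sup>2 \<partial>\<rho>) <= (real (Suc n))\<^sup>2 * (?h\<^sup>2 * (E0 * exp (rate * (t + 1))))"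
   by (rule mult_left_mono) simp
   also have "... = E0 * exp (rate * (t + 1))" by (simp add: power_divide)
   finally show ?thesis unfolding power_mult_distrib by simp
  qed
  show "AE x in \<rho>. (%n. ?f n x) \<longlonglongrightarrow> V x t"
   using V_within[OF g, of "t + 1"] by eventually_elim (rule right_slope_sequence, use t in auto)
  show "(%x. V x t) \<in> borel_measurable \<rho>" by (rule measurable_rho[OF V_measurable[OF t]])
 qed measurable
qed

text \<open>\<open>balance\<close> at the times \<open>t\<close> and \<open>t + u n < t\<close>, tested against the same function of the position at time \<open>t\<close>,
gives the identity for backward difference quotients, whose second moments are bounded.  Backward quotients
are essential: the test function must see the later position.\<close>

lemma V_balance:
 assumes g: "good t" and [measurable]: "h \<in> borel_measurable borel"
  and h2: "integrable \<rho> (%x. (h (X x t))\<^sup>2)"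
 shows "(\<integral>x. (V x t - Z x t) * h (X x t) \<partial>\<rho>) = 0"
proof (rule conditional_expectation_zero[where \<xi>="%x. X x t" and h=h, OF _ _ _ _ _ h2])
 have t: "0 < t" using g by (simp add: good_def)
 have t0: "0 <= t" using t by simp
 have [measurable]: "(%x. V x t) \<in> borel_measurable borel" by (rule V_measurable[OF t])
 have [measurable]: "(%x. Z x t) \<in> borel_measurable borel" by (rule Z_measurable[OF t0])
 show "(%x. V x t - Z x t) \<in> borel_measurable \<rho>" by measurable
 show "integrable \<rho> (%x. (V x t - Z x t)\<^sup>2)"
  by (rule integrable_square_diff[OF _ _ V_square[OF g] Z_square[OF t0]]) measurable
 fix k :: "real => real" assume kc: "continuous_on UNIV k" and k01: "!!z. 0 <= k z & k z <= 1"
 have [measurable]: "k \<in> borel_measurable borel" by (rule borel_measurable_continuous_onI[OF kc])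
 define u where "u n = - (t / real (Suc n))" for n
 have u: "u n ~= 0" "u n <= 0" "0 <= t + u n" "t + u n <= t" for n
  using t by (auto simp: u_def field_simps mult_left_mono)
 have "(%n. - t * (1 / real (Suc n))) \<longlonglongrightarrow> - t * 0" by (intro tendsto_mult_left inverse_Suc_tendsto)
 then have u0: "u \<longlonglongrightarrow> 0" by (simp add: u_def[abs_def])
 let ?a = "%n x. (X x (t + u n) - X x t) / u n" and ?b = "%n x. (Y x (t + u n) - Y x t) / u n"
 let ?f = "%n x. ?a n x - ?b n x"
 have [measurable]: "(%x. Y x t) \<in> borel_measurable borel" "(%x. Y x (t + u n)) \<in> borel_measurable borel" for n
  using Y_measurable t0 u(3)[of n] by auto
 have Ea: "integrable \<rho> (%x. (?a n x)\<^sup>2)" "(\<integral>x. (?a n x)\<^sup>2 \<partial>\<rho>) <= E0 * exp (rate * t)" for n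
 proof -
  have sq: "integrable \<rho> (%x. (X x (t + u n) - X x t)\<^sup>2)" by (intro integrable_square_diff X_square t0 u) auto
  show "integrable \<rho> (%x. (?a n x)\<^sup>2)" unfolding power_divide by (rule integrable_divide[OF sq])
  have "(\<integral>x. (X x (t + u n) - X x t)\<^sup>2 \<partial>\<rho>) = (\<integral>x. (X x t - X x (t + u n))\<^sup>2 \<partial>\<rho>)" by (simp add: power2_commute)
  also have "... <= (u n)\<^sup>2 * (E0 * exp (rate * t))" using X_displacement[OF u(3,4)] by simp
  finally show "(\<integral>x. (?a n x)\<^sup>2 \<partial>\<rho>) <= E0 * exp (rate * t)"
   unfolding power_divide using u(1)[of n] by (simp add: pos_divide_le_eq mult.commute)
 qed
 let ?C = "Z_growth t"
 have Bb: "\<bar>?b n x\<bar> <= ?C * (1 + \<bar>x\<bar>)" for n x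
 proof -
  have "\<bar>Y x t - Y x (t + u n)\<bar> <= (t - (t + u n)) * (?C * (1 + \<bar>x\<bar>))"
   by (rule Y_increment[OF u(3,4) order_refl])
  then have "\<bar>Y x (t + u n) - Y x t\<bar> <= \<bar>u n\<bar> * (?C * (1 + \<bar>x\<bar>))"
   using u(2)[of n] by (simp add: abs_minus_commute abs_of_nonpos)
  then show ?thesis using u(1)[of n] unfolding abs_divide by (simp add: pos_divide_le_eq mult.commute)
 qed
 have Eb: "integrable \<rho> (%x. (?b n x)\<^sup>2)" for n by (rule square_integrableI[OF _ Bb]) measurable
 have Ec: "integrable \<rho> (%x. (?C * (1 + \<bar>x\<bar>))\<^sup>2)"
  by (rule square_integrableI[where C="?C"]) (use Z_growth_nonneg[of t] in \<open>auto simp: abs_mult\<close>)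
 have Eb': "(\<integral>x. (?b n x)\<^sup>2 \<partial>\<rho>) <= (\<integral>x. (?C * (1 + \<bar>x\<bar>))\<^sup>2 \<partial>\<rho>)" for n
 proof (rule integral_mono[OF Eb Ec])
  fix x show "(?b n x)\<^sup>2 <= (?C * (1 + \<bar>x\<bar>))\<^sup>2"
  proof -
   have "\<bar>?b n x\<bar> <= ?C * (1 + \<bar>x\<bar>)" by (rule Bb)
   from power_mono[OF this abs_ge_zero, of 2] show ?thesis by (simp only: power2_abs)
  qed
 qed
 have Ef: "integrable \<rho> (%x. (?f n x)\<^sup>2)" for n by (rule integrable_square_diff[OF _ _ Ea(1) Eb]) measurable
 have "(%n. \<integral>x. ?f n x * k (X x t) \<partial>\<rho>) \<longlonglongrightarrow> (\<integral>x. (V x t - Z x t) * k (X x t) \<partial>\<rho>)"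
 proof (rule square_bound_L1_limit[OF _ _ _ Ef, where B=1])
  show "(\<integral>x. (?f n x)\<^sup>2 \<partial>\<rho>) <= 2 * (E0 * exp (rate * t)) + 2 * (\<integral>x. (?C * (1 + \<bar>x\<bar>))\<^sup>2 \<partial>\<rho>)" for n
  proof -
   have "(?f n x)\<^sup>2 <= 2 * (?a n x)\<^sup>2 + 2 * (?b n x)\<^sup>2" for x
   proof -
   have "0 <= (?a n x + ?b n x)\<^sup>2" by simp
   then show ?thesis unfolding power2_sum power2_diff by linarith
   qed
   then have "(\<integral>x. (?f n x)\<^sup>2 \<partial>\<rho>) <= (\<integral>x. 2 * (?a n x)\<^sup>2 + 2 * (?b n x)\<^sup>2 \<partial>\<rho>)"
   by (intro integral_mono Ef Bochner_Integration.integrable_add integrable_mult_right Ea Eb)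
   also have "... = 2 * (\<integral>x. (?a n x)\<^sup>2 \<partial>\<rho>) + 2 * (\<integral>x. (?b n x)\<^sup>2 \<partial>\<rho>)"
   by (subst Bochner_Integration.integral_add) (intro integrable_mult_right Ea Eb, intro integrable_mult_right Ea Eb, simp)
   finally show ?thesis using Ea(2)[of n] Eb'[of n] by linarith
  qed
  show "AE x in \<rho>. (%n. ?f n x) \<longlonglongrightarrow> V x t - Z x t"
   using V_within[OF g, of t]
  proof eventually_elim
   case (elim x)
   have T: "t + u n \<in> {0..t}" for n using u by auto
   show ?case
   by (intro tendsto_diff slope_sequence[OF conjunct2[OF elim] u0 u(1) T]
   slope_sequence[OF Y_derivative[OF conjunct1[OF elim]] u0 u(1) T]) (use t in auto)
  qed
  show "\<bar>k (X x t)\<bar> <= 1" for x using k01[of "X x t"] by simp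
 qed measurable
 moreover have "(\<integral>x. ?f n x * k (X x t) \<partial>\<rho>) = 0" for n
 proof -
  have k2: "integrable \<rho> (%x. (k (X x t))\<^sup>2)"
   by (rule integrable_const_bound[where B=1]) (use k01 in \<open>auto simp: power_le_one\<close>)
  have i: "integrable \<rho> (%x. (X x r - Y x r) * k (X x t))" if "0 <= r" "(%x. Y x r) \<in> borel_measurable borel" for r
   using that by (intro integrable_square_mult integrable_square_diff X_square Y_square k2) auto
  have "(\<integral>x. ?f n x * k (X x t) \<partial>\<rho>)
   = (\<integral>x. ((X x (t + u n) - Y x (t + u n)) * k (X x t) - (X x t - Y x t) * k (X x t)) / u n \<partial>\<rho>)"
   by (rule Bochner_Integration.integral_cong[OF refl]) (use u(1)[of n] in \<open>simp add: field_simps\<close>)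
  also have "... = ((\<integral>x. (X x (t + u n) - Y x (t + u n)) * k (X x t) \<partial>\<rho>) - (\<integral>x. (X x t - Y x t) * k (X x t) \<partial>\<rho>)) / u n"
   unfolding integral_divide_zero by (subst Bochner_Integration.integral_diff) (auto intro!: i u t0)
  also have "... = 0"
  proof -
   have k1: "\<bar>k z\<bar> <= 1" for z using k01[of z] by simp
   show ?thesis unfolding balance[OF u(3,4) kc k1] balance[OF t0 order_refl kc k1] by simp
  qed
  finally show ?thesis .
 qed
 ultimately have "(%n::nat. 0::real) \<longlonglongrightarrow> (\<integral>x. (V x t - Z x t) * k (X x t) \<partial>\<rho>)" by simp
 then show "(\<integral>x. (V x t - Z x t) * k (X x t) \<partial>\<rho>) = 0" by (simp add: LIMSEQ_const_iff)
qed measurable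

lemma eta_integral: "f \<in> borel_measurable borel ==> (\<integral>\<gamma>. f \<gamma> \<partial>\<eta>) = (\<integral>x. (f (P x) :: real) \<partial>\<rho>)"
 unfolding \<eta>_def by (rule integral_distr) simp_all

lemma eta_integrable: "f \<in> borel_measurable borel ==> integrable \<eta> f \<longleftrightarrow> integrable \<rho> (%x. (f (P x) :: real))"
 unfolding \<eta>_def by (rule integrable_distr_eq) simp_all

lemma convol_eta: "0 <= s ==> convol w (eval_distr s \<eta>) (X x s) = - G x s"
proof -
 assume s: "0 <= s"
 have [measurable]: "w \<in> borel_measurable borel" by (rule w_measurable)
 show ?thesis unfolding convol_def eval_distr_eq[OF s] G_def by (subst integral_distr) simp_all
qed

lemma force_integrable: assumes s: "0 <= s" shows "integrable (eval_distr s \<eta>) (%y. w (x - y))"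
proof -
 have [measurable]: "w \<in> borel_measurable borel" by (rule w_measurable)
 have "integrable \<rho> (%y. w (x - X y s))"
 proof (rule Bochner_Integration.integrable_bound[OF integrable_w_bound[of "1 + growth s" x]])
  show "AE y in \<rho>. norm (w (x - X y s)) <= norm (L * (1 + (1 + growth s) * (1 + \<bar>x\<bar>)) + L * (1 + growth s) * (1 + \<bar>y\<bar>))"
  proof (rule AE_I2)
   fix y
   have "1 * \<bar>x\<bar> <= (1 + growth s) * (1 + \<bar>x\<bar>)" using growth_nonneg[of s] by (intro mult_mono) auto
   then have 1: "\<bar>x\<bar> <= (1 + growth s) * (1 + \<bar>x\<bar>)" by simp
   have 2: "\<bar>X y s\<bar> <= (1 + growth s) * (1 + \<bar>y\<bar>)"
   using X_bound[OF s order_refl, of y] by (simp add: distrib_right)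
   show "norm (w (x - X y s)) <= norm (L * (1 + (1 + growth s) * (1 + \<bar>x\<bar>)) + L * (1 + growth s) * (1 + \<bar>y\<bar>))"
   using w_difference_bound[OF 1 2] unfolding real_norm_def by (rule order_trans[OF _ abs_ge_self])
  qed
 qed measurable
 then show ?thesis unfolding eval_distr_eq[OF s] by (subst integrable_distr_eq) simp_all
qed

lemma momentum_eq:
 assumes x: "x \<in> S" and t: "0 <= t"
 shows "set_integrable lborel {0..t} (%s. convol w (eval_distr s \<eta>) (ev (P x) s))"
  "v0 (ev (P x) 0) - (LBINT s:{0..t}. convol w (eval_distr s \<eta>) (ev (P x) s)) = Z x t"
proof -
 have e: "convol w (eval_distr s \<eta>) (ev (P x) s) = - G x s" if "s \<in> {0..t}" for s
  using that by (simp add: P_apply convol_eta)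
 have "set_integrable lborel {0..t} (%s. - G x s)" using G_integrable[OF x, of t] by (simp add: set_integrable_def)
 then show "set_integrable lborel {0..t} (%s. convol w (eval_distr s \<eta>) (ev (P x) s))"
  by (subst set_integrable_cong[OF refl refl e])
 have "(LBINT s:{0..t}. convol w (eval_distr s \<eta>) (ev (P x) s)) = (LBINT s:{0..t}. - G x s)"
  by (rule set_lebesgue_integral_cong) (auto simp: e)
 also have "... = - (LBINT s:{0..t}. G x s)" by (simp add: set_lebesgue_integral_def)
 finally show "v0 (ev (P x) 0) - (LBINT s:{0..t}. convol w (eval_distr s \<eta>) (ev (P x) s)) = Z x t"
  by (simp add: Z_eq x P_apply X_initial)
qed

lemma AE_momentum_integrable:
 "0 <= t ==> AE \<gamma> in \<eta>. set_integrable lborel {0..t} (%s. convol w (eval_distr s \<eta>) (ev \<gamma> s))"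
 using AE_eta_range by (auto elim!: eventually_mono simp: momentum_eq)

lemma momentum_measurable:
 "(%\<gamma>. v0 (ev \<gamma> 0) - (LBINT s:{0..t}. convol w (eval_distr s \<eta>) (ev \<gamma> s))) \<in> borel_measurable borel"
proof -
 have [measurable]: "w \<in> borel_measurable borel" "v0 \<in> borel_measurable borel" by (rule w_measurable v0_measurable)+
 have "convol w (eval_distr s \<eta>) z = (\<integral>\<xi>. w (z - ev \<xi> s) \<partial>\<eta>)" for s z
  unfolding convol_def by (rule integral_distr) measurable
 then show ?thesis unfolding set_lebesgue_integral_def by simp
qed

text \<open>Rewriting \<open>V_balance\<close> from labels to paths.\<close>

theorem momentum_balance:
 assumes g: "good t" and h[measurable]: "h \<in> borel_measurable borel" and h2: "integrable \<eta> (%\<gamma>. (h (ev \<gamma> t))\<^sup>2)"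
 shows "integrable \<eta> (%\<gamma>. deriv (ev \<gamma>) t * h (ev \<gamma> t))"
  "integrable \<eta> (%\<gamma>. (v0 (ev \<gamma> 0) - (LBINT s:{0..t}. convol w (eval_distr s \<eta>) (ev \<gamma> s))) * h (ev \<gamma> t))"
  "(\<integral>\<gamma>. deriv (ev \<gamma>) t * h (ev \<gamma> t) \<partial>\<eta>) =
   (\<integral>\<gamma>. (v0 (ev \<gamma> 0) - (LBINT s:{0..t}. convol w (eval_distr s \<eta>) (ev \<gamma> s))) * h (ev \<gamma> t) \<partial>\<eta>)"
proof -
 have t: "0 < t" "0 <= t" using g by (auto simp: good_def)
 define F where "F \<gamma> = v0 (ev \<gamma> 0) - (LBINT s:{0..t}. convol w (eval_distr s \<eta>) (ev \<gamma> s))" for \<gamma>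
 have [measurable]: "F \<in> borel_measurable borel" unfolding F_def by (rule momentum_measurable)
 have dm: "(%\<gamma>. deriv (ev \<gamma>) t) \<in> borel_measurable borel" by (rule deriv_cpath_measurable[OF t(1)])
 have [measurable]: "(%x. V x t) \<in> borel_measurable borel" by (rule V_measurable[OF t(1)])
 have [measurable]: "(%x. Z x t) \<in> borel_measurable borel" by (rule Z_measurable[OF t(2)])
 have m1: "(%\<gamma>. deriv (ev \<gamma>) t * h (ev \<gamma> t)) \<in> borel_measurable borel"
  and m2: "(%\<gamma>. F \<gamma> * h (ev \<gamma> t)) \<in> borel_measurable borel"
  and m3: "(%\<gamma>. (h (ev \<gamma> t))\<^sup>2) \<in> borel_measurable borel"
 proof -
  show "(%\<gamma>. deriv (ev \<gamma>) t * h (ev \<gamma> t)) \<in> borel_measurable borel"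
   by (rule borel_measurable_times[OF dm]) measurable
  show "(%\<gamma>. F \<gamma> * h (ev \<gamma> t)) \<in> borel_measurable borel"
   "(%\<gamma>. (h (ev \<gamma> t))\<^sup>2) \<in> borel_measurable borel" by measurable
 qed
 have h2': "integrable \<rho> (%x. (h (X x t))\<^sup>2)" using h2 unfolding eta_integrable[OF m3] P_apply[OF t(2)] .
 have iV: "integrable \<rho> (%x. V x t * h (X x t))" and iZ: "integrable \<rho> (%x. Z x t * h (X x t))"
  by (intro integrable_square_mult V_square[OF g] Z_square[OF t(2)] h2'; measurable)+
 have ae: "AE x in \<rho>. Z x t * h (X x t) = F (P x) * h (ev (P x) t)"
  using AE_S by eventually_elim (simp only: F_def momentum_eq(2)[OF _ t(2)] P_apply[OF t(2)])
 show "integrable \<eta> (%\<gamma>. deriv (ev \<gamma>) t * h (ev \<gamma> t))"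
  unfolding eta_integrable[OF m1] using iV by (simp only: V_def P_apply[OF t(2)])
 have F1: "(%x. Z x t * h (X x t)) \<in> borel_measurable \<rho>" "(%x. F (P x) * h (ev (P x) t)) \<in> borel_measurable \<rho>"
  by measurable
 show "integrable \<eta> (%\<gamma>. (v0 (ev \<gamma> 0) - (LBINT s:{0..t}. convol w (eval_distr s \<eta>) (ev \<gamma> s))) * h (ev \<gamma> t))"
  unfolding F_def[symmetric] eta_integrable[OF m2] by (rule iffD1[OF integrable_cong_AE[OF F1 ae] iZ])
 have "(\<integral>x. V x t * h (X x t) \<partial>\<rho>) - (\<integral>x. Z x t * h (X x t) \<partial>\<rho>) = (\<integral>x. (V x t - Z x t) * h (X x t) \<partial>\<rho>)"
  unfolding left_diff_distrib by (rule Bochner_Integration.integral_diff[OF iV iZ, symmetric])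
 also have "... = 0" by (rule V_balance[OF g h h2'])
 finally have "(\<integral>x. V x t * h (X x t) \<partial>\<rho>) = (\<integral>x. Z x t * h (X x t) \<partial>\<rho>)" by simp
 also have "... = (\<integral>x. F (P x) * h (ev (P x) t) \<partial>\<rho>)" by (rule integral_cong_AE[OF F1 ae])
 finally show "(\<integral>\<gamma>. deriv (ev \<gamma>) t * h (ev \<gamma> t) \<partial>\<eta>) =
   (\<integral>\<gamma>. (v0 (ev \<gamma> 0) - (LBINT s:{0..t}. convol w (eval_distr s \<eta>) (ev \<gamma> s))) * h (ev \<gamma> t) \<partial>\<eta>)"
  unfolding F_def[symmetric] eta_integral[OF m1] eta_integral[OF m2] V_def P_apply[OF t(2)] .
qed

section \<open>Decay of the energy\<close>

lemma velocity_at_measurable: assumes t: "0 < t" shows "(%z. velocity (z, t)) \<in> borel_measurable borel"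
proof -
 have [measurable]: "flow t (t + 1 / real (Suc n)) \<in> borel_measurable borel" for n by (rule flow_measurable) (use t in auto)
 show ?thesis unfolding velocity_def fst_conv snd_conv by (intro borel_measurable_lim_metric) measurable
qed

lemma V_eq: assumes g: "good t" shows "AE x in \<rho>. x \<in> S & V x t = velocity (X x t, t)"
 using AE_S conjunct2[OF g[unfolded good_def]]
proof eventually_elim
 case (elim x)
 have t: "0 < t" using g by (simp add: good_def)
 show ?case unfolding V_def using DERIV_imp_deriv[OF velocity_eq[OF elim(1) t elim(2)]] elim(1) by blast
qed

lemma V_balance_later_velocity:
 assumes gs: "good s" and gt: "good t" and st: "s <= t"
 shows "(\<integral>x. (V x s - Z x s) * V x t \<partial>\<rho>) = 0"
proof -
 have s: "0 < s" "0 <= s" and t: "0 < t" using gs gt by (auto simp: good_def)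
 have [measurable]: "(%x. V x t) \<in> borel_measurable borel" "(%x. V x s) \<in> borel_measurable borel" by (rule V_measurable[OF t] V_measurable[OF s(1)])+
 have [measurable]: "(%x. Z x s) \<in> borel_measurable borel" by (rule Z_measurable[OF s(2)])
 have h: "(%z. velocity (flow s t z, t)) \<in> borel_measurable borel"
  by (rule measurable_compose[OF flow_measurable[OF s(1) st] velocity_at_measurable[OF t]])
 note [measurable] = h
 have ae: "AE x in \<rho>. V x t = velocity (flow s t (X x s), t)"
  using V_eq[OF gt] by eventually_elim (simp add: flow_eq[OF s(1) st])
 have m: "(%x. (V x t)\<^sup>2) \<in> borel_measurable \<rho>" "(%x. (velocity (flow s t (X x s), t))\<^sup>2) \<in> borel_measurable \<rho>"
  "(%x. (V x s - Z x s) * V x t) \<in> borel_measurable \<rho>" "(%x. (V x s - Z x s) * velocity (flow s t (X x s), t)) \<in> borel_measurable \<rho>"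
  by measurable
 have "AE x in \<rho>. (V x t)\<^sup>2 = (velocity (flow s t (X x s), t))\<^sup>2" using ae by eventually_elim simp
 then have h2: "integrable \<rho> (%x. (velocity (flow s t (X x s), t))\<^sup>2)"
  by (rule iffD1[OF integrable_cong_AE[OF m(1,2)] V_square[OF gt]])
 have "(\<integral>x. (V x s - Z x s) * V x t \<partial>\<rho>) = (\<integral>x. (V x s - Z x s) * velocity (flow s t (X x s), t) \<partial>\<rho>)"
  by (rule integral_cong_AE[OF m(3,4)]) (use ae in \<open>auto elim!: eventually_mono\<close>)
 also have "... = 0" by (rule V_balance[OF gs h h2])
 finally show ?thesis .
qed

lemma V_balance_later_force:
 assumes gs: "good s" and st: "s <= t"
 shows "(\<integral>x. (V x s - Z x s) * G x t \<partial>\<rho>) = 0"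
proof -
 have s: "0 < s" "0 <= s" "0 <= t" using gs st by (auto simp: good_def)
 have [measurable]: "w \<in> borel_measurable borel" by (rule w_measurable)
 have [measurable]: "(%x. V x s) \<in> borel_measurable borel" by (rule V_measurable[OF s(1)])
 have [measurable]: "(%x. Z x s) \<in> borel_measurable borel" by (rule Z_measurable[OF s(2)])
 have [measurable]: "flow s t \<in> borel_measurable borel" by (rule flow_measurable[OF s(1) st])
 define h where "h z = - (\<integral>y. w (flow s t z - X y t) \<partial>\<rho>)" for z
 have h[measurable]: "h \<in> borel_measurable borel" unfolding h_def by measurable
 have ae: "AE x in \<rho>. G x t = h (X x s)"
  using AE_S by eventually_elim (simp add: G_def h_def flow_eq[OF s(1) st])
 have m: "(%x. (G x t)\<^sup>2) \<in> borel_measurable \<rho>" "(%x. (h (X x s))\<^sup>2) \<in> borel_measurable \<rho>"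
  "(%x. (V x s - Z x s) * G x t) \<in> borel_measurable \<rho>" "(%x. (V x s - Z x s) * h (X x s)) \<in> borel_measurable \<rho>"
  by measurable
 have "AE x in \<rho>. (G x t)\<^sup>2 = (h (X x s))\<^sup>2" using ae by eventually_elim simp
 then have h2: "integrable \<rho> (%x. (h (X x s))\<^sup>2)" by (rule iffD1[OF integrable_cong_AE[OF m(1,2)] G_square[OF s(3)]])
 have "(\<integral>x. (V x s - Z x s) * G x t \<partial>\<rho>) = (\<integral>x. (V x s - Z x s) * h (X x s) \<partial>\<rho>)"
  by (rule integral_cong_AE[OF m(3,4)]) (use ae in \<open>auto elim!: eventually_mono\<close>)
 also have "... = 0" by (rule V_balance[OF gs h h2])
 finally show ?thesis .
qed

text \<open>The derivative of \<open>\<integral>x. R x * Z x r \<partial>\<rho>\<close> in \<open>r\<close> is \<open>\<integral>x. R x * G x r \<partial>\<rho>\<close>, which vanishes; monotonicity in this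
form for both \<open>R\<close> and \<open>- R\<close> gives constancy without an interchange of integrals.\<close>

lemma pairing_with_momentum_nonincreasing:
 assumes st: "0 <= s" "s <= t" and Rm[measurable]: "R \<in> borel_measurable \<rho>" and R2: "integrable \<rho> (%x. (R x)\<^sup>2)"
  and zero: "!!r. s <= r ==> r <= t ==> (\<integral>x. R x * G x r \<partial>\<rho>) = 0"
 shows "(\<integral>x. R x * Z x t \<partial>\<rho>) <= (\<integral>x. R x * Z x s \<partial>\<rho>)"
proof -
 let ?F = "force_growth t"
 define D where "D = (\<integral>x. \<bar>R x * (?F * (1 + \<bar>x\<bar>))\<bar> \<partial>\<rho>)"
 have Zm[measurable]: "(%x. Z x r) \<in> borel_measurable \<rho>" if "s <= r" for r
  by (rule measurable_rho[OF Z_measurable]) (use that st in simp)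
 have iF: "integrable \<rho> (%x. R x * (?F * (1 + \<bar>x\<bar>)))" by (rule integrable_square_mult[OF _ _ R2 square_integrable_affine]) measurable
 have iZ: "integrable \<rho> (%x. R x * Z x r)" if "s <= r" for r
  by (rule integrable_square_mult[OF Rm Zm[OF that] R2 Z_square]) (use that st in simp)
 have dZ: "(\<integral>x. R x * Z x b \<partial>\<rho>) - (\<integral>x. R x * Z x a \<partial>\<rho>) = (\<integral>x. R x * (Z x b - Z x a) \<partial>\<rho>)" if "s <= a" "s <= b" for a b
  unfolding right_diff_distrib by (rule Bochner_Integration.integral_diff[OF iZ[OF that(2)] iZ[OF that(1)], symmetric])
 have ptw: "\<bar>R x * (Z x b - Z x a)\<bar> <= (b - a) * \<bar>R x * (?F * (1 + \<bar>x\<bar>))\<bar>" if "s <= a" "a <= b" "b <= t" for a b x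
 proof -
  have "\<bar>Z x b - Z x a\<bar> <= (b - a) * (?F * (1 + \<bar>x\<bar>))" using Z_increment[of a b t x] that st by simp
  then have "\<bar>R x\<bar> * \<bar>Z x b - Z x a\<bar> <= \<bar>R x\<bar> * ((b - a) * (?F * (1 + \<bar>x\<bar>)))" by (rule mult_left_mono) simp
  then show ?thesis using force_growth_nonneg[of t] by (simp add: abs_mult mult_ac)
 qed
 show ?thesis
 proof (rule nonincreasing_of_sequential_slopes[where f="%r. \<integral>x. R x * Z x r \<partial>\<rho>"])
  have lip: "\<bar>(\<integral>x. R x * Z x b \<partial>\<rho>) - (\<integral>x. R x * Z x a \<partial>\<rho>)\<bar> <= D * (b - a)" if ab: "s <= a" "a <= b" "b <= t" for a b
  proof -
   have sb: "s <= b" using ab by simp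
   have "\<bar>\<integral>x. R x * (Z x b - Z x a) \<partial>\<rho>\<bar> <= (\<integral>x. \<bar>R x * (Z x b - Z x a)\<bar> \<partial>\<rho>)" by (rule integral_abs_bound)
   also have "... <= (\<integral>x. (b - a) * \<bar>R x * (?F * (1 + \<bar>x\<bar>))\<bar> \<partial>\<rho>)"
   proof (rule integral_mono[OF _ _ ptw[OF ab]])
   show "integrable \<rho> (%x. \<bar>R x * (Z x b - Z x a)\<bar>)" unfolding right_diff_distrib
   by (intro integrable_abs Bochner_Integration.integrable_diff iZ ab sb)
   show "integrable \<rho> (%x. (b - a) * \<bar>R x * (?F * (1 + \<bar>x\<bar>))\<bar>)" by (intro integrable_mult_right integrable_abs iF)
   qed
   finally show ?thesis unfolding dZ[OF ab(1) sb] by (simp add: D_def mult.commute)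
  qed
  have "D-lipschitz_on {s..t} (%r. \<integral>x. R x * Z x r \<partial>\<rho>)"
  proof (rule lipschitz_onI)
   fix a b assume "a \<in> {s..t}" "b \<in> {s..t}"
   then show "dist (\<integral>x. R x * Z x a \<partial>\<rho>) (\<integral>x. R x * Z x b \<partial>\<rho>) <= D * dist a b"
   using lip[of a b] lip[of b a] by (cases "a <= b") (auto simp: dist_real_def abs_minus_commute)
  next
   show "0 <= D" unfolding D_def by (rule Bochner_Integration.integral_nonneg) simp
  qed
  then show "continuous_on {s..t} (%r. \<integral>x. R x * Z x r \<partial>\<rho>)" by (rule lipschitz_on_continuous_on)
  fix r and u :: "nat => real"
  assume r: "s <= r" "r < t" and u: "!!n. 0 < u n" "!!n. r + u n <= t" "u \<longlonglongrightarrow> 0"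
  have su: "s <= r + u n" for n using r u(1)[of n] by simp
  define \<phi> where "\<phi> n = (\<integral>x. R x * ((Z x (r + u n) - Z x r) / u n) \<partial>\<rho>)" for n
  have "\<phi> \<longlonglongrightarrow> (\<integral>x. R x * G x r \<partial>\<rho>)"
   unfolding \<phi>_def
  proof (rule integral_dominated_convergence[where w="%x. \<bar>R x * (?F * (1 + \<bar>x\<bar>))\<bar>"])
   show "AE x in \<rho>. (%n. R x * ((Z x (r + u n) - Z x r) / u n)) \<longlonglongrightarrow> R x * G x r"
   using AE_S
   proof eventually_elim
   case (elim x)
   have rT: "r \<in> {0..t}" using r st by simp
   show ?case
   by (intro tendsto_mult_left slope_sequence[OF Z_derivative[OF elim rT] u(3)])
   (use u r st in \<open>auto simp: less_imp_neq[symmetric] add_nonneg_nonneg less_imp_le\<close>)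
   qed
   show "AE x in \<rho>. norm (R x * ((Z x (r + u n) - Z x r) / u n)) <= \<bar>R x * (?F * (1 + \<bar>x\<bar>))\<bar>" for n
   proof (rule AE_I2)
   fix x
   have "\<bar>R x * (Z x (r + u n) - Z x r)\<bar> <= u n * \<bar>R x * (?F * (1 + \<bar>x\<bar>))\<bar>"
   using ptw[of r "r + u n" x] r u(1)[of n] u(2)[of n] by simp
   then show "norm (R x * ((Z x (r + u n) - Z x r) / u n)) <= \<bar>R x * (?F * (1 + \<bar>x\<bar>))\<bar>"
   using u(1)[of n] unfolding real_norm_def times_divide_eq_right abs_divide
   by (simp only: abs_of_pos pos_divide_le_eq mult.commute[of _ "u n"])
   qed
   show "integrable \<rho> (%x. \<bar>R x * (?F * (1 + \<bar>x\<bar>))\<bar>)" by (rule integrable_abs[OF iF])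
   show "(%x. R x * ((Z x (r + u n) - Z x r) / u n)) \<in> borel_measurable \<rho>" for n
   using Zm[OF su[of n]] Zm[OF r(1)] by measurable
  qed measurable
  then have "\<phi> \<longlonglongrightarrow> 0" using zero[of r] r by simp
  moreover have "(\<integral>x. R x * Z x (r + u n) \<partial>\<rho>) - (\<integral>x. R x * Z x r \<partial>\<rho>) <= u n * \<phi> n" for n
  proof -
   have "u n * \<phi> n = (\<integral>x. u n * (R x * ((Z x (r + u n) - Z x r) / u n)) \<partial>\<rho>)" by (simp add: \<phi>_def)
   also have "... = (\<integral>x. R x * (Z x (r + u n) - Z x r) \<partial>\<rho>)"
   by (rule Bochner_Integration.integral_cong[OF refl]) (use u(1)[of n] in simp)
   finally show ?thesis using dZ[OF r(1) su] by simp
  qed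
  ultimately show "\<exists>\<phi>. \<phi> \<longlonglongrightarrow> 0 & (\<forall>n::nat. (\<integral>x. R x * Z x (r + u n) \<partial>\<rho>) - (\<integral>x. R x * Z x r \<partial>\<rho>) <= u n * \<phi> n)"
   by blast
 qed (rule st(2))
qed

lemma V_balance_later_momentum:
 assumes gs: "good s" and st: "s <= t"
 shows "(\<integral>x. (V x s - Z x s) * Z x t \<partial>\<rho>) = (\<integral>x. (V x s - Z x s) * Z x s \<partial>\<rho>)"
proof -
 have s: "0 < s" "0 <= s" using gs by (auto simp: good_def)
 have [measurable]: "(%x. V x s) \<in> borel_measurable borel" by (rule V_measurable[OF s(1)])
 have [measurable]: "(%x. Z x s) \<in> borel_measurable borel" by (rule Z_measurable[OF s(2)])
 have R2: "integrable \<rho> (%x. (V x s - Z x s)\<^sup>2)"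
  by (rule integrable_square_diff[OF _ _ V_square[OF gs] Z_square[OF s(2)]]) measurable
 have 1: "(\<integral>x. (V x s - Z x s) * Z x t \<partial>\<rho>) <= (\<integral>x. (V x s - Z x s) * Z x s \<partial>\<rho>)"
  by (rule pairing_with_momentum_nonincreasing[OF s(2) st _ R2 V_balance_later_force[OF gs]]) measurable
 have z: "(\<integral>x. - (V x s - Z x s) * G x r \<partial>\<rho>) = 0" if "s <= r" for r
  unfolding mult_minus_left Bochner_Integration.integral_minus V_balance_later_force[OF gs that] by simp
 have "(\<integral>x. - (V x s - Z x s) * Z x t \<partial>\<rho>) <= (\<integral>x. - (V x s - Z x s) * Z x s \<partial>\<rho>)"
 proof (rule pairing_with_momentum_nonincreasing[OF s(2) st _ _ z])
  show "(%x. - (V x s - Z x s)) \<in> borel_measurable \<rho>" by measurable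
  show "integrable \<rho> (%x. (- (V x s - Z x s))\<^sup>2)" unfolding power2_minus by (rule R2)
 qed
 then have 2: "(\<integral>x. (V x s - Z x s) * Z x s \<partial>\<rho>) <= (\<integral>x. (V x s - Z x s) * Z x t \<partial>\<rho>)"
  unfolding mult_minus_left Bochner_Integration.integral_minus by simp
 show ?thesis using 1 2 by simp
qed

text \<open>\<open>V t\<close> is the projection of \<open>Z t\<close> onto functions of the position at time \<open>t\<close>, and such functions are functions
of the position at time \<open>s\<close>.  Expanding the square of \<open>V t - (V s - Z s) - Z t\<close> and using these orthogonalities
bounds the gain of kinetic energy by the gain for the collisionless velocities.\<close>

lemma kinetic_energy_step:
 assumes gs: "good s" and gt: "good t" and st: "s <= t"
 shows "(\<integral>x. (V x t)\<^sup>2 \<partial>\<rho>) - (\<integral>x. (V x s)\<^sup>2 \<partial>\<rho>) <= (\<integral>x. (Z x t)\<^sup>2 \<partial>\<rho>) - (\<integral>x. (Z x s)\<^sup>2 \<partial>\<rho>)"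
proof -
 have s: "0 < s" "0 <= s" and t: "0 < t" "0 <= t" using gs gt by (auto simp: good_def)
 have m: "(%x. V x t) \<in> borel_measurable \<rho>" "(%x. V x s) \<in> borel_measurable \<rho>" "(%x. Z x t) \<in> borel_measurable \<rho>" "(%x. Z x s) \<in> borel_measurable \<rho>"
  using V_measurable[OF t(1)] V_measurable[OF s(1)] Z_measurable[OF t(2)] Z_measurable[OF s(2)] by simp_all
 note sq = V_square[OF gt] V_square[OF gs] Z_square[OF t(2)] Z_square[OF s(2)]
 define I where "I f g = (\<integral>x. f x * g x \<partial>\<rho>)" for f g :: "real => real"
 let ?a = "%x. V x t" and ?b = "%x. V x s" and ?y = "%x. Z x t" and ?z = "%x. Z x s"
 note i = integrable_square_mult[OF m(1,1) sq(1,1)] integrable_square_mult[OF m(2,2) sq(2,2)]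
  integrable_square_mult[OF m(3,3) sq(3,3)] integrable_square_mult[OF m(4,4) sq(4,4)]
  integrable_square_mult[OF m(2,1) sq(2,1)] integrable_square_mult[OF m(4,1) sq(4,1)]
  integrable_square_mult[OF m(3,1) sq(3,1)] integrable_square_mult[OF m(2,4) sq(2,4)]
  integrable_square_mult[OF m(2,3) sq(2,3)] integrable_square_mult[OF m(4,3) sq(4,3)]
 have Idiff: "(\<integral>x. (f x - g x) * h x \<partial>\<rho>) = I f h - I g h"
  if "integrable \<rho> (%x. f x * h x)" "integrable \<rho> (%x. g x * h x)" for f g h
  unfolding I_def left_diff_distrib by (rule Bochner_Integration.integral_diff[OF that])
 have e1: "I ?b ?a - I ?z ?a = 0"
  using V_balance_later_velocity[OF gs gt st] Idiff[of ?b ?a ?z, OF i(5,6)] by linarith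
 have e2: "I ?a ?a - I ?y ?a = 0"
  using V_balance_later_velocity[OF gt gt order_refl] Idiff[of ?a ?a ?y, OF i(1,7)] by linarith
 have e3: "I ?b ?y - I ?z ?y = I ?b ?z - I ?z ?z"
  using V_balance_later_momentum[OF gs st] Idiff[of ?b ?y ?z, OF i(9,10)] Idiff[of ?b ?z ?z, OF i(8,4)] by linarith
 have "0 <= (\<integral>x. (V x t - (V x s - Z x s) - Z x t)\<^sup>2 \<partial>\<rho>)" by (rule Bochner_Integration.integral_nonneg) simp
 also have "... = (\<integral>x. V x t * V x t + V x s * V x s + Z x s * Z x s + Z x t * Z x t - 2 * (V x s * V x t) + 2 * (Z x s * V x t)
   - 2 * (Z x t * V x t) - 2 * (V x s * Z x s) + 2 * (V x s * Z x t) - 2 * (Z x s * Z x t) \<partial>\<rho>)"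
  by (rule Bochner_Integration.integral_cong[OF refl]) (simp add: power2_eq_square algebra_simps)
 also have "... = I ?a ?a + I ?b ?b + I ?z ?z + I ?y ?y - 2 * I ?b ?a + 2 * I ?z ?a - 2 * I ?y ?a - 2 * I ?b ?z + 2 * I ?b ?y - 2 * I ?z ?y"
  using i by (simp add: I_def)
 finally have "I ?a ?a - I ?b ?b <= I ?y ?y - I ?z ?z" using e1 e2 e3 by linarith
 then show ?thesis by (simp add: I_def power2_eq_square)
qed

end

text \<open>\<open>W_semiconcave_step\<close> is the tangent inequality of the convex function \<open>W x + c/2 * x\<^sup>2\<close> at \<open>b\<close>.\<close>

locale potential_interaction = interaction +
 fixes W :: "real => real"
 assumes W_cont: "continuous_on UNIV W"
  and W_semiconcave_step: "!!a b. W b - W a <= w b * (b - a) + c / 2 * (b - a)\<^sup>2"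
  and w_odd: "!!x. w (- x) = - w x"
begin

lemma W_measurable [measurable]: "W \<in> borel_measurable borel"
 by (rule borel_measurable_continuous_onI[OF W_cont])

definition W_size :: real where "W_size = \<bar>W 0\<bar> + 2 * L + c"

lemma W_size_nonneg: "0 <= W_size" using L_nonneg c_pos by (simp add: W_size_def)

lemma W_quadratic: "\<bar>W x\<bar> <= W_size * (1 + \<bar>x\<bar>)\<^sup>2"
proof -
 let ?m = "(1 + \<bar>x\<bar>)\<^sup>2"
 have m: "1 <= ?m" "\<bar>x\<bar> <= ?m" "(1 + \<bar>x\<bar>) * \<bar>x\<bar> <= ?m" "x\<^sup>2 <= ?m"
  by (simp_all add: power2_eq_square algebra_simps)
 have 1: "\<bar>w x * x\<bar> <= L * ?m"
 proof -
  have "\<bar>w x * x\<bar> <= L * (1 + \<bar>x\<bar>) * \<bar>x\<bar>" unfolding abs_mult by (rule mult_right_mono[OF w_growth]) simp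
  also have "... <= L * ?m" using mult_left_mono[OF m(3) L_nonneg] by (simp only: mult.assoc)
  finally show ?thesis .
 qed
 have 2: "\<bar>w 0 * x\<bar> <= L * ?m"
 proof -
  have "\<bar>w 0 * x\<bar> <= L * \<bar>x\<bar>" unfolding abs_mult using w_growth[of 0] by (intro mult_right_mono) auto
  also have "... <= L * ?m" by (rule mult_left_mono[OF m(2) L_nonneg])
  finally show ?thesis .
 qed
 have 3: "c / 2 * x\<^sup>2 <= c * ?m" using c_pos m(4) by (intro mult_mono) auto
 have 4: "\<bar>W 0\<bar> <= \<bar>W 0\<bar> * ?m" using mult_left_mono[OF m(1), of "\<bar>W 0\<bar>"] by simp
 have 5: "0 <= L * ?m" using L_nonneg by simp
 have "W x - W 0 <= w x * x + c / 2 * x\<^sup>2" using W_semiconcave_step[of x 0] by simp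
 moreover have "W 0 - W x <= - (w 0 * x) + c / 2 * x\<^sup>2" using W_semiconcave_step[of 0 x] by simp
 ultimately have "\<bar>W x\<bar> <= \<bar>W 0\<bar> * ?m + 2 * (L * ?m) + c * ?m" using 1 2 3 4 5 by linarith
 then show ?thesis by (simp add: W_size_def distrib_right mult.assoc)
qed

definition envelope :: "real => real => real" where
 "envelope T x = ((1 + growth T) * (1 + \<bar>x\<bar>))\<^sup>2"

lemma envelope_integrable: "integrable \<rho> (envelope T)"
 unfolding envelope_def[abs_def] by (rule square_integrable_affine)

lemma envelope_measurable [measurable]: "envelope T \<in> borel_measurable borel"
 unfolding envelope_def[abs_def] by measurable

lemma X_square_envelope: assumes t: "0 <= t" "t <= T" shows "(X x t)\<^sup>2 <= envelope T x"
proof -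
 have "\<bar>X x t\<bar> <= (1 + growth T) * (1 + \<bar>x\<bar>)" using X_bound[OF t, of x] by (simp add: distrib_right)
 from power_mono[OF this abs_ge_zero, of 2] show ?thesis by (simp only: envelope_def power2_abs)
qed

lemma difference_square_envelope:
 assumes t: "0 <= t" "t <= T" shows "(1 + \<bar>X x t - X y t\<bar>)\<^sup>2 <= 2 * envelope T x + 2 * envelope T y"
proof -
 let ?m = "%x. (1 + growth T) * (1 + \<bar>x\<bar>)"
 have "1 + \<bar>X x t - X y t\<bar> <= ?m x + ?m y"
  using X_bound[OF t, of x] X_bound[OF t, of y] by (simp add: distrib_right)
 then have "(1 + \<bar>X x t - X y t\<bar>)\<^sup>2 <= (?m x + ?m y)\<^sup>2" by (rule power_mono) simp
 also have "... <= 2 * (?m x)\<^sup>2 + 2 * (?m y)\<^sup>2"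
 proof -
  have "(p + q)\<^sup>2 <= 2 * p\<^sup>2 + 2 * q\<^sup>2" for p q :: real
  proof -
   have "0 <= (p - q)\<^sup>2" by simp
   then show ?thesis unfolding power2_diff power2_sum by linarith
  qed
  then show ?thesis .
 qed
 finally show ?thesis by (simp only: envelope_def)
qed

lemma W_envelope:
 assumes t: "0 <= t" "t <= T" shows "\<bar>W (X x t - X y t)\<bar> <= 2 * W_size * envelope T x + 2 * W_size * envelope T y"
proof -
 have "\<bar>W (X x t - X y t)\<bar> <= W_size * (2 * envelope T x + 2 * envelope T y)"
  by (rule order_trans[OF W_quadratic mult_left_mono[OF difference_square_envelope[OF t] W_size_nonneg]])
 then show ?thesis by (simp add: distrib_left mult_ac)
qed

abbreviation \<rho>2 :: "(real \<times> real) measure" where "\<rho>2 \<equiv> \<rho> \<Otimes>\<^sub>M \<rho>"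

sublocale pp: pair_sigma_finite \<rho> \<rho> by unfold_locales

lemma X_pair_measurable [measurable]:
 "(%z. X (fst z) t) \<in> borel_measurable \<rho>2" "(%z. X (snd z) t) \<in> borel_measurable \<rho>2"
 by measurable

lemma W_pair_measurable [measurable]: "(%z. W (X (fst z) t - X (snd z) t)) \<in> borel_measurable \<rho>2"
 by measurable

lemma W_pair_integrable: assumes t: "0 <= t" shows "integrable \<rho>2 (%z. W (X (fst z) t - X (snd z) t))"
 by (rule integrable_pair_sum_bound[where a="%x. 2 * W_size * envelope t x"])
  (use W_envelope[OF t order_refl] envelope_integrable in auto)

text \<open>Twice the interaction energy, in terms of labels.\<close>

definition double_potential :: "real => real" where
 "double_potential t = (\<integral>z. W (X (fst z) t - X (snd z) t) \<partial>\<rho>2)"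

lemma double_potential_iterated:
 assumes t: "0 <= t" shows "double_potential t = (\<integral>y. \<integral>x. W (X x t - X y t) \<partial>\<rho> \<partial>\<rho>)"
 using pp.integral_snd[of "%x y. W (X x t - X y t)"] W_pair_integrable[OF t]
 unfolding double_potential_def case_prod_beta' by simp

lemma pair_fst: assumes "k \<in> borel_measurable \<rho>" shows "(\<integral>z. (k (fst z) :: real) \<partial>\<rho>2) = (\<integral>x. k x \<partial>\<rho>)"
 using integral_distr[OF measurable_fst assms, of \<rho>] by (simp add: distr_pair_fst)

lemma pair_swap: assumes "f \<in> borel_measurable \<rho>2" shows "(\<integral>z. (f (snd z, fst z) :: real) \<partial>\<rho>2) = (\<integral>z. f z \<partial>\<rho>2)"
 using pp.integral_product_swap[OF assms] by (simp add: case_prod_beta')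

text \<open>The tangent inequality is taken at the later time \<open>b\<close>, so that the first order term pairs \<open>X b - X a\<close> with
the force at time \<open>b\<close>, a function of the position at \<open>b\<close>.  By \<open>balance_borel\<close> the increment of \<open>X\<close> may then be
replaced by that of \<open>Y\<close>.  Oddness of \<open>w\<close> turns the double integral into twice a single one.\<close>

lemma double_potential_step:
 assumes ab: "0 <= a" "a <= b"
 shows "double_potential b - double_potential a
  <= - 2 * (\<integral>x. G x b * (Y x b - Y x a) \<partial>\<rho>) + 2 * c * ((b - a)\<^sup>2 * (E0 * exp (rate * b)))"
proof -
 have b: "0 <= b" "a <= b" "b <= b" using ab by auto
 have [measurable]: "w \<in> borel_measurable borel" by (rule w_measurable)
 have [measurable]: "(%x. Y x a) \<in> borel_measurable borel" "(%x. Y x b) \<in> borel_measurable borel"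
  using Y_measurable ab b by auto
 define \<Delta> where "\<Delta> x = X x b - X x a" for x
 have [measurable]: "\<Delta> \<in> borel_measurable borel" unfolding \<Delta>_def[abs_def] by measurable
 have \<Delta>2: "(\<Delta> x)\<^sup>2 <= 4 * envelope b x" for x
 proof -
  have "0 <= (X x b + X x a)\<^sup>2" by simp
  then have "(\<Delta> x)\<^sup>2 <= 2 * (X x b)\<^sup>2 + 2 * (X x a)\<^sup>2" unfolding \<Delta>_def power2_sum power2_diff by linarith
  then show ?thesis using X_square_envelope[OF b(1,3), of x] X_square_envelope[OF ab, of x] by linarith
 qed
 have \<Delta>i: "integrable \<rho> (%x. (\<Delta> x)\<^sup>2)" unfolding \<Delta>_def by (intro integrable_square_diff X_square ab b) auto
 define f where "f z = w (X (fst z) b - X (snd z) b) * \<Delta> (fst z)" for z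
 have fm[measurable]: "f \<in> borel_measurable \<rho>2" unfolding f_def[abs_def] by measurable
 have env0: "0 <= envelope b x" for x by (simp add: envelope_def)
 have fi: "integrable \<rho>2 f"
 proof (rule integrable_pair_sum_bound[OF fm, where a="%x. (2 * L\<^sup>2 + 4) * envelope b x"])
  fix x y
  have "\<bar>w (X x b - X y b)\<bar>\<^sup>2 <= (L * (1 + \<bar>X x b - X y b\<bar>))\<^sup>2" by (rule power_mono[OF w_growth]) simp
  also have "... <= L\<^sup>2 * (2 * envelope b x + 2 * envelope b y)"
   unfolding power_mult_distrib by (rule mult_left_mono[OF difference_square_envelope[OF b(1,3)]]) simp
  finally have w2: "(w (X x b - X y b))\<^sup>2 <= 2 * L\<^sup>2 * envelope b x + 2 * L\<^sup>2 * envelope b y" by (simp add: distrib_left mult_ac)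
  have prod: "\<bar>p * q\<bar> <= p\<^sup>2 + q\<^sup>2" for p q :: real
  proof -
   have "0 <= (\<bar>p\<bar> - \<bar>q\<bar>)\<^sup>2" by simp
   moreover have "0 <= \<bar>p\<bar> * \<bar>q\<bar>" by simp
   ultimately show ?thesis unfolding power2_diff power2_abs abs_mult by linarith
  qed
  have "\<bar>f (x, y)\<bar> <= (w (X x b - X y b))\<^sup>2 + (\<Delta> x)\<^sup>2" unfolding f_def fst_conv snd_conv by (rule prod)
  also have "... <= 2 * L\<^sup>2 * envelope b x + 2 * L\<^sup>2 * envelope b y + 4 * envelope b x" using w2 \<Delta>2[of x] by linarith
  also have "... <= (2 * L\<^sup>2 + 4) * envelope b x + (2 * L\<^sup>2 + 4) * envelope b y" using env0[of y] by (simp add: distrib_right)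
  finally show "\<bar>f (x, y)\<bar> <= (2 * L\<^sup>2 + 4) * envelope b x + (2 * L\<^sup>2 + 4) * envelope b y" .
 qed (intro integrable_mult_right envelope_integrable)
 have fsi: "integrable \<rho>2 (%z. f (snd z, fst z))" using pp.integrable_product_swap[OF fi] by (simp add: case_prod_beta')
 have Di: "integrable \<rho>2 (%z. (\<Delta> (fst z))\<^sup>2)" "integrable \<rho>2 (%z. (\<Delta> (snd z))\<^sup>2)"
  by (rule integrable_pair_sum_bound[where a="%x. (\<Delta> x)\<^sup>2"], measurable, rule \<Delta>i, simp)+
 have If: "(\<integral>z. f z \<partial>\<rho>2) = - (\<integral>x. G x b * \<Delta> x \<partial>\<rho>)"
 proof -
  have "(\<integral>z. f z \<partial>\<rho>2) = (\<integral>x. \<integral>y. f (x, y) \<partial>\<rho> \<partial>\<rho>)"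
   using pp.integral_fst[of "%x y. f (x, y)"] fi by (simp add: case_prod_beta')
  also have "... = (\<integral>x. - (G x b * \<Delta> x) \<partial>\<rho>)"
   by (rule Bochner_Integration.integral_cong[OF refl]) (simp add: f_def G_def)
  finally show ?thesis by simp
 qed
 have ptw: "W (X x b - X y b) - W (X x a - X y a) <= f (x, y) + f (y, x) + (c * (\<Delta> x)\<^sup>2 + c * (\<Delta> y)\<^sup>2)" for x y
 proof -
  have "w (X y b - X x b) = - w (X x b - X y b)" using w_odd[of "X x b - X y b"] by simp
  then have "w (X x b - X y b) * (\<Delta> x - \<Delta> y) = f (x, y) + f (y, x)" by (simp add: f_def algebra_simps)
  moreover have "X x b - X y b - (X x a - X y a) = \<Delta> x - \<Delta> y" by (simp add: \<Delta>_def)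
  moreover have "c / 2 * (\<Delta> x - \<Delta> y)\<^sup>2 <= c * (\<Delta> x)\<^sup>2 + c * (\<Delta> y)\<^sup>2"
  proof -
   have "0 <= (\<Delta> x + \<Delta> y)\<^sup>2" by simp
   then have "(\<Delta> x - \<Delta> y)\<^sup>2 <= 2 * (\<Delta> x)\<^sup>2 + 2 * (\<Delta> y)\<^sup>2" unfolding power2_sum power2_diff by linarith
   then have "c / 2 * (\<Delta> x - \<Delta> y)\<^sup>2 <= c / 2 * (2 * (\<Delta> x)\<^sup>2 + 2 * (\<Delta> y)\<^sup>2)" using c_pos by (intro mult_left_mono) auto
   then show ?thesis by (simp add: distrib_left)
  qed
  ultimately show ?thesis using W_semiconcave_step[of "X x b - X y b" "X x a - X y a"] by simp
 qed
 have "double_potential b - double_potential a = (\<integral>z. W (X (fst z) b - X (snd z) b) - W (X (fst z) a - X (snd z) a) \<partial>\<rho>2)"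
  unfolding double_potential_def
  by (rule Bochner_Integration.integral_diff[OF W_pair_integrable[OF b(1)] W_pair_integrable[OF ab(1)], symmetric])
 also have "... <= (\<integral>z. f z + f (snd z, fst z) + (c * (\<Delta> (fst z))\<^sup>2 + c * (\<Delta> (snd z))\<^sup>2) \<partial>\<rho>2)"
 proof (rule integral_mono)
  show "W (X (fst z) b - X (snd z) b) - W (X (fst z) a - X (snd z) a) <= f z + f (snd z, fst z) + (c * (\<Delta> (fst z))\<^sup>2 + c * (\<Delta> (snd z))\<^sup>2)" for z
   using ptw[of "fst z" "snd z"] by simp
 qed (intro Bochner_Integration.integrable_diff Bochner_Integration.integrable_add integrable_mult_right W_pair_integrable fi fsi Di b ab)+
 also have "... = ((\<integral>z. f z \<partial>\<rho>2) + (\<integral>z. f (snd z, fst z) \<partial>\<rho>2)) + (c * (\<integral>z. (\<Delta> (fst z))\<^sup>2 \<partial>\<rho>2) + c * (\<integral>z. (\<Delta> (snd z))\<^sup>2 \<partial>\<rho>2))"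
  using fi fsi Di by simp
 also have "(\<integral>z. (\<Delta> (snd z))\<^sup>2 \<partial>\<rho>2) = (\<integral>z. (\<Delta> (fst z))\<^sup>2 \<partial>\<rho>2)"
  using pair_swap[of "%z. (\<Delta> (fst z))\<^sup>2"] by simp
 also have "(\<integral>z. (\<Delta> (fst z))\<^sup>2 \<partial>\<rho>2) = (\<integral>x. (\<Delta> x)\<^sup>2 \<partial>\<rho>)" by (rule pair_fst) measurable
 also have "(\<integral>z. f (snd z, fst z) \<partial>\<rho>2) = (\<integral>z. f z \<partial>\<rho>2)" by (rule pair_swap[OF fm])
 also have "(\<integral>z. f z \<partial>\<rho>2) + (\<integral>z. f z \<partial>\<rho>2) + (c * (\<integral>x. (\<Delta> x)\<^sup>2 \<partial>\<rho>) + c * (\<integral>x. (\<Delta> x)\<^sup>2 \<partial>\<rho>))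
   = - 2 * (\<integral>x. G x b * \<Delta> x \<partial>\<rho>) + 2 * c * (\<integral>x. (\<Delta> x)\<^sup>2 \<partial>\<rho>)" unfolding If by simp
 also have "(\<integral>x. G x b * \<Delta> x \<partial>\<rho>) = (\<integral>x. G x b * (Y x b - Y x a) \<partial>\<rho>)"
 proof -
  define h where "h z = - (\<integral>y. w (z - X y b) \<partial>\<rho>)" for z
  have hm[measurable]: "h \<in> borel_measurable borel" unfolding h_def by measurable
  have hG: "h (X x b) = G x b" for x by (simp add: h_def G_def)
  have h2: "integrable \<rho> (%x. (h (X x b))\<^sup>2)" unfolding hG by (rule G_square[OF b(1)])
  have z: "(\<integral>x. (X x b - Y x b) * G x b \<partial>\<rho>) = 0" "(\<integral>x. (X x a - Y x a) * G x b \<partial>\<rho>) = 0"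
   using balance_borel[OF b(1,3) hm h2] balance_borel[OF ab hm h2] unfolding hG by simp_all
  have i: "integrable \<rho> (%x. (X x b - Y x b) * G x b)" "integrable \<rho> (%x. (X x a - Y x a) * G x b)"
   "integrable \<rho> (%x. G x b * (Y x b - Y x a))"
   by (intro integrable_square_mult integrable_square_diff X_square Y_square G_square ab b; measurable)+
  have "(\<integral>x. G x b * \<Delta> x \<partial>\<rho>) = (\<integral>x. (X x b - Y x b) * G x b - (X x a - Y x a) * G x b + G x b * (Y x b - Y x a) \<partial>\<rho>)"
   by (rule Bochner_Integration.integral_cong[OF refl]) (simp add: \<Delta>_def algebra_simps)
  also have "... = (\<integral>x. G x b * (Y x b - Y x a) \<partial>\<rho>)" using i z by simp
  finally show ?thesis .
 qed
 finally have "double_potential b - double_potential a <= - 2 * (\<integral>x. G x b * (Y x b - Y x a) \<partial>\<rho>) + 2 * c * (\<integral>x. (\<Delta> x)\<^sup>2 \<partial>\<rho>)" .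
 moreover have "2 * c * (\<integral>x. (\<Delta> x)\<^sup>2 \<partial>\<rho>) <= 2 * c * ((b - a)\<^sup>2 * (E0 * exp (rate * b)))"
  using X_displacement[OF ab] c_pos unfolding \<Delta>_def by (intro mult_left_mono) auto
 ultimately show ?thesis by linarith
qed

end

context potential_interaction
begin

text \<open>The total energy, computed with the collisionless velocities.\<close>

definition free_energy :: "real => real" where
 "free_energy t = 1 / 2 * (\<integral>x. (Z x t)\<^sup>2 \<partial>\<rho>) + 1 / 2 * double_potential t"

lemma free_energy_continuous: assumes s: "0 <= s" shows "continuous_on {s..t} free_energy"
 unfolding continuous_on_sequentially
proof (intro allI ballI impI)
 fix u :: "nat => real" and a assume a: "a \<in> {s..t}" and "(\<forall>n. u n \<in> {s..t}) & u \<longlonglongrightarrow> a"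
 then have u: "!!n. u n \<in> {s..t}" "u \<longlonglongrightarrow> a" by auto
 have u0: "0 <= u n" "u n <= t" "0 <= a" "a <= t" for n using u(1)[of n] a s by auto
 have [measurable]: "(%x. Z x (u n)) \<in> borel_measurable borel" "(%x. Z x a) \<in> borel_measurable borel" for n
  using Z_measurable u0 by auto
 have "(%n. \<integral>x. (Z x (u n))\<^sup>2 \<partial>\<rho>) \<longlonglongrightarrow> (\<integral>x. (Z x a)\<^sup>2 \<partial>\<rho>)"
 proof (rule integral_dominated_convergence[where w="%x. (Z_growth t * (1 + \<bar>x\<bar>))\<^sup>2"])
  show "AE x in \<rho>. (%n. (Z x (u n))\<^sup>2) \<longlonglongrightarrow> (Z x a)\<^sup>2"
   using AE_S
  proof eventually_elim
   case (elim x)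
   have "continuous_on {0..t} (Z x)" by (rule DERIV_continuous_on[OF Z_derivative[OF elim]])
   from continuous_on_tendsto_compose[OF this u(2)] show ?case using u0 by (intro tendsto_power) auto
  qed
  show "AE x in \<rho>. norm ((Z x (u n))\<^sup>2) <= (Z_growth t * (1 + \<bar>x\<bar>))\<^sup>2" for n
  proof (rule AE_I2)
   fix x
   have "\<bar>Z x (u n)\<bar> <= Z_growth t * (1 + \<bar>x\<bar>)" by (rule Z_bound[OF u0(1,2)])
   from power_mono[OF this abs_ge_zero, of 2]
   show "norm ((Z x (u n))\<^sup>2) <= (Z_growth t * (1 + \<bar>x\<bar>))\<^sup>2" by simp
  qed
 qed (use square_integrable_affine in auto)
 moreover have "(%n. double_potential (u n)) \<longlonglongrightarrow> double_potential a"
  unfolding double_potential_def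
 proof (rule integral_dominated_convergence[where w="%z. 2 * W_size * envelope t (fst z) + 2 * W_size * envelope t (snd z)"])
  have Xl: "(%n. X x (u n)) \<longlonglongrightarrow> X x a" for x
   by (rule continuous_on_tendsto_compose[OF X_cont_all u(2)]) (use u0 in auto)
  have "isCont W z" for z using W_cont by (simp add: continuous_on_eq_continuous_at)
  then show "AE z in \<rho>2. (%n. W (X (fst z) (u n) - X (snd z) (u n))) \<longlonglongrightarrow> W (X (fst z) a - X (snd z) a)"
   by (intro AE_I2 isCont_tendsto_compose[where g=W] tendsto_diff Xl)
  show "AE z in \<rho>2. norm (W (X (fst z) (u n) - X (snd z) (u n))) <= 2 * W_size * envelope t (fst z) + 2 * W_size * envelope t (snd z)" for n
   using W_envelope[OF u0(1,2)] by (intro AE_I2) simp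
  show "integrable \<rho>2 (%z. 2 * W_size * envelope t (fst z) + 2 * W_size * envelope t (snd z))"
  proof (rule integrable_pair_sum_bound[where a="%x. 2 * W_size * envelope t x"])
   show "integrable \<rho> (%x. 2 * W_size * envelope t x)" by (intro integrable_mult_right envelope_integrable)
   show "\<bar>2 * W_size * envelope t (fst (x, y)) + 2 * W_size * envelope t (snd (x, y))\<bar> <= 2 * W_size * envelope t x + 2 * W_size * envelope t y" for x y
   using W_size_nonneg by (simp add: envelope_def)
  qed measurable
 qed measurable
 ultimately show "(free_energy \<circ> u) \<longlonglongrightarrow> free_energy a"
  unfolding o_def free_energy_def by (intro tendsto_add tendsto_mult_left)
qed

text \<open>Kinetic energy gains \<open>\<integral> G * Z\<close> per unit of time and potential energy loses the same amount up to a quadratic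
error, so all right difference quotients have nonpositive limits superior.\<close>

lemma free_energy_nonincreasing:
 assumes st: "0 <= s" "s <= t" shows "free_energy t <= free_energy s"
proof (rule nonincreasing_of_sequential_slopes[OF st(2) free_energy_continuous[OF st(1)]])
 fix r and u :: "nat => real"
 assume r: "s <= r" "r < t" and u: "!!n. 0 < u n" "!!n. r + u n <= t" "u \<longlonglongrightarrow> 0"
 have r0: "0 <= r" "0 <= r + u n" "r <= r + u n" "u n ~= 0" for n using r u(1)[of n] st by auto
 have rT: "r \<in> {0..t}" "r + u n \<in> {0..t}" for n using r r0(2)[of n] u(2)[of n] st by auto
 have [measurable]: "(%x. Z x (r + u n)) \<in> borel_measurable borel" "(%x. Z x r) \<in> borel_measurable borel"
  "(%x. Y x (r + u n)) \<in> borel_measurable borel" "(%x. Y x r) \<in> borel_measurable borel" for n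
  using Z_measurable Y_measurable r0 by auto
 let ?z = "%n x. (Z x (r + u n) - Z x r) / u n" and ?y = "%n x. (Y x (r + u n) - Y x r) / u n"
 define f where "f n x = 1 / 2 * (?z n x * (Z x (r + u n) + Z x r)) - G x (r + u n) * ?y n x" for n x
 let ?F = "force_growth t" and ?Z = "Z_growth t"
 have F0: "0 <= ?F" "0 <= ?Z" by (rule force_growth_nonneg Z_growth_nonneg)+
 have fb: "\<bar>f n x\<bar> <= 2 * (?F * ?Z) * (1 * (1 + \<bar>x\<bar>))\<^sup>2" for n x
 proof -
  let ?k = "1 + \<bar>x\<bar>"
  have zi': "\<bar>Z x (r + u n) - Z x r\<bar> <= (r + u n - r) * (?F * ?k)" by (rule Z_increment[OF r0(1,3) u(2)])
  have yi': "\<bar>Y x (r + u n) - Y x r\<bar> <= (r + u n - r) * (?Z * ?k)" by (rule Y_increment[OF r0(1,3) u(2)])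
  have zi: "\<bar>?z n x\<bar> <= ?F * ?k"
   using zi' u(1)[of n]
   unfolding abs_divide by (simp add: pos_divide_le_eq mult.commute)
  have yi: "\<bar>?y n x\<bar> <= ?Z * ?k"
   using yi' u(1)[of n]
   unfolding abs_divide by (simp add: pos_divide_le_eq mult.commute)
  have zs: "\<bar>Z x (r + u n) + Z x r\<bar> <= 2 * (?Z * ?k)"
   using Z_bound[of "r + u n" t x] Z_bound[of r t x] rT(1) rT(2)[of n] by simp
  have gb: "\<bar>G x (r + u n)\<bar> <= ?F * ?k" using G_bound[of "r + u n" t x] rT(2)[of n] by simp
  have k0: "0 <= ?F * ?k" "0 <= ?Z * ?k" using F0 by simp_all
  have "\<bar>?z n x * (Z x (r + u n) + Z x r)\<bar> <= ?F * ?k * (2 * (?Z * ?k))"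
   unfolding abs_mult by (rule mult_mono[OF zi zs k0(1) abs_ge_zero])
  moreover have "\<bar>G x (r + u n) * ?y n x\<bar> <= ?F * ?k * (?Z * ?k)"
   unfolding abs_mult by (rule mult_mono[OF gb yi k0(1) abs_ge_zero])
  moreover have "?F * ?k * (2 * (?Z * ?k)) = 2 * (?F * ?Z * ?k\<^sup>2)" "?F * ?k * (?Z * ?k) = ?F * ?Z * ?k\<^sup>2"
   by (simp_all add: power2_eq_square mult_ac)
  ultimately have "\<bar>f n x\<bar> <= 2 * (?F * ?Z * ?k\<^sup>2)" unfolding f_def by linarith
  then show ?thesis by (simp add: mult.assoc)
 qed
 have fi: "integrable \<rho> (f n)" for n
 proof (rule Bochner_Integration.integrable_bound[OF integrable_mult_right[OF square_integrable_affine]])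
  show "AE x in \<rho>. norm (f n x) <= norm (2 * (?F * ?Z) * (1 * (1 + \<bar>x\<bar>))\<^sup>2)"
   using fb[of n] F0 by (intro AE_I2) (simp add: abs_mult)
  show "f n \<in> borel_measurable \<rho>" unfolding f_def[abs_def] by measurable
 qed
 have lim: "(%n. \<integral>x. f n x \<partial>\<rho>) \<longlonglongrightarrow> (\<integral>x. 0 \<partial>\<rho>)"
 proof (rule integral_dominated_convergence[where w="%x. 2 * (?F * ?Z) * (1 * (1 + \<bar>x\<bar>))\<^sup>2"])
  show "AE x in \<rho>. (%n. f n x) \<longlonglongrightarrow> 0"
   using AE_S
  proof eventually_elim
   case (elim x)
   have ru: "(%n. r + u n) \<longlonglongrightarrow> r" using tendsto_add[OF tendsto_const u(3), of r] by simp
   have 1: "(%n. ?z n x) \<longlonglongrightarrow> G x r" by (rule slope_sequence[OF Z_derivative[OF elim rT(1)] u(3) r0(4) rT(2)])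
   have 2: "(%n. ?y n x) \<longlonglongrightarrow> Z x r" by (rule slope_sequence[OF Y_derivative[OF elim rT(1)] u(3) r0(4) rT(2)])
   have zc: "continuous_on {0..t} (Z x)" by (rule DERIV_continuous_on[OF Z_derivative[OF elim]])
   have 3: "(%n. Z x (r + u n)) \<longlonglongrightarrow> Z x r"
   by (rule continuous_on_tendsto_compose[OF zc ru rT(1) always_eventually]) (intro allI rT(2))
   have 4: "(%n. G x (r + u n)) \<longlonglongrightarrow> G x r"
   by (rule continuous_on_tendsto_compose[OF G_cont[OF elim] ru]) (use r0 in auto)
   have "(%n. f n x) \<longlonglongrightarrow> 1 / 2 * (G x r * (Z x r + Z x r)) - G x r * Z x r"
   unfolding f_def by (intro tendsto_diff tendsto_mult tendsto_add tendsto_const 1 2 3 4)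
   then show ?case by simp
  qed
  show "AE x in \<rho>. norm (f n x) <= 2 * (?F * ?Z) * (1 * (1 + \<bar>x\<bar>))\<^sup>2" for n
   using fb[of n] by (intro AE_I2) simp
  show "integrable \<rho> (%x. 2 * (?F * ?Z) * (1 * (1 + \<bar>x\<bar>))\<^sup>2)" by (rule integrable_mult_right[OF square_integrable_affine])
  show "f n \<in> borel_measurable \<rho>" for n using fi by simp
 qed simp
 define K where "K = c * (E0 * exp (rate * t))"
 define \<phi> where "\<phi> n = (\<integral>x. f n x \<partial>\<rho>) + u n * K" for n
 have "\<phi> \<longlonglongrightarrow> 0 + 0 * K" unfolding \<phi>_def using lim by (intro tendsto_add tendsto_mult_right u(3)) simp
 then have "\<phi> \<longlonglongrightarrow> 0" by simp
 moreover have "free_energy (r + u n) - free_energy r <= u n * \<phi> n" for n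
 proof -
  let ?b = "r + u n"
  have zi: "integrable \<rho> (%x. (Z x ?b)\<^sup>2)" "integrable \<rho> (%x. (Z x r)\<^sup>2)" by (rule Z_square[OF r0(2)] Z_square[OF r0(1)])+
  have gi: "integrable \<rho> (%x. G x ?b * (Y x ?b - Y x r))"
   by (intro integrable_square_mult integrable_square_diff Y_square G_square r0(1,2); measurable)
  have "u n * (\<integral>x. f n x \<partial>\<rho>) = (\<integral>x. u n * f n x \<partial>\<rho>)" by simp
  also have "... = (\<integral>x. 1 / 2 * (Z x ?b)\<^sup>2 - 1 / 2 * (Z x r)\<^sup>2 - G x ?b * (Y x ?b - Y x r) \<partial>\<rho>)"
   by (rule Bochner_Integration.integral_cong[OF refl])
   (use r0(4)[of n] in \<open>simp add: f_def field_simps power2_eq_square\<close>)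
  also have "... = 1 / 2 * (\<integral>x. (Z x ?b)\<^sup>2 \<partial>\<rho>) - 1 / 2 * (\<integral>x. (Z x r)\<^sup>2 \<partial>\<rho>) - (\<integral>x. G x ?b * (Y x ?b - Y x r) \<partial>\<rho>)"
   using zi gi by simp
  finally have e: "u n * (\<integral>x. f n x \<partial>\<rho>) = ..." .
  have "double_potential ?b - double_potential r <= - 2 * (\<integral>x. G x ?b * (Y x ?b - Y x r) \<partial>\<rho>) + 2 * c * ((?b - r)\<^sup>2 * (E0 * exp (rate * ?b)))"
   by (rule double_potential_step[OF r0(1,3)])
  moreover have "2 * c * ((?b - r)\<^sup>2 * (E0 * exp (rate * ?b))) <= 2 * (u n * (u n * K))"
  proof -
   have "exp (rate * ?b) <= exp (rate * t)" using u(2)[of n] rate_nonneg by (simp add: mult_left_mono)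
   then have "2 * c * ((u n)\<^sup>2 * (E0 * exp (rate * ?b))) <= 2 * c * ((u n)\<^sup>2 * (E0 * exp (rate * t)))"
   using E0(1) c_pos by (intro mult_left_mono) auto
   then show ?thesis by (simp add: K_def power2_eq_square mult_ac)
  qed
  moreover have "u n * \<phi> n = u n * (\<integral>x. f n x \<partial>\<rho>) + u n * (u n * K)" by (simp add: \<phi>_def distrib_left)
  ultimately show ?thesis unfolding free_energy_def e by linarith
 qed
 ultimately show "\<exists>\<phi>. \<phi> \<longlonglongrightarrow> 0 & (\<forall>n::nat. free_energy (r + u n) - free_energy r <= u n * \<phi> n)" by blast
qed

lemma energy_well_defined:
 assumes g: "good t"
 shows "integrable \<eta> (%\<gamma>. 1 / 2 * (deriv (ev \<gamma>) t)\<^sup>2)"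
  "integrable (\<eta> \<Otimes>\<^sub>M \<eta>) (%(\<gamma>, \<xi>). W (ev \<gamma> t - ev \<xi> t))"
  "(\<integral>\<gamma>. 1 / 2 * (deriv (ev \<gamma>) t)\<^sup>2 \<partial>\<eta>) = 1 / 2 * (\<integral>x. (V x t)\<^sup>2 \<partial>\<rho>)"
  "(\<integral>\<xi>. \<integral>\<gamma>. W (ev \<gamma> t - ev \<xi> t) \<partial>\<eta> \<partial>\<eta>) = double_potential t"
proof -
 have t: "0 < t" "0 <= t" using g by (auto simp: good_def)
 have dm: "(%\<gamma>. 1 / 2 * (deriv (ev \<gamma>) t)\<^sup>2) \<in> borel_measurable borel"
  by (intro borel_measurable_times borel_measurable_power borel_measurable_const deriv_cpath_measurable t)
 show "integrable \<eta> (%\<gamma>. 1 / 2 * (deriv (ev \<gamma>) t)\<^sup>2)"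
  unfolding eta_integrable[OF dm] V_def[symmetric] by (intro integrable_mult_right V_square g)
 show "(\<integral>\<gamma>. 1 / 2 * (deriv (ev \<gamma>) t)\<^sup>2 \<partial>\<eta>) = 1 / 2 * (\<integral>x. (V x t)\<^sup>2 \<partial>\<rho>)"
  unfolding eta_integral[OF dm] V_def[symmetric] by simp
 have xm: "(%\<gamma>. (1 + \<bar>ev \<gamma> t\<bar>)\<^sup>2) \<in> borel_measurable borel" by measurable
 have "integrable \<rho> (%x. (1 + \<bar>X x t\<bar>)\<^sup>2)"
 proof (rule square_integrableI)
  show "\<bar>1 + \<bar>X x t\<bar>\<bar> <= (1 + growth t) * (1 + \<bar>x\<bar>)" for x using X_bound[OF t(2) order_refl, of x] by (simp add: distrib_right)
 qed measurable
 then have xi: "integrable \<eta> (%\<gamma>. (1 + \<bar>ev \<gamma> t\<bar>)\<^sup>2)" unfolding eta_integrable[OF xm] P_apply[OF t(2)] .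
 show "integrable (\<eta> \<Otimes>\<^sub>M \<eta>) (%(\<gamma>, \<xi>). W (ev \<gamma> t - ev \<xi> t))"
 proof (rule eta.integrable_pair_sum_bound[where a="%\<gamma>. 2 * W_size * (1 + \<bar>ev \<gamma> t\<bar>)\<^sup>2"])
  show "integrable \<eta> (%\<gamma>. 2 * W_size * (1 + \<bar>ev \<gamma> t\<bar>)\<^sup>2)" by (rule integrable_mult_right[OF xi])
  fix \<gamma> \<xi>
  let ?p = "ev \<gamma> t" and ?q = "ev \<xi> t"
  have "(1 + \<bar>?p - ?q\<bar>)\<^sup>2 <= ((1 + \<bar>?p\<bar>) + (1 + \<bar>?q\<bar>))\<^sup>2" by (rule power_mono) auto
  also have "... <= 2 * (1 + \<bar>?p\<bar>)\<^sup>2 + 2 * (1 + \<bar>?q\<bar>)\<^sup>2"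
  proof -
   have "(p + q)\<^sup>2 <= 2 * p\<^sup>2 + 2 * q\<^sup>2" for p q :: real
   proof -
   have "0 <= (p - q)\<^sup>2" by simp
   then show ?thesis unfolding power2_diff power2_sum by linarith
   qed
   then show ?thesis .
  qed
  finally have "W_size * (1 + \<bar>?p - ?q\<bar>)\<^sup>2 <= W_size * (2 * (1 + \<bar>?p\<bar>)\<^sup>2 + 2 * (1 + \<bar>?q\<bar>)\<^sup>2)"
   by (rule mult_left_mono[OF _ W_size_nonneg])
  then have "\<bar>W (?p - ?q)\<bar> <= W_size * (2 * (1 + \<bar>?p\<bar>)\<^sup>2 + 2 * (1 + \<bar>?q\<bar>)\<^sup>2)" by (rule order_trans[OF W_quadratic])
  then show "\<bar>case (\<gamma>, \<xi>) of (\<gamma>, \<xi>) => W (ev \<gamma> t - ev \<xi> t)\<bar>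
   <= 2 * W_size * (1 + \<bar>?p\<bar>)\<^sup>2 + 2 * W_size * (1 + \<bar>?q\<bar>)\<^sup>2"
   by (simp only: prod.case distrib_left mult.assoc mult.left_commute[of W_size 2])
 qed measurable
 have "(\<integral>\<xi>. \<integral>\<gamma>. W (ev \<gamma> t - ev \<xi> t) \<partial>\<eta> \<partial>\<eta>) = (\<integral>y. \<integral>\<gamma>. W (ev \<gamma> t - X y t) \<partial>\<eta> \<partial>\<rho>)"
  by (subst eta_integral) (measurable, simp only: P_apply[OF t(2)])
 also have "... = (\<integral>y. \<integral>x. W (X x t - X y t) \<partial>\<rho> \<partial>\<rho>)"
  by (rule Bochner_Integration.integral_cong[OF refl], subst eta_integral) (measurable, simp only: P_apply[OF t(2)])
 finally show "(\<integral>\<xi>. \<integral>\<gamma>. W (ev \<gamma> t - ev \<xi> t) \<partial>\<eta> \<partial>\<eta>) = double_potential t"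
  by (simp only: double_potential_iterated[OF t(2)])
qed

text \<open>The kinetic energy of the sticky system grows by at most that of the collisionless velocities, and the
latter is compensated by the potential energy.\<close>

theorem energy_nonincreasing:
 assumes gs: "good s" and gt: "good t" and st: "s <= t"
 shows "(\<integral>\<gamma>. 1 / 2 * (deriv (ev \<gamma>) t)\<^sup>2 \<partial>\<eta>) + 1 / 2 * (\<integral>\<xi>. \<integral>\<gamma>. W (ev \<gamma> t - ev \<xi> t) \<partial>\<eta> \<partial>\<eta>)
  <= (\<integral>\<gamma>. 1 / 2 * (deriv (ev \<gamma>) s)\<^sup>2 \<partial>\<eta>) + 1 / 2 * (\<integral>\<xi>. \<integral>\<gamma>. W (ev \<gamma> s - ev \<xi> s) \<partial>\<eta> \<partial>\<eta>)"
proof -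
 have "0 <= s" using gs by (simp add: good_def)
 then show ?thesis
  using free_energy_nonincreasing[of s t] kinetic_energy_step[OF gs gt st] st
  unfolding energy_well_defined(3,4)[OF gs] energy_well_defined(3,4)[OF gt] free_energy_def by linarith
qed

end

section \<open>Existence of the path measure\<close>

text \<open>The graph of the convex function \<open>W x + c/2 * x\<^sup>2\<close> lies above its tangent at \<open>b\<close>.\<close>

lemma semiconvex_step:
 fixes W w :: "real => real"
 assumes W: "!!x. (W has_real_derivative w x) (at x)" and cv: "convex_on UNIV (%x. W x + c / 2 * x\<^sup>2)"
 shows "W b - W a <= w b * (b - a) + c / 2 * (b - a)\<^sup>2"
proof -
 have "((%x. W x + c / 2 * x\<^sup>2) has_real_derivative w b + c * b) (at b within UNIV)"
  by (rule derivative_eq_intros W refl | simp)+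
 then have "(w b + c * b) * (a - b) <= W a + c / 2 * a\<^sup>2 - (W b + c / 2 * b\<^sup>2)"
  using convex_on_imp_above_tangent[OF cv connected_UNIV, of b a "w b + c * b"] by simp
 moreover have "(w b + c * b) * (a - b) = - (w b * (b - a)) + c * b * a - c * b\<^sup>2"
  by (simp add: power2_eq_square algebra_simps)
 moreover have "c / 2 * (b - a)\<^sup>2 = c / 2 * b\<^sup>2 + c / 2 * a\<^sup>2 - c * b * a"
  by (simp add: power2_eq_square field_simps)
 moreover have "c * b\<^sup>2 = c / 2 * b\<^sup>2 + c / 2 * b\<^sup>2" by (simp add: field_simps)
 ultimately show ?thesis by linarith
qed

theorem theorem3p1:
  fixes W v0 :: "real \<Rightarrow> real" and c :: real and \<rho>0 :: "real measure"
  assumes W_C1: "W C1_differentiable_on UNIV"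
    and W_even: "\<And>x. W (- x) = W x"
    and c_pos: "c > 0"
    and W_semiconvex: "convex_on UNIV (\<lambda>x. W x + c / 2 * x\<^sup>2)"
    and W_growth: "bdd_above (range (\<lambda>x. \<bar>deriv W x\<bar> / (1 + \<bar>x\<bar>)))"
    and rho0_prob: "prob_space \<rho>0" "sets \<rho>0 = sets borel"
    and rho0_moment: "integrable \<rho>0 (\<lambda>x. x\<^sup>2)"
    and v0_ac: "abs_continuous_on UNIV v0"
  shows "\<exists>\<eta> :: cpath measure. prob_space \<eta> \<and> sets \<eta> = sets borel \<and>
    \<comment> \<open>(i)\<close>
    (AE \<gamma> in \<eta>. Psi c \<gamma> < \<infinity>) \<and>
    \<comment> \<open>(ii)\<close>
    \<rho>0 = eval_distr 0 \<eta> \<and>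
    \<comment> \<open>(iii)\<close>
    (\<forall>s t. \<forall>\<gamma>\<in>supp \<eta>. \<forall>\<xi>\<in>supp \<eta>. 0 < s \<and> s \<le> t \<longrightarrow>
       \<bar>\<gamma> t - \<xi> t\<bar> / sinh (sqrt c * t) \<le> \<bar>\<gamma> s - \<xi> s\<bar> / sinh (sqrt c * s)) \<and>
    \<comment> \<open>(iv)\<close>
    (\<forall>t\<ge>0. \<forall>\<gamma>\<in>supp \<eta>. \<forall>\<xi>\<in>supp \<eta>. \<gamma> 0 \<ge> \<xi> 0 \<longrightarrow>
       0 \<le> \<gamma> t - \<xi> t \<and>
       \<gamma> t - \<xi> t \<le> cosh (sqrt c * t) * (\<gamma> 0 - \<xi> 0)
         + 1 / sqrt c * sinh (sqrt c * t) * (LBINT x:{\<xi> 0..\<gamma> 0}. \<bar>deriv v0 x\<bar>)) \<and>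
    \<comment> \<open>(v)\<close>
    (\<exists>v :: real \<times> real \<Rightarrow> real.
       v \<in> borel_measurable (restrict_space borel (UNIV \<times> {0<..})) \<and>
       (AE \<gamma> in \<eta>. AE t in lborel. t > 0 \<longrightarrow>
          ((\<gamma> :: real \<Rightarrow> real) has_real_derivative v (\<gamma> t, t)) (at t))) \<and>
    \<comment> \<open>(vi), including that all integrals occurring in it are well defined\<close>
    (\<forall>s\<ge>0. \<forall>x. integrable (eval_distr s \<eta>) (\<lambda>y. deriv W (x - y))) \<and>
    (\<forall>t\<ge>0. AE \<gamma> in \<eta>.
       set_integrable lborel {0..t} (\<lambda>s. convol (deriv W) (eval_distr s \<eta>) (\<gamma> s))) \<and>
    (AE t in lborel. t \<ge> 0 \<longrightarrow> (\<forall>h \<in> borel_measurable borel.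
       integrable \<eta> (\<lambda>\<gamma>. (h (\<gamma> t))\<^sup>2) \<longrightarrow>
       integrable \<eta> (\<lambda>\<gamma>. deriv \<gamma> t * h (\<gamma> t)) \<and>
       integrable \<eta> (\<lambda>\<gamma>.
         (v0 (\<gamma> 0) - (LBINT s:{0..t}. convol (deriv W) (eval_distr s \<eta>) (\<gamma> s))) * h (\<gamma> t)) \<and>
       (LINT \<gamma>|\<eta>. deriv \<gamma> t * h (\<gamma> t)) =
       (LINT \<gamma>|\<eta>.
         (v0 (\<gamma> 0) - (LBINT s:{0..t}. convol (deriv W) (eval_distr s \<eta>) (\<gamma> s))) * h (\<gamma> t)))) \<and>
    \<comment> \<open>(vii), including that all integrals occurring in it are well defined\<close>
    (\<exists>N \<in> null_sets lborel.
       (\<forall>t. 0 \<le> t \<and> t \<notin> N \<longrightarrow>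
          integrable \<eta> (\<lambda>\<gamma>. 1 / 2 * (deriv \<gamma> t)\<^sup>2) \<and>
          integrable (\<eta> \<Otimes>\<^sub>M \<eta>) (\<lambda>(\<gamma>, \<xi>). W (apply_cpath \<gamma> t - apply_cpath \<xi> t))) \<and>
       (\<forall>s t. 0 \<le> s \<and> s \<le> t \<and> s \<notin> N \<and> t \<notin> N \<longrightarrow>
          (LINT \<gamma>|\<eta>. 1 / 2 * (deriv \<gamma> t)\<^sup>2)
            + 1 / 2 * (LINT \<xi>|\<eta>. LINT \<gamma>|\<eta>. W (\<gamma> t - \<xi> t))
          \<le> (LINT \<gamma>|\<eta>. 1 / 2 * (deriv \<gamma> s)\<^sup>2)
            + 1 / 2 * (LINT \<xi>|\<eta>. LINT \<gamma>|\<eta>. W (\<gamma> s - \<xi> s))))"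
proof -
 let ?w = "deriv W"
 obtain D where D: "!!x. (W has_vector_derivative D x) (at x)" "continuous_on UNIV D"
  using W_C1 unfolding C1_differentiable_on_def by auto
 then have DD: "(W has_real_derivative D x) (at x)" for x by (simp add: has_real_derivative_iff_has_vector_derivative)
 have wD: "?w = D" by (rule ext) (rule DERIV_imp_deriv[OF DD])
 have W': "(W has_real_derivative ?w x) (at x)" for x unfolding wD by (rule DD)
 have step: "W b - W a <= ?w b * (b - a) + c / 2 * (b - a)\<^sup>2" for a b
  by (rule semiconvex_step[OF W' W_semiconvex])
 have odd: "?w (- x) = - ?w x" for x
 proof -
  have "((%x. W (- x)) has_real_derivative ?w (- x) * (- 1)) (at x)"
   by (rule DERIV_chain2[OF W']) (auto intro!: derivative_eq_intros)
  then have "(W has_real_derivative - ?w (- x)) (at x)" by (simp add: W_even)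
  from DERIV_unique[OF this W'] show ?thesis by simp
 qed
 from W_growth obtain M where "\<forall>y\<in>range (%x. \<bar>?w x\<bar> / (1 + \<bar>x\<bar>)). y <= M" unfolding bdd_above_def by (rule exE)
 then have M: "\<bar>?w x\<bar> <= M * (1 + \<bar>x\<bar>)" for x by (simp add: pos_divide_le_eq)
 obtain J where J: "!!a b. a <= b ==> J b - J a = (LBINT x:{a..b}. \<bar>deriv v0 x\<bar>)"
  "!!a b. a <= b ==> \<bar>v0 b - v0 a\<bar> <= J b - J a"
  "!!\<epsilon>. \<epsilon> > 0 ==> \<exists>\<delta>>0. \<forall>a b. a <= b & b - a < \<delta> --> J b - J a <= \<epsilon>"
 proof (rule abs_continuous_antiderivative[OF v0_ac])
  fix J
  assume "!!a b. a <= b ==> J b - J a = (LBINT x:{a..b}. \<bar>deriv v0 x\<bar>)"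
   "!!a b. a <= b ==> \<bar>v0 b - v0 a\<bar> <= J b - J a"
   "!!\<epsilon>. \<epsilon> > 0 ==> \<exists>\<delta>>0. \<forall>a b. a <= b & b - a < \<delta> --> J b - J a <= \<epsilon>"
  then show thesis by (rule that)
 qed
 interpret potential_interaction \<rho>0 v0 J ?w c M W
 proof (intro potential_interaction.intro interaction.intro potential_interaction_axioms.intro)
  show "prob_space \<rho>0" "sets \<rho>0 = sets borel" "integrable \<rho>0 (%x. x\<^sup>2)" "0 < c"
   by (fact rho0_prob rho0_moment c_pos)+
  show "continuous_on UNIV ?w" unfolding wD by (rule D(2))
  show "continuous_on UNIV W" by (rule DERIV_continuous_on[OF has_field_derivative_at_within[OF W']])
  fix x y :: real assume xy: "x <= y"
  show "?w x - ?w y <= c * (y - x)"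
  proof (cases "x = y")
   case False
   have "0 <= (?w y - ?w x) * (y - x) + c * (y - x)\<^sup>2"
   proof -
   have "c / 2 * (x - y)\<^sup>2 = c / 2 * (y - x)\<^sup>2" by (simp add: power2_commute)
   moreover have "?w x * (x - y) = - (?w x * (y - x))" by (simp add: algebra_simps)
   moreover have "c * (y - x)\<^sup>2 = c / 2 * (y - x)\<^sup>2 + c / 2 * (y - x)\<^sup>2" by simp
   ultimately show ?thesis using step[of y x] step[of x y] unfolding left_diff_distrib by linarith
   qed
   then have "0 <= (?w y - ?w x + c * (y - x)) * (y - x)" by (simp add: power2_eq_square distrib_right mult.assoc)
   then show ?thesis using False xy by (simp add: zero_le_mult_iff)
  qed simp
 qed (fact J(2) J(3) M step odd)+
 have momentum: "AE t in lborel. t >= 0 --> (\<forall>h \<in> borel_measurable borel.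
   integrable \<eta> (%\<gamma>. (h (ev \<gamma> t))\<^sup>2) -->
   integrable \<eta> (%\<gamma>. deriv (ev \<gamma>) t * h (ev \<gamma> t)) &
   integrable \<eta> (%\<gamma>.
   (v0 (ev \<gamma> 0) - (LBINT s:{0..t}. convol ?w (eval_distr s \<eta>) (ev \<gamma> s))) * h (ev \<gamma> t)) &
   (LINT \<gamma>|\<eta>. deriv (ev \<gamma>) t * h (ev \<gamma> t)) =
   (LINT \<gamma>|\<eta>.
   (v0 (ev \<gamma> 0) - (LBINT s:{0..t}. convol ?w (eval_distr s \<eta>) (ev \<gamma> s))) * h (ev \<gamma> t)))"
  using AE_good AE_lborel_singleton[of 0]
 proof eventually_elim
  case (elim t)
  show ?case
  proof (intro impI ballI)
   fix h :: "real => real"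
   assume t: "0 <= t" and h: "h \<in> borel_measurable borel" "integrable \<eta> (%\<gamma>. (h (ev \<gamma> t))\<^sup>2)"
   have g: "good t" using elim t by simp
   show "integrable \<eta> (%\<gamma>. deriv (ev \<gamma>) t * h (ev \<gamma> t)) &
   integrable \<eta> (%\<gamma>.
   (v0 (ev \<gamma> 0) - (LBINT s:{0..t}. convol ?w (eval_distr s \<eta>) (ev \<gamma> s))) * h (ev \<gamma> t)) &
   (LINT \<gamma>|\<eta>. deriv (ev \<gamma>) t * h (ev \<gamma> t)) =
   (LINT \<gamma>|\<eta>.
   (v0 (ev \<gamma> 0) - (LBINT s:{0..t}. convol ?w (eval_distr s \<eta>) (ev \<gamma> s))) * h (ev \<gamma> t))"
   by (intro conjI momentum_balance[OF g h])
  qed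
 qed
 from AE_good[unfolded eventually_ae_filter] obtain N
  where N: "N \<in> null_sets lborel" "{t \<in> space lborel. ~ (0 < t --> good t)} \<subseteq> N" by (rule bexE)
 have "{0::real} \<in> null_sets lborel" by (rule null_setsI) simp_all
 then have N0: "N \<union> {0} \<in> null_sets lborel" by (rule null_sets.Un[OF N(1)])
 have gN: "good t" if "0 <= t" "t \<notin> N \<union> {0}" for t
 proof (rule ccontr)
  assume "~ good t"
  then have "t \<in> {t \<in> space lborel. ~ (0 < t --> good t)}" using that by simp
  then have "t \<in> N" by (rule subsetD[OF N(2)])
  then show False using that(2) by simp
 qed
 show ?thesis
 proof (rule exI[of _ \<eta>], intro conjI)
  show "prob_space \<eta>" by (rule prob_eta)
  show "sets \<eta> = sets borel" by simp
  show "AE \<gamma> in \<eta>. Psi c \<gamma> < \<infinity>" by (rule Psi_finite)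
  show "\<rho>0 = eval_distr 0 \<eta>" by (rule initial_distr)
  show "\<forall>s t. \<forall>\<gamma>\<in>supp \<eta>. \<forall>\<xi>\<in>supp \<eta>. 0 < s & s <= t -->
   \<bar>ev \<gamma> t - ev \<xi> t\<bar> / sinh (sqrt c * t) <= \<bar>ev \<gamma> s - ev \<xi> s\<bar> / sinh (sqrt c * s)"
   by (intro allI ballI impI, elim conjE) (rule contraction_supp)
  show "\<forall>t\<ge>0. \<forall>\<gamma>\<in>supp \<eta>. \<forall>\<xi>\<in>supp \<eta>. ev \<gamma> 0 >= ev \<xi> 0 -->
   0 <= ev \<gamma> t - ev \<xi> t &
   ev \<gamma> t - ev \<xi> t <= cosh (sqrt c * t) * (ev \<gamma> 0 - ev \<xi> 0)
   + 1 / sqrt c * sinh (sqrt c * t) * (LBINT x:{ev \<xi> 0..ev \<gamma> 0}. \<bar>deriv v0 x\<bar>)"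
  proof (intro allI ballI impI)
   fix t \<gamma> \<xi>
   assume a: "0 <= (t::real)" "\<gamma> \<in> supp \<eta>" "\<xi> \<in> supp \<eta>" "ev \<gamma> 0 >= ev \<xi> 0"
   show "0 <= ev \<gamma> t - ev \<xi> t &
   ev \<gamma> t - ev \<xi> t <= cosh (sqrt c * t) * (ev \<gamma> 0 - ev \<xi> 0)
   + 1 / sqrt c * sinh (sqrt c * t) * (LBINT x:{ev \<xi> 0..ev \<gamma> 0}. \<bar>deriv v0 x\<bar>)"
   using gap_supp[OF a(2,3,1,4)] unfolding J(1)[OF a(4)] by blast
  qed
  show "\<exists>v :: real \<times> real => real. v \<in> borel_measurable (restrict_space borel (UNIV \<times> {0<..})) &
   (AE \<gamma> in \<eta>. AE t in lborel. t > 0 --> (ev \<gamma> has_real_derivative v (ev \<gamma> t, t)) (at t))"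
   by (intro exI[of _ velocity] conjI velocity_measurable velocity_field)
  show "\<forall>s\<ge>0. \<forall>x. integrable (eval_distr s \<eta>) (%y. ?w (x - y))" by (intro allI impI force_integrable)
  show "\<forall>t\<ge>0. AE \<gamma> in \<eta>. set_integrable lborel {0..t} (%s. convol ?w (eval_distr s \<eta>) (ev \<gamma> s))"
   by (intro allI impI AE_momentum_integrable)
  show "\<exists>N \<in> null_sets lborel.
   (\<forall>t. 0 <= t & t \<notin> N -->
   integrable \<eta> (%\<gamma>. 1 / 2 * (deriv (ev \<gamma>) t)\<^sup>2) &
   integrable (\<eta> \<Otimes>\<^sub>M \<eta>) (%(\<gamma>, \<xi>). W (ev \<gamma> t - ev \<xi> t))) &
   (\<forall>s t. 0 <= s & s <= t & s \<notin> N & t \<notin> N -->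
   (LINT \<gamma>|\<eta>. 1 / 2 * (deriv (ev \<gamma>) t)\<^sup>2)
   + 1 / 2 * (LINT \<xi>|\<eta>. LINT \<gamma>|\<eta>. W (ev \<gamma> t - ev \<xi> t))
   <= (LINT \<gamma>|\<eta>. 1 / 2 * (deriv (ev \<gamma>) s)\<^sup>2)
   + 1 / 2 * (LINT \<xi>|\<eta>. LINT \<gamma>|\<eta>. W (ev \<gamma> s - ev \<xi> s)))"
  proof (rule bexI[OF _ N0], intro conjI allI impI)
   fix t assume t: "0 <= t & t \<notin> N \<union> {0}"
   have g: "good t" by (rule gN[OF conjunct1[OF t] conjunct2[OF t]])
   show "integrable \<eta> (%\<gamma>. 1 / 2 * (deriv (ev \<gamma>) t)\<^sup>2)" by (rule energy_well_defined(1)[OF g])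
   show "integrable (\<eta> \<Otimes>\<^sub>M \<eta>) (%(\<gamma>, \<xi>). W (ev \<gamma> t - ev \<xi> t))" by (rule energy_well_defined(2)[OF g])
  next
   fix s t assume st: "0 <= s & s <= t & s \<notin> N \<union> {0} & t \<notin> N \<union> {0}"
   then have "0 <= s" "0 <= t" "s \<notin> N \<union> {0}" "t \<notin> N \<union> {0}" "s <= t" by auto
   then show "(LINT \<gamma>|\<eta>. 1 / 2 * (deriv (ev \<gamma>) t)\<^sup>2)
   + 1 / 2 * (LINT \<xi>|\<eta>. LINT \<gamma>|\<eta>. W (ev \<gamma> t - ev \<xi> t))
   <= (LINT \<gamma>|\<eta>. 1 / 2 * (deriv (ev \<gamma>) s)\<^sup>2)
   + 1 / 2 * (LINT \<xi>|\<eta>. LINT \<gamma>|\<eta>. W (ev \<gamma> s - ev \<xi> s))" by (intro energy_nonincreasing gN)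
  qed
 qed (fact momentum)
qed

end
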